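(* Let $-1<q\le 1$, $f\in L^2(0,T;\dot H^q(\Omega))$ and $v\equiv 0$, and let $$u(t)=\int_0^t \bar E(t-s)f(s)\,ds .$$ Then $u\in L^2(0,T;\dot H^{q+2}(\Omega))$, and there is a constant $C>0$ independent of $f$ and $t$ such that for all $t\in(0,T]$ $$\|u\|_{L^2(0,t;\dot H^{q+2}(\Omega))}+\|P(\partial_t)u\|_{L^2(0,t;\dot H^{q}(\Omega))}\le C\|f\|_{L^2(0,t;\dot H^q(\Omega))}.$$
   Context: $\Omega\subset\mathbb R^d$ ($d\in\{1,2,3\}$) is a bounded convex polygonal (polyhedral) domain, $T>0$ is fixed, $m\ge 0$ is an integer, $0<\alpha_m\le\dots\le\alpha_1<\alpha<1$, $b_i>0$ for $i=1,\dots,m$. For $0<\beta<1$ the Caputo derivative is $\partial_t^\beta u(t)=\frac1{\Gamma(1-\beta)}\int_0^t(t-\tau)^{-\beta}\frac{d}{d\tau}u(\tau)\,d\tau$, and $P(\partial_t)=\partial_t^\alpha+\sum_{i=1}^m b_i\partial_t^{\alpha_i}$. The underlying problem is $P(\partial_t)u-\Delta u=f$ in $\Omega\times(0,T]$, $u=0$ on $\partial\Omega\times(0,T]$, $u(0)=v$ in $\Omega$. $\{\lambda_j\}_{j\ge1}$ and $\{\varphi_j\}_{j\ge1}$ are the eigenvalues and $L^2(\Omega)$-orthonormal eigenfunctions of $-\Delta$ on $\Omega$ with homogeneous Dirichlet boundary condition. For $s\ge-1$, $\dot H^s(\Omega)\subset H^{-1}(\Omega)$ is the Hilbert space with norm $\|v\|_{\dot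 H^s(\Omega)}^2=\sum_{j}\lambda_j^s\langle v,\varphi_j\rangle^2$, where $\langle\cdot,\cdot\rangle$ is the duality pairing extending the $L^2(\Omega)$ inner product. For a Banach space $B$, $L^r(0,T;B)$ is the usual Bochner space. The multinomial Mittag-Leffler function is $$E_{(\beta_1,\dots,\beta_n),\beta}(z_1,\dots,z_n)=\sum_{k=0}^\infty\ \sum_{l_1+\dots+l_n=k,\ l_i\ge0}\frac{k!}{l_1!\cdots l_n!}\frac{\prod_{i=1}^n z_i^{l_i}}{\Gamma(\beta+\sum_{i=1}^n\beta_il_i)}.$$ With $\vec\alpha=(\alpha,\alpha-\alpha_1,\dots,\alpha-\alpha_m)$, $$\bar E(t)\chi=\sum_{j=1}^\infty t^{\alpha-1}E_{\vec\alpha,\alpha}(-\lambda_jt^\alpha,-b_1t^{\alpha-\alpha_1},\dots,-b_mt^{\alpha-\alpha_m})\,\langle\chi,\varphi_j\rangle\,\varphi_j .$$ *)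

theory Defs
  imports "HOL-Analysis.Analysis"
begin

definition convex_polyhedral_domain :: "(real^'d) set \<Rightarrow> bool" where
  "convex_polyhedral_domain \<Omega> \<longleftrightarrow>
     open \<Omega> \<and> \<Omega> \<noteq> {} \<and> bounded \<Omega> \<and> convex \<Omega> \<and> polytope (closure \<Omega>)"

definition pderiv_at :: "'d \<Rightarrow> (real^'d \<Rightarrow> real) \<Rightarrow> real^'d \<Rightarrow> real" where
  "pderiv_at i w x = frechet_derivative w (at x) (axis i 1)"

fun Ck :: "nat \<Rightarrow> (real^'d \<Rightarrow> real) \<Rightarrow> bool" where
  "Ck 0 w \<longleftrightarrow> continuous_on UNIV w"
| "Ck (Suc k) w \<longleftrightarrow> (\<forall>x. w differentiable (at x)) \<and> (\<forall>i. Ck k (pderiv_at i w))"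

definition test_functions :: "(real^'d) set \<Rightarrow> (real^'d \<Rightarrow> real) set" where
  "test_functions \<Omega> =
     {w. (\<forall>k. Ck k w) \<and> (\<exists>K. compact K \<and> K \<subseteq> \<Omega> \<and> (\<forall>x. x \<notin> K \<longrightarrow> w x = 0))}"

definition L2_space :: "(real^'d) set \<Rightarrow> (real^'d \<Rightarrow> real) set" where
  "L2_space \<Omega> = {w. w \<in> borel_measurable (lebesgue_on \<Omega>) \<and>
                    integrable (lebesgue_on \<Omega>) (\<lambda>x. (w x)\<^sup>2)}"

definition L2_inner :: "(real^'d) set \<Rightarrow> (real^'d \<Rightarrow> real) \<Rightarrow> (real^'d \<Rightarrow> real) \<Rightarrow> real" where
  "L2_inner \<Omega> w z = (LINT x|lebesgue_on \<Omega>. w x * z x)"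

definition has_weak_gradient ::
    "(real^'d) set \<Rightarrow> (real^'d \<Rightarrow> real) \<Rightarrow> (real^'d \<Rightarrow> real^'d) \<Rightarrow> bool" where
  "has_weak_gradient \<Omega> w g \<longleftrightarrow>
     (\<forall>i. (\<lambda>x. g x $ i) \<in> L2_space \<Omega>) \<and>
     (\<forall>i. \<forall>z\<in>test_functions \<Omega>.
        L2_inner \<Omega> w (pderiv_at i z) = - L2_inner \<Omega> (\<lambda>x. g x $ i) z)"

definition H1_space :: "(real^'d) set \<Rightarrow> (real^'d \<Rightarrow> real) set" where
  "H1_space \<Omega> = {w \<in> L2_space \<Omega>. \<exists>g. has_weak_gradient \<Omega> w g}"

text \<open>The weak gradient is unique only almost everywhere on the domain; every use of the
  choice below is inside an integral over the domain.\<close>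

definition weak_gradient :: "(real^'d) set \<Rightarrow> (real^'d \<Rightarrow> real) \<Rightarrow> real^'d \<Rightarrow> real^'d" where
  "weak_gradient \<Omega> w = (SOME g. has_weak_gradient \<Omega> w g)"

definition gradient_inner ::
    "(real^'d) set \<Rightarrow> (real^'d \<Rightarrow> real) \<Rightarrow> (real^'d \<Rightarrow> real) \<Rightarrow> real" where
  "gradient_inner \<Omega> w z =
     (LINT x|lebesgue_on \<Omega>. weak_gradient \<Omega> w x \<bullet> weak_gradient \<Omega> z x)"

definition H1_norm :: "(real^'d) set \<Rightarrow> (real^'d \<Rightarrow> real) \<Rightarrow> real" where
  "H1_norm \<Omega> w = sqrt (L2_inner \<Omega> w w + gradient_inner \<Omega> w w)"

definition H10_space :: "(real^'d) set \<Rightarrow> (real^'d \<Rightarrow> real) set" where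
  "H10_space \<Omega> = {w \<in> H1_space \<Omega>. \<exists>z. (\<forall>n. z n \<in> test_functions \<Omega>) \<and>
                    (\<lambda>n. H1_norm \<Omega> (\<lambda>x. w x - z n x)) \<longlonglongrightarrow> 0}"

text \<open>Elements of \<open>H\<^sup>-\<^sup>1\<close> are bounded linear functionals on \<open>H\<^sup>1\<^sub>0\<close>, represented as total functions
  on \<open>real^'d \<Rightarrow> real\<close> that are set to 0 off \<open>H\<^sup>1\<^sub>0\<close>, so that equality of functionals is equality
  of HOL functions. Boundedness forces them to respect equality almost everywhere on the domain.\<close>

type_synonym 'd functional = "(real^'d \<Rightarrow> real) \<Rightarrow> real"

definition Hm1_space :: "(real^'d) set \<Rightarrow> 'd functional set" where
  "Hm1_space \<Omega> = {\<eta>.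
     (\<forall>w\<in>H10_space \<Omega>. \<forall>z\<in>H10_space \<Omega>. \<eta> (\<lambda>x. w x + z x) = \<eta> w + \<eta> z) \<and>
     (\<forall>c. \<forall>w\<in>H10_space \<Omega>. \<eta> (\<lambda>x. c * w x) = c * \<eta> w) \<and>
     (\<exists>C. \<forall>w\<in>H10_space \<Omega>. \<bar>\<eta> w\<bar> \<le> C * H1_norm \<Omega> w) \<and>
     (\<forall>w. w \<notin> H10_space \<Omega> \<longrightarrow> \<eta> w = 0)}"

definition Hm1_norm :: "(real^'d) set \<Rightarrow> 'd functional \<Rightarrow> real" where
  "Hm1_norm \<Omega> \<eta> = (SUP w\<in>{w \<in> H10_space \<Omega>. H1_norm \<Omega> w \<le> 1}. \<bar>\<eta> w\<bar>)"

definition Hm1_tendsto :: "(real^'d) set \<Rightarrow> (nat \<Rightarrow> 'd functional) \<Rightarrow> 'd functional \<Rightarrow> bool" where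
  "Hm1_tendsto \<Omega> X \<eta> \<longleftrightarrow>
     \<eta> \<in> Hm1_space \<Omega> \<and> (\<lambda>n. Hm1_norm \<Omega> (\<lambda>w. X n w - \<eta> w)) \<longlonglongrightarrow> 0"

definition Hm1_suminf :: "(real^'d) set \<Rightarrow> (nat \<Rightarrow> 'd functional) \<Rightarrow> 'd functional" where
  "Hm1_suminf \<Omega> X = (THE \<eta>. Hm1_tendsto \<Omega> (\<lambda>n w. \<Sum>j<n. X j w) \<eta>)"

definition Hm1_of_L2 :: "(real^'d) set \<Rightarrow> (real^'d \<Rightarrow> real) \<Rightarrow> 'd functional" where
  "Hm1_of_L2 \<Omega> z = (\<lambda>w. if w \<in> H10_space \<Omega> then L2_inner \<Omega> z w else 0)"

text \<open>\<open>-\<Delta>\<close> with homogeneous Dirichlet condition is understood weakly on \<open>H\<^sup>1\<^sub>0\<close>. The eigenfunctions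
  form a complete orthonormal system of \<open>L\<^sup>2\<close>, so that every eigenvalue is listed as often as its
  multiplicity; the enumeration starts at 0 and no order of the eigenvalues is imposed.\<close>

definition dirichlet_eigenpair ::
    "(real^'d) set \<Rightarrow> real \<Rightarrow> (real^'d \<Rightarrow> real) \<Rightarrow> bool" where
  "dirichlet_eigenpair \<Omega> l \<phi> \<longleftrightarrow>
     \<phi> \<in> H10_space \<Omega> \<and> (\<forall>w\<in>H10_space \<Omega>. gradient_inner \<Omega> \<phi> w = l * L2_inner \<Omega> \<phi> w)"

definition dirichlet_eigensystem ::
    "(real^'d) set \<Rightarrow> (nat \<Rightarrow> real) \<Rightarrow> (nat \<Rightarrow> real^'d \<Rightarrow> real) \<Rightarrow> bool" where
  "dirichlet_eigensystem \<Omega> lam \<phi> \<longleftrightarrow>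
     (\<forall>j. dirichlet_eigenpair \<Omega> (lam j) (\<phi> j)) \<and>
     (\<forall>i j. L2_inner \<Omega> (\<phi> i) (\<phi> j) = (if i = j then 1 else 0)) \<and>
     (\<forall>w\<in>L2_space \<Omega>. (\<forall>j. L2_inner \<Omega> w (\<phi> j) = 0) \<longrightarrow> (AE x in lebesgue_on \<Omega>. w x = 0))"

definition Hdot_space ::
    "(real^'d) set \<Rightarrow> (nat \<Rightarrow> real) \<Rightarrow> (nat \<Rightarrow> real^'d \<Rightarrow> real) \<Rightarrow> real \<Rightarrow> 'd functional set" where
  "Hdot_space \<Omega> lam \<phi> s =
     {\<eta> \<in> Hm1_space \<Omega>. summable (\<lambda>j. lam j powr s * (\<eta> (\<phi> j))\<^sup>2)}"

definition Hdot_norm ::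
    "(nat \<Rightarrow> real) \<Rightarrow> (nat \<Rightarrow> real^'d \<Rightarrow> real) \<Rightarrow> real \<Rightarrow> 'd functional \<Rightarrow> real" where
  "Hdot_norm lam \<phi> s \<eta> = sqrt (\<Sum>j. lam j powr s * (\<eta> (\<phi> j))\<^sup>2)"

text \<open>These spaces depend on the domain and so are not types; the notions below transcribe those
  of the library theory of Bochner integration for a space \<open>V\<close> of functionals with norm \<open>N\<close>.\<close>

definition strongly_measurable_on ::
    "'t measure \<Rightarrow> 'd functional set \<Rightarrow> ('d functional \<Rightarrow> real) \<Rightarrow> ('t \<Rightarrow> 'd functional) \<Rightarrow> bool" where
  "strongly_measurable_on M V N g \<longleftrightarrow>
     (AE t in M. g t \<in> V) \<and>
     (\<exists>s. (\<forall>n. simple_function M (s n) \<and> s n ` space M \<subseteq> V) \<and>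
          (AE t in M. (\<lambda>n. N (\<lambda>w. g t w - s n t w)) \<longlonglongrightarrow> 0))"

definition simple_integral_on :: "'t measure \<Rightarrow> ('t \<Rightarrow> 'd functional) \<Rightarrow> 'd functional" where
  "simple_integral_on M s =
     (\<lambda>w. \<Sum>\<eta>\<in>s ` space M. measure M (s -` {\<eta>} \<inter> space M) * \<eta> w)"

text \<open>For finite measures only, so simple functions need no further support condition.\<close>

definition has_Hm1_integral ::
    "(real^'d) set \<Rightarrow> 't measure \<Rightarrow> ('t \<Rightarrow> 'd functional) \<Rightarrow> 'd functional \<Rightarrow> bool" where
  "has_Hm1_integral \<Omega> M g I \<longleftrightarrow>
     strongly_measurable_on M (Hm1_space \<Omega>) (Hm1_norm \<Omega>) g \<and>
     (\<exists>s. (\<forall>n. simple_function M (s n) \<and> s n ` space M \<subseteq> Hm1_space \<Omega>) \<and>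
          (\<lambda>n. \<integral>\<^sup>+t. ennreal (Hm1_norm \<Omega> (\<lambda>w. g t w - s n t w)) \<partial>M) \<longlonglongrightarrow> 0 \<and>
          Hm1_tendsto \<Omega> (\<lambda>n. simple_integral_on M (s n)) I)"

definition Hm1_integrable ::
    "(real^'d) set \<Rightarrow> 't measure \<Rightarrow> ('t \<Rightarrow> 'd functional) \<Rightarrow> bool" where
  "Hm1_integrable \<Omega> M g \<longleftrightarrow> (\<exists>I. has_Hm1_integral \<Omega> M g I)"

definition Hm1_integral ::
    "(real^'d) set \<Rightarrow> 't measure \<Rightarrow> ('t \<Rightarrow> 'd functional) \<Rightarrow> 'd functional" where
  "Hm1_integral \<Omega> M g = (THE I. has_Hm1_integral \<Omega> M g I)"

abbreviation time_measure :: "real \<Rightarrow> real measure" where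
  "time_measure t \<equiv> lebesgue_on {0<..<t}"

definition L2_time_space ::
    "real \<Rightarrow> 'd functional set \<Rightarrow> ('d functional \<Rightarrow> real) \<Rightarrow> (real \<Rightarrow> 'd functional) set" where
  "L2_time_space t V N =
     {g. strongly_measurable_on (time_measure t) V N g \<and>
         integrable (time_measure t) (\<lambda>s. (N (g s))\<^sup>2)}"

definition L2_time_norm ::
    "real \<Rightarrow> ('d functional \<Rightarrow> real) \<Rightarrow> (real \<Rightarrow> 'd functional) \<Rightarrow> real" where
  "L2_time_norm t N g = sqrt (LINT s|time_measure t. (N (g s))\<^sup>2)"

definition fractional_integral ::
    "(real^'d) set \<Rightarrow> real \<Rightarrow> (real \<Rightarrow> 'd functional) \<Rightarrow> real \<Rightarrow> 'd functional" where
  "fractional_integral \<Omega> \<gamma> u t =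
     Hm1_integral \<Omega> (time_measure t) (\<lambda>\<tau> w. (t - \<tau>) powr (\<gamma> - 1) / Gamma \<gamma> * u \<tau> w)"

text \<open>The Caputo derivative of order \<open>\<beta>\<close> is \<open>J\<^sup>1\<^sup>-\<^sup>\<beta> u'\<close>, with \<open>J\<^sup>\<gamma>\<close> the fractional integral above.
  A function \<open>u(t) = \<integral>\<^sub>0\<^sup>t \<dots>\<close> with square integrable data is in general not absolutely continuous,
  so \<open>u'\<close> has to be read as the distributional derivative of \<open>u\<close> started from its initial value
  \<open>v\<close>. Since \<open>J\<^sup>1\<^sup>-\<^sup>\<beta>\<close> commutes with that derivative, \<open>g = J\<^sup>1\<^sup>-\<^sup>\<beta> u'\<close> then means
  \<open>g = (J\<^sup>1\<^sup>-\<^sup>\<beta> (u - v))'\<close> with \<open>J\<^sup>1\<^sup>-\<^sup>\<beta> (u - v)\<close> vanishing at 0, i.e. \<open>J\<^sup>1\<^sup>-\<^sup>\<beta> (u - v) = J\<^sup>1 g\<close>.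
  If \<open>u = v + J\<^sup>1 u'\<close> with integrable \<open>u'\<close>, then \<open>J\<^sup>1\<^sup>-\<^sup>\<beta> (u - v) = J\<^sup>1 (J\<^sup>1\<^sup>-\<^sup>\<beta> u')\<close>, and \<open>g\<close> is the
  classical \<open>J\<^sup>1\<^sup>-\<^sup>\<beta> u'\<close> almost everywhere.\<close>

definition has_caputo_derivative ::
    "(real^'d) set \<Rightarrow> real \<Rightarrow> real \<Rightarrow> 'd functional \<Rightarrow> (real \<Rightarrow> 'd functional) \<Rightarrow>
     (real \<Rightarrow> 'd functional) \<Rightarrow> bool" where
  "has_caputo_derivative \<Omega> T \<beta> v u g \<longleftrightarrow>
     Hm1_integrable \<Omega> (time_measure T) u \<and> Hm1_integrable \<Omega> (time_measure T) g \<and>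
     (AE t in time_measure T.
        fractional_integral \<Omega> (1 - \<beta>) (\<lambda>\<tau> w. u \<tau> w - v w) t = Hm1_integral \<Omega> (time_measure t) g)"

definition caputo_differentiable ::
    "(real^'d) set \<Rightarrow> real \<Rightarrow> real \<Rightarrow> 'd functional \<Rightarrow> (real \<Rightarrow> 'd functional) \<Rightarrow> bool" where
  "caputo_differentiable \<Omega> T \<beta> v u \<longleftrightarrow> (\<exists>g. has_caputo_derivative \<Omega> T \<beta> v u g)"

text \<open>Determined up to a null set of times.\<close>

definition caputo_derivative ::
    "(real^'d) set \<Rightarrow> real \<Rightarrow> real \<Rightarrow> 'd functional \<Rightarrow> (real \<Rightarrow> 'd functional) \<Rightarrow>
     real \<Rightarrow> 'd functional" where
  "caputo_derivative \<Omega> T \<beta> v u = (SOME g. has_caputo_derivative \<Omega> T \<beta> v u g)"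

definition multiterm_derivative ::
    "(real^'d) set \<Rightarrow> real \<Rightarrow> real \<Rightarrow> nat \<Rightarrow> (nat \<Rightarrow> real) \<Rightarrow> (nat \<Rightarrow> real) \<Rightarrow>
     'd functional \<Rightarrow> (real \<Rightarrow> 'd functional) \<Rightarrow> real \<Rightarrow> 'd functional" where
  "multiterm_derivative \<Omega> T \<alpha> m a b v u =
     (\<lambda>t w. caputo_derivative \<Omega> T \<alpha> v u t w +
            (\<Sum>i=1..m. b i * caputo_derivative \<Omega> T (a i) v u t w))"

text \<open>The \<open>n\<close> parameters and the \<open>n\<close> arguments are indexed by \<open>{..<n}\<close>.\<close>

definition multinomial_ML ::
    "nat \<Rightarrow> (nat \<Rightarrow> real) \<Rightarrow> real \<Rightarrow> (nat \<Rightarrow> real) \<Rightarrow> real" where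
  "multinomial_ML n \<beta>s \<beta> z =
     (\<Sum>k. \<Sum>l\<in>{l \<in> {..<n} \<rightarrow>\<^sub>E (UNIV :: nat set). (\<Sum>i<n. l i) = k}.
        fact k / (\<Prod>i<n. fact (l i)) *
        ((\<Prod>i<n. z i ^ l i) / Gamma (\<beta> + (\<Sum>i<n. \<beta>s i * real (l i)))))"

definition E_bar_coeff ::
    "real \<Rightarrow> nat \<Rightarrow> (nat \<Rightarrow> real) \<Rightarrow> (nat \<Rightarrow> real) \<Rightarrow> real \<Rightarrow> real \<Rightarrow> real" where
  "E_bar_coeff \<alpha> m a b l t =
     t powr (\<alpha> - 1) *
     multinomial_ML (Suc m) (\<lambda>i. if i = 0 then \<alpha> else \<alpha> - a i) \<alpha>
       (\<lambda>i. if i = 0 then - l * t powr \<alpha> else - b i * t powr (\<alpha> - a i))"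

definition E_bar ::
    "(real^'d) set \<Rightarrow> (nat \<Rightarrow> real) \<Rightarrow> (nat \<Rightarrow> real^'d \<Rightarrow> real) \<Rightarrow>
     real \<Rightarrow> nat \<Rightarrow> (nat \<Rightarrow> real) \<Rightarrow> (nat \<Rightarrow> real) \<Rightarrow> real \<Rightarrow> 'd functional \<Rightarrow> 'd functional" where
  "E_bar \<Omega> lam \<phi> \<alpha> m a b t \<eta> =
     Hm1_suminf \<Omega> (\<lambda>j w. E_bar_coeff \<alpha> m a b (lam j) t * \<eta> (\<phi> j) * Hm1_of_L2 \<Omega> (\<phi> j) w)"

definition duhamel ::
    "(real^'d) set \<Rightarrow> (nat \<Rightarrow> real) \<Rightarrow> (nat \<Rightarrow> real^'d \<Rightarrow> real) \<Rightarrow>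
     real \<Rightarrow> nat \<Rightarrow> (nat \<Rightarrow> real) \<Rightarrow> (nat \<Rightarrow> real) \<Rightarrow> (real \<Rightarrow> 'd functional) \<Rightarrow>
     real \<Rightarrow> 'd functional" where
  "duhamel \<Omega> lam \<phi> \<alpha> m a b f t =
     Hm1_integral \<Omega> (time_measure t) (\<lambda>s. E_bar \<Omega> lam \<phi> \<alpha> m a b (t - s) (f s))"

end

theory Submission
  imports Defs
begin

text \<open>
  Write \<open>f\<^sub>j\<close>, \<open>u\<^sub>j\<close> for the coefficients with respect to the eigenfunctions, so that \<open>u\<^sub>j = k\<^sub>\<lambda> * f\<^sub>j\<close>
  with \<open>\<lambda> = \<lambda>\<^sub>j\<close> and \<open>k\<^sub>\<lambda>(t) = t\<^sup>\<alpha>\<^sup>-\<^sup>1 E(-\<lambda> t\<^sup>\<alpha>, \<dots>)\<close>. Summing the Mittag-Leffler series term by term shows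
  that \<open>k\<^sub>\<lambda>\<close> solves \<open>g\<^sub>\<lambda> * k\<^sub>\<lambda> = 1\<close>, where \<open>g\<^sub>\<lambda>(t) = t\<^sup>-\<^sup>\<alpha> / \<Gamma>(1 - \<alpha>) + \<Sum>\<^sub>i b\<^sub>i t\<^sup>-\<^sup>a\<^sub>i / \<Gamma>(1 - a\<^sub>i) + \<lambda>\<close>. As
  \<open>g\<^sub>\<lambda>\<close> decreases, \<open>k\<^sub>\<lambda>\<close> is positive; as \<open>g\<^sub>\<lambda> \<ge> \<lambda>\<close>, this yields \<open>\<lambda> \<integral> k\<^sub>\<lambda> \<le> 1\<close>, and Young's inequality bounds
  \<open>\<lambda>\<^sub>j u\<^sub>j\<close> by \<open>f\<^sub>j\<close> in \<open>L\<^sup>2(0,t)\<close>, uniformly in \<open>j\<close>. The resolvent identity \<open>k\<^sub>\<lambda> + \<lambda> k\<^sub>0 * k\<^sub>\<lambda> = k\<^sub>0\<close> gives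
  \<open>k\<^sub>\<lambda> \<le> k\<^sub>0\<close>, a majorant that makes the functional-valued integrals converge, and
  \<open>u\<^sub>j = k\<^sub>0 * (f\<^sub>j - \<lambda>\<^sub>j u\<^sub>j)\<close>, from which the Caputo derivatives of \<open>u\<^sub>j\<close> are read off and
  \<open>P(\<partial>\<^sub>t)u\<^sub>j = f\<^sub>j - \<lambda>\<^sub>j u\<^sub>j\<close>. Hence \<open>C = 1 + 2\<close> works.
\<close>

section \<open>Weak derivatives and test functions\<close>

text \<open>The kernel calculus uses neither Laplace inversion nor complete monotonicity. The layers
  of the series of \<open>kern\<close> alternate in sign, so positivity is invisible termwise and
  has to come from the first-kind equation, by a contradiction at a first zero. Two bounds on the
  kernels are needed: the integral bound gains two orders of smoothness, but integrating functionals
  requires one pointwise majorant for all modes at once, and the comparison with eigenvalue 0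
  provides it.

  As f is merely square integrable in time and the kernels are only locally integrable, functions
  are cut off at T and iterated convolutions are compared for almost every t; where an inequality is
  wanted for every t, continuity restores it. Series, integrals and Caputo derivatives are given by
  description or choice operators, so each evaluation needs a uniqueness argument; all are reduced
  to coefficients. The derivative of order \<alpha> cannot be found like the lower ones, because its
  kernel would contain a point mass; it is what remains of the equation after the lower orders are
  subtracted.\<close>

locale semi_inner =
  fixes V :: "('x \<Rightarrow> real) set" and ip :: "('x \<Rightarrow> real) \<Rightarrow> ('x \<Rightarrow> real) \<Rightarrow> real"
  assumes add: "w \<in> V \<Longrightarrow> z \<in> V \<Longrightarrow> (\<lambda>x. w x + z x) \<in> V"
    and scale: "w \<in> V \<Longrightarrow> (\<lambda>x. c * w x) \<in> V"
    and zero: "(\<lambda>x. 0) \<in> V"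
    and ip_add: "w \<in> V \<Longrightarrow> z \<in> V \<Longrightarrow> y \<in> V \<Longrightarrow> ip (\<lambda>x. w x + z x) y = ip w y + ip z y"
    and ip_scale: "w \<in> V \<Longrightarrow> z \<in> V \<Longrightarrow> ip (\<lambda>x. c * w x) z = c * ip w z"
    and ip_sym: "w \<in> V \<Longrightarrow> z \<in> V \<Longrightarrow> ip w z = ip z w"
    and ip_nonneg: "w \<in> V \<Longrightarrow> ip w w \<ge> 0"
begin

lemma diff: "w \<in> V \<Longrightarrow> z \<in> V \<Longrightarrow> (\<lambda>x. w x - z x) \<in> V"
  using add[OF _ scale[of z "-1"], of w] by simp

lemma ip_add_right: "w \<in> V \<Longrightarrow> z \<in> V \<Longrightarrow> y \<in> V \<Longrightarrow> ip y (\<lambda>x. w x + z x) = ip y w + ip y z"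
  using ip_add[of w z y] ip_sym[OF _ add[of w z], of y] ip_sym[of y w] ip_sym[of y z] by simp

lemma ip_scale_right: "w \<in> V \<Longrightarrow> z \<in> V \<Longrightarrow> ip z (\<lambda>x. c * w x) = c * ip z w"
  using ip_scale[of w z c] ip_sym[OF _ scale[of w c], of z] ip_sym[of z w] by simp

lemma ip_expand:
  assumes "w \<in> V" "z \<in> V"
  shows "ip (\<lambda>x. w x + c * z x) (\<lambda>x. w x + c * z x) = ip w w + 2 * c * ip w z + c\<^sup>2 * ip z z"
  using assms by (simp add: ip_add ip_add_right ip_scale ip_scale_right scale add ip_sym[of z w]
      power2_eq_square algebra_simps)

text \<open>Functions equal almost everywhere are not identified, so the form is only semidefinite.
  If \<open>ip z z = 0\<close>, the quadratic polynomial in c degenerates to an affine one, which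
  stays nonnegative only if its slope vanishes.\<close>

lemma cauchy_schwarz_sq:
  assumes "w \<in> V" "z \<in> V"
  shows "(ip w z)\<^sup>2 \<le> ip w w * ip z z"
proof -
  have *: "0 \<le> ip w w + 2 * c * ip w z + c\<^sup>2 * ip z z" for c
    using ip_nonneg[OF add[OF assms(1) scale[OF assms(2)]]] ip_expand[OF assms] by metis
  show ?thesis
  proof (cases "ip z z = 0")
    case True
    have "ip w z = 0"
    proof (rule ccontr)
      assume n: "ip w z \<noteq> 0"
      \<comment> \<open>At this c the affine function takes the value -1.\<close>
      show False using *[of "- (ip w w + 1) / (2 * ip w z)"] n True by (simp add: field_simps)
    qed
    then show ?thesis using True by simp
  next
    case False
    then have p: "ip z z > 0" using ip_nonneg[OF assms(2)] by linarith
    have "0 \<le> ip w w - (ip w z)\<^sup>2 / ip z z"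
      using *[of "- ip w z / ip z z"] p by (simp add: field_simps power2_eq_square)
    then show ?thesis using p by (simp add: field_simps)
  qed
qed

lemma cauchy_schwarz:
  assumes "w \<in> V" "z \<in> V"
  shows "\<bar>ip w z\<bar> \<le> sqrt (ip w w) * sqrt (ip z z)"
  using real_sqrt_le_mono[OF cauchy_schwarz_sq[OF assms]] by (simp add: real_sqrt_mult)

lemma triangle:
  assumes "w \<in> V" "z \<in> V"
  shows "sqrt (ip (\<lambda>x. w x + z x) (\<lambda>x. w x + z x)) \<le> sqrt (ip w w) + sqrt (ip z z)"
proof (rule real_le_lsqrt)
  show "0 \<le> sqrt (ip w w) + sqrt (ip z z)" using assms ip_nonneg by simp
  have "ip (\<lambda>x. w x + z x) (\<lambda>x. w x + z x) = ip w w + 2 * ip w z + ip z z"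
    using ip_expand[OF assms, of 1] by simp
  also have "\<dots> \<le> ip w w + 2 * (sqrt (ip w w) * sqrt (ip z z)) + ip z z"
    using cauchy_schwarz[OF assms] by linarith
  also have "\<dots> = (sqrt (ip w w) + sqrt (ip z z))\<^sup>2"
    using assms ip_nonneg by (simp add: power2_sum)
  finally show "ip (\<lambda>x. w x + z x) (\<lambda>x. w x + z x) \<le> (sqrt (ip w w) + sqrt (ip z z))\<^sup>2" .
qed

lemma norm_scale:
  assumes "w \<in> V"
  shows "sqrt (ip (\<lambda>x. c * w x) (\<lambda>x. c * w x)) = \<bar>c\<bar> * sqrt (ip w w)"
  using assms by (simp add: ip_scale ip_scale_right scale real_sqrt_mult[symmetric] mult.assoc[symmetric]
      flip: power2_eq_square) (simp add: real_sqrt_mult)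

lemma triangle_diff:
  assumes "w \<in> V" "z \<in> V"
  shows "sqrt (ip w w) \<le> sqrt (ip (\<lambda>x. w x - z x) (\<lambda>x. w x - z x)) + sqrt (ip z z)"
  using triangle[OF diff[OF assms] assms(2)] by simp

lemma sum_in:
  assumes "\<And>j. e j \<in> V"
  shows "(\<lambda>x. \<Sum>j<n::nat. a j * e j x) \<in> V"
  by (induction n) (auto simp: zero intro!: add scale assms)

lemma ip_sum:
  assumes e: "\<And>j. e j \<in> V" and y: "y \<in> V"
  shows "ip (\<lambda>x. \<Sum>j<n::nat. a j * e j x) y = (\<Sum>j<n. a j * ip (e j) y)"
proof (induction n)
  case 0
  show ?case using ip_scale[OF zero y, of 0] by simp
next
  case (Suc n)
  then show ?case
    by (simp add: ip_add[OF sum_in[OF e] scale[OF e] y] ip_scale[OF e y])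
qed

text \<open>The projection p of y satisfies \<open>ip p y = ip p p\<close>, and Cauchy-Schwarz for p
  and y leaves the claim after cancelling this number. Squared lengths \<open>\<mu>\<close> are
  allowed because the eigenfunctions, orthonormal in L2, are merely orthogonal in H1.\<close>

lemma bessel:
  assumes e: "\<And>j. e j \<in> V" and y: "y \<in> V" and mu: "\<And>j. \<mu> j > 0"
    and orth: "\<And>i j. ip (e i) (e j) = (if i = j then \<mu> i else 0)"
  shows "(\<Sum>j<n::nat. (ip (e j) y)\<^sup>2 / \<mu> j) \<le> ip y y"
proof -
  let ?p = "\<lambda>x. \<Sum>j<n. (ip (e j) y / \<mu> j) * e j x"
  let ?Q = "\<Sum>j<n. (ip (e j) y)\<^sup>2 / \<mu> j"
  have p: "?p \<in> V" by (rule sum_in[OF e])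
  have 1: "ip ?p y = ?Q" unfolding ip_sum[OF e y] by (simp add: power2_eq_square)
  have "ip ?p ?p = (\<Sum>j<n. (ip (e j) y / \<mu> j) * ip (e j) ?p)" by (rule ip_sum[OF e p])
  also have "\<dots> = (\<Sum>j<n. (ip (e j) y)\<^sup>2 / \<mu> j)"
  proof (rule sum.cong[OF refl])
    fix j assume j: "j \<in> {..<n}"
    have "ip (e j) ?p = ip ?p (e j)" by (rule ip_sym[OF e p])
    also have "\<dots> = (\<Sum>k<n. (ip (e k) y / \<mu> k) * ip (e k) (e j))" by (rule ip_sum[OF e e])
    also have "\<dots> = (\<Sum>k<n. if k = j then ip (e j) y else 0)"
      by (rule sum.cong[OF refl]) (use mu in \<open>auto simp: orth less_imp_neq[symmetric]\<close>)
    also have "\<dots> = ip (e j) y" using j by simp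
    finally show "(ip (e j) y / \<mu> j) * ip (e j) ?p = (ip (e j) y)\<^sup>2 / \<mu> j"
      by (simp add: power2_eq_square)
  qed
  finally have 2: "ip ?p ?p = ?Q" .
  have Q0: "?Q \<ge> 0" by (intro sum_nonneg divide_nonneg_pos) (auto simp: mu)
  have "?Q * ?Q \<le> ?Q * ip y y"
    using cauchy_schwarz_sq[OF p y] unfolding 1 2 by (simp add: power2_eq_square)
  then show ?thesis
    using Q0 ip_nonneg[OF y] by (cases "?Q = 0") (auto simp: mult_le_cancel_left)
qed

end

section \<open>The space L2 as a semi-inner product space\<close>

lemma L2_mult_integrable:
  assumes "w \<in> L2_space \<Omega>" "z \<in> L2_space \<Omega>"
  shows "integrable (lebesgue_on \<Omega>) (\<lambda>x. w x * z x)"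
proof (rule Bochner_Integration.integrable_bound)
  show "integrable (lebesgue_on \<Omega>) (\<lambda>x. (w x)\<^sup>2 + (z x)\<^sup>2)"
    using assms by (auto simp: L2_space_def)
  show "(\<lambda>x. w x * z x) \<in> borel_measurable (lebesgue_on \<Omega>)"
    using assms by (auto simp: L2_space_def)
  have "norm (a * b) \<le> norm (a\<^sup>2 + b\<^sup>2)" for a b :: real
    using sum_squares_bound[of "\<bar>a\<bar>" "\<bar>b\<bar>"] mult_nonneg_nonneg[OF abs_ge_zero[of a] abs_ge_zero[of b]]
    unfolding abs_mult power2_abs real_norm_def by linarith
  then show "AE x in lebesgue_on \<Omega>. norm (w x * z x) \<le> norm ((w x)\<^sup>2 + (z x)\<^sup>2)" by blast
qed

interpretation L2: semi_inner "L2_space \<Omega>" "L2_inner \<Omega>" for \<Omega> :: "(real^'d) set"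
proof
  fix w z y :: "real^'d \<Rightarrow> real" and c :: real
  assume w: "w \<in> L2_space \<Omega>"
  show "(\<lambda>x. c * w x) \<in> L2_space \<Omega>"
    using w by (auto simp: L2_space_def power_mult_distrib)
  show "0 \<le> L2_inner \<Omega> w w" by (simp add: L2_inner_def)
  assume z: "z \<in> L2_space \<Omega>"
  note i = L2_mult_integrable
  show "(\<lambda>x. w x + z x) \<in> L2_space \<Omega>"
    using w z i[OF w z] by (auto simp: L2_space_def power2_sum mult.assoc)
  show "L2_inner \<Omega> w z = L2_inner \<Omega> z w" by (simp add: L2_inner_def mult.commute)
  show "L2_inner \<Omega> (\<lambda>x. c * w x) z = c * L2_inner \<Omega> w z"
    by (simp add: L2_inner_def mult.assoc)
  assume y: "y \<in> L2_space \<Omega>"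
  show "L2_inner \<Omega> (\<lambda>x. w x + z x) y = L2_inner \<Omega> w y + L2_inner \<Omega> z y"
    using i[OF w y] i[OF z y] by (simp add: L2_inner_def distrib_right)
qed (auto simp: L2_space_def)

section \<open>Partial derivatives and integration by parts\<close>

lemma pderiv_at_unique:
  assumes "(w has_derivative D) (at x)"
  shows "pderiv_at i w x = D (axis i 1)"
  unfolding pderiv_at_def frechet_derivative_at[OF assms, symmetric] ..

lemma pderiv_at_lincomb:
  assumes "w differentiable (at x)" "z differentiable (at x)"
  shows "pderiv_at i (\<lambda>x. c * w x + d * z x) x = c * pderiv_at i w x + d * pderiv_at i z x"
  by (rule pderiv_at_unique[THEN trans])
    (use assms in \<open>auto intro!: derivative_eq_intros simp: frechet_derivative_works pderiv_at_def\<close>)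

lemma pderiv_at_mult:
  assumes "w differentiable (at x)" "z differentiable (at x)"
  shows "pderiv_at i (\<lambda>x. w x * z x) x = w x * pderiv_at i z x + pderiv_at i w x * z x"
  by (rule pderiv_at_unique[THEN trans])
    (use assms in \<open>auto intro!: derivative_eq_intros simp: frechet_derivative_works pderiv_at_def\<close>)

lemma pderiv_at_coord: "pderiv_at i (\<lambda>x. x $ i) x = 1"
  by (rule trans[OF pderiv_at_unique[OF bounded_linear_imp_has_derivative[OF bounded_linear_vec_nth]]])
    (simp add: axis_def)

lemma coord_differentiable: "(\<lambda>x. x $ i) differentiable (at x)"
  using bounded_linear_imp_differentiable bounded_linear_vec_nth by blast

text \<open>Restriction to a line, so that one-dimensional calculus, in particular the mean value
  theorem, applies.\<close>

lemma pderiv_at_direction: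
  assumes "\<And>x. h differentiable (at x)"
  shows "((\<lambda>t. h (x + t *\<^sub>R axis i 1)) has_real_derivative pderiv_at i h (x + s *\<^sub>R axis i 1)) (at s)"
proof -
  let ?F = "frechet_derivative h (at (x + s *\<^sub>R axis i 1))"
  have h: "(h has_derivative ?F) (at (x + s *\<^sub>R axis i 1))"
    using assms frechet_derivative_works by blast
  then have lin: "linear ?F" using has_derivative_linear by blast
  have "((\<lambda>t. h (x + t *\<^sub>R axis i 1)) has_derivative (\<lambda>t. ?F (t *\<^sub>R axis i 1))) (at s)"
    by (rule has_derivative_compose[where g = h and f = "\<lambda>t. x + t *\<^sub>R axis i 1", OF _ h])
      (auto intro!: derivative_eq_intros)
  moreover have "(\<lambda>t. ?F (t *\<^sub>R axis i 1)) = (*) (pderiv_at i h (x + s *\<^sub>R axis i 1))"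
    by (auto simp: linear_cmul[OF lin] pderiv_at_def)
  ultimately show ?thesis by (simp add: has_field_derivative_def)
qed

lemma pderiv_at_support:
  assumes "compact K" "\<And>x. x \<notin> K \<Longrightarrow> h x = 0" "x \<notin> K"
  shows "pderiv_at i h x = 0"
proof -
  have o: "open (- K)" using assms(1) by (metis compact_imp_closed open_Compl)
  have x: "x \<in> - K" using assms(3) by blast
  have e: "0 = h y" if "y \<in> - K" for y using assms(2)[of y] that by simp
  have "(h has_derivative (\<lambda>_. 0)) (at x)"
    by (rule has_derivative_transform_within_open[OF has_derivative_const[of 0] o x e])
  from pderiv_at_unique[OF this] show ?thesis .
qed

lemma integrable_compact_support:
  fixes h :: "real^'d \<Rightarrow> real"
  assumes "compact K" "\<And>x. x \<notin> K \<Longrightarrow> h x = 0" "continuous_on UNIV h"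
  shows "integrable lborel h"
proof -
  have "integrable lborel (\<lambda>x. indicator K x *\<^sub>R h x)"
    using assms by (intro borel_integrable_compact) (auto intro: continuous_on_subset)
  moreover have "indicator K x *\<^sub>R h x = h x" for x by (cases "x \<in> K") (simp_all add: assms(2))
  then have "(\<lambda>x. indicator K x *\<^sub>R h x) = h" by (rule ext)
  ultimately show ?thesis by (simp only:)
qed

text \<open>By translation invariance every difference quotient has integral 0, and the quotients
  converge to the derivative under a common integrable bound. This replaces iterated integration and
  the fundamental theorem.\<close>

lemma integral_pderiv_at_compact_support:
  fixes h :: "real^'d \<Rightarrow> real"
  assumes K: "compact K" and supp: "\<And>x. x \<notin> K \<Longrightarrow> h x = 0"
    and d: "\<And>x. h differentiable (at x)" and c: "continuous_on UNIV (pderiv_at i h)"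
  shows "(LINT x|lborel. pderiv_at i h x) = 0"
proof -
  define e :: "real^'d" where "e = axis i 1"
  have ne: "norm e = 1" by (simp add: e_def norm_axis_1)
  define f where "f = (\<lambda>n x. real (Suc n) * (h (inverse (real (Suc n)) *\<^sub>R e + x) - h x))"
  have hc: "continuous_on UNIV h"
    using d by (simp add: continuous_at_imp_continuous_on differentiable_imp_continuous_within)
  have hi: "integrable lborel h" by (rule integrable_compact_support[OF K supp hc])
  have "bounded (pderiv_at i h ` K)"
    using c K by (meson compact_continuous_image compact_imp_bounded continuous_on_subset top_greatest)
  then obtain B where B: "\<And>x. x \<in> K \<Longrightarrow> \<bar>pderiv_at i h x\<bar> \<le> B" "B > 0"
    unfolding bounded_pos by auto
  have B: "\<bar>pderiv_at i h x\<bar> \<le> B" for x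
    using B pderiv_at_support[OF K supp, where x = x and i = i] by (cases "x \<in> K") auto
  have B0: "B \<ge> 0" using B[of 0] by linarith
  obtain R where R: "\<And>x. x \<in> K \<Longrightarrow> norm x \<le> R"
    using compact_imp_bounded[OF K] unfolding bounded_iff by auto
  have fz: "(LINT x|lborel. f n x) = 0" for n
  proof -
    let ?c = "inverse (real (Suc n)) *\<^sub>R e"
    have "integrable (distr lborel borel ((+) ?c)) h"
      using hi by (simp add: lborel_distr_plus)
    then have i2: "integrable lborel (\<lambda>x. h (?c + x))"
      by (subst (asm) integrable_distr_eq) (use borel_measurable_integrable[OF hi] in auto)
    have "(LINT x|lborel. h x) = (LINT x|distr lborel borel ((+) ?c). h x)"
      by (simp add: lborel_distr_plus)
    also have "\<dots> = (LINT x|lborel. h (?c + x))"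
      by (subst integral_distr) (use borel_measurable_integrable[OF hi] in auto)
    finally show ?thesis using hi i2 by (simp add: f_def)
  qed
  have lim: "(\<lambda>n. f n x) \<longlonglongrightarrow> pderiv_at i h x" for x
  proof -
    have "((\<lambda>t. h (x + t *\<^sub>R e)) has_real_derivative pderiv_at i h x) (at 0)"
      using pderiv_at_direction[OF d, of x i 0] by (simp add: e_def)
    then have "((\<lambda>t. (h (x + t *\<^sub>R e) - h x) / t) \<longlongrightarrow> pderiv_at i h x) (at 0)"
      by (simp add: DERIV_def)
    then have "(\<lambda>n. (h (x + inverse (real (Suc n)) *\<^sub>R e) - h x) / inverse (real (Suc n)))
       \<longlonglongrightarrow> pderiv_at i h x"
      using LIMSEQ_inverse_real_of_nat by (auto simp: tendsto_at_iff_sequentially comp_def)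
    then show ?thesis by (simp add: f_def field_simps add.commute del: of_nat_Suc)
  qed
  \<comment> \<open>The mean value theorem bounds the quotient by B. Steps have length at most 1,
    hence the radius \<open>R + 1\<close>: outside that ball both points miss the support.\<close>
  have bound: "\<bar>f n x\<bar> \<le> indicator (cball 0 (R + 1)) x * B" for n x
  proof (cases "x \<in> cball 0 (R + 1)")
    case True
    let ?t = "inverse (real (Suc n))"
    have "\<exists>z. 0 < z \<and> z < ?t \<and> h (x + ?t *\<^sub>R e) - h (x + 0 *\<^sub>R e) = (?t - 0) * pderiv_at i h (x + z *\<^sub>R e)"
      unfolding e_def by (rule MVT2) (auto intro!: pderiv_at_direction d)
    then obtain z where "h (x + ?t *\<^sub>R e) - h x = ?t * pderiv_at i h (x + z *\<^sub>R e)" by auto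
    then have "f n x = pderiv_at i h (x + z *\<^sub>R e)" by (simp add: f_def add.commute del: of_nat_Suc)
    then show ?thesis using B True by simp
  next
    case False
    then have "norm x > R + 1" by simp
    moreover have "norm x \<le> norm (inverse (real (Suc n)) *\<^sub>R e + x) + norm (inverse (real (Suc n)) *\<^sub>R e)"
      using norm_triangle_ineq4[of "inverse (real (Suc n)) *\<^sub>R e + x" "inverse (real (Suc n)) *\<^sub>R e"] by simp
    moreover have "norm (inverse (real (Suc n)) *\<^sub>R e) \<le> 1" by (simp add: ne field_simps)
    ultimately have "norm (inverse (real (Suc n)) *\<^sub>R e + x) > R" "norm x > R" by linarith+
    then have "h (inverse (real (Suc n)) *\<^sub>R e + x) = 0" "h x = 0" using R supp by (meson not_less)+
    then show ?thesis using False by (simp add: f_def)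
  qed
  have "(\<lambda>n. LINT x|lborel. f n x) \<longlonglongrightarrow> (LINT x|lborel. pderiv_at i h x)"
  proof (rule integral_dominated_convergence[where w = "\<lambda>x. indicator (cball 0 (R + 1)) x * B"])
    show "integrable lborel (\<lambda>x::real^'d. indicator (cball 0 (R + 1)) x * B)"
      using borel_integrable_compact[of "cball 0 (R + 1)" "\<lambda>_::real^'d. B"] by simp
    show "pderiv_at i h \<in> borel_measurable lborel"
      using c by (simp add: borel_measurable_continuous_onI)
    show "f n \<in> borel_measurable lborel" for n
    proof -
      have [measurable]: "h \<in> borel_measurable borel" using hc by (simp add: borel_measurable_continuous_onI)
      show ?thesis unfolding f_def by measurable
    qed
  qed (use lim bound in auto)
  then show ?thesis by (simp add: fz LIMSEQ_const_iff)
qed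

section \<open>Test functions and their weak gradients\<close>

lemma Ck_lincomb: "Ck k w \<Longrightarrow> Ck k z \<Longrightarrow> Ck k (\<lambda>x. c * w x + d * z x)"
proof (induction k arbitrary: w z)
  case 0
  then show ?case by (auto intro!: continuous_intros)
next
  case (Suc k)
  have "pderiv_at i (\<lambda>x. c * w x + d * z x) = (\<lambda>x. c * pderiv_at i w x + d * pderiv_at i z x)" for i
    using Suc.prems by (intro ext pderiv_at_lincomb) auto
  then show ?case using Suc by (auto intro!: derivative_intros)
qed

lemma test_lincomb:
  assumes "w \<in> test_functions \<Omega>" "z \<in> test_functions \<Omega>"
  shows "(\<lambda>x. c * w x + d * z x) \<in> test_functions \<Omega>"
proof -
  from assms obtain K L where "compact K" "K \<subseteq> \<Omega>" "\<forall>x. x \<notin> K \<longrightarrow> w x = 0"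
     "compact L" "L \<subseteq> \<Omega>" "\<forall>x. x \<notin> L \<longrightarrow> z x = 0" by (auto simp: test_functions_def)
  then have "compact (K \<union> L) \<and> K \<union> L \<subseteq> \<Omega> \<and> (\<forall>x. x \<notin> K \<union> L \<longrightarrow> c * w x + d * z x = 0)" by auto
  then show ?thesis using assms unfolding test_functions_def by (blast intro: Ck_lincomb)
qed

lemma Ck_const_zero: "Ck k (\<lambda>_::real^'d. 0)"
proof (induction k)
  case (Suc k)
  have "pderiv_at i (\<lambda>_::real^'d. 0) = (\<lambda>_. 0)" for i by (auto intro!: ext pderiv_at_unique)
  then show ?case using Suc by simp
qed auto

lemma test_zero: "(\<lambda>_. 0) \<in> test_functions \<Omega>"
  by (auto simp: test_functions_def Ck_const_zero intro!: exI[of _ "{}"])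

lemma test_cases:
  assumes "z \<in> test_functions \<Omega>"
  obtains K where "compact K" "K \<subseteq> \<Omega>" "\<And>x. x \<notin> K \<Longrightarrow> z x = 0" "\<And>i x. x \<notin> K \<Longrightarrow> pderiv_at i z x = 0"
    "continuous_on UNIV z" "\<And>x. z differentiable (at x)" "\<And>i. continuous_on UNIV (pderiv_at i z)"
proof -
  from assms obtain K where K: "compact K" "K \<subseteq> \<Omega>" "\<And>x. x \<notin> K \<Longrightarrow> z x = 0"
    and C: "\<And>k. Ck k z" by (auto simp: test_functions_def)
  have "pderiv_at i z x = 0" if "x \<notin> K" for i x by (rule pderiv_at_support[OF K(1,3) that])
  then show ?thesis using that K C[of 0] C[of "Suc 0"] by auto
qed

lemma lebesgue_on_compact_support:
  fixes h :: "real^'d \<Rightarrow> real"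
  assumes K: "compact K" and supp: "\<And>x. x \<notin> K \<Longrightarrow> h x = 0" and c: "continuous_on UNIV h"
    and \<Omega>: "\<Omega> \<in> sets lebesgue" "K \<subseteq> \<Omega>"
  shows "integrable (lebesgue_on \<Omega>) h" "(LINT x|lebesgue_on \<Omega>. h x) = (LINT x|lborel. h x)"
    "h \<in> borel_measurable (lebesgue_on \<Omega>)"
proof -
  have e: "(\<lambda>x. indicat_real \<Omega> x * h x) = h"
    using supp \<Omega>(2) by (auto simp: indicator_def fun_eq_iff)
  have hm: "h \<in> borel_measurable lborel" using c by (simp add: borel_measurable_continuous_onI)
  have hi: "integrable lebesgue h"
    using integrable_compact_support[OF K supp c] integrable_completion[OF hm] by blast
  show "integrable (lebesgue_on \<Omega>) h"
    using \<Omega> hi by (subst integrable_restrict_space) (auto simp: e)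
  show "(LINT x|lebesgue_on \<Omega>. h x) = (LINT x|lborel. h x)"
    using \<Omega> by (subst integral_restrict_space) (auto simp: e integral_completion[OF hm])
  show "h \<in> borel_measurable (lebesgue_on \<Omega>)"
    using \<open>integrable (lebesgue_on \<Omega>) h\<close> by auto
qed

lemma L2_compact_support:
  fixes h :: "real^'d \<Rightarrow> real"
  assumes "compact K" "\<And>x. x \<notin> K \<Longrightarrow> h x = 0" "continuous_on UNIV h" "\<Omega> \<in> sets lebesgue" "K \<subseteq> \<Omega>"
  shows "h \<in> L2_space \<Omega>"
  using assms lebesgue_on_compact_support[of K h \<Omega>] lebesgue_on_compact_support[of K "\<lambda>x. (h x)\<^sup>2" \<Omega>]
  by (auto simp: L2_space_def intro!: continuous_intros)

lemma test_L2:
  assumes "\<Omega> \<in> sets lebesgue" "z \<in> test_functions \<Omega>"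
  shows "z \<in> L2_space \<Omega>" "pderiv_at i z \<in> L2_space \<Omega>"
proof -
  obtain K where K: "compact K" "K \<subseteq> \<Omega>" "\<And>x. x \<notin> K \<Longrightarrow> z x = 0" "\<And>i x. x \<notin> K \<Longrightarrow> pderiv_at i z x = 0"
    "continuous_on UNIV z" "\<And>x. z differentiable (at x)" "\<And>i. continuous_on UNIV (pderiv_at i z)"
    using test_cases[OF assms(2)] by blast
  show "z \<in> L2_space \<Omega>" by (rule L2_compact_support[OF K(1,3,5) assms(1) K(2)])
  show "pderiv_at i z \<in> L2_space \<Omega>" by (rule L2_compact_support[OF K(1,4,7) assms(1) K(2)])
qed

text \<open>Integration by parts: the product of z with another test function has compact support,
  so its partial derivative integrates to 0.\<close>

lemma test_weak_gradient:
  fixes \<Omega> :: "(real^'d) set"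
  assumes \<Omega>: "\<Omega> \<in> sets lebesgue" and z: "z \<in> test_functions \<Omega>"
  shows "has_weak_gradient \<Omega> z (\<lambda>x. \<chi> i. pderiv_at i z x)"
  unfolding has_weak_gradient_def
proof (intro conjI allI ballI)
  show "(\<lambda>x. (\<chi> i. pderiv_at i z x) $ i) \<in> L2_space \<Omega>" for i using test_L2[OF assms] by simp
  fix i v assume v: "v \<in> test_functions \<Omega>"
  obtain K where K: "compact K" "K \<subseteq> \<Omega>" "\<And>x. x \<notin> K \<Longrightarrow> z x = 0" "\<And>i x. x \<notin> K \<Longrightarrow> pderiv_at i z x = 0"
    "continuous_on UNIV z" "\<And>x. z differentiable (at x)" "\<And>i. continuous_on UNIV (pderiv_at i z)"
    using test_cases[OF z] by blast
  obtain L where L: "continuous_on UNIV v" "\<And>x. v differentiable (at x)" "\<And>i. continuous_on UNIV (pderiv_at i v)"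
    using test_cases[OF v] by blast
  have p: "pderiv_at i (\<lambda>x. z x * v x) = (\<lambda>x. z x * pderiv_at i v x + pderiv_at i z x * v x)"
    by (intro ext pderiv_at_mult K L)
  have c: "continuous_on UNIV (pderiv_at i (\<lambda>x. z x * v x))"
    unfolding p by (intro continuous_intros K L)
  have "L2_inner \<Omega> z (pderiv_at i v) + L2_inner \<Omega> (pderiv_at i z) v
      = (LINT x|lebesgue_on \<Omega>. pderiv_at i (\<lambda>x. z x * v x) x)"
    unfolding p L2_inner_def
    by (intro Bochner_Integration.integral_add[symmetric] L2_mult_integrable test_L2[OF \<Omega>] z v)
  also have "\<dots> = (LINT x|lborel. pderiv_at i (\<lambda>x. z x * v x) x)"
    by (rule lebesgue_on_compact_support(2)[OF K(1) _ c \<Omega> K(2)]) (auto simp: p K)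
  also have "\<dots> = 0"
    by (rule integral_pderiv_at_compact_support[OF K(1) _ _ c]) (auto simp: K L intro!: derivative_intros)
  finally show "L2_inner \<Omega> z (pderiv_at i v) = - L2_inner \<Omega> (\<lambda>x. (\<chi> i. pderiv_at i z x) $ i) v" by simp
qed

lemma test_H1: "\<Omega> \<in> sets lebesgue \<Longrightarrow> z \<in> test_functions \<Omega> \<Longrightarrow> z \<in> H1_space \<Omega>"
  unfolding H1_space_def using test_weak_gradient test_L2 by blast

section \<open>The Dirichlet eigensystem\<close>

lemma has_weak_gradient_lincomb:
  fixes \<Omega> :: "(real^'d) set"
  assumes \<Omega>: "\<Omega> \<in> sets lebesgue" and w: "w \<in> L2_space \<Omega>" "has_weak_gradient \<Omega> w g"
    and z: "z \<in> L2_space \<Omega>" "has_weak_gradient \<Omega> z h"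
  shows "has_weak_gradient \<Omega> (\<lambda>x. c * w x + d * z x) (\<lambda>x. c *\<^sub>R g x + d *\<^sub>R h x)"
  unfolding has_weak_gradient_def
proof (intro conjI allI ballI)
  fix i
  have g: "(\<lambda>x. g x $ i) \<in> L2_space \<Omega>" and h: "(\<lambda>x. h x $ i) \<in> L2_space \<Omega>"
    using w z by (auto simp: has_weak_gradient_def)
  then show "(\<lambda>x. (c *\<^sub>R g x + d *\<^sub>R h x) $ i) \<in> L2_space \<Omega>"
    by (simp add: L2.add L2.scale)
  fix v assume v: "v \<in> test_functions \<Omega>"
  note vL = test_L2[OF \<Omega> v]
  show "L2_inner \<Omega> (\<lambda>x. c * w x + d * z x) (pderiv_at i v)
      = - L2_inner \<Omega> (\<lambda>x. (c *\<^sub>R g x + d *\<^sub>R h x) $ i) v"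
    using w z v g h vL by (simp add: L2.ip_add L2.ip_scale L2.scale has_weak_gradient_def)
qed

lemma gradient_product_integrable:
  fixes \<Omega> :: "(real^'d) set"
  assumes "has_weak_gradient \<Omega> w g" "has_weak_gradient \<Omega> z h"
  shows "integrable (lebesgue_on \<Omega>) (\<lambda>x. g x \<bullet> h x)"
  using assms by (auto simp: inner_vec_def has_weak_gradient_def intro!: L2_mult_integrable)

lemma gradient_inner_nonneg: "gradient_inner \<Omega> w w \<ge> 0"
  by (simp add: gradient_inner_def)

locale dirichlet =
  fixes \<Omega> :: "(real^'d) set" and lam :: "nat \<Rightarrow> real" and \<phi> :: "nat \<Rightarrow> real^'d \<Rightarrow> real"
  assumes open_domain: "open \<Omega>" and bounded_domain: "bounded \<Omega>"
    and eigensystem: "dirichlet_eigensystem \<Omega> lam \<phi>"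
begin

lemma meas: "\<Omega> \<in> sets lebesgue"
  using open_domain by simp

lemma eigenfunction: "\<phi> j \<in> H10_space \<Omega>"
  and eigenfunction_gradient: "w \<in> H10_space \<Omega> \<Longrightarrow> gradient_inner \<Omega> (\<phi> j) w = lam j * L2_inner \<Omega> (\<phi> j) w"
  and orthonormal: "L2_inner \<Omega> (\<phi> i) (\<phi> j) = (if i = j then 1 else 0)"
  and complete: "w \<in> L2_space \<Omega> \<Longrightarrow> (\<And>j. L2_inner \<Omega> w (\<phi> j) = 0) \<Longrightarrow> AE x in lebesgue_on \<Omega>. w x = 0"
  using eigensystem unfolding dirichlet_eigensystem_def dirichlet_eigenpair_def by auto

lemma H10_H1: "w \<in> H10_space \<Omega> \<Longrightarrow> w \<in> H1_space \<Omega>"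
  and H1_L2: "w \<in> H1_space \<Omega> \<Longrightarrow> w \<in> L2_space \<Omega>"
  by (auto simp: H10_space_def H1_space_def)

lemma H1_norm_ge_L2: "sqrt (L2_inner \<Omega> w w) \<le> H1_norm \<Omega> w"
  and H1_norm_ge_gradient: "sqrt (gradient_inner \<Omega> w w) \<le> H1_norm \<Omega> w"
  using gradient_inner_nonneg[of \<Omega> w] by (auto simp: H1_norm_def L2_inner_def)

(* The eigenfunctions are L2-limits of test functions, so completeness of the eigensystem replaces
  the fundamental lemma of the calculus of variations. *)
lemma L2_orthogonal_test:
  assumes g: "g \<in> L2_space \<Omega>" and orth: "\<And>z. z \<in> test_functions \<Omega> \<Longrightarrow> L2_inner \<Omega> g z = 0"
  shows "AE x in lebesgue_on \<Omega>. g x = 0"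
proof (rule complete[OF g])
  fix j
  have p: "\<phi> j \<in> L2_space \<Omega>" using eigenfunction H10_H1 H1_L2 by blast
  obtain z where z: "\<And>n. z n \<in> test_functions \<Omega>" and lim: "(\<lambda>n. H1_norm \<Omega> (\<lambda>x. \<phi> j x - z n x)) \<longlonglongrightarrow> 0"
    using eigenfunction[of j] by (auto simp: H10_space_def)
  have b: "\<bar>L2_inner \<Omega> g (\<phi> j)\<bar> \<le> sqrt (L2_inner \<Omega> g g) * H1_norm \<Omega> (\<lambda>x. \<phi> j x - z n x)" for n
  proof -
    have zL: "z n \<in> L2_space \<Omega>" using test_L2(1)[OF meas z] .
    have "L2_inner \<Omega> g (\<phi> j) = L2_inner \<Omega> g (\<lambda>x. \<phi> j x - z n x)"
      using L2.ip_add_right[OF L2.diff[OF p zL] zL g] orth[OF z] by simp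
    then show ?thesis
      using L2.cauchy_schwarz[OF g L2.diff[OF p zL]] L2.ip_nonneg[OF g]
        mult_left_mono[OF H1_norm_ge_L2[of "\<lambda>x. \<phi> j x - z n x"], of "sqrt (L2_inner \<Omega> g g)"] by fastforce
  qed
  have "(\<lambda>n. sqrt (L2_inner \<Omega> g g) * H1_norm \<Omega> (\<lambda>x. \<phi> j x - z n x)) \<longlonglongrightarrow> 0"
    using tendsto_mult_left[OF lim, of "sqrt (L2_inner \<Omega> g g)"] by simp
  then have "\<bar>L2_inner \<Omega> g (\<phi> j)\<bar> \<le> 0" by (rule LIMSEQ_le_const) (use b in blast)
  then show "L2_inner \<Omega> g (\<phi> j) = 0" by simp
qed

lemma weak_gradient_unique:
  assumes w: "w \<in> L2_space \<Omega>" and g: "has_weak_gradient \<Omega> w g" and h: "has_weak_gradient \<Omega> w h"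
  shows "AE x in lebesgue_on \<Omega>. g x = h x"
proof -
  have "AE x in lebesgue_on \<Omega>. g x $ i - h x $ i = 0" for i
  proof (rule L2_orthogonal_test)
    have gi: "(\<lambda>x. g x $ i) \<in> L2_space \<Omega>" and hi: "(\<lambda>x. h x $ i) \<in> L2_space \<Omega>"
      using g h by (auto simp: has_weak_gradient_def)
    show d: "(\<lambda>x. g x $ i - h x $ i) \<in> L2_space \<Omega>" by (rule L2.diff[OF gi hi])
    fix z assume z: "z \<in> test_functions \<Omega>"
    have "L2_inner \<Omega> (\<lambda>x. g x $ i) z = L2_inner \<Omega> (\<lambda>x. h x $ i) z"
      using g h z by (fastforce simp: has_weak_gradient_def)
    then show "L2_inner \<Omega> (\<lambda>x. g x $ i - h x $ i) z = 0"
      using L2.ip_add[OF d hi test_L2(1)[OF meas z]] by simp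
  qed
  then have "AE x in lebesgue_on \<Omega>. \<forall>i\<in>UNIV. g x $ i - h x $ i = 0"
    by (subst AE_finite_all) auto
  then show ?thesis by eventually_elim (simp add: vec_eq_iff)
qed

text \<open>Chosen gradients of w, z and w + z need not add up pointwise. Uniqueness almost
  everywhere allows any representative to compute the integral, which is what makes the form
  bilinear.\<close>

lemma gradient_inner_eq:
  assumes w: "w \<in> L2_space \<Omega>" "has_weak_gradient \<Omega> w g" and z: "z \<in> L2_space \<Omega>" "has_weak_gradient \<Omega> z h"
  shows "gradient_inner \<Omega> w z = (LINT x|lebesgue_on \<Omega>. g x \<bullet> h x)"
proof -
  have W: "has_weak_gradient \<Omega> w (weak_gradient \<Omega> w)" "has_weak_gradient \<Omega> z (weak_gradient \<Omega> z)"
    unfolding weak_gradient_def by (rule someI[of "has_weak_gradient \<Omega> w", OF w(2)], rule someI[of "has_weak_gradient \<Omega> z", OF z(2)])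
  show ?thesis unfolding gradient_inner_def
  proof (rule integral_cong_AE)
    show "AE x in lebesgue_on \<Omega>. weak_gradient \<Omega> w x \<bullet> weak_gradient \<Omega> z x = g x \<bullet> h x"
      using weak_gradient_unique[OF w(1) W(1) w(2)] weak_gradient_unique[OF z(1) W(2) z(2)]
      by eventually_elim simp
  qed (use gradient_product_integrable[OF W] gradient_product_integrable[OF w(2) z(2)] in auto)
qed

sublocale grad: semi_inner "H1_space \<Omega>" "gradient_inner \<Omega>"
proof
  fix w z y :: "real^'d \<Rightarrow> real" and c :: real
  show zero: "(\<lambda>x. 0) \<in> H1_space \<Omega>" by (rule test_H1[OF meas test_zero])
  show "gradient_inner \<Omega> w w \<ge> 0" by (rule gradient_inner_nonneg)
  assume "w \<in> H1_space \<Omega>"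
  then obtain g where w: "w \<in> L2_space \<Omega>" and g: "has_weak_gradient \<Omega> w g" by (auto simp: H1_space_def)
  have cg: "has_weak_gradient \<Omega> (\<lambda>x. c * w x) (\<lambda>x. c *\<^sub>R g x)"
    using has_weak_gradient_lincomb[OF meas w g w g, of c 0] by simp
  then show "(\<lambda>x. c * w x) \<in> H1_space \<Omega>"
    using L2.scale[OF w] by (auto simp: H1_space_def)
  assume "z \<in> H1_space \<Omega>"
  then obtain h where z: "z \<in> L2_space \<Omega>" and h: "has_weak_gradient \<Omega> z h" by (auto simp: H1_space_def)
  have gh: "has_weak_gradient \<Omega> (\<lambda>x. w x + z x) (\<lambda>x. g x + h x)"
    using has_weak_gradient_lincomb[OF meas w g z h, of 1 1] by simp
  then show "(\<lambda>x. w x + z x) \<in> H1_space \<Omega>"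
    using L2.add[OF w z] by (auto simp: H1_space_def)
  show "gradient_inner \<Omega> w z = gradient_inner \<Omega> z w"
    by (simp add: gradient_inner_def inner_commute)
  show "gradient_inner \<Omega> (\<lambda>x. c * w x) z = c * gradient_inner \<Omega> w z"
    by (simp add: gradient_inner_eq[OF w g z h] gradient_inner_eq[OF L2.scale[OF w] cg z h])
  assume "y \<in> H1_space \<Omega>"
  then obtain k where y: "y \<in> L2_space \<Omega>" and k: "has_weak_gradient \<Omega> y k" by (auto simp: H1_space_def)
  show "gradient_inner \<Omega> (\<lambda>x. w x + z x) y = gradient_inner \<Omega> w y + gradient_inner \<Omega> z y"
    using gradient_product_integrable[OF g k] gradient_product_integrable[OF h k]
    by (simp add: gradient_inner_eq[OF w g y k] gradient_inner_eq[OF z h y k]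
        gradient_inner_eq[OF L2.add[OF w z] gh y k] inner_add_left)
qed

sublocale h1: semi_inner "H1_space \<Omega>" "\<lambda>w z. L2_inner \<Omega> w z + gradient_inner \<Omega> w z"
  by unfold_locales
    (auto simp: grad.zero grad.add grad.scale grad.ip_add grad.ip_scale grad.ip_nonneg L2.ip_add
       L2.ip_scale L2.ip_nonneg H1_L2 distrib_left intro: grad.ip_sym L2.ip_sym
       arg_cong2[where f = "(+)", OF L2.ip_sym grad.ip_sym])

lemma H1_norm_triangle:
  "w \<in> H1_space \<Omega> \<Longrightarrow> z \<in> H1_space \<Omega> \<Longrightarrow> H1_norm \<Omega> (\<lambda>x. w x + z x) \<le> H1_norm \<Omega> w + H1_norm \<Omega> z"
  and H1_norm_scale: "w \<in> H1_space \<Omega> \<Longrightarrow> H1_norm \<Omega> (\<lambda>x. c * w x) = \<bar>c\<bar> * H1_norm \<Omega> w"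
  unfolding H1_norm_def by (rule h1.triangle; assumption) (rule h1.norm_scale)

lemma H1_norm_nonneg: "H1_norm \<Omega> w \<ge> 0"
  using gradient_inner_nonneg[of \<Omega> w] by (simp add: H1_norm_def L2_inner_def)

lemma H10_add:
  assumes w: "w \<in> H10_space \<Omega>" and z: "z \<in> H10_space \<Omega>"
  shows "(\<lambda>x. w x + z x) \<in> H10_space \<Omega>"
proof -
  obtain u where u: "\<And>n. u n \<in> test_functions \<Omega>" "(\<lambda>n. H1_norm \<Omega> (\<lambda>x. w x - u n x)) \<longlonglongrightarrow> 0"
    using w by (auto simp: H10_space_def)
  obtain v where v: "\<And>n. v n \<in> test_functions \<Omega>" "(\<lambda>n. H1_norm \<Omega> (\<lambda>x. z x - v n x)) \<longlonglongrightarrow> 0"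
    using z by (auto simp: H10_space_def)
  have b: "H1_norm \<Omega> (\<lambda>x. w x + z x - (u n x + v n x))
     \<le> H1_norm \<Omega> (\<lambda>x. w x - u n x) + H1_norm \<Omega> (\<lambda>x. z x - v n x)" for n
  proof -
    have "(\<lambda>x. w x - u n x) \<in> H1_space \<Omega>" "(\<lambda>x. z x - v n x) \<in> H1_space \<Omega>"
      using w z u v test_H1[OF meas] H10_H1 by (auto intro!: grad.diff)
    from H1_norm_triangle[OF this] show ?thesis by (simp add: algebra_simps)
  qed
  have "(\<lambda>n. H1_norm \<Omega> (\<lambda>x. w x + z x - (u n x + v n x))) \<longlonglongrightarrow> 0"
    by (rule tendsto_sandwich[OF _ _ tendsto_const])
      (use b H1_norm_nonneg tendsto_add[OF u(2) v(2)] in \<open>auto intro!: always_eventually\<close>)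
  moreover have "(\<lambda>x. u n x + v n x) \<in> test_functions \<Omega>" for n
    using test_lincomb[OF u(1) v(1), of 1 _ 1] by simp
  ultimately show ?thesis using grad.add[OF H10_H1[OF w] H10_H1[OF z]]
    unfolding H10_space_def by (auto intro!: exI[of _ "\<lambda>n x. u n x + v n x"])
qed

lemma H10_scale:
  assumes w: "w \<in> H10_space \<Omega>"
  shows "(\<lambda>x. c * w x) \<in> H10_space \<Omega>"
proof -
  obtain u where u: "\<And>n. u n \<in> test_functions \<Omega>" "(\<lambda>n. H1_norm \<Omega> (\<lambda>x. w x - u n x)) \<longlonglongrightarrow> 0"
    using w by (auto simp: H10_space_def)
  have b: "H1_norm \<Omega> (\<lambda>x. c * w x - c * u n x) = \<bar>c\<bar> * H1_norm \<Omega> (\<lambda>x. w x - u n x)" for n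
    using H1_norm_scale[of "\<lambda>x. w x - u n x" c] w u test_H1[OF meas] H10_H1
    by (auto simp: grad.diff algebra_simps)
  have "(\<lambda>n. H1_norm \<Omega> (\<lambda>x. c * w x - c * u n x)) \<longlonglongrightarrow> 0"
    unfolding b using tendsto_mult_left[OF u(2), of "\<bar>c\<bar>"] by simp
  moreover have "(\<lambda>x. c * u n x) \<in> test_functions \<Omega>" for n
    using test_lincomb[OF u(1) test_zero, of c _ 1] by simp
  ultimately show ?thesis using grad.scale[OF H10_H1[OF w]]
    unfolding H10_space_def by (auto intro!: exI[of _ "\<lambda>n x. c * u n x"])
qed

lemma zero_H10: "(\<lambda>x. 0) \<in> H10_space \<Omega>"
  using H10_scale[OF eigenfunction[of 0], of 0] by simp

section \<open>The Poincare inequality and a positive lower bound for the eigenvalues\<close>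

text \<open>Integrating the i-th partial derivative of \<open>x $ i * (z x)\<^sup>2\<close> gives 0,
  and the product rule expresses the square of the L2 norm of z through z and its i-th derivative.
  The weight \<open>x $ i\<close> is at most R on the domain; one factor of the L2 norm of z then
  cancels.\<close>

lemma poincare_test:
  assumes R0: "R \<ge> 0" and R: "\<And>x. x \<in> \<Omega> \<Longrightarrow> norm x \<le> R" and z: "z \<in> test_functions \<Omega>"
  shows "sqrt (L2_inner \<Omega> z z) \<le> 2 * R * sqrt (gradient_inner \<Omega> z z)"
proof -
  fix i :: 'd
  obtain K where K: "compact K" "K \<subseteq> \<Omega>" "\<And>x. x \<notin> K \<Longrightarrow> z x = 0" "\<And>i x. x \<notin> K \<Longrightarrow> pderiv_at i z x = 0"
    "continuous_on UNIV z" "\<And>x. z differentiable (at x)" "\<And>i. continuous_on UNIV (pderiv_at i z)"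
    using test_cases[OF z] by blast
  note zL = test_L2[OF meas z]
  define y where "y = (\<lambda>x. x $ i * z x)"
  have yL: "y \<in> L2_space \<Omega>" unfolding y_def
    by (rule L2_compact_support[OF K(1) _ _ meas K(2)]) (use K in \<open>auto intro!: continuous_intros\<close>)
  have yd: "y differentiable (at x)" for x
    unfolding y_def by (intro derivative_intros coord_differentiable K)
  have dy: "pderiv_at i y = (\<lambda>x. x $ i * pderiv_at i z x + z x)"
    unfolding y_def by (rule ext, subst pderiv_at_mult) (auto simp: coord_differentiable K pderiv_at_coord)
  have dyz: "pderiv_at i (\<lambda>x. y x * z x) = (\<lambda>x. 2 * (y x * pderiv_at i z x) + z x * z x)"
    by (rule ext, subst pderiv_at_mult) (auto simp: yd K dy, simp add: y_def algebra_simps)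
  have c: "continuous_on UNIV (pderiv_at i (\<lambda>x. y x * z x))"
    unfolding dyz unfolding y_def by (intro continuous_intros K)
  have "0 = (LINT x|lborel. pderiv_at i (\<lambda>x. y x * z x) x)"
    by (rule integral_pderiv_at_compact_support[OF K(1) _ _ c, symmetric])
      (auto simp: K yd intro!: derivative_intros)
  also have "\<dots> = (LINT x|lebesgue_on \<Omega>. pderiv_at i (\<lambda>x. y x * z x) x)"
    by (rule lebesgue_on_compact_support(2)[OF K(1) _ c meas K(2), symmetric]) (auto simp: dyz K)
  also have "\<dots> = 2 * L2_inner \<Omega> y (pderiv_at i z) + L2_inner \<Omega> z z"
    unfolding dyz L2_inner_def using L2_mult_integrable[OF yL zL(2)] L2_mult_integrable[OF zL(1) zL(1)]
    by simp
  finally have 1: "L2_inner \<Omega> z z \<le> 2 * \<bar>L2_inner \<Omega> y (pderiv_at i z)\<bar>" by linarith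
  have gz: "gradient_inner \<Omega> z z = (LINT x|lebesgue_on \<Omega>. (\<chi> i. pderiv_at i z x) \<bullet> (\<chi> i. pderiv_at i z x))"
    by (rule gradient_inner_eq[OF zL(1) test_weak_gradient[OF meas z] zL(1) test_weak_gradient[OF meas z]])
  have gi: "integrable (lebesgue_on \<Omega>) (\<lambda>x. (\<chi> i. pderiv_at i z x) \<bullet> (\<chi> i. pderiv_at i z x))"
    by (rule gradient_product_integrable[OF test_weak_gradient[OF meas z] test_weak_gradient[OF meas z]])
  have 2: "L2_inner \<Omega> (pderiv_at i z) (pderiv_at i z) \<le> gradient_inner \<Omega> z z"
    unfolding gz L2_inner_def
  proof (rule integral_mono[OF L2_mult_integrable[OF zL(2) zL(2)] gi])
    fix x
    show "pderiv_at i z x * pderiv_at i z x \<le> (\<chi> i. pderiv_at i z x) \<bullet> (\<chi> i. pderiv_at i z x)"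
      using power_mono[OF component_le_norm_cart[of "\<chi> i. pderiv_at i z x" i], of 2]
      by (simp add: power2_norm_eq_inner power2_eq_square[symmetric])
  qed
  show "sqrt (L2_inner \<Omega> z z) \<le> 2 * R * sqrt (gradient_inner \<Omega> z z)"
  proof -
    have "L2_inner \<Omega> y y \<le> L2_inner \<Omega> (\<lambda>x. R * z x) (\<lambda>x. R * z x)"
      unfolding L2_inner_def
    proof (rule integral_mono[OF L2_mult_integrable[OF yL yL] L2_mult_integrable[OF L2.scale[OF zL(1)] L2.scale[OF zL(1)]]])
      fix x assume "x \<in> space (lebesgue_on \<Omega>)"
      then have "\<bar>x $ i\<bar> \<le> R" using R component_le_norm_cart[of x i] by force
      then have "(x $ i)\<^sup>2 \<le> R\<^sup>2" using abs_le_square_iff[of "x $ i" R] R0 by simp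
      then show "y x * y x \<le> R * z x * (R * z x)"
        using mult_right_mono[of "(x $ i)\<^sup>2" "R\<^sup>2" "(z x)\<^sup>2"] by (simp add: y_def power2_eq_square algebra_simps)
    qed
    then have 3: "sqrt (L2_inner \<Omega> y y) \<le> R * sqrt (L2_inner \<Omega> z z)"
      using L2.norm_scale[OF zL(1), of R] R0 by (metis abs_of_nonneg real_sqrt_le_iff)
    let ?a = "sqrt (L2_inner \<Omega> z z)"
    have "?a * ?a = L2_inner \<Omega> z z" using L2.ip_nonneg[OF zL(1)] by simp
    also have "\<dots> \<le> 2 * (sqrt (L2_inner \<Omega> y y) * sqrt (L2_inner \<Omega> (pderiv_at i z) (pderiv_at i z)))"
      using 1 L2.cauchy_schwarz[OF yL zL(2)[of i]] by linarith
    also have "\<dots> \<le> 2 * ((R * ?a) * sqrt (gradient_inner \<Omega> z z))"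
      using 2 3 R0 L2.ip_nonneg[OF zL(1)] L2.ip_nonneg[OF zL(2)] by (intro mult_left_mono mult_mono) auto
    finally have f: "?a * ?a \<le> (2 * R * sqrt (gradient_inner \<Omega> z z)) * ?a" by (simp add: mult_ac)
    show ?thesis
    proof (cases "?a > 0")
      case True
      then show ?thesis using mult_right_le_imp_le[OF f] by blast
    next
      case False
      moreover have "0 \<le> 2 * R * sqrt (gradient_inner \<Omega> z z)" using R0 gradient_inner_nonneg[of \<Omega> z] by simp
      ultimately show ?thesis by linarith
    qed
  qed
qed

text \<open>The Poincare inequality passes from approximating test functions to the normalized
  eigenfunction, whose gradient has squared norm \<open>lam j\<close>.\<close>

lemma eigenvalues_bounded_below: "\<exists>c>0. \<forall>j. c \<le> lam j"
proof -
  obtain R where R0: "R > 0" and R: "\<And>x. x \<in> \<Omega> \<Longrightarrow> norm x \<le> R"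
    using bounded_domain bounded_pos by blast
  have "1 \<le> 2 * R * sqrt (lam j)" for j
  proof -
    obtain z where z: "\<And>n. z n \<in> test_functions \<Omega>" and lim: "(\<lambda>n. H1_norm \<Omega> (\<lambda>x. \<phi> j x - z n x)) \<longlonglongrightarrow> 0"
      using eigenfunction[of j] by (auto simp: H10_space_def)
    note p = H10_H1[OF eigenfunction[of j]]
    have b: "1 \<le> 2 * R * sqrt (lam j) + (1 + 2 * R) * H1_norm \<Omega> (\<lambda>x. \<phi> j x - z n x)" for n
    proof -
      let ?d = "\<lambda>x. \<phi> j x - z n x"
      have zH: "z n \<in> H1_space \<Omega>" using test_H1[OF meas z] .
      have "1 = sqrt (L2_inner \<Omega> (\<phi> j) (\<phi> j))" by (simp add: orthonormal)
      also have "\<dots> \<le> sqrt (L2_inner \<Omega> ?d ?d) + sqrt (L2_inner \<Omega> (z n) (z n))"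
        by (rule L2.triangle_diff[OF H1_L2[OF p] H1_L2[OF zH]])
      also have "\<dots> \<le> H1_norm \<Omega> ?d + 2 * R * sqrt (gradient_inner \<Omega> (z n) (z n))"
        using H1_norm_ge_L2[of ?d] poincare_test[OF less_imp_le[OF R0] R z[of n]] by linarith
      also have "sqrt (gradient_inner \<Omega> (z n) (z n)) \<le> sqrt (gradient_inner \<Omega> (\<phi> j) (\<phi> j)) + H1_norm \<Omega> ?d"
      proof -
        have "sqrt (gradient_inner \<Omega> (z n) (z n)) \<le>
          sqrt (gradient_inner \<Omega> (\<lambda>x. -1 * ?d x) (\<lambda>x. -1 * ?d x)) + sqrt (gradient_inner \<Omega> (\<phi> j) (\<phi> j))"
          using grad.triangle_diff[OF zH p] by simp
        then show ?thesis
          using grad.norm_scale[OF grad.diff[OF p zH], of "-1"] H1_norm_ge_gradient[of ?d] by simp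
      qed
      finally show ?thesis using R0 eigenfunction_gradient[OF eigenfunction, of j j]
        by (simp add: orthonormal algebra_simps)
    qed
    have "(\<lambda>n. 2 * R * sqrt (lam j) + (1 + 2 * R) * H1_norm \<Omega> (\<lambda>x. \<phi> j x - z n x))
       \<longlonglongrightarrow> 2 * R * sqrt (lam j) + (1 + 2 * R) * 0"
      by (intro tendsto_intros lim)
    then have "1 \<le> 2 * R * sqrt (lam j) + (1 + 2 * R) * 0" by (rule LIMSEQ_le_const) (use b in blast)
    then show ?thesis by simp
  qed
  then have "1 / (2 * R) \<le> sqrt (lam j)" for j using R0 by (simp add: field_simps)
  then have l: "1 / (2 * R) \<le> sqrt (lam j)" for j .
  have "(1 / (2 * R))\<^sup>2 \<le> lam j" for j
  proof -
    \<comment> \<open>No sign of \<open>lam j\<close> is known yet. The square root of a negative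
      number is negative here, so positivity of the root forces \<open>lam j > 0\<close> and
      squaring is legitimate.\<close>
    have "0 < sqrt (lam j)" using l[of j] R0 by (intro less_le_trans[OF _ l]) simp
    then have "(sqrt (lam j))\<^sup>2 = lam j" by simp
    then show ?thesis using power_mono[OF l[of j], of 2] R0 by simp
  qed
  then show ?thesis using R0 by (intro exI[of _ "(1 / (2 * R))\<^sup>2"]) auto
qed

end

section \<open>Functionals given by coefficients\<close>

definition wnorm :: "(nat \<Rightarrow> real) \<Rightarrow> (nat \<Rightarrow> real) \<Rightarrow> real" where
  "wnorm v c = sqrt (\<Sum>j. v j * (c j)\<^sup>2)"

text \<open>Kept apart from \<open>wnorm\<close>, because the sum of a divergent series carries no
  information.\<close>

definition wsummable :: "(nat \<Rightarrow> real) \<Rightarrow> (nat \<Rightarrow> real) \<Rightarrow> bool" where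
  "wsummable v c \<longleftrightarrow> summable (\<lambda>j. v j * (c j)\<^sup>2)"

lemma wnorm_nonneg: "(\<And>j. v j \<ge> 0) \<Longrightarrow> wsummable v c \<Longrightarrow> wnorm v c \<ge> 0"
  by (auto simp: wnorm_def wsummable_def intro!: suminf_nonneg)

lemma wsummable_dominated:
  assumes "\<And>j. v j \<ge> 0" "\<And>j. \<bar>d j\<bar> \<le> K * \<bar>c j\<bar>" "K \<ge> 0" "wsummable v c"
  shows "wsummable v d" "wnorm v d \<le> K * wnorm v c"
proof -
  have b: "v j * (d j)\<^sup>2 \<le> K\<^sup>2 * (v j * (c j)\<^sup>2)" for j
  proof -
    have "(d j)\<^sup>2 \<le> K\<^sup>2 * (c j)\<^sup>2"
      using power_mono[OF assms(2)[of j] abs_ge_zero, of 2] by (simp add: power_mult_distrib)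
    from mult_left_mono[OF this assms(1)[of j]] show ?thesis by (simp add: mult_ac)
  qed
  have s: "summable (\<lambda>j. K\<^sup>2 * (v j * (c j)\<^sup>2))"
    using assms(4) by (simp add: wsummable_def summable_mult)
  show w: "wsummable v d" unfolding wsummable_def
    by (rule summable_comparison_test'[OF s]) (use b assms(1) in auto)
  have "(\<Sum>j. v j * (d j)\<^sup>2) \<le> (\<Sum>j. K\<^sup>2 * (v j * (c j)\<^sup>2))"
    by (rule suminf_le) (use b s w in \<open>auto simp: wsummable_def\<close>)
  also have "\<dots> = K\<^sup>2 * (\<Sum>j. v j * (c j)\<^sup>2)"
    using assms(4) by (simp add: wsummable_def suminf_mult)
  finally show "wnorm v d \<le> K * wnorm v c"
    using assms(3) real_sqrt_le_mono[of "\<Sum>j. v j * (d j)\<^sup>2"] by (fastforce simp: wnorm_def real_sqrt_mult)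
qed

lemma wsummable_add:
  assumes v: "\<And>j. v j \<ge> 0" and "wsummable v c" "wsummable v d"
  shows "wsummable v (\<lambda>j. c j + d j)"
  unfolding wsummable_def
proof (rule summable_comparison_test')
  show "summable (\<lambda>j. 2 * (v j * (c j)\<^sup>2) + 2 * (v j * (d j)\<^sup>2))"
    using assms by (auto simp: wsummable_def intro!: summable_add summable_mult)
  fix j
  have "(c j + d j)\<^sup>2 \<le> 2 * (c j)\<^sup>2 + 2 * (d j)\<^sup>2"
    using sum_squares_bound[of "c j" "d j"] by (simp add: power2_sum)
  from mult_left_mono[OF this v[of j]]
  show "norm (v j * (c j + d j)\<^sup>2) \<le> 2 * (v j * (c j)\<^sup>2) + 2 * (v j * (d j)\<^sup>2)"
    using v by (simp add: algebra_simps)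
qed

lemma wsummable_scale: "wsummable v c \<Longrightarrow> wsummable v (\<lambda>j. a * c j)"
  unfolding wsummable_def by (drule summable_mult[of _ "a\<^sup>2"]) (simp add: power_mult_distrib mult_ac)

lemma wsummable_diff: "(\<And>j. v j \<ge> 0) \<Longrightarrow> wsummable v c \<Longrightarrow> wsummable v d \<Longrightarrow> wsummable v (\<lambda>j. c j - d j)"
  using wsummable_add[of v c "\<lambda>j. - 1 * d j"] wsummable_scale[of v d "-1"] by simp

lemma wsummable_finite: "(\<And>j. j \<ge> n \<Longrightarrow> c j = 0) \<Longrightarrow> wsummable v c"
  unfolding wsummable_def by (rule summable_finite[of "{..<n}"]) auto

lemma wsummable_weight:
  assumes "\<And>j. 0 \<le> v j" "\<And>j. v j \<le> K * v' j" "wsummable v' c"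
  shows "wsummable v c" "(\<Sum>j. v j * (c j)\<^sup>2) \<le> K * (\<Sum>j. v' j * (c j)\<^sup>2)"
proof -
  have s: "summable (\<lambda>j. K * (v' j * (c j)\<^sup>2))"
    using assms(3) by (simp add: wsummable_def summable_mult)
  have b: "v j * (c j)\<^sup>2 \<le> K * (v' j * (c j)\<^sup>2)" for j
    using mult_right_mono[OF assms(2)[of j], of "(c j)\<^sup>2"] by (simp add: mult_ac)
  show w: "wsummable v c" unfolding wsummable_def
    by (rule summable_comparison_test'[OF s]) (use b assms(1) in auto)
  have "(\<Sum>j. v j * (c j)\<^sup>2) \<le> (\<Sum>j. K * (v' j * (c j)\<^sup>2))"
    by (rule suminf_le) (use b s w in \<open>auto simp: wsummable_def\<close>)
  then show "(\<Sum>j. v j * (c j)\<^sup>2) \<le> K * (\<Sum>j. v' j * (c j)\<^sup>2)"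
    using assms(3) by (simp add: wsummable_def suminf_mult)
qed

lemma component_le_wnorm:
  assumes "\<And>j. v j > 0" "wsummable v c"
  shows "\<bar>c j\<bar> \<le> wnorm v c / sqrt (v j)"
proof -
  have "v j * (c j)\<^sup>2 \<le> (\<Sum>j. v j * (c j)\<^sup>2)"
    using sum_le_suminf[of "\<lambda>j. v j * (c j)\<^sup>2" "{j}"] assms by (auto simp: wsummable_def less_imp_le)
  from real_sqrt_le_mono[OF this] show ?thesis
    using assms(1)[of j] by (simp add: wnorm_def real_sqrt_mult field_simps)
qed

text \<open>Duality of the weights \<open>v j\<close> and \<open>1 / v j\<close>. The condition on d
  is on partial sums, which is the form in which Bessel's inequality delivers it.\<close>

lemma weighted_cauchy_schwarz:
  assumes v: "\<And>j. v j > 0" and c: "wsummable v c" and B: "B \<ge> 0"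
    and d: "\<And>n. (\<Sum>j<n. (d j)\<^sup>2 / v j) \<le> B\<^sup>2"
  shows "summable (\<lambda>j. \<bar>c j * d j\<bar>)" "(\<Sum>j. \<bar>c j * d j\<bar>) \<le> wnorm v c * B"
proof -
  have b: "(\<Sum>j<n. \<bar>c j * d j\<bar>) \<le> wnorm v c * B" for n
  proof -
    have "(\<Sum>j<n. \<bar>c j * d j\<bar>) = (\<Sum>j<n. \<bar>sqrt (v j) * c j\<bar> * \<bar>d j / sqrt (v j)\<bar>)"
      using v by (intro sum.cong) (auto simp: abs_mult less_imp_neq[symmetric])
    also have "\<dots> \<le> L2_set (\<lambda>j. sqrt (v j) * c j) {..<n} * L2_set (\<lambda>j. d j / sqrt (v j)) {..<n}"
      by (rule L2_set_mult_ineq)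
    also have "\<dots> \<le> wnorm v c * B"
    proof (rule mult_mono)
      have "(\<Sum>j<n. v j * (c j)\<^sup>2) \<le> (\<Sum>j. v j * (c j)\<^sup>2)"
        using c v by (intro sum_le_suminf) (auto simp: wsummable_def less_imp_le)
      then show "L2_set (\<lambda>j. sqrt (v j) * c j) {..<n} \<le> wnorm v c"
        using v by (simp add: L2_set_def wnorm_def power_mult_distrib less_imp_le)
      have "L2_set (\<lambda>j. d j / sqrt (v j)) {..<n} = sqrt (\<Sum>j<n. (d j)\<^sup>2 / v j)"
        using v by (simp add: L2_set_def power_divide less_imp_le)
      also have "\<dots> \<le> B" using d[of n] B by (simp add: real_le_lsqrt)
      finally show "L2_set (\<lambda>j. d j / sqrt (v j)) {..<n} \<le> B" .
    qed (use wnorm_nonneg[OF _ c] v less_imp_le in \<open>auto simp: L2_set_nonneg\<close>)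
    finally show ?thesis .
  qed
  show s: "summable (\<lambda>j. \<bar>c j * d j\<bar>)"
    by (rule bounded_imp_summable[of _ "wnorm v c * B"])
      (use b[of "Suc _"] in \<open>auto simp: lessThan_Suc_atMost\<close>)
  show "(\<Sum>j. \<bar>c j * d j\<bar>) \<le> wnorm v c * B"
    by (rule suminf_le_const[OF s b])
qed

section \<open>Bounded functionals on H10 and their coefficients\<close>

context dirichlet
begin

text \<open>The dual weight: \<open>\<phi> j\<close> has squared H1 norm \<open>1 + lam j\<close>,
  so the coefficients of a bounded functional on H10 are square summable with the reciprocal
  weight.\<close>

definition hw :: "nat \<Rightarrow> real" where "hw j = 1 / (1 + lam j)"

text \<open>The functional with coefficients c, meaningful when \<open>wsummable hw c\<close>. The
  value 0 off H10 follows the convention of \<open>Hm1_space\<close>. All functionals of the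
  solution are brought to this form.\<close>

definition S :: "(nat \<Rightarrow> real) \<Rightarrow> 'd functional" where
  "S c = (\<lambda>w. if w \<in> H10_space \<Omega> then (\<Sum>j. c j * L2_inner \<Omega> (\<phi> j) w) else 0)"

lemma lam_pos: "lam j > 0"
  using eigenvalues_bounded_below by (metis less_le_trans)

lemma hw_pos: "hw j > 0"
  using lam_pos[of j] by (simp add: hw_def)

lemma hw_nonneg: "hw j \<ge> 0"
  using hw_pos[of j] by simp

lemma lam_powr_pos: "lam j powr s > 0"
  using lam_pos[of j] by simp

text \<open>Factor 1 / \<open>lam j\<close> as \<open>lam j powr (-1 - s) * lam j powr s\<close>.
  The first exponent is nonpositive, so the lower bound c of the eigenvalues bounds that factor by
  \<open>c powr (-1 - s)\<close>.\<close>

lemma hw_le: 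
  assumes "s \<ge> -1"
  shows "\<exists>K>0. \<forall>j. hw j \<le> K * lam j powr s"
proof -
  obtain c where c: "c > 0" "\<And>j. c \<le> lam j" using eigenvalues_bounded_below by blast
  have "hw j \<le> c powr (-1 - s) * lam j powr s" for j
  proof -
    have "hw j \<le> lam j powr (-1)" using lam_pos[of j] by (simp add: hw_def powr_minus field_simps)
    also have "\<dots> = lam j powr (-1 - s) * lam j powr s" by (simp flip: powr_add)
    also have "\<dots> \<le> c powr (-1 - s) * lam j powr s"
      using assms c lam_pos[of j] by (intro mult_right_mono powr_mono2') auto
    finally show ?thesis .
  qed
  then show ?thesis using c(1) by (intro exI[of _ "c powr (-1 - s)"]) auto
qed

text \<open>By the eigenvalue equation the H1 product of \<open>\<phi> j\<close> with w is
  \<open>1 + lam j\<close> times the L2 product. Hence the eigenfunctions are orthogonal in H1 too,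
  and Bessel's inequality is applied there.\<close>

lemma eigen_bessel:
  assumes w: "w \<in> H10_space \<Omega>"
  shows "(\<Sum>j<n. (L2_inner \<Omega> (\<phi> j) w)\<^sup>2 / hw j) \<le> (H1_norm \<Omega> w)\<^sup>2"
proof -
  have ip: "L2_inner \<Omega> (\<phi> j) w + gradient_inner \<Omega> (\<phi> j) w = (1 + lam j) * L2_inner \<Omega> (\<phi> j) w"
    if "w \<in> H10_space \<Omega>" for j w
    using eigenfunction_gradient[OF that] by (simp add: algebra_simps)
  have "(\<Sum>j<n. (L2_inner \<Omega> (\<phi> j) w + gradient_inner \<Omega> (\<phi> j) w)\<^sup>2 / (1 + lam j))
     \<le> L2_inner \<Omega> w w + gradient_inner \<Omega> w w"
    by (rule h1.bessel)
      (auto simp: H10_H1 eigenfunction eigenfunction_gradient w orthonormal lam_pos add_pos_pos)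
  moreover have "((1 + lam j) * L2_inner \<Omega> (\<phi> j) w)\<^sup>2 / (1 + lam j) = (L2_inner \<Omega> (\<phi> j) w)\<^sup>2 / hw j" for j
    using lam_pos[of j] by (simp add: hw_def power2_eq_square)
  moreover have "(H1_norm \<Omega> w)\<^sup>2 = L2_inner \<Omega> w w + gradient_inner \<Omega> w w"
    using gradient_inner_nonneg[of \<Omega> w] L2.ip_nonneg[OF H1_L2[OF H10_H1[OF w]]] by (simp add: H1_norm_def)
  ultimately show ?thesis by (simp add: ip[OF w])
qed

lemma S_bound:
  assumes c: "wsummable hw c" and w: "w \<in> H10_space \<Omega>"
  shows "summable (\<lambda>j. \<bar>c j * L2_inner \<Omega> (\<phi> j) w\<bar>)"
    and "(\<Sum>j. \<bar>c j * L2_inner \<Omega> (\<phi> j) w\<bar>) \<le> wnorm hw c * H1_norm \<Omega> w"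
    and "summable (\<lambda>j. c j * L2_inner \<Omega> (\<phi> j) w)" and "\<bar>S c w\<bar> \<le> wnorm hw c * H1_norm \<Omega> w"
proof -
  note cs = weighted_cauchy_schwarz[OF hw_pos c H1_norm_nonneg[of w] eigen_bessel[OF w]]
  show "summable (\<lambda>j. \<bar>c j * L2_inner \<Omega> (\<phi> j) w\<bar>)" "(\<Sum>j. \<bar>c j * L2_inner \<Omega> (\<phi> j) w\<bar>) \<le> wnorm hw c * H1_norm \<Omega> w"
    by (fact cs)+
  show "summable (\<lambda>j. c j * L2_inner \<Omega> (\<phi> j) w)" using cs(1) by (rule summable_rabs_cancel)
  show "\<bar>S c w\<bar> \<le> wnorm hw c * H1_norm \<Omega> w"
    using summable_rabs[OF cs(1)] cs(2) w by (simp add: S_def)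
qed

lemma S_eigenfunction: "S c (\<phi> i) = c i"
proof -
  have "(\<Sum>j. c j * L2_inner \<Omega> (\<phi> j) (\<phi> i)) = (\<Sum>j\<in>{i}. c j * L2_inner \<Omega> (\<phi> j) (\<phi> i))"
    by (rule suminf_finite) (auto simp: orthonormal)
  then show ?thesis by (simp add: S_def eigenfunction orthonormal)
qed

lemma S_add: "wsummable hw c \<Longrightarrow> wsummable hw d \<Longrightarrow> S c w + S d w = S (\<lambda>j. c j + d j) w"
  by (auto simp: S_def distrib_right intro!: suminf_add S_bound)

lemma S_scale: "wsummable hw c \<Longrightarrow> a * S c w = S (\<lambda>j. a * c j) w"
  by (auto simp: S_def mult.assoc intro!: suminf_mult[symmetric] S_bound)

lemma S_diff: "wsummable hw c \<Longrightarrow> wsummable hw d \<Longrightarrow> S c w - S d w = S (\<lambda>j. c j - d j) w"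
  using S_add[of c "\<lambda>j. -1 * d j" w] S_scale[of d "-1" w] wsummable_scale[of hw d "-1"] by simp

lemma S_in_Hm1:
  assumes c: "wsummable hw c"
  shows "S c \<in> Hm1_space \<Omega>"
proof -
  have HL: "w \<in> L2_space \<Omega>" if "w \<in> H10_space \<Omega>" for w using that H1_L2 H10_H1 by blast
  note pL = HL[OF eigenfunction]
  have "S c (\<lambda>x. w x + z x) = S c w + S c z" if wz: "w \<in> H10_space \<Omega>" "z \<in> H10_space \<Omega>" for w z
    using wz H10_add[OF wz] suminf_add[OF S_bound(3)[OF c wz(1)] S_bound(3)[OF c wz(2)]]
    by (simp add: S_def L2.ip_add_right[OF HL[OF wz(1)] HL[OF wz(2)] pL] distrib_left)
  moreover have "S c (\<lambda>x. a * w x) = a * S c w" if w: "w \<in> H10_space \<Omega>" for w a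
    using w H10_scale[OF w, of a] suminf_mult[OF S_bound(3)[OF c w], of a]
    by (simp add: S_def L2.ip_scale_right[OF HL[OF w] pL] mult_ac)
  moreover have "\<exists>C. \<forall>w\<in>H10_space \<Omega>. \<bar>S c w\<bar> \<le> C * H1_norm \<Omega> w"
    using S_bound(4)[OF c] by blast
  ultimately show ?thesis by (auto simp: Hm1_space_def S_def)
qed

lemma Hm1_norm_le:
  assumes "\<And>w. w \<in> H10_space \<Omega> \<Longrightarrow> \<bar>\<eta> w\<bar> \<le> C * H1_norm \<Omega> w" "C \<ge> 0"
  shows "Hm1_norm \<Omega> \<eta> \<le> C"
  unfolding Hm1_norm_def
proof (rule cSUP_least)
  have "H1_norm \<Omega> (\<lambda>x. 0) = 0" using H1_norm_scale[OF H10_H1[OF zero_H10], of 0] by simp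
  then show "{w \<in> H10_space \<Omega>. H1_norm \<Omega> w \<le> 1} \<noteq> {}" using zero_H10 by fastforce
  fix w assume "w \<in> {w \<in> H10_space \<Omega>. H1_norm \<Omega> w \<le> 1}"
  then show "\<bar>\<eta> w\<bar> \<le> C" using assms(1)[of w] mult_left_mono[of "H1_norm \<Omega> w" 1 C] assms(2) by auto
qed

lemma Hm1_norm_S: "wsummable hw c \<Longrightarrow> Hm1_norm \<Omega> (S c) \<le> wnorm hw c"
  using S_bound(4)[of c] wnorm_nonneg[OF hw_nonneg] by (intro Hm1_norm_le) auto

text \<open>Normalize w. Boundedness of \<open>\<eta>\<close> makes the supremum in the norm a
  genuine one, and it also settles the case where the seminorm of w vanishes, in which no
  normalization exists.\<close>

lemma Hm1_bound:
  assumes \<eta>: "\<eta> \<in> Hm1_space \<Omega>" and w: "w \<in> H10_space \<Omega>"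
  shows "\<bar>\<eta> w\<bar> \<le> Hm1_norm \<Omega> \<eta> * H1_norm \<Omega> w"
proof -
  obtain C where C: "\<And>w. w \<in> H10_space \<Omega> \<Longrightarrow> \<bar>\<eta> w\<bar> \<le> C * H1_norm \<Omega> w"
    using \<eta> unfolding Hm1_space_def by blast
  have sc: "\<eta> (\<lambda>x. a * w x) = a * \<eta> w" for a using \<eta> w by (auto simp: Hm1_space_def)
  show ?thesis
  proof (cases "H1_norm \<Omega> w = 0")
    case True
    then show ?thesis using C[OF w] by simp
  next
    case False
    then have p: "H1_norm \<Omega> w > 0" using H1_norm_nonneg[of w] by linarith
    let ?w = "\<lambda>x. inverse (H1_norm \<Omega> w) * w x"
    have "H1_norm \<Omega> ?w = 1"
      using H1_norm_scale[OF H10_H1[OF w], of "inverse (H1_norm \<Omega> w)"] p by simp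
    then have m: "?w \<in> {w \<in> H10_space \<Omega>. H1_norm \<Omega> w \<le> 1}" using H10_scale[OF w] by simp
    have "bdd_above ((\<lambda>w. \<bar>\<eta> w\<bar>) ` {w \<in> H10_space \<Omega>. H1_norm \<Omega> w \<le> 1})"
    proof (rule bdd_aboveI2[where M = "\<bar>C\<bar>"])
      fix w assume "w \<in> {w \<in> H10_space \<Omega>. H1_norm \<Omega> w \<le> 1}"
      then have "\<bar>\<eta> w\<bar> \<le> C * H1_norm \<Omega> w" "H1_norm \<Omega> w \<le> 1" using C by auto
      moreover have "C * H1_norm \<Omega> w \<le> \<bar>C\<bar> * 1"
        using \<open>H1_norm \<Omega> w \<le> 1\<close> H1_norm_nonneg[of w] by (intro mult_mono) auto
      ultimately show "\<bar>\<eta> w\<bar> \<le> \<bar>C\<bar>" by simp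
    qed
    from cSUP_upper[OF m this] have "\<bar>\<eta> ?w\<bar> \<le> Hm1_norm \<Omega> \<eta>" by (simp add: Hm1_norm_def)
    then show ?thesis using p unfolding sc by (simp add: abs_mult field_simps)
  qed
qed

text \<open>The operator bound at \<open>\<phi> 0\<close>, whose H1 norm is at least 1, can only
  hold with a nonnegative constant.\<close>

lemma Hm1_norm_nonneg:
  assumes "\<eta> \<in> Hm1_space \<Omega>"
  shows "Hm1_norm \<Omega> \<eta> \<ge> 0"
proof -
  have "L2_inner \<Omega> (\<phi> 0) (\<phi> 0) = 1" by (simp add: orthonormal)
  then have "1 \<le> H1_norm \<Omega> (\<phi> 0)" using H1_norm_ge_L2[of "\<phi> 0"] by simp
  moreover have "0 \<le> Hm1_norm \<Omega> \<eta> * H1_norm \<Omega> (\<phi> 0)"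
    using Hm1_bound[OF assms eigenfunction[of 0]] by linarith
  ultimately show ?thesis by (simp add: zero_le_mult_iff)
qed

lemma Hm1_add:
  assumes "\<eta> \<in> Hm1_space \<Omega>" "\<theta> \<in> Hm1_space \<Omega>"
  shows "(\<lambda>w. \<eta> w + \<theta> w) \<in> Hm1_space \<Omega>"
proof -
  have "\<bar>\<eta> w + \<theta> w\<bar> \<le> (Hm1_norm \<Omega> \<eta> + Hm1_norm \<Omega> \<theta>) * H1_norm \<Omega> w" if "w \<in> H10_space \<Omega>" for w
    using Hm1_bound[OF assms(1) that] Hm1_bound[OF assms(2) that] by (simp add: distrib_right)
  then have "\<exists>C. \<forall>w\<in>H10_space \<Omega>. \<bar>\<eta> w + \<theta> w\<bar> \<le> C * H1_norm \<Omega> w" by blast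
  then show ?thesis using assms by (auto simp: Hm1_space_def algebra_simps)
qed

lemma Hm1_scale:
  assumes "\<eta> \<in> Hm1_space \<Omega>"
  shows "(\<lambda>w. a * \<eta> w) \<in> Hm1_space \<Omega>"
proof -
  have "\<bar>a * \<eta> w\<bar> \<le> (\<bar>a\<bar> * Hm1_norm \<Omega> \<eta>) * H1_norm \<Omega> w" if "w \<in> H10_space \<Omega>" for w
    using mult_left_mono[OF Hm1_bound[OF assms that], of "\<bar>a\<bar>"] by (simp add: abs_mult mult_ac)
  then have "\<exists>C. \<forall>w\<in>H10_space \<Omega>. \<bar>a * \<eta> w\<bar> \<le> C * H1_norm \<Omega> w" by blast
  then show ?thesis using assms by (auto simp: Hm1_space_def algebra_simps)
qed

lemma Hm1_diff: "\<eta> \<in> Hm1_space \<Omega> \<Longrightarrow> \<theta> \<in> Hm1_space \<Omega> \<Longrightarrow> (\<lambda>w. \<eta> w - \<theta> w) \<in> Hm1_space \<Omega>"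
  using Hm1_add[OF _ Hm1_scale[of \<theta> "-1"], of \<eta>] by simp

lemma Hm1_zero: "(\<lambda>w. 0) \<in> Hm1_space \<Omega>"
  by (auto simp: Hm1_space_def intro!: exI[of _ 0])

lemma Hm1_sum: "finite A \<Longrightarrow> (\<And>i. i \<in> A \<Longrightarrow> \<eta> i \<in> Hm1_space \<Omega>) \<Longrightarrow> (\<lambda>w. \<Sum>i\<in>A. \<eta> i w) \<in> Hm1_space \<Omega>"
  by (induction A rule: finite_induct) (auto simp: Hm1_zero intro!: Hm1_add)

lemma Hm1_eqI:
  assumes "\<eta> \<in> Hm1_space \<Omega>" "\<theta> \<in> Hm1_space \<Omega>" "\<And>w. w \<in> H10_space \<Omega> \<Longrightarrow> \<eta> w = \<theta> w"
  shows "\<eta> = \<theta>"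
proof
  fix w show "\<eta> w = \<theta> w" using assms by (cases "w \<in> H10_space \<Omega>") (auto simp: Hm1_space_def)
qed

lemma Hm1_tendsto_pointwise:
  assumes "Hm1_tendsto \<Omega> X \<eta>" "\<And>n. X n \<in> Hm1_space \<Omega>" "w \<in> H10_space \<Omega>"
  shows "(\<lambda>n. X n w) \<longlonglongrightarrow> \<eta> w"
proof -
  have lim: "(\<lambda>n. Hm1_norm \<Omega> (\<lambda>w. X n w - \<eta> w) * H1_norm \<Omega> w) \<longlonglongrightarrow> 0"
    using tendsto_mult_right[of "\<lambda>n. Hm1_norm \<Omega> (\<lambda>w. X n w - \<eta> w)" 0 sequentially] assms(1)
    by (auto simp: Hm1_tendsto_def)
  have "norm (X n w - \<eta> w) \<le> Hm1_norm \<Omega> (\<lambda>w. X n w - \<eta> w) * H1_norm \<Omega> w" for n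
    using Hm1_bound[OF Hm1_diff[OF assms(2)[of n]] assms(3)] assms(1) by (simp add: Hm1_tendsto_def)
  then have "(\<lambda>n. X n w - \<eta> w) \<longlonglongrightarrow> 0"
    by (intro Lim_null_comparison[OF _ lim] always_eventually allI)
  then show ?thesis by (simp add: LIM_zero_iff)
qed

lemma Hm1_tendsto_unique:
  assumes "Hm1_tendsto \<Omega> X \<eta>" "Hm1_tendsto \<Omega> X \<theta>" "\<And>n. X n \<in> Hm1_space \<Omega>"
  shows "\<eta> = \<theta>"
  using assms LIMSEQ_unique[OF Hm1_tendsto_pointwise[OF assms(1,3)] Hm1_tendsto_pointwise[OF assms(2,3)]]
  by (intro Hm1_eqI) (auto simp: Hm1_tendsto_def)

text \<open>Partial sums are \<open>S\<close> of truncated coefficients, and the truncation error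
  tends to 0 in \<open>wnorm hw\<close> by dominated convergence for series. Uniqueness of limits
  then resolves the description operator in \<open>Hm1_suminf\<close>.\<close>

lemma Hm1_suminf_eq:
  assumes c: "wsummable hw c"
  shows "Hm1_suminf \<Omega> (\<lambda>j w. c j * Hm1_of_L2 \<Omega> (\<phi> j) w) = S c"
proof -
  define cut where "cut = (\<lambda>n j. if j < n then c j else 0)"
  have cut: "wsummable hw (cut n)" for n
    by (rule wsummable_finite[of n]) (simp add: cut_def)
  have part: "(\<lambda>w. \<Sum>j<n. c j * Hm1_of_L2 \<Omega> (\<phi> j) w) = S (cut n)" for n
  proof
    fix w
    have "(\<Sum>j. cut n j * L2_inner \<Omega> (\<phi> j) w) = (\<Sum>j<n. cut n j * L2_inner \<Omega> (\<phi> j) w)"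
      by (rule suminf_finite) (auto simp: cut_def)
    then show "(\<Sum>j<n. c j * Hm1_of_L2 \<Omega> (\<phi> j) w) = S (cut n) w"
      by (auto simp: S_def Hm1_of_L2_def cut_def)
  qed
  have "Hm1_tendsto \<Omega> (\<lambda>n. S (cut n)) (S c)"
    unfolding Hm1_tendsto_def
  proof (intro conjI S_in_Hm1 c)
    have d: "wsummable hw (\<lambda>j. cut n j - c j)" for n by (intro wsummable_diff hw_nonneg cut c)
    have "(\<lambda>n. \<Sum>j. hw j * (cut n j - c j)\<^sup>2) \<longlonglongrightarrow> (\<Sum>j::nat. 0)"
    proof (rule tannerys_theorem[THEN conjunct2, THEN conjunct2])
      fix j
      have "eventually (\<lambda>n. hw j * (cut n j - c j)\<^sup>2 = 0) sequentially"
        using eventually_gt_at_top[of j] by eventually_elim (simp add: cut_def)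
      then show "(\<lambda>n. hw j * (cut n j - c j)\<^sup>2) \<longlonglongrightarrow> 0" by (rule tendsto_eventually)
    next
      show "summable (\<lambda>j. hw j * (c j)\<^sup>2)" using c by (simp add: wsummable_def)
      show "\<forall>\<^sub>F (k, n) in sequentially \<times>\<^sub>F sequentially. norm (hw k * (cut n k - c k)\<^sup>2) \<le> hw k * (c k)\<^sup>2"
        using hw_nonneg by (intro always_eventually) (auto simp: cut_def)
    qed auto
    then have lim: "(\<lambda>n. wnorm hw (\<lambda>j. cut n j - c j)) \<longlonglongrightarrow> 0"
      unfolding wnorm_def using tendsto_real_sqrt by fastforce
    have e: "(\<lambda>w. S (cut n) w - S c w) = S (\<lambda>j. cut n j - c j)" for n
      using S_diff[OF cut c] by blast
    show "(\<lambda>n. Hm1_norm \<Omega> (\<lambda>w. S (cut n) w - S c w)) \<longlonglongrightarrow> 0"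
      unfolding e
      by (rule tendsto_sandwich[OF _ _ tendsto_const lim])
        (auto intro!: always_eventually Hm1_norm_nonneg S_in_Hm1 d Hm1_norm_S)
  qed
  then show ?thesis unfolding Hm1_suminf_def part
    using Hm1_tendsto_unique S_in_Hm1[OF cut] by blast
qed

lemma Hdot_norm_eq: "Hdot_norm lam \<phi> s \<eta> = wnorm (\<lambda>j. lam j powr s) (\<lambda>j. \<eta> (\<phi> j))"
  by (simp add: Hdot_norm_def wnorm_def)

lemma Hdot_space_iff: "\<eta> \<in> Hdot_space \<Omega> lam \<phi> s \<longleftrightarrow> \<eta> \<in> Hm1_space \<Omega> \<and> wsummable (\<lambda>j. lam j powr s) (\<lambda>j. \<eta> (\<phi> j))"
  by (simp add: Hdot_space_def wsummable_def)

lemma wsummable_hw: "s \<ge> -1 \<Longrightarrow> wsummable (\<lambda>j. lam j powr s) c \<Longrightarrow> wsummable hw c"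
  using hw_le[of s] wsummable_weight(1)[of hw _ "\<lambda>j. lam j powr s" c, OF hw_nonneg] by blast

lemma S_Hdot: "s \<ge> -1 \<Longrightarrow> wsummable (\<lambda>j. lam j powr s) c \<Longrightarrow> S c \<in> Hdot_space \<Omega> lam \<phi> s"
  by (simp add: Hdot_space_iff S_eigenfunction S_in_Hm1 wsummable_hw)

end

section \<open>Strong measurability\<close>

text \<open>Strongly measurable functions are limits only almost everywhere; completeness keeps such
  limits measurable.\<close>

lemma complete_measure_lebesgue_on:
  assumes S: "S \<in> sets lebesgue"
  shows "complete_measure (lebesgue_on S)"
proof
  fix A B assume B: "B \<subseteq> A" and A: "A \<in> null_sets (lebesgue_on S)"
  then have "A \<in> null_sets lebesgue" "A \<subseteq> S" using S by (auto simp: null_sets_restrict_space)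
  then have "B \<in> sets lebesgue" using completion.complete[OF B] by blast
  then show "B \<in> sets (lebesgue_on S)" using S B \<open>A \<subseteq> S\<close> by (auto simp: sets_restrict_space_iff)
qed

lemma finite_measure_lebesgue_on_interval: "finite_measure (lebesgue_on {0<..<t::real})"
  using emeasure_bounded_finite[of "{0<..<t}"]
  by (intro finite_measureI) (simp add: emeasure_restrict_space less_top)

context complete_measure
begin

lemma measurable_AE_cong:
  fixes f g :: "'a \<Rightarrow> real"
  assumes f: "f \<in> borel_measurable M" and eq: "AE x in M. f x = g x"
  shows "g \<in> borel_measurable M"
proof (rule measurableI)
  fix A :: "real set" assume A: "A \<in> sets borel"
  show "g -` A \<inter> space M \<in> sets M"
    by (rule in_sets_AE[OF _ measurable_sets[OF f A]]) (use eq in \<open>eventually_elim, auto\<close>)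
qed simp

lemma measurable_AE_LIMSEQ:
  fixes f :: "nat \<Rightarrow> 'a \<Rightarrow> real"
  assumes f: "\<And>n. f n \<in> borel_measurable M" and lim: "AE x in M. (\<lambda>n. f n x) \<longlonglongrightarrow> g x"
  shows "g \<in> borel_measurable M"
proof (rule measurable_AE_cong)
  show "(\<lambda>x. lim (\<lambda>n. f n x)) \<in> borel_measurable M" using f by measurable
  show "AE x in M. lim (\<lambda>n. f n x) = g x" using lim by eventually_elim (rule limI)
qed

end

text \<open>Truncate to the first n coefficients and replace each of them by a simple function. One
  sequence serves every weight v. The factor 3 is 1 + 2, where 2 comes from the bound on the scalar
  simple functions; its square 9 dominates the series.\<close>

lemma simple_approximation:
  fixes c :: "'t \<Rightarrow> nat \<Rightarrow> real"
  assumes c: "\<And>j. (\<lambda>t. c t j) \<in> borel_measurable M"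
  obtains x :: "nat \<Rightarrow> 't \<Rightarrow> nat \<Rightarrow> real" where "\<And>n. simple_function M (x n)" "\<And>n t j. j \<ge> n \<Longrightarrow> x n t j = 0"
    "\<And>n t j. t \<in> space M \<Longrightarrow> \<bar>c t j - x n t j\<bar> \<le> 3 * \<bar>c t j\<bar>"
    "\<And>v t. t \<in> space M \<Longrightarrow> (\<And>j. v j \<ge> 0) \<Longrightarrow> wsummable v (c t) \<Longrightarrow>
       (\<lambda>n. wnorm v (\<lambda>j. c t j - x n t j)) \<longlonglongrightarrow> 0"
proof -
  have "\<exists>F. (\<forall>i. simple_function M (F i)) \<and> (\<forall>t\<in>space M. (\<lambda>i. F i t) \<longlonglongrightarrow> c t j) \<and>
    (\<forall>i. \<forall>t\<in>space M. dist (F i t) 0 \<le> 2 * dist (c t j) 0)" for j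
    by (rule borel_measurable_implies_sequence_metric[OF c])
  then obtain F where F: "\<And>j i. simple_function M (F j i)"
    "\<And>j t. t \<in> space M \<Longrightarrow> (\<lambda>i. F j i t) \<longlonglongrightarrow> c t j"
    "\<And>j i t. t \<in> space M \<Longrightarrow> \<bar>F j i t\<bar> \<le> 2 * \<bar>c t j\<bar>"
    by (simp add: dist_norm) metis
  define x where "x = (\<lambda>n t j. if j < n then F j n t else 0)"
  have b: "\<bar>c t j - x n t j\<bar> \<le> 3 * \<bar>c t j\<bar>" if "t \<in> space M" for n t j
    using F(3)[OF that, of j n] by (auto simp: x_def)
  show ?thesis
  proof (rule that[of x])
    fix n
    \<comment> \<open>Sequences are built one coordinate at a time: updating a simple function by
      another simple function stays simple.\<close>
    have "simple_function M (\<lambda>t j. if j < k then F j n t else 0)" for k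
    proof (induction k)
      case (Suc k)
      have "(\<lambda>t j. if j < Suc k then F j n t else 0)
          = (\<lambda>t. (\<lambda>f v. f(k := v)) (\<lambda>j. if j < k then F j n t else 0) (F k n t))"
        by (auto simp: fun_eq_iff less_Suc_eq)
      then show ?case using simple_function_compose2[OF Suc F(1)[of k n], of "\<lambda>f v. f(k := v)"] by simp
    qed simp
    then show "simple_function M (x n)" by (simp add: x_def)
  next
    fix v t assume t: "t \<in> space M" and v: "\<And>j::nat. v j \<ge> (0::real)" and s: "wsummable v (c t)"
    have "(\<lambda>n. \<Sum>j. v j * (c t j - x n t j)\<^sup>2) \<longlonglongrightarrow> (\<Sum>j::nat. 0)"
    proof (rule tannerys_theorem[THEN conjunct2, THEN conjunct2])
      fix j
      have "(\<lambda>n. x n t j) \<longlonglongrightarrow> c t j"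
        by (rule Lim_transform_eventually[OF F(2)[OF t]])
          (use eventually_gt_at_top[of j] in \<open>eventually_elim, simp add: x_def\<close>)
      then have "(\<lambda>n. v j * (c t j - x n t j)\<^sup>2) \<longlonglongrightarrow> v j * (c t j - c t j)\<^sup>2" by (intro tendsto_intros)
      then show "(\<lambda>n. v j * (c t j - x n t j)\<^sup>2) \<longlonglongrightarrow> 0" by simp
    next
      show "summable (\<lambda>j. 9 * (v j * (c t j)\<^sup>2))" using s by (simp add: wsummable_def summable_mult)
      have "norm (v k * (c t k - x n t k)\<^sup>2) \<le> 9 * (v k * (c t k)\<^sup>2)" for k n
        using mult_left_mono[OF power_mono[OF b[OF t] abs_ge_zero, of k n 2] v[of k]] v[of k]
        by (simp add: power_mult_distrib mult_ac)
      then show "\<forall>\<^sub>F (k, n) in sequentially \<times>\<^sub>F sequentially. norm (v k * (c t k - x n t k)\<^sup>2) \<le> 9 * (v k * (c t k)\<^sup>2)"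
        by (intro always_eventually) auto
    qed auto
    then show "(\<lambda>n. wnorm v (\<lambda>j. c t j - x n t j)) \<longlonglongrightarrow> 0"
      unfolding wnorm_def using tendsto_real_sqrt by fastforce
  qed (use b in \<open>auto simp: x_def\<close>)
qed

context dirichlet
begin

lemma Hm1_addD: "\<eta> \<in> Hm1_space \<Omega> \<Longrightarrow> w \<in> H10_space \<Omega> \<Longrightarrow> z \<in> H10_space \<Omega> \<Longrightarrow> \<eta> (\<lambda>x. w x + z x) = \<eta> w + \<eta> z"
  and Hm1_scaleD: "\<eta> \<in> Hm1_space \<Omega> \<Longrightarrow> w \<in> H10_space \<Omega> \<Longrightarrow> \<eta> (\<lambda>x. a * w x) = a * \<eta> w"
  by (auto simp: Hm1_space_def)

text \<open>Converse of \<open>S_in_Hm1\<close>. The test element p is the Riesz representative of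
  the truncated functional in H1, so \<open>\<eta>\<close> applied to p equals the squared H1 norm Q
  of p, and boundedness gives that \<open>sqrt Q\<close> is at most the norm of
  \<open>\<eta>\<close>.\<close>

lemma Hm1_coeffs_wsummable:
  assumes \<eta>: "\<eta> \<in> Hm1_space \<Omega>"
  shows "wsummable hw (\<lambda>j. \<eta> (\<phi> j))"
  unfolding wsummable_def
proof (rule bounded_imp_summable[where B = "(Hm1_norm \<Omega> \<eta>)\<^sup>2"])
  show "0 \<le> hw j * (\<eta> (\<phi> j))\<^sup>2" for j using hw_nonneg by simp
  fix n
  \<comment> \<open>\<open>Suc n\<close>, because the summability criterion bounds the sums over j
    \<le> n.\<close>
  define Q where "Q = (\<Sum>j<Suc n. hw j * (\<eta> (\<phi> j))\<^sup>2)"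
  define p where "p k = (\<lambda>x. \<Sum>j<k. (hw j * \<eta> (\<phi> j)) * \<phi> j x)" for k
  have pH: "p k \<in> H10_space \<Omega>" for k
  proof (induction k)
    case (Suc k)
    then show ?case using H10_add[OF Suc H10_scale[OF eigenfunction[of k], of "hw k * \<eta> (\<phi> k)"]]
      by (simp add: p_def)
  qed (use zero_H10 in \<open>simp add: p_def\<close>)
  have \<eta>p: "\<eta> (p k) = (\<Sum>j<k. hw j * (\<eta> (\<phi> j))\<^sup>2)" for k
  proof (induction k)
    case 0
    have "\<eta> (\<lambda>x. 0 * \<phi> 0 x) = 0 * \<eta> (\<phi> 0)" by (rule Hm1_scaleD[OF \<eta> eigenfunction])
    then show ?case by (simp add: p_def)
  next
    case (Suc k)
    have "\<eta> (\<lambda>x. p k x + (hw k * \<eta> (\<phi> k)) * \<phi> k x) = \<eta> (p k) + \<eta> (\<lambda>x. (hw k * \<eta> (\<phi> k)) * \<phi> k x)"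
      by (rule Hm1_addD[OF \<eta> pH H10_scale[OF eigenfunction]])
    also have "\<eta> (\<lambda>x. (hw k * \<eta> (\<phi> k)) * \<phi> k x) = (hw k * \<eta> (\<phi> k)) * \<eta> (\<phi> k)"
      by (rule Hm1_scaleD[OF \<eta> eigenfunction])
    finally show ?case using Suc by (simp add: p_def power2_eq_square)
  qed
  let ?ip = "\<lambda>w z. L2_inner \<Omega> w z + gradient_inner \<Omega> w z"
  have orth: "?ip (\<phi> i) (\<phi> j) = (if i = j then 1 / hw i else 0)" for i j
    by (simp add: eigenfunction_gradient eigenfunction orthonormal hw_def)
  have ips: "?ip (p k) y = (\<Sum>j<k. (hw j * \<eta> (\<phi> j)) * ?ip (\<phi> j) y)" if "y \<in> H1_space \<Omega>" for k y
    unfolding p_def by (rule h1.ip_sum[OF H10_H1[OF eigenfunction] that])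
  have "?ip (p (Suc n)) (p (Suc n)) = (\<Sum>j<Suc n. (hw j * \<eta> (\<phi> j)) * ?ip (\<phi> j) (p (Suc n)))"
    by (rule ips[OF H10_H1[OF pH]])
  also have "\<dots> = Q" unfolding Q_def
  proof (rule sum.cong[OF refl])
    fix j assume j: "j \<in> {..<Suc n}"
    have "?ip (\<phi> j) (p (Suc n)) = ?ip (p (Suc n)) (\<phi> j)"
      by (rule h1.ip_sym[OF H10_H1[OF eigenfunction] H10_H1[OF pH]])
    also have "\<dots> = (\<Sum>k<Suc n. (hw k * \<eta> (\<phi> k)) * ?ip (\<phi> k) (\<phi> j))"
      by (rule ips[OF H10_H1[OF eigenfunction]])
    also have "\<dots> = (\<Sum>k<Suc n. if k = j then \<eta> (\<phi> j) else 0)"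
      by (rule sum.cong[OF refl]) (auto simp: orth hw_pos less_imp_neq[OF hw_pos, symmetric])
    also have "\<dots> = \<eta> (\<phi> j)" using j by (subst sum.delta) auto
    finally show "hw j * \<eta> (\<phi> j) * ?ip (\<phi> j) (p (Suc n)) = hw j * (\<eta> (\<phi> j))\<^sup>2"
      by (simp add: power2_eq_square)
  qed
  finally have n: "H1_norm \<Omega> (p (Suc n)) = sqrt Q" by (simp add: H1_norm_def)
  have Q0: "Q \<ge> 0" unfolding Q_def by (intro sum_nonneg) (simp add: hw_nonneg)
  have "\<eta> (p (Suc n)) = Q" using \<eta>p[of "Suc n"] by (simp only: Q_def)
  then have "Q \<le> Hm1_norm \<Omega> \<eta> * sqrt Q"
    using Hm1_bound[OF \<eta> pH[of "Suc n"]] unfolding n by linarith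
  then have le: "sqrt Q * sqrt Q \<le> Hm1_norm \<Omega> \<eta> * sqrt Q" using Q0 by simp
  have "sqrt Q \<le> Hm1_norm \<Omega> \<eta>"
  proof (cases "sqrt Q > 0")
    case True
    then show ?thesis using mult_right_le_imp_le[OF le] by blast
  qed (use Hm1_norm_nonneg[OF \<eta>] in linarith)
  then have "Q \<le> (Hm1_norm \<Omega> \<eta>)\<^sup>2" using power_mono[of "sqrt Q" _ 2] Q0 by simp
  then show "(\<Sum>j\<le>n. hw j * (\<eta> (\<phi> j))\<^sup>2) \<le> (Hm1_norm \<Omega> \<eta>)\<^sup>2"
    by (simp add: Q_def lessThan_Suc_atMost)
qed

text \<open>Measurable coefficients suffice: finitely many modes with simple coefficients
  approximate g in the Hdot norm at almost every t.\<close>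

lemma Hdot_strongly_measurable:
  assumes s: "s \<ge> -1" and c: "\<And>j. (\<lambda>t. c t j) \<in> borel_measurable M"
    and g: "AE t in M. g t \<in> Hm1_space \<Omega>" "AE t in M. \<forall>j. g t (\<phi> j) = c t j"
    and summ: "AE t in M. wsummable (\<lambda>j. lam j powr s) (c t)"
  shows "strongly_measurable_on M (Hdot_space \<Omega> lam \<phi> s) (Hdot_norm lam \<phi> s) g"
proof -
  obtain x where x: "\<And>n. simple_function M (x n)" "\<And>n t j. j \<ge> n \<Longrightarrow> x n t j = 0"
    "\<And>v t. t \<in> space M \<Longrightarrow> (\<And>j. v j \<ge> 0) \<Longrightarrow> wsummable v (c t) \<Longrightarrow>
       (\<lambda>n. wnorm v (\<lambda>j. c t j - x n t j)) \<longlonglongrightarrow> 0"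
    by (rule simple_approximation[of c M, OF c]) blast
  show ?thesis unfolding strongly_measurable_on_def
  proof (intro conjI exI[of _ "\<lambda>n t. S (x n t)"] allI)
    show "AE t in M. g t \<in> Hdot_space \<Omega> lam \<phi> s"
      using g summ by eventually_elim (simp add: Hdot_space_iff)
    show "simple_function M (\<lambda>t. S (x n t))" for n using x(1) by (rule simple_function_compose1)
    show "(\<lambda>t. S (x n t)) ` space M \<subseteq> Hdot_space \<Omega> lam \<phi> s" for n
      using x(2) by (auto intro!: S_Hdot[OF s] wsummable_finite)
    show "AE t in M. (\<lambda>n. Hdot_norm lam \<phi> s (\<lambda>w. g t w - S (x n t) w)) \<longlonglongrightarrow> 0"
      using g(2) summ AE_space
    proof eventually_elim
      case (elim t)
      have "(\<lambda>n. wnorm (\<lambda>j. lam j powr s) (\<lambda>j. c t j - x n t j)) \<longlonglongrightarrow> 0"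
        by (rule x(3)) (use elim in auto)
      then show ?case using elim(1) by (simp add: Hdot_norm_eq S_eigenfunction)
    qed
  qed
qed

text \<open>Each coefficient is continuous in the Hdot norm, so it inherits the simple approximation
  of g almost everywhere.\<close>

lemma Hdot_coeff_measurable:
  assumes M: "complete_measure M" and g: "strongly_measurable_on M (Hdot_space \<Omega> lam \<phi> s) (Hdot_norm lam \<phi> s) g"
  shows "(\<lambda>t. g t (\<phi> j)) \<in> borel_measurable M"
proof -
  obtain r where r: "\<And>n. simple_function M (r n)" "\<And>n. r n ` space M \<subseteq> Hdot_space \<Omega> lam \<phi> s"
    "AE t in M. (\<lambda>n. Hdot_norm lam \<phi> s (\<lambda>w. g t w - r n t w)) \<longlonglongrightarrow> 0" and gV: "AE t in M. g t \<in> Hdot_space \<Omega> lam \<phi> s"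
    using g unfolding strongly_measurable_on_def by blast
  show ?thesis
  proof (rule complete_measure.measurable_AE_LIMSEQ[OF M])
    show "(\<lambda>t. r n t (\<phi> j)) \<in> borel_measurable M" for n
      using simple_function_compose1[OF r(1), of "\<lambda>\<eta>. \<eta> (\<phi> j)"] by (rule borel_measurable_simple_function)
    show "AE t in M. (\<lambda>n. r n t (\<phi> j)) \<longlonglongrightarrow> g t (\<phi> j)"
      using r(3) gV AE_space
    proof eventually_elim
      case (elim t)
      let ?v = "\<lambda>j. lam j powr s"
      have rV: "r n t \<in> Hdot_space \<Omega> lam \<phi> s" for n using r(2) elim by auto
      have b: "norm (r n t (\<phi> j) - g t (\<phi> j)) \<le> Hdot_norm lam \<phi> s (\<lambda>w. g t w - r n t w) / sqrt (?v j)" for n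
      proof -
        have "wsummable ?v (\<lambda>j. g t (\<phi> j) - r n t (\<phi> j))"
          by (rule wsummable_diff) (use elim(2) rV[of n] in \<open>auto simp: Hdot_space_iff\<close>)
        from component_le_wnorm[OF lam_powr_pos this, of j] show ?thesis
          by (simp add: Hdot_norm_eq abs_minus_commute)
      qed
      have "sqrt (?v j) \<noteq> 0" using lam_powr_pos[of j s] by simp
      from tendsto_divide[OF elim(1) tendsto_const this]
      have "(\<lambda>n. Hdot_norm lam \<phi> s (\<lambda>w. g t w - r n t w) / sqrt (?v j)) \<longlonglongrightarrow> 0"
        by (simp only: div_0)
      then have "(\<lambda>n. r n t (\<phi> j) - g t (\<phi> j)) \<longlonglongrightarrow> 0"
        by (rule Lim_null_comparison[rotated]) (rule always_eventually, rule allI, rule b)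
      then show ?case by (simp add: LIM_zero_iff)
    qed
  qed
qed

end

section \<open>Integration of functionals\<close>

lemma simple_integral_on_eq:
  assumes M: "finite_measure M" and s: "simple_function M s"
  shows "integrable M (\<lambda>t. s t w)" "simple_integral_on M s w = (LINT t|M. s t w)"
proof -
  interpret finite_measure M by fact
  have fin: "finite (s ` space M)" and ms: "\<And>\<eta>. s -` {\<eta>} \<inter> space M \<in> sets M"
    using s by (auto simp: simple_function_def intro: simple_functionD(2)[OF s])
  have e: "s t w = (\<Sum>\<eta>\<in>s ` space M. indicat_real (s -` {\<eta>} \<inter> space M) t * \<eta> w)" if "t \<in> space M" for t
  proof -
    have "(\<Sum>\<eta>\<in>s ` space M. indicat_real (s -` {\<eta>} \<inter> space M) t * \<eta> w)
       = (\<Sum>\<eta>\<in>s ` space M. if s t = \<eta> then s t w else 0)"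
      using that by (intro sum.cong) (auto simp: indicator_def)
    also have "\<dots> = s t w" using that fin by (subst sum.delta') auto
    finally show ?thesis ..
  qed
  have i: "integrable M (\<lambda>t. indicat_real (s -` {\<eta>} \<inter> space M) t * \<eta> w)" for \<eta>
    using ms by (intro integrable_mult_left integrable_real_indicator) (auto simp: less_top[symmetric])
  show "integrable M (\<lambda>t. s t w)"
    by (subst Bochner_Integration.integrable_cong[OF refl e]) (auto intro: i)
  have "(LINT t|M. s t w) = (LINT t|M. (\<Sum>\<eta>\<in>s ` space M. indicat_real (s -` {\<eta>} \<inter> space M) t * \<eta> w))"
    by (rule Bochner_Integration.integral_cong[OF refl e])
  also have "\<dots> = (\<Sum>\<eta>\<in>s ` space M. (LINT t|M. indicat_real (s -` {\<eta>} \<inter> space M) t * \<eta> w))"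
    by (rule Bochner_Integration.integral_sum) (rule i)
  also have "\<dots> = simple_integral_on M s w"
    unfolding simple_integral_on_def using ms by (intro sum.cong refl) simp
  finally show "simple_integral_on M s w = (LINT t|M. s t w)" ..
qed

context dirichlet
begin

definition simple_L1_approx :: "'t measure \<Rightarrow> ('t \<Rightarrow> 'd functional) \<Rightarrow> (nat \<Rightarrow> 't \<Rightarrow> 'd functional) \<Rightarrow> bool" where
  "simple_L1_approx M g s \<longleftrightarrow> (\<forall>n. simple_function M (s n) \<and> s n ` space M \<subseteq> Hm1_space \<Omega>) \<and>
     (\<lambda>n. \<integral>\<^sup>+t. ennreal (Hm1_norm \<Omega> (\<lambda>w. g t w - s n t w)) \<partial>M) \<longlonglongrightarrow> 0"

text \<open>The weak (Pettis) integral. It is the only value that the strong integral can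
  have.\<close>

definition pairing :: "'t measure \<Rightarrow> ('t \<Rightarrow> 'd functional) \<Rightarrow> 'd functional" where
  "pairing M g = (\<lambda>w. if w \<in> H10_space \<Omega> then LINT t|M. g t w else 0)"

lemma nn_integral_Hm1_bound:
  assumes m: "(\<lambda>t. d t w) \<in> borel_measurable M" and d: "AE t in M. d t \<in> Hm1_space \<Omega>" and w: "w \<in> H10_space \<Omega>"
  shows "(\<integral>\<^sup>+t. ennreal \<bar>d t w\<bar> \<partial>M) \<le> ennreal (H1_norm \<Omega> w) * (\<integral>\<^sup>+t. ennreal (Hm1_norm \<Omega> (d t)) \<partial>M)"
proof (cases "H1_norm \<Omega> w = 0")
  case True
  have "AE t in M. ennreal \<bar>d t w\<bar> = 0"
    using d by eventually_elim (use Hm1_bound[OF _ w] True in fastforce)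
  then have "(\<integral>\<^sup>+t. ennreal \<bar>d t w\<bar> \<partial>M) = 0" using m by (subst nn_integral_0_iff_AE) auto
  then show ?thesis by simp
next
  case False
  then have p: "H1_norm \<Omega> w > 0" using H1_norm_nonneg[of w] by linarith
  have "(\<integral>\<^sup>+t. ennreal \<bar>d t w\<bar> \<partial>M) = (\<integral>\<^sup>+t. ennreal (H1_norm \<Omega> w) * ennreal (\<bar>d t w\<bar> / H1_norm \<Omega> w) \<partial>M)"
    using p by (intro nn_integral_cong) (simp flip: ennreal_mult)
  also have "\<dots> = ennreal (H1_norm \<Omega> w) * (\<integral>\<^sup>+t. ennreal (\<bar>d t w\<bar> / H1_norm \<Omega> w) \<partial>M)"
    using m by (intro nn_integral_cmult) simp
  also have "\<dots> \<le> ennreal (H1_norm \<Omega> w) * (\<integral>\<^sup>+t. ennreal (Hm1_norm \<Omega> (d t)) \<partial>M)"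
  proof (intro mult_left_mono nn_integral_mono_AE)
    show "AE t in M. ennreal (\<bar>d t w\<bar> / H1_norm \<Omega> w) \<le> ennreal (Hm1_norm \<Omega> (d t))"
      using d by eventually_elim (use Hm1_bound[OF _ w] p in \<open>auto simp: field_simps intro!: ennreal_leI\<close>)
  qed simp
  finally show ?thesis .
qed

lemma Hm1_pairing_measurable:
  assumes M: "complete_measure M" and g: "strongly_measurable_on M (Hm1_space \<Omega>) (Hm1_norm \<Omega>) g"
    and w: "w \<in> H10_space \<Omega>"
  shows "(\<lambda>t. g t w) \<in> borel_measurable M"
proof -
  obtain r where r: "\<And>n. simple_function M (r n)" "\<And>n. r n ` space M \<subseteq> Hm1_space \<Omega>"
    "AE t in M. (\<lambda>n. Hm1_norm \<Omega> (\<lambda>w. g t w - r n t w)) \<longlonglongrightarrow> 0" and gV: "AE t in M. g t \<in> Hm1_space \<Omega>"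
    using g unfolding strongly_measurable_on_def by blast
  show ?thesis
  proof (rule complete_measure.measurable_AE_LIMSEQ[OF M])
    show "(\<lambda>t. r n t w) \<in> borel_measurable M" for n
      using simple_function_compose1[OF r(1), of "\<lambda>\<eta>. \<eta> w"] by (rule borel_measurable_simple_function)
    show "AE t in M. (\<lambda>n. r n t w) \<longlonglongrightarrow> g t w"
      using r(3) gV AE_space
    proof eventually_elim
      case (elim t)
      have rV: "r n t \<in> Hm1_space \<Omega>" for n using r(2) elim by auto
      have b: "norm (r n t w - g t w) \<le> Hm1_norm \<Omega> (\<lambda>w. g t w - r n t w) * H1_norm \<Omega> w" for n
        using Hm1_bound[OF Hm1_diff[OF elim(2) rV[of n]] w] by (simp add: abs_minus_commute)
      have "(\<lambda>n. Hm1_norm \<Omega> (\<lambda>w. g t w - r n t w) * H1_norm \<Omega> w) \<longlonglongrightarrow> 0"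
        using tendsto_mult[OF elim(1) tendsto_const[of "H1_norm \<Omega> w"]] by (simp only: mult_zero_left)
      then have "(\<lambda>n. r n t w - g t w) \<longlonglongrightarrow> 0"
        by (rule Lim_null_comparison[rotated]) (rule always_eventually, rule allI, rule b)
      then show ?case by (simp add: LIM_zero_iff)
    qed
  qed
qed

context
  fixes M :: "'t measure" and g :: "'t \<Rightarrow> 'd functional" and s :: "nat \<Rightarrow> 't \<Rightarrow> 'd functional"
  assumes M: "complete_measure M" "finite_measure M"
    and g: "strongly_measurable_on M (Hm1_space \<Omega>) (Hm1_norm \<Omega>) g"
    and s: "simple_L1_approx M g s"
begin

lemma simple_L1_approxD: "simple_function M (s n)" "t \<in> space M \<Longrightarrow> s n t \<in> Hm1_space \<Omega>"
  "(\<lambda>n. \<integral>\<^sup>+t. ennreal (Hm1_norm \<Omega> (\<lambda>w. g t w - s n t w)) \<partial>M) \<longlonglongrightarrow> 0"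
  using s by (auto simp: simple_L1_approx_def)

lemma gV: "AE t in M. g t \<in> Hm1_space \<Omega>"
  using g by (simp add: strongly_measurable_on_def)

lemma nn_integral_approx_bound:
  assumes w: "w \<in> H10_space \<Omega>"
  shows "(\<integral>\<^sup>+t. ennreal \<bar>g t w - s n t w\<bar> \<partial>M)
    \<le> ennreal (H1_norm \<Omega> w) * (\<integral>\<^sup>+t. ennreal (Hm1_norm \<Omega> (\<lambda>w. g t w - s n t w)) \<partial>M)"
proof (rule nn_integral_Hm1_bound[of "\<lambda>t w. g t w - s n t w", OF _ _ w])
  show "(\<lambda>t. g t w - s n t w) \<in> borel_measurable M"
    using Hm1_pairing_measurable[OF M(1) g w] borel_measurable_integrable[OF simple_integral_on_eq(1)[OF M(2) simple_L1_approxD(1)]]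
    by (intro borel_measurable_diff) auto
  show "AE t in M. (\<lambda>w. g t w - s n t w) \<in> Hm1_space \<Omega>"
    using gV AE_space by eventually_elim (auto intro: Hm1_diff simple_L1_approxD)
qed

lemma pairing_integrable:
  assumes w: "w \<in> H10_space \<Omega>"
  shows "integrable M (\<lambda>t. g t w)"
proof -
  have "eventually (\<lambda>n. (\<integral>\<^sup>+t. ennreal (Hm1_norm \<Omega> (\<lambda>w. g t w - s n t w)) \<partial>M) < 1) sequentially"
    by (rule order_tendstoD(2)[OF simple_L1_approxD(3)]) simp
  then obtain n where n: "(\<integral>\<^sup>+t. ennreal (Hm1_norm \<Omega> (\<lambda>w. g t w - s n t w)) \<partial>M) < 1"
    by (meson eventually_happens sequentially_bot)
  have "(\<integral>\<^sup>+t. ennreal \<bar>g t w - s n t w\<bar> \<partial>M) < \<infinity>"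
  proof (rule order.strict_trans1[OF nn_integral_approx_bound[OF w]])
    show "ennreal (H1_norm \<Omega> w) * (\<integral>\<^sup>+t. ennreal (Hm1_norm \<Omega> (\<lambda>w. g t w - s n t w)) \<partial>M) < \<infinity>"
      using order.strict_trans[OF n, of \<infinity>] by (simp add: ennreal_mult_less_top)
  qed
  then have "integrable M (\<lambda>t. g t w - s n t w)"
    using Hm1_pairing_measurable[OF M(1) g w] borel_measurable_integrable[OF simple_integral_on_eq(1)[OF M(2) simple_L1_approxD(1)]]
    by (intro integrableI_bounded) auto
  then have "integrable M (\<lambda>t. (g t w - s n t w) + s n t w)"
    by (intro Bochner_Integration.integrable_add simple_integral_on_eq(1)[OF M(2) simple_L1_approxD(1)])
  then show ?thesis by simp
qed

lemma pairing_approx_bound: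
  assumes w: "w \<in> H10_space \<Omega>"
  shows "ennreal \<bar>simple_integral_on M (s n) w - (LINT t|M. g t w)\<bar>
    \<le> ennreal (H1_norm \<Omega> w) * (\<integral>\<^sup>+t. ennreal (Hm1_norm \<Omega> (\<lambda>w. g t w - s n t w)) \<partial>M)"
proof -
  note si = simple_integral_on_eq[OF M(2) simple_L1_approxD(1)]
  have "simple_integral_on M (s n) w - (LINT t|M. g t w) = - (LINT t|M. g t w - s n t w)"
    using pairing_integrable[OF w] si by simp
  then have "ennreal \<bar>simple_integral_on M (s n) w - (LINT t|M. g t w)\<bar> = ennreal (norm (LINT t|M. g t w - s n t w))"
    by (simp only: abs_minus_cancel real_norm_def)
  also have "\<dots> \<le> (\<integral>\<^sup>+t. ennreal (norm (g t w - s n t w)) \<partial>M)"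
    by (rule integral_norm_bound_ennreal) (use pairing_integrable[OF w] si in auto)
  finally show ?thesis using nn_integral_approx_bound[OF w, of n] by simp
qed

lemma simple_integral_Hm1: "simple_integral_on M (s n) \<in> Hm1_space \<Omega>"
  unfolding simple_integral_on_def
  using simple_functionD(1)[OF simple_L1_approxD(1)]
  by (intro Hm1_sum Hm1_scale) (auto intro: simple_L1_approxD)

text \<open>A single approximant with L1 error below 1 gives boundedness, with the constant 1 plus
  the norm of its integral. Linearity holds for almost every \<open>g t\<close> and survives the
  scalar integral.\<close>

lemma pairing_Hm1: "pairing M g \<in> Hm1_space \<Omega>"
proof -
  have "eventually (\<lambda>n. (\<integral>\<^sup>+t. ennreal (Hm1_norm \<Omega> (\<lambda>w. g t w - s n t w)) \<partial>M) < 1) sequentially"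
    by (rule order_tendstoD(2)[OF simple_L1_approxD(3)]) simp
  then obtain n where n: "(\<integral>\<^sup>+t. ennreal (Hm1_norm \<Omega> (\<lambda>w. g t w - s n t w)) \<partial>M) < 1"
    by (meson eventually_happens sequentially_bot)
  have b: "\<bar>pairing M g w\<bar> \<le> (1 + Hm1_norm \<Omega> (simple_integral_on M (s n))) * H1_norm \<Omega> w" if w: "w \<in> H10_space \<Omega>" for w
  proof -
    have "ennreal \<bar>simple_integral_on M (s n) w - (LINT t|M. g t w)\<bar> \<le> ennreal (H1_norm \<Omega> w) * 1"
      by (rule order_trans[OF pairing_approx_bound[OF w] mult_left_mono]) (use n in auto)
    then have "\<bar>simple_integral_on M (s n) w - (LINT t|M. g t w)\<bar> \<le> H1_norm \<Omega> w"
      using H1_norm_nonneg[of w] by simp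
    then show ?thesis using Hm1_bound[OF simple_integral_Hm1[of n] w] w
      by (simp add: pairing_def distrib_right)
  qed
  have addA: "AE t in M. g t (\<lambda>x. w x + z x) = g t w + g t z" if "w \<in> H10_space \<Omega>" "z \<in> H10_space \<Omega>" for w z
    using gV by eventually_elim (rule Hm1_addD[OF _ that])
  have scA: "AE t in M. g t (\<lambda>x. a * w x) = a * g t w" if "w \<in> H10_space \<Omega>" for w a
    using gV by eventually_elim (rule Hm1_scaleD[OF _ that])
  have "pairing M g (\<lambda>x. w x + z x) = pairing M g w + pairing M g z" if wz: "w \<in> H10_space \<Omega>" "z \<in> H10_space \<Omega>" for w z
  proof -
    have "(LINT t|M. g t (\<lambda>x. w x + z x)) = (LINT t|M. g t w + g t z)"
      by (rule integral_cong_AE)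
        (use addA[OF wz] borel_measurable_integrable[OF pairing_integrable] wz H10_add[OF wz] in auto)
    then show ?thesis using wz H10_add[OF wz] pairing_integrable by (simp add: pairing_def)
  qed
  moreover have "pairing M g (\<lambda>x. a * w x) = a * pairing M g w" if w: "w \<in> H10_space \<Omega>" for w a
  proof -
    have "(LINT t|M. g t (\<lambda>x. a * w x)) = (LINT t|M. a * g t w)"
      by (rule integral_cong_AE)
        (use scA[OF w, of a] borel_measurable_integrable[OF pairing_integrable] w H10_scale[OF w, of a] in auto)
    then show ?thesis using w H10_scale[OF w, of a] by (simp add: pairing_def)
  qed
  moreover have "\<exists>C. \<forall>w\<in>H10_space \<Omega>. \<bar>pairing M g w\<bar> \<le> C * H1_norm \<Omega> w" using b by blast
  ultimately show ?thesis by (simp add: Hm1_space_def pairing_def)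
qed

lemma pairing_tendsto: "Hm1_tendsto \<Omega> (\<lambda>n. simple_integral_on M (s n)) (pairing M g)"
  unfolding Hm1_tendsto_def
proof (intro conjI pairing_Hm1)
  let ?D = "\<lambda>n. \<integral>\<^sup>+t. ennreal (Hm1_norm \<Omega> (\<lambda>w. g t w - s n t w)) \<partial>M"
  have "?D \<longlonglongrightarrow> ennreal 0" using simple_L1_approxD(3) by simp
  from tendsto_enn2real[OF this] have lim: "(\<lambda>n. enn2real (?D n)) \<longlonglongrightarrow> 0" by simp
  \<comment> \<open>\<open>enn2real\<close> sends infinity to 0, so the error must be known to be
    finite before it serves as a bound.\<close>
  have ev: "eventually (\<lambda>n. ?D n < 1) sequentially"
    by (rule order_tendstoD(2)[OF simple_L1_approxD(3)]) simp
  show "(\<lambda>n. Hm1_norm \<Omega> (\<lambda>w. simple_integral_on M (s n) w - pairing M g w)) \<longlonglongrightarrow> 0"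
  proof (rule tendsto_sandwich[OF _ _ tendsto_const lim])
    show "\<forall>\<^sub>F n in sequentially. 0 \<le> Hm1_norm \<Omega> (\<lambda>w. simple_integral_on M (s n) w - pairing M g w)"
      by (intro always_eventually allI Hm1_norm_nonneg Hm1_diff simple_integral_Hm1 pairing_Hm1)
    show "\<forall>\<^sub>F n in sequentially. Hm1_norm \<Omega> (\<lambda>w. simple_integral_on M (s n) w - pairing M g w) \<le> enn2real (?D n)"
      using ev
    proof eventually_elim
      case (elim n)
      then have fin: "?D n = ennreal (enn2real (?D n))" by (intro ennreal_enn2real[symmetric] order.strict_trans[OF elim]) simp
      show ?case
      proof (rule Hm1_norm_le)
        fix w assume w: "w \<in> H10_space \<Omega>"
        have "ennreal \<bar>simple_integral_on M (s n) w - pairing M g w\<bar> \<le> ennreal (H1_norm \<Omega> w) * ennreal (enn2real (?D n))"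
          using pairing_approx_bound[OF w, of n] w fin by (simp add: pairing_def)
        then show "\<bar>simple_integral_on M (s n) w - pairing M g w\<bar> \<le> enn2real (?D n) * H1_norm \<Omega> w"
          using H1_norm_nonneg[of w] by (simp flip: ennreal_mult add: mult.commute)
      qed simp
    qed
  qed
qed

end

lemma has_Hm1_integralI:
  assumes "complete_measure M" "finite_measure M" "strongly_measurable_on M (Hm1_space \<Omega>) (Hm1_norm \<Omega>) g"
    "simple_L1_approx M g s"
  shows "has_Hm1_integral \<Omega> M g (pairing M g)"
  unfolding has_Hm1_integral_def
  using assms(3) pairing_tendsto[OF assms] assms(4) by (auto simp: simple_L1_approx_def)

text \<open>The simple integrals converge to \<open>pairing M g\<close> along any admissible
  approximation, so every admissible value equals it; this resolves the description operator in
  \<open>Hm1_integral\<close>.\<close>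

lemma has_Hm1_integralD:
  assumes M: "complete_measure M" "finite_measure M" and g: "has_Hm1_integral \<Omega> M g I"
  shows "I = pairing M g" "w \<in> H10_space \<Omega> \<Longrightarrow> integrable M (\<lambda>t. g t w)" "I \<in> Hm1_space \<Omega>"
    "strongly_measurable_on M (Hm1_space \<Omega>) (Hm1_norm \<Omega>) g" "\<exists>s. simple_L1_approx M g s"
proof -
  from g obtain s where sm: "strongly_measurable_on M (Hm1_space \<Omega>) (Hm1_norm \<Omega>) g"
    and s: "simple_L1_approx M g s" and t: "Hm1_tendsto \<Omega> (\<lambda>n. simple_integral_on M (s n)) I"
    unfolding has_Hm1_integral_def simple_L1_approx_def by blast
  show e: "I = pairing M g"
    by (rule Hm1_tendsto_unique[OF t pairing_tendsto[OF M sm s] simple_integral_Hm1[OF M sm s]])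
  show "integrable M (\<lambda>t. g t w)" if "w \<in> H10_space \<Omega>" by (rule pairing_integrable[OF M sm s that])
  show "I \<in> Hm1_space \<Omega>" unfolding e by (rule pairing_Hm1[OF M sm s])
  show "strongly_measurable_on M (Hm1_space \<Omega>) (Hm1_norm \<Omega>) g" by (rule sm)
  show "\<exists>s. simple_L1_approx M g s" using s by blast
qed

lemma Hm1_integral_eq:
  assumes M: "complete_measure M" "finite_measure M" and g: "has_Hm1_integral \<Omega> M g I"
  shows "Hm1_integral \<Omega> M g = I"
  unfolding Hm1_integral_def using g has_Hm1_integralD(1)[OF M] by blast

section \<open>Integrals over intervals of time\<close>

lemma time_measure_props: "complete_measure (time_measure t)" "finite_measure (time_measure t)"
  by (auto intro: complete_measure_lebesgue_on finite_measure_lebesgue_on_interval)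

lemma AE_time_measure_mono:
  assumes "AE s in time_measure T. P s" "t \<le> T"
  shows "AE s in time_measure t. P s"
  using assms by (auto simp: AE_restrict_space_iff elim!: eventually_mono)

lemma simple_function_time_measure_mono:
  assumes s: "simple_function (time_measure T) s" and t: "t \<le> T"
  shows "simple_function (time_measure t) s"
  unfolding simple_function_def
proof (intro conjI ballI)
  have sub: "space (time_measure t) \<subseteq> space (time_measure T)" using t by auto
  then show "finite (s ` space (time_measure t))"
    using simple_functionD(1)[OF s] by (meson finite_subset image_mono)
  fix x
  have "s -` {x} \<inter> space (time_measure T) \<in> sets (time_measure T)" by (rule simple_functionD(2)[OF s])
  then have "s -` {x} \<inter> {0<..<T} \<in> sets lebesgue" by (auto simp: sets_restrict_space_iff)
  then have "s -` {x} \<inter> {0<..<T} \<inter> {0<..<t} \<in> sets lebesgue" by (rule sets.Int) simp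
  moreover have "s -` {x} \<inter> {0<..<T} \<inter> {0<..<t} = s -` {x} \<inter> {0<..<t}" using t by auto
  ultimately show "s -` {x} \<inter> space (time_measure t) \<in> sets (time_measure t)"
    by (auto simp: sets_restrict_space_iff)
qed

text \<open>The Caputo relation integrates g over every (0,t), while integrability is demanded on
  (0,T); the same simple functions serve on the smaller interval.\<close>

lemma has_Hm1_integral_restrict:
  assumes g: "has_Hm1_integral \<Omega> (time_measure T) g I" and t: "t \<le> T"
  shows "has_Hm1_integral \<Omega> (time_measure t) g (pairing (time_measure t) g)"
proof -
  have sub: "space (time_measure t) \<subseteq> space (time_measure T)" using t by auto
  note D = has_Hm1_integralD[OF time_measure_props g]
  obtain s where s: "simple_L1_approx (time_measure T) g s" using D(5) by blast
  obtain r where r: "\<And>n. simple_function (time_measure T) (r n)" "\<And>n. r n ` space (time_measure T) \<subseteq> Hm1_space \<Omega>"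
    "AE u in time_measure T. (\<lambda>n. Hm1_norm \<Omega> (\<lambda>w. g u w - r n u w)) \<longlonglongrightarrow> 0" "AE u in time_measure T. g u \<in> Hm1_space \<Omega>"
    using D(4) unfolding strongly_measurable_on_def by blast
  have sm: "strongly_measurable_on (time_measure t) (Hm1_space \<Omega>) (Hm1_norm \<Omega>) g"
    unfolding strongly_measurable_on_def
    using AE_time_measure_mono[OF r(4) t] AE_time_measure_mono[OF r(3) t]
      simple_function_time_measure_mono[OF r(1) t] order_trans[OF image_mono[OF sub] r(2)]
    by (intro conjI exI[of _ r] allI)
  have "simple_L1_approx (time_measure t) g s"
    unfolding simple_L1_approx_def
  proof (intro conjI allI)
    fix n
    show "simple_function (time_measure t) (s n)"
      using s t simple_function_time_measure_mono by (auto simp: simple_L1_approx_def)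
    show "s n ` space (time_measure t) \<subseteq> Hm1_space \<Omega>"
      using s sub unfolding simple_L1_approx_def by blast
  next
    show "(\<lambda>n. \<integral>\<^sup>+u. ennreal (Hm1_norm \<Omega> (\<lambda>w. g u w - s n u w)) \<partial>time_measure t) \<longlonglongrightarrow> 0"
    proof (rule tendsto_sandwich[OF _ _ tendsto_const])
      show "(\<lambda>n. \<integral>\<^sup>+u. ennreal (Hm1_norm \<Omega> (\<lambda>w. g u w - s n u w)) \<partial>time_measure T) \<longlonglongrightarrow> 0"
        using s by (simp add: simple_L1_approx_def)
      show "\<forall>\<^sub>F n in sequentially. (\<integral>\<^sup>+u. ennreal (Hm1_norm \<Omega> (\<lambda>w. g u w - s n u w)) \<partial>time_measure t)
         \<le> (\<integral>\<^sup>+u. ennreal (Hm1_norm \<Omega> (\<lambda>w. g u w - s n u w)) \<partial>time_measure T)"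
        using t by (intro always_eventually allI)
          (auto simp: nn_integral_restrict_space indicator_def intro!: nn_integral_mono)
    qed simp
  qed
  then show ?thesis by (rule has_Hm1_integralI[OF time_measure_props sm])
qed

text \<open>The domination by \<open>3 * wnorm hw (c t)\<close> turns coefficientwise simple
  functions into an L1 approximation. The value is found by testing with w: the partial sums are
  dominated by \<open>wnorm hw (c t) * H1_norm \<Omega> w\<close>, so sum and integral
  commute.\<close>

lemma has_Hm1_integral_S:
  assumes M: "complete_measure M" "finite_measure M"
    and c: "\<And>j. (\<lambda>t. c t j) \<in> borel_measurable M"
    and summ: "AE t in M. wsummable hw (c t)" and g: "AE t in M. g t = S (c t)"
    and fin: "(\<integral>\<^sup>+t. ennreal (wnorm hw (c t)) \<partial>M) < \<infinity>"
  shows "has_Hm1_integral \<Omega> M g (S (\<lambda>j. LINT t|M. c t j))"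
    and "wsummable hw (\<lambda>j. LINT t|M. c t j)"
proof -
  obtain x where x: "\<And>n. simple_function M (x n)" "\<And>n t j. j \<ge> n \<Longrightarrow> x n t j = 0"
    "\<And>n t j. t \<in> space M \<Longrightarrow> \<bar>c t j - x n t j\<bar> \<le> 3 * \<bar>c t j\<bar>"
    "\<And>v t. t \<in> space M \<Longrightarrow> (\<And>j. v j \<ge> 0) \<Longrightarrow> wsummable v (c t) \<Longrightarrow>
       (\<lambda>n. wnorm v (\<lambda>j. c t j - x n t j)) \<longlonglongrightarrow> 0"
    by (rule simple_approximation[of c M, OF c]) blast
  have xs: "wsummable hw (x n t)" for n t using x(2) by (rule wsummable_finite)
  have [measurable]: "(\<lambda>t. c t j) \<in> borel_measurable M" for j by (rule c)
  have xm [measurable]: "(\<lambda>t. x n t j) \<in> borel_measurable M" for n j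
    using simple_function_compose1[OF x(1), of "\<lambda>f. f j"] by (rule borel_measurable_simple_function)
  have nb: "Hm1_norm \<Omega> (\<lambda>w. g t w - S (x n t) w) \<le> wnorm hw (\<lambda>j. c t j - x n t j)"
    if "wsummable hw (c t)" "g t = S (c t)" for t n
    using that Hm1_norm_S[OF wsummable_diff[OF hw_nonneg that(1) xs[of n t]]] S_diff[OF that(1) xs] by simp
  have sm: "strongly_measurable_on M (Hm1_space \<Omega>) (Hm1_norm \<Omega>) g"
    unfolding strongly_measurable_on_def
  proof (intro conjI exI[of _ "\<lambda>n t. S (x n t)"] allI)
    show "AE t in M. g t \<in> Hm1_space \<Omega>" using g summ by eventually_elim (simp add: S_in_Hm1)
    show "simple_function M (\<lambda>t. S (x n t))" for n using x(1) by (rule simple_function_compose1)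
    show "(\<lambda>t. S (x n t)) ` space M \<subseteq> Hm1_space \<Omega>" for n using S_in_Hm1[OF xs] by auto
    show "AE t in M. (\<lambda>n. Hm1_norm \<Omega> (\<lambda>w. g t w - S (x n t) w)) \<longlonglongrightarrow> 0"
      using g summ AE_space
    proof eventually_elim
      case (elim t)
      show ?case
      proof (rule tendsto_sandwich[OF _ _ tendsto_const x(4)[OF elim(3) hw_nonneg elim(2)]])
        show "\<forall>\<^sub>F n in sequentially. 0 \<le> Hm1_norm \<Omega> (\<lambda>w. g t w - S (x n t) w)"
          using elim by (intro always_eventually allI Hm1_norm_nonneg Hm1_diff) (auto intro: S_in_Hm1 xs)
        show "\<forall>\<^sub>F n in sequentially. Hm1_norm \<Omega> (\<lambda>w. g t w - S (x n t) w) \<le> wnorm hw (\<lambda>j. c t j - x n t j)"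
          by (intro always_eventually allI nb elim)
      qed
    qed
  qed
  have wm: "(\<lambda>t. wnorm hw (\<lambda>j. c t j - x n t j)) \<in> borel_measurable M" "(\<lambda>t. wnorm hw (c t)) \<in> borel_measurable M" for n
    unfolding wnorm_def by measurable
  have lim: "(\<lambda>n. \<integral>\<^sup>+t. ennreal (wnorm hw (\<lambda>j. c t j - x n t j)) \<partial>M) \<longlonglongrightarrow> (\<integral>\<^sup>+t. 0 \<partial>M)"
  proof (rule nn_integral_dominated_convergence[where w = "\<lambda>t. 3 * ennreal (wnorm hw (c t))"])
    show "(\<integral>\<^sup>+t. 3 * ennreal (wnorm hw (c t)) \<partial>M) < \<infinity>"
      using fin wm by (subst nn_integral_cmult) (auto simp: ennreal_mult_less_top)
    show "AE t in M. ennreal (wnorm hw (\<lambda>j. c t j - x n t j)) \<le> 3 * ennreal (wnorm hw (c t))" for n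
      using summ AE_space
    proof eventually_elim
      case (elim t)
      have "ennreal (wnorm hw (\<lambda>j. c t j - x n t j)) \<le> ennreal (3 * wnorm hw (c t))"
        by (intro ennreal_leI wsummable_dominated[OF hw_nonneg _ _ elim(1)] x(3) elim(2)) simp
      then show ?case using wnorm_nonneg[OF hw_nonneg elim(1)] by (simp add: ennreal_mult)
    qed
    show "AE t in M. (\<lambda>n. ennreal (wnorm hw (\<lambda>j. c t j - x n t j))) \<longlonglongrightarrow> 0"
      using summ AE_space by eventually_elim (use x(4)[OF _ hw_nonneg] tendsto_ennrealI in fastforce)
  qed (use wm in auto)
  have ap: "simple_L1_approx M g (\<lambda>n t. S (x n t))"
    unfolding simple_L1_approx_def
  proof (intro conjI allI)
    show "simple_function M (\<lambda>t. S (x n t))" for n using x(1) by (rule simple_function_compose1)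
    show "(\<lambda>t. S (x n t)) ` space M \<subseteq> Hm1_space \<Omega>" for n using S_in_Hm1[OF xs] by auto
    show "(\<lambda>n. \<integral>\<^sup>+t. ennreal (Hm1_norm \<Omega> (\<lambda>w. g t w - S (x n t) w)) \<partial>M) \<longlonglongrightarrow> 0"
    proof (rule tendsto_sandwich[OF _ _ tendsto_const])
      show "(\<lambda>n. \<integral>\<^sup>+t. ennreal (wnorm hw (\<lambda>j. c t j - x n t j)) \<partial>M) \<longlonglongrightarrow> 0" using lim by simp
      have "AE t in M. ennreal (Hm1_norm \<Omega> (\<lambda>w. g t w - S (x n t) w)) \<le> ennreal (wnorm hw (\<lambda>j. c t j - x n t j))" for n
        using g summ by eventually_elim (intro ennreal_leI nb)
      note le = nn_integral_mono_AE[OF this]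
      show "\<forall>\<^sub>F n in sequentially. (\<integral>\<^sup>+t. ennreal (Hm1_norm \<Omega> (\<lambda>w. g t w - S (x n t) w)) \<partial>M)
          \<le> (\<integral>\<^sup>+t. ennreal (wnorm hw (\<lambda>j. c t j - x n t j)) \<partial>M)"
        by (intro always_eventually allI le)
    qed simp
  qed
  have hi: "has_Hm1_integral \<Omega> M g (pairing M g)" by (rule has_Hm1_integralI[OF M sm ap])
  have pH: "pairing M g \<in> Hm1_space \<Omega>" by (rule pairing_Hm1[OF M sm ap])
  have gi: "integrable M (\<lambda>t. g t w)" if "w \<in> H10_space \<Omega>" for w by (rule pairing_integrable[OF M sm ap that])
  have cg: "AE t in M. g t (\<phi> j) = c t j" for j using g by eventually_elim (simp add: S_eigenfunction)
  have ci: "integrable M (\<lambda>t. c t j)" for j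
    using integrable_cong_AE[OF borel_measurable_integrable[OF gi[OF eigenfunction]] c cg[of j]]
      gi[OF eigenfunction[of j]] by simp
  have pe: "pairing M g (\<phi> j) = (LINT t|M. c t j)" for j
    unfolding pairing_def using eigenfunction cg[of j] gi[OF eigenfunction[of j]] by (simp, intro integral_cong_AE) auto
  \<comment> \<open>The integrated coefficients are those of the bounded functional
    \<open>pairing M g\<close>, which spares a Minkowski inequality for integrals.\<close>
  show ws: "wsummable hw (\<lambda>j. LINT t|M. c t j)" using Hm1_coeffs_wsummable[OF pH] by (simp add: pe)
  have "pairing M g = S (\<lambda>j. LINT t|M. c t j)"
  proof (rule Hm1_eqI[OF pH S_in_Hm1[OF ws]])
    fix w assume w: "w \<in> H10_space \<Omega>"
    let ?d = "\<lambda>j. L2_inner \<Omega> (\<phi> j) w"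
    have "(\<lambda>n. LINT t|M. (\<Sum>j<n. c t j * ?d j)) \<longlonglongrightarrow> (LINT t|M. g t w)"
    proof (rule integral_dominated_convergence[where w = "\<lambda>t. wnorm hw (c t) * H1_norm \<Omega> w"])
      show "(\<lambda>t. g t w) \<in> borel_measurable M" using gi[OF w] by simp
      have "integrable M (\<lambda>t. wnorm hw (c t))"
      proof (rule integrableI_bounded)
        have "AE t in M. ennreal (norm (wnorm hw (c t))) = ennreal (wnorm hw (c t))"
          using summ by eventually_elim (simp add: wnorm_nonneg[OF hw_nonneg])
        then show "(\<integral>\<^sup>+t. ennreal (norm (wnorm hw (c t))) \<partial>M) < \<infinity>"
          using fin by (simp add: nn_integral_cong_AE)
      qed (rule wm)
      then show "integrable M (\<lambda>t. wnorm hw (c t) * H1_norm \<Omega> w)" by simp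
      show "AE t in M. (\<lambda>n. \<Sum>j<n. c t j * ?d j) \<longlonglongrightarrow> g t w"
        using summ g
      proof eventually_elim
        case (elim t)
        show ?case using summable_LIMSEQ[OF S_bound(3)[OF elim(1) w]] elim(2) w by (simp add: S_def)
      qed
      show "AE t in M. norm (\<Sum>j<n. c t j * ?d j) \<le> wnorm hw (c t) * H1_norm \<Omega> w" for n
        using summ
      proof eventually_elim
        case (elim t)
        have "norm (\<Sum>j<n. c t j * ?d j) \<le> (\<Sum>j<n. \<bar>c t j * ?d j\<bar>)" by simp
        also have "\<dots> \<le> (\<Sum>j. \<bar>c t j * ?d j\<bar>)" by (rule sum_le_suminf[OF S_bound(1)[OF elim w]]) auto
        finally show ?case using S_bound(2)[OF elim w] by linarith
      qed
    qed measurable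
    moreover have "(LINT t|M. (\<Sum>j<n. c t j * ?d j)) = (\<Sum>j<n. (LINT t|M. c t j) * ?d j)" for n
      using ci by simp
    ultimately have "(\<lambda>j. (LINT t|M. c t j) * ?d j) sums (LINT t|M. g t w)" by (simp add: sums_def)
    then show "pairing M g w = S (\<lambda>j. LINT t|M. c t j) w"
      using w by (simp add: pairing_def S_def sums_iff)
  qed
  with hi show "has_Hm1_integral \<Omega> M g (S (\<lambda>j. LINT t|M. c t j))" by simp
qed

end

section \<open>Causal convolution\<close>

text \<open>Over the whole line, so that the algebraic laws come from translations and reflections.
  For causal factors the integrand lives on (0,t).\<close>

definition convol :: "(real \<Rightarrow> real) \<Rightarrow> (real \<Rightarrow> real) \<Rightarrow> real \<Rightarrow> real" where
  "convol f g t = (LINT s|lborel. f (t - s) * g s)"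

lemma nn_integral_translate:
  fixes f :: "real \<Rightarrow> ennreal"
  assumes [measurable]: "f \<in> borel_measurable borel"
  shows "(\<integral>\<^sup>+t. f (t - s) \<partial>lborel) = (\<integral>\<^sup>+t. f t \<partial>lborel)"
  using nn_integral_real_affine[of f 1 "- s"] by simp

lemma nn_integral_reflect:
  fixes f :: "real \<Rightarrow> ennreal"
  assumes [measurable]: "f \<in> borel_measurable borel"
  shows "(\<integral>\<^sup>+s. f (t - s) \<partial>lborel) = (\<integral>\<^sup>+s. f s \<partial>lborel)"
  using nn_integral_real_affine[of f "-1" t] by simp

lemma nn_integral_convol:
  fixes f g :: "real \<Rightarrow> ennreal"
  assumes [measurable]: "f \<in> borel_measurable borel" "g \<in> borel_measurable borel"
  shows "(\<integral>\<^sup>+t. \<integral>\<^sup>+s. f (t - s) * g s \<partial>lborel \<partial>lborel) = (\<integral>\<^sup>+t. f t \<partial>lborel) * (\<integral>\<^sup>+s. g s \<partial>lborel)"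
proof -
  have "(\<integral>\<^sup>+t. \<integral>\<^sup>+s. f (t - s) * g s \<partial>lborel \<partial>lborel) = (\<integral>\<^sup>+s. \<integral>\<^sup>+t. f (t - s) * g s \<partial>lborel \<partial>lborel)"
    by (rule lborel_pair.Fubini') measurable
  also have "\<dots> = (\<integral>\<^sup>+s. (\<integral>\<^sup>+t. f t \<partial>lborel) * g s \<partial>lborel)"
    by (simp add: nn_integral_multc nn_integral_translate)
  finally show ?thesis by (simp add: nn_integral_cmult)
qed

lemma convol_measurable [measurable]:
  assumes [measurable]: "f \<in> borel_measurable borel" "g \<in> borel_measurable borel"
  shows "convol f g \<in> borel_measurable borel"
  unfolding convol_def by measurable

lemma convol_commute: "convol f g = convol g f"
proof
  fix t
  show "convol f g t = convol g f t"
    unfolding convol_def by (subst lborel_integral_real_affine[of "-1" _ t]) (simp_all add: mult.commute)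
qed

lemma convol_pair_integrable:
  fixes f g :: "real \<Rightarrow> real"
  assumes f: "integrable lborel f" and g: "integrable lborel g"
  shows "integrable (lborel \<Otimes>\<^sub>M lborel) (\<lambda>(t, s). f (t - s) * g s)"
proof (rule integrableI_bounded)
  have [measurable]: "f \<in> borel_measurable borel" "g \<in> borel_measurable borel" using f g by auto
  show "(\<lambda>(t, s). f (t - s) * g s) \<in> borel_measurable (lborel \<Otimes>\<^sub>M lborel)" by measurable
  have "(\<integral>\<^sup>+x. ennreal (norm (case x of (t, s) \<Rightarrow> f (t - s) * g s)) \<partial>(lborel \<Otimes>\<^sub>M lborel))
     = (\<integral>\<^sup>+t. \<integral>\<^sup>+s. ennreal \<bar>f (t - s)\<bar> * ennreal \<bar>g s\<bar> \<partial>lborel \<partial>lborel)"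
    by (subst lborel.nn_integral_fst[symmetric]) (auto simp: abs_mult ennreal_mult)
  also have "\<dots> = (\<integral>\<^sup>+t. ennreal \<bar>f t\<bar> \<partial>lborel) * (\<integral>\<^sup>+s. ennreal \<bar>g s\<bar> \<partial>lborel)"
    by (rule nn_integral_convol[of "\<lambda>t. ennreal \<bar>f t\<bar>"]) measurable
  also have "\<dots> < \<infinity>" using f g by (simp add: integrable_iff_bounded ennreal_mult_less_top)
  finally show "(\<integral>\<^sup>+x. ennreal (norm (case x of (t, s) \<Rightarrow> f (t - s) * g s)) \<partial>(lborel \<Otimes>\<^sub>M lborel)) < \<infinity>" .
qed

lemma convol_integrable: "integrable lborel f \<Longrightarrow> integrable lborel g \<Longrightarrow> integrable lborel (convol f g)"
  using lborel_pair.integrable_fst[OF convol_pair_integrable] by (simp add: convol_def[abs_def])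

lemma convol_AE_integrable:
  fixes f g :: "real \<Rightarrow> real"
  shows "integrable lborel f \<Longrightarrow> integrable lborel g \<Longrightarrow> AE t in lborel. integrable lborel (\<lambda>s. f (t - s) * g s)"
  using lborel_pair.AE_integrable_fst[OF convol_pair_integrable] by simp

text \<open>Fubini's theorem applies at those t where the iterated integral \<open>N t\<close> of
  absolute values is finite. These are almost all t, because N has finite total integral, the
  product of three L1 norms.\<close>

lemma convol_assoc:
  assumes f: "integrable lborel f" and g: "integrable lborel g" and h: "integrable lborel h"
  shows "AE t in lborel. convol f (convol g h) t = convol (convol f g) h t"
proof -
  have [measurable]: "f \<in> borel_measurable borel" "g \<in> borel_measurable borel" "h \<in> borel_measurable borel"
    using f g h by auto
  define N where "N t = (\<integral>\<^sup>+s. ennreal \<bar>f (t - s)\<bar> * (\<integral>\<^sup>+r. ennreal \<bar>g (s - r)\<bar> * ennreal \<bar>h r\<bar> \<partial>lborel) \<partial>lborel)" for t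
  have "(\<integral>\<^sup>+t. N t \<partial>lborel) = (\<integral>\<^sup>+t. ennreal \<bar>f t\<bar> \<partial>lborel) *
      (\<integral>\<^sup>+s. \<integral>\<^sup>+r. ennreal \<bar>g (s - r)\<bar> * ennreal \<bar>h r\<bar> \<partial>lborel \<partial>lborel)"
    unfolding N_def by (rule nn_integral_convol[of "\<lambda>t. ennreal \<bar>f t\<bar>"]) measurable
  also have "\<dots> = (\<integral>\<^sup>+t. ennreal \<bar>f t\<bar> \<partial>lborel) * ((\<integral>\<^sup>+t. ennreal \<bar>g t\<bar> \<partial>lborel) * (\<integral>\<^sup>+t. ennreal \<bar>h t\<bar> \<partial>lborel))"
    by (subst nn_integral_convol[of "\<lambda>t. ennreal \<bar>g t\<bar>"]) auto
  also have "\<dots> < \<infinity>" using f g h by (simp add: integrable_iff_bounded ennreal_mult_less_top)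
  finally have "(\<integral>\<^sup>+t. N t \<partial>lborel) \<noteq> \<infinity>" by simp
  moreover have "N \<in> borel_measurable lborel" unfolding N_def by measurable
  ultimately have "AE t in lborel. N t \<noteq> \<infinity>" by (rule nn_integral_PInf_AE[rotated])
  then show ?thesis
  proof eventually_elim
    case (elim t)
    let ?F = "\<lambda>s r. f (t - s) * g (s - r) * h r"
    have F: "integrable (lborel \<Otimes>\<^sub>M lborel) (\<lambda>(s, r). ?F s r)"
    proof (rule integrableI_bounded)
      have "(\<integral>\<^sup>+x. ennreal (norm (case x of (s, r) \<Rightarrow> ?F s r)) \<partial>(lborel \<Otimes>\<^sub>M lborel))
         = (\<integral>\<^sup>+s. \<integral>\<^sup>+r. ennreal \<bar>f (t - s)\<bar> * (ennreal \<bar>g (s - r)\<bar> * ennreal \<bar>h r\<bar>) \<partial>lborel \<partial>lborel)"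
        by (subst lborel.nn_integral_fst[symmetric]) (auto simp: abs_mult ennreal_mult mult.assoc)
      also have "\<dots> = N t" unfolding N_def by (subst nn_integral_cmult) auto
      finally show "(\<integral>\<^sup>+x. ennreal (norm (case x of (s, r) \<Rightarrow> ?F s r)) \<partial>(lborel \<Otimes>\<^sub>M lborel)) < \<infinity>"
        using elim by (simp add: less_top)
    qed measurable
    have "convol f (convol g h) t = (LINT s|lborel. LINT r|lborel. ?F s r)"
      by (simp add: convol_def mult.assoc)
    also have "\<dots> = (LINT r|lborel. LINT s|lborel. ?F s r)"
      by (rule lborel_pair.Fubini_integral[OF F, symmetric])
    also have "\<dots> = (LINT r|lborel. convol f g (t - r) * h r)"
    proof (rule Bochner_Integration.integral_cong[OF refl])
      fix r
      have "(LINT s|lborel. f (t - s) * g (s - r)) = (LINT s|lborel. f (t - r - s) * g s)"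
        by (subst lborel_integral_real_affine[of 1 _ r]) (simp_all add: algebra_simps)
      then show "(LINT s|lborel. ?F s r) = convol f g (t - r) * h r" by (simp add: convol_def)
    qed
    finally show ?case by (simp add: convol_def)
  qed
qed

lemma convol_lincomb:
  assumes f: "integrable lborel f" and g: "integrable lborel g" and h: "integrable lborel h"
  shows "AE t in lborel. convol f (\<lambda>s. a * g s + b * h s) t = a * convol f g t + b * convol f h t"
  using convol_AE_integrable[OF f g] convol_AE_integrable[OF f h]
proof eventually_elim
  case (elim t)
  have "convol f (\<lambda>s. a * g s + b * h s) t = (LINT s|lborel. a * (f (t - s) * g s) + b * (f (t - s) * h s))"
    by (simp add: convol_def algebra_simps)
  then show ?case using elim by (simp add: convol_def)
qed

text \<open>Cauchy-Schwarz after splitting the absolute value of f into two square roots, then the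
  L1 case. Where the integrand is not integrable the convolution is 0 by convention, and the
  pointwise bound still holds.\<close>

lemma young_L2:
  assumes [measurable]: "f \<in> borel_measurable borel" "g \<in> borel_measurable borel"
  shows "(\<integral>\<^sup>+t. ennreal ((convol f g t)\<^sup>2) \<partial>lborel)
    \<le> (\<integral>\<^sup>+t. ennreal \<bar>f t\<bar> \<partial>lborel)\<^sup>2 * (\<integral>\<^sup>+t. ennreal ((g t)\<^sup>2) \<partial>lborel)"
proof -
  let ?A = "\<integral>\<^sup>+t. ennreal \<bar>f t\<bar> \<partial>lborel"
  have "ennreal ((convol f g t)\<^sup>2) \<le> ?A * (\<integral>\<^sup>+s. ennreal \<bar>f (t - s)\<bar> * ennreal ((g s)\<^sup>2) \<partial>lborel)" for t
  proof -
    have "ennreal \<bar>convol f g t\<bar> \<le> (\<integral>\<^sup>+s. ennreal (norm (f (t - s) * g s)) \<partial>lborel)"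
    proof (cases "integrable lborel (\<lambda>s. f (t - s) * g s)")
      case True
      from integral_norm_bound_ennreal[OF this] show ?thesis by (simp add: convol_def)
    qed (simp add: convol_def not_integrable_integral_eq)
    also have "\<dots> = (\<integral>\<^sup>+s. ennreal (sqrt \<bar>f (t - s)\<bar>) * ennreal (sqrt \<bar>f (t - s)\<bar> * \<bar>g s\<bar>) \<partial>lborel)"
      by (intro nn_integral_cong) (simp add: ennreal_mult[symmetric] abs_mult mult.assoc[symmetric])
    finally have "(ennreal \<bar>convol f g t\<bar>)\<^sup>2
      \<le> (\<integral>\<^sup>+s. ennreal (sqrt \<bar>f (t - s)\<bar>) * ennreal (sqrt \<bar>f (t - s)\<bar> * \<bar>g s\<bar>) \<partial>lborel)\<^sup>2"
      by (intro power_mono) auto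
    also have "\<dots> \<le> (\<integral>\<^sup>+s. (ennreal (sqrt \<bar>f (t - s)\<bar>))\<^sup>2 \<partial>lborel) * (\<integral>\<^sup>+s. (ennreal (sqrt \<bar>f (t - s)\<bar> * \<bar>g s\<bar>))\<^sup>2 \<partial>lborel)"
      by (rule Cauchy_Schwarz_nn_integral) measurable
    also have "\<dots> = (\<integral>\<^sup>+s. ennreal \<bar>f (t - s)\<bar> \<partial>lborel) * (\<integral>\<^sup>+s. ennreal \<bar>f (t - s)\<bar> * ennreal ((g s)\<^sup>2) \<partial>lborel)"
      by (simp add: ennreal_power power_mult_distrib ennreal_mult)
    also have "(\<integral>\<^sup>+s. ennreal \<bar>f (t - s)\<bar> \<partial>lborel) = ?A"
      by (rule nn_integral_reflect) measurable
    finally show ?thesis by (simp add: ennreal_power)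
  qed
  then have "(\<integral>\<^sup>+t. ennreal ((convol f g t)\<^sup>2) \<partial>lborel)
      \<le> (\<integral>\<^sup>+t. ?A * (\<integral>\<^sup>+s. ennreal \<bar>f (t - s)\<bar> * ennreal ((g s)\<^sup>2) \<partial>lborel) \<partial>lborel)"
    by (intro nn_integral_mono)
  also have "\<dots> = ?A * (?A * (\<integral>\<^sup>+t. ennreal ((g t)\<^sup>2) \<partial>lborel))"
    by (subst nn_integral_cmult) (auto simp: nn_integral_convol[of "\<lambda>t. ennreal \<bar>f t\<bar>"])
  finally show ?thesis by (simp add: power2_eq_square mult.assoc)
qed

section \<open>Causal functions and cut-off kernels\<close>

definition causal :: "(real \<Rightarrow> real) \<Rightarrow> bool" where
  "causal f \<longleftrightarrow> f \<in> borel_measurable borel \<and> (\<forall>t\<le>0. f t = 0)"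

lemma causal_measurable [measurable_dest]: "causal f \<Longrightarrow> f \<in> borel_measurable borel"
  and causal_zero: "causal f \<Longrightarrow> t \<le> 0 \<Longrightarrow> f t = 0"
  by (auto simp: causal_def)

text \<open>With a causal kernel the value at t sees only the past. Identities valid almost
  everywhere before T may therefore be substituted inside a convolution.\<close>

lemma convol_cong_right:
  assumes "causal f" "g \<in> borel_measurable borel" "g' \<in> borel_measurable borel"
    and eq: "AE s in lborel. s < T \<longrightarrow> g s = g' s" and t: "t \<le> T"
  shows "convol f g t = convol f g' t"
  unfolding convol_def
proof (rule integral_cong_AE)
  have [measurable]: "f \<in> borel_measurable borel" "g \<in> borel_measurable borel" "g' \<in> borel_measurable borel"
    using assms by (auto simp: causal_def)
  show "(\<lambda>s. f (t - s) * g s) \<in> borel_measurable lborel" "(\<lambda>s. f (t - s) * g' s) \<in> borel_measurable lborel"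
    by measurable
  show "AE s in lborel. f (t - s) * g s = f (t - s) * g' s"
    using eq by eventually_elim (use causal_zero[OF assms(1)] t in \<open>force simp: not_less\<close>)
qed

lemma convol_cong_left:
  assumes "causal g" "f \<in> borel_measurable borel" "f' \<in> borel_measurable borel"
    and "AE s in lborel. s < T \<longrightarrow> f s = f' s" and "t \<le> T"
  shows "convol f g t = convol f' g t"
  using convol_cong_right[OF assms] by (simp add: convol_commute)

lemma causal_convol:
  assumes f: "causal f" and g: "causal g"
  shows "causal (convol f g)"
proof -
  have [measurable]: "f \<in> borel_measurable borel" "g \<in> borel_measurable borel" using f g by (auto simp: causal_def)
  have "convol f g t = 0" if "t \<le> 0" for t
  proof -
    have z: "f (t - s) * g s = 0" for s
      using causal_zero[OF f, of "t - s"] causal_zero[OF g, of s] that by (cases "s \<le> 0") auto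
    show ?thesis by (simp add: convol_def z)
  qed
  then show ?thesis by (auto simp: causal_def)
qed

(* The kernels are only locally integrable; before time T, cutting them off does not change their
  convolutions with causal functions. *)
definition cut :: "real \<Rightarrow> (real \<Rightarrow> real) \<Rightarrow> real \<Rightarrow> real" where
  "cut T f t = (if 0 < t \<and> t < T then f t else 0)"

lemma cut_causal: "f \<in> borel_measurable borel \<Longrightarrow> causal (cut T f)"
  unfolding causal_def cut_def by auto

text \<open>As \<open>ennreal\<close> truncates negative numbers to 0, the two densities are the
  positive and the negative part of x. Their measures agree on half-lines, hence everywhere, so both
  parts coincide.\<close>

lemma AE_zero_of_integrals:
  fixes x :: "real \<Rightarrow> real"
  assumes x: "integrable lborel x" and z: "\<And>a. (LINT s|lborel. indicator {a<..} s * x s) = 0"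
  shows "AE s in lborel. x s = 0"
proof -
  have [measurable]: "x \<in> borel_measurable borel" using x by auto
  let ?P = "density lborel (\<lambda>s. ennreal (x s))" and ?N = "density lborel (\<lambda>s. ennreal (- x s))"
  have fin: "(\<integral>\<^sup>+s. ennreal (x s) * indicator {a<..} s \<partial>lborel) < \<infinity>" "(\<integral>\<^sup>+s. ennreal (- x s) * indicator {a<..} s \<partial>lborel) < \<infinity>" for a
  proof -
    have "(\<integral>\<^sup>+s. ennreal (norm (x s)) \<partial>lborel) < \<infinity>" using x by (simp add: integrable_iff_bounded)
    moreover have "(\<integral>\<^sup>+s. ennreal (x s) * indicator {a<..} s \<partial>lborel) \<le> (\<integral>\<^sup>+s. ennreal (norm (x s)) \<partial>lborel)"
      "(\<integral>\<^sup>+s. ennreal (- x s) * indicator {a<..} s \<partial>lborel) \<le> (\<integral>\<^sup>+s. ennreal (norm (x s)) \<partial>lborel)"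
      by (auto intro!: nn_integral_mono ennreal_leI simp: indicator_def)
    ultimately show "(\<integral>\<^sup>+s. ennreal (x s) * indicator {a<..} s \<partial>lborel) < \<infinity>" "(\<integral>\<^sup>+s. ennreal (- x s) * indicator {a<..} s \<partial>lborel) < \<infinity>"
      by (auto elim: le_less_trans)
  qed
  have "?P = ?N"
  proof (rule measure_eqI_lessThan)
    fix a
    have i: "integrable lborel (\<lambda>s. indicator {a<..} s * x s)"
      using integrable_mult_indicator[OF _ x, of "{a<..}"] by simp
    have e: "(\<integral>\<^sup>+s. ennreal (indicator {a<..} s * x s) \<partial>lborel) = (\<integral>\<^sup>+s. ennreal (x s) * indicator {a<..} s \<partial>lborel)"
      "(\<integral>\<^sup>+s. ennreal (- (indicator {a<..} s * x s)) \<partial>lborel) = (\<integral>\<^sup>+s. ennreal (- x s) * indicator {a<..} s \<partial>lborel)"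
      by (auto intro!: nn_integral_cong simp: indicator_def)
    have "enn2real (\<integral>\<^sup>+s. ennreal (x s) * indicator {a<..} s \<partial>lborel) = enn2real (\<integral>\<^sup>+s. ennreal (- x s) * indicator {a<..} s \<partial>lborel)"
      using z[of a] real_lebesgue_integral_def[OF i] unfolding e by simp
    then have "(\<integral>\<^sup>+s. ennreal (x s) * indicator {a<..} s \<partial>lborel) = (\<integral>\<^sup>+s. ennreal (- x s) * indicator {a<..} s \<partial>lborel)"
      using fin[of a] by (metis ennreal_enn2real infinity_ennreal_def)
    then show "emeasure ?P {a<..} = emeasure ?N {a<..}" by (simp add: emeasure_density)
    show "emeasure ?P {a<..} < \<infinity>" using fin by (simp add: emeasure_density)
  qed auto
  then have "AE s in lborel. ennreal (x s) = ennreal (- x s)"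
    by (subst (asm) sigma_finite_measure.density_unique_iff[OF lborel.sigma_finite_measure_axioms]) auto
  then show ?thesis
  proof eventually_elim
    case (elim s)
    then show ?case by (cases "x s" "0::real" rule: linorder_cases) (auto simp: ennreal_neg)
  qed
qed

text \<open>The convolution is the primitive X of x. It vanishes at almost every t, and X is
  continuous from the left, so it vanishes at every t \<le> T; differences of X are then the
  integrals over intervals needed to conclude x = 0. All uniqueness statements in time rest on
  this.\<close>

lemma convol_one_zero:
  assumes x: "integrable lborel x" "causal x"
    and z: "AE t in lborel. t < T \<longrightarrow> convol (cut T (\<lambda>_. 1)) x t = 0"
  shows "AE t in lborel. t < T \<longrightarrow> x t = 0"
proof -
  have [measurable]: "x \<in> borel_measurable borel" using x by auto
  define X where "X t = (LINT s|lborel. indicator {..<t} s * x s)" for t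
  have i: "integrable lborel (\<lambda>s. indicator A s * x s)" if "A \<in> sets borel" for A
    using integrable_mult_indicator[OF _ x(1), of A] that by simp
  have c: "convol (cut T (\<lambda>_. 1)) x t = X t" if "t < T" for t
    unfolding convol_def X_def
    by (rule Bochner_Integration.integral_cong[OF refl])
      (use causal_zero[OF x(2)] that in \<open>auto simp: cut_def indicator_def not_less\<close>)
  have X0: "X t = 0" if t: "t \<le> T" for t
  proof -
    have "\<exists>u. t - inverse (real (Suc n)) < u \<and> u < t \<and> X u = 0" for n
    proof (rule ccontr)
      assume n: "\<not> ?thesis"
      have "AE u in lborel. u \<notin> {t - inverse (real (Suc n)) <..< t}"
        using z by eventually_elim (use n c t in force)
      then have "{t - inverse (real (Suc n)) <..< t} \<in> null_sets lborel"
        by (subst (asm) AE_iff_null_sets[symmetric]) auto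
      then show False by (simp add: null_sets_def)
    qed
    then obtain u where u: "\<And>n. t - inverse (real (Suc n)) < u n" "\<And>n. u n < t" "\<And>n. X (u n) = 0" by metis
    have ul: "u \<longlonglongrightarrow> t"
    proof (rule tendsto_sandwich[OF _ _ _ tendsto_const])
      show "(\<lambda>n. t - inverse (real (Suc n))) \<longlonglongrightarrow> t"
        using tendsto_diff[OF tendsto_const LIMSEQ_inverse_real_of_nat, of t] by simp
    qed (auto intro!: always_eventually less_imp_le u simp del: of_nat_Suc)
    have "(\<lambda>n. X (u n)) \<longlonglongrightarrow> X t" unfolding X_def
    proof (rule integral_dominated_convergence[where w = "\<lambda>s. \<bar>x s\<bar>"])
      show "AE s in lborel. (\<lambda>n. indicator {..<u n} s * x s) \<longlonglongrightarrow> indicator {..<t} s * x s"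
      proof (rule AE_I2)
        fix s
        show "(\<lambda>n. indicator {..<u n} s * x s) \<longlonglongrightarrow> indicator {..<t} s * x s"
        proof (cases "s < t")
          case True
          have "eventually (\<lambda>n. indicator {..<u n} s * x s = indicator {..<t} s * x s) sequentially"
            using order_tendstoD(1)[OF ul True] by eventually_elim (use True in auto)
          then show ?thesis by (rule tendsto_eventually)
        next
          case False
          then have "indicator {..<u n} s * x s = indicator {..<t} s * x s" for n using u(2)[of n] by (auto simp: indicator_def)
          then show ?thesis by (simp only: tendsto_const)
        qed
      qed
    qed (use x in \<open>auto simp: indicator_def\<close>)
    then show ?thesis using u(3) by (simp add: LIMSEQ_const_iff)
  qed
  have "AE s in lborel. indicator {..<T} s * x s = 0"
  proof (rule AE_zero_of_integrals[OF i])
    fix a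
    show "(LINT s|lborel. indicator {a<..} s * (indicator {..<T} s * x s)) = 0"
    proof (cases "a < T")
      case True
      have "(LINT s|lborel. indicator {a<..} s * (indicator {..<T} s * x s))
          = (LINT s|lborel. indicator {..<T} s * x s - indicator {..<a} s * x s)"
      proof (rule integral_cong_AE)
        show "AE s in lborel. indicator {a<..} s * (indicator {..<T} s * x s) = indicator {..<T} s * x s - indicator {..<a} s * x s"
          using AE_lborel_singleton[of a] by eventually_elim (use True in \<open>auto simp: indicator_def\<close>)
      qed measurable
      also have "\<dots> = X T - X a" using i by (simp add: X_def)
      finally show ?thesis using X0 True by simp
    next
      case False
      then have z: "indicator {a<..} s * (indicator {..<T} s * x s) = 0" for s by (auto simp: indicator_def)
      show ?thesis by (simp add: z)
    qed
  qed simp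
  then show ?thesis by eventually_elim (auto simp: indicator_def)
qed

section \<open>The multinomial Mittag-Leffler function\<close>

text \<open>The Riemann-Liouville kernel: convolution with it is the fractional integral of order p,
  and \<open>omega 1\<close> is the Heaviside function.\<close>

definition omega :: "real \<Rightarrow> real \<Rightarrow> real" where
  "omega p t = (if t > 0 then t powr (p - 1) / Gamma p else 0)"

lemma omega_measurable [measurable]: "omega p \<in> borel_measurable borel"
  unfolding omega_def by measurable

lemma omega_causal: "causal (omega p)"
  by (auto simp: causal_def) (simp add: omega_def)

lemma omega_nonneg: "p > 0 \<Longrightarrow> omega p t \<ge> 0"
  by (simp add: omega_def Gamma_real_pos less_imp_le)

lemma omega_one: "omega 1 t = (if t > 0 then 1 else 0)"
  by (simp add: omega_def)

text \<open>The Gamma integral rescaled by \<open>\<sigma>\<close>. Its purpose is to compare the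
  Mittag-Leffler series with a geometric one.\<close>

lemma nn_integral_omega_laplace:
  assumes p: "p > 0" and \<sigma>: "\<sigma> > 0"
  shows "(\<integral>\<^sup>+t. ennreal (exp (- \<sigma> * t) * omega p t) \<partial>lborel) = ennreal (\<sigma> powr (- p))"
proof -
  let ?f = "\<lambda>t::real. indicator {0..} t * t powr (p - 1) / exp t"
  have "ennreal (Gamma p) = (\<integral>\<^sup>+t. ennreal (?f t) \<partial>lborel)"
    using Gamma_conv_nn_integral_real[OF p] .
  also have "\<dots> = \<sigma> * (\<integral>\<^sup>+t. ennreal (?f (0 + \<sigma> * t)) \<partial>lborel)"
    using \<sigma> by (subst nn_integral_real_affine[of _ \<sigma> 0]) auto
  also have "(\<integral>\<^sup>+t. ennreal (?f (0 + \<sigma> * t)) \<partial>lborel)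
      = (\<integral>\<^sup>+t. ennreal (\<sigma> powr (p - 1) * Gamma p) * ennreal (exp (- \<sigma> * t) * omega p t) \<partial>lborel)"
  proof (rule nn_integral_cong)
    fix t
    have "?f (0 + \<sigma> * t) = \<sigma> powr (p - 1) * Gamma p * (exp (- \<sigma> * t) * omega p t)"
    proof (cases "t > 0")
      case True
      then show ?thesis using \<sigma> Gamma_real_pos[OF p]
        by (simp add: omega_def powr_mult exp_minus field_simps)
    next
      case False
      then show ?thesis using \<sigma> by (cases "t = 0") (auto simp: omega_def indicator_def zero_le_mult_iff)
    qed
    then show "ennreal (?f (0 + \<sigma> * t)) = ennreal (\<sigma> powr (p - 1) * Gamma p) * ennreal (exp (- \<sigma> * t) * omega p t)"
      using p Gamma_real_pos[OF p] omega_nonneg[OF p] by (simp add: ennreal_mult)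
  qed
  also have "\<dots> = ennreal (\<sigma> powr (p - 1) * Gamma p) * (\<integral>\<^sup>+t. ennreal (exp (- \<sigma> * t) * omega p t) \<partial>lborel)"
    by (rule nn_integral_cmult) measurable
  finally have e: "ennreal (Gamma p) = ennreal \<sigma> * (ennreal (\<sigma> powr (p - 1) * Gamma p) * (\<integral>\<^sup>+t. ennreal (exp (- \<sigma> * t) * omega p t) \<partial>lborel))" .
  define a where "a = \<sigma> * (\<sigma> powr (p - 1) * Gamma p)"
  have a: "a > 0" using \<sigma> Gamma_real_pos[OF p] by (simp add: a_def)
  have "a * \<sigma> powr (- p) = Gamma p" using \<sigma> by (simp add: a_def powr_diff powr_minus field_simps)
  then have "ennreal a * ennreal (\<sigma> powr (- p)) = ennreal (Gamma p)"
    using a by (simp flip: ennreal_mult')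
  also have "\<dots> = ennreal a * (\<integral>\<^sup>+t. ennreal (exp (- \<sigma> * t) * omega p t) \<partial>lborel)"
    unfolding e a_def using \<sigma> Gamma_real_pos[OF p] by (simp add: ennreal_mult' mult.assoc)
  finally show ?thesis using a by (auto simp: ennreal_mult_cancel_left)
qed

text \<open>The semigroup law of fractional integration: rescaling (0,t) to (0,1) produces the Beta
  function.\<close>

lemma nn_integral_omega_convol:
  assumes p: "p > 0" and q: "q > 0"
  shows "(\<integral>\<^sup>+s. ennreal (omega p (t - s) * omega q s) \<partial>lborel) = ennreal (omega (p + q) t)"
proof (cases "t > 0")
  case False
  then have z: "omega p (t - s) * omega q s = 0" for s by (auto simp: omega_def)
  show ?thesis unfolding z using False by (simp add: omega_def)
next
  case True
  let ?f = "\<lambda>x::real. indicator {0..1} x * (x powr (q - 1) * (1 - x) powr (p - 1))"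
  have B: "(\<integral>\<^sup>+x. ennreal (?f x) \<partial>lborel) = ennreal (Beta q p)"
    using nn_integral_has_integral_lebesgue[OF _ has_integral_Beta_real[OF q p]]
    by (simp add: nn_integral_completion)
  have "(\<integral>\<^sup>+s. ennreal (omega p (t - s) * omega q s) \<partial>lborel)
     = t * (\<integral>\<^sup>+x. ennreal (omega p (t - (0 + t * x)) * omega q (0 + t * x)) \<partial>lborel)"
    using True by (subst nn_integral_real_affine[of _ t 0]) auto
  also have "(\<integral>\<^sup>+x. ennreal (omega p (t - (0 + t * x)) * omega q (0 + t * x)) \<partial>lborel)
     = (\<integral>\<^sup>+x. ennreal (t powr (p + q - 2) / (Gamma p * Gamma q)) * ennreal (?f x) \<partial>lborel)"
  proof (rule nn_integral_cong_AE)
    show "AE x in lborel. ennreal (omega p (t - (0 + t * x)) * omega q (0 + t * x))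
       = ennreal (t powr (p + q - 2) / (Gamma p * Gamma q)) * ennreal (?f x)"
      using AE_lborel_singleton[of 0] AE_lborel_singleton[of 1]
    proof eventually_elim
      case (elim x)
      have "omega p (t - t * x) * omega q (t * x) = t powr (p + q - 2) / (Gamma p * Gamma q) * ?f x"
      proof (cases "0 < x \<and> x < 1")
        case x: True
        then have pos: "t - t * x > 0" using True by (simp add: mult_less_cancel_left1 algebra_simps)
        have "t - t * x = t * (1 - x)" by (simp add: algebra_simps)
        then have "(t - t * x) powr (p - 1) * (t * x) powr (q - 1)
            = (t powr (p - 1) * t powr (q - 1)) * (x powr (q - 1) * (1 - x) powr (p - 1))"
          using x True by (simp add: powr_mult mult_ac)
        also have "t powr (p - 1) * t powr (q - 1) = t powr (p + q - 2)"
          by (simp flip: powr_add)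
        finally show ?thesis using x True pos by (simp add: omega_def)
      next
        case False
        then have "x < 0 \<or> x > 1" using elim by auto
        then have "omega p (t - t * x) * omega q (t * x) = 0"
        proof
          assume "x < 0"
          then show ?thesis using True by (simp add: omega_def zero_less_mult_iff)
        next
          assume "x > 1"
          then have "t - t * x < 0" using True by simp
          then show ?thesis by (simp add: omega_def)
        qed
        then show ?thesis using \<open>x < 0 \<or> x > 1\<close> by (auto simp: indicator_def)
      qed
      then show ?case using Gamma_real_pos[OF p] Gamma_real_pos[OF q] by (simp flip: ennreal_mult')
    qed
  qed
  also have "\<dots> = ennreal (t powr (p + q - 2) / (Gamma p * Gamma q)) * ennreal (Beta q p)"
    by (subst nn_integral_cmult) (auto simp: B)
  also have "t * \<dots> = ennreal (t * (t powr (p + q - 2) / (Gamma p * Gamma q) * Beta q p))"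
    by (subst ennreal_mult', use True in simp, subst ennreal_mult')
      (use Gamma_real_pos[OF p] Gamma_real_pos[OF q] in auto)
  also have "t * (t powr (p + q - 2) / (Gamma p * Gamma q) * Beta q p) = omega (p + q) t"
  proof -
    have "t powr (p + q - 1) = t * t powr (p + q - 2)"
      using True powr_add[of t 1 "p + q - 2"] by simp
    then show ?thesis using True Gamma_real_pos[OF p] Gamma_real_pos[OF q]
      by (simp add: omega_def Beta_def add.commute)
  qed
  finally show ?thesis .
qed

section \<open>Multinomial sums\<close>

definition multi_indices :: "nat \<Rightarrow> nat \<Rightarrow> (nat \<Rightarrow> nat) set" where
  "multi_indices n k = {l \<in> {..<n} \<rightarrow>\<^sub>E (UNIV :: nat set). (\<Sum>i<n. l i) = k}"

lemma finite_multi_indices: "finite (multi_indices n k)"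
proof (rule finite_subset)
  show "multi_indices n k \<subseteq> {..<n} \<rightarrow>\<^sub>E {..k}"
  proof
    fix l assume l: "l \<in> multi_indices n k"
    then have "l i \<le> k" if "i < n" for i
      using member_le_sum[of i "{..<n}" l] that by (auto simp: multi_indices_def)
    then show "l \<in> {..<n} \<rightarrow>\<^sub>E {..k}" using l by (auto simp: multi_indices_def PiE_iff)
  qed
  show "finite ({..<n} \<rightarrow>\<^sub>E {..k})" by (intro finite_PiE) auto
qed

definition mcoef :: "nat \<Rightarrow> (nat \<Rightarrow> real) \<Rightarrow> nat \<Rightarrow> (nat \<Rightarrow> nat) \<Rightarrow> real" where
  "mcoef n c k l = fact k / (\<Prod>i<n. fact (l i)) * (\<Prod>i<n. c i ^ l i)"

lemma mcoef_nonneg: "(\<And>i. c i \<ge> 0) \<Longrightarrow> mcoef n c k l \<ge> 0"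
  unfolding mcoef_def by (intro mult_nonneg_nonneg divide_nonneg_nonneg prod_nonneg) auto

text \<open>The index k is not tied to the sum of l, so \<open>fact k\<close> is untouched when one
  entry grows; only one factorial and one power change.\<close>

lemma mcoef_shift:
  assumes i: "i < n"
  shows "mcoef n c k (l(i := Suc (l i))) * real (Suc (l i)) = c i * mcoef n c k l"
proof -
  have pr: "(\<Prod>j<n. h j ((l(i := Suc (l i))) j)) = h i (Suc (l i)) * (\<Prod>j\<in>{..<n} - {i}. h j (l j))"
    for h :: "nat \<Rightarrow> nat \<Rightarrow> real"
    using i by (subst prod.remove[of _ i]) (auto intro!: prod.cong)
  have pr': "(\<Prod>j<n. h j (l j)) = h i (l i) * (\<Prod>j\<in>{..<n} - {i}. h j (l j))" for h :: "nat \<Rightarrow> nat \<Rightarrow> real"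
    using i by (subst prod.remove[of _ i]) auto
  have nz: "(\<Prod>j\<in>{..<n} - {i}. fact (l j) :: real) \<noteq> 0" by simp
  show ?thesis
    unfolding mcoef_def pr[of "\<lambda>_ x. fact x"] pr[of "\<lambda>j x. c j ^ x"] pr'[of "\<lambda>_ x. fact x"] pr'[of "\<lambda>j x. c j ^ x"]
    using nz by (simp add: field_simps del: of_nat_Suc)
qed

text \<open>Write \<open>Suc k\<close> as the sum of the entries of l and distribute. In the i-th
  part only indices with \<open>l i \<noteq> 0\<close> contribute, and these arise from the indices
  of order k by raising the entry i. The weight F is arbitrary because the kernels
  \<open>omega\<close> are not powers of a product.\<close>

lemma multinomial_pascal:
  "(\<Sum>l\<in>multi_indices n (Suc k). mcoef n c (Suc k) l * F l)
   = (\<Sum>i<n. c i * (\<Sum>l\<in>multi_indices n k. mcoef n c k l * F (l(i := Suc (l i)))))"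
proof -
  have "(\<Sum>l\<in>multi_indices n (Suc k). mcoef n c (Suc k) l * F l)
     = (\<Sum>l\<in>multi_indices n (Suc k). \<Sum>i<n. mcoef n c k l * real (l i) * F l)"
  proof (rule sum.cong[OF refl])
    fix l assume "l \<in> multi_indices n (Suc k)"
    then have "real (Suc k) = (\<Sum>i<n. real (l i))" by (simp add: multi_indices_def flip: of_nat_sum)
    moreover have "mcoef n c (Suc k) l = real (Suc k) * mcoef n c k l" by (simp add: mcoef_def)
    ultimately have "mcoef n c (Suc k) l * F l = (\<Sum>i<n. real (l i)) * mcoef n c k l * F l" by simp
    then show "mcoef n c (Suc k) l * F l = (\<Sum>i<n. mcoef n c k l * real (l i) * F l)"
      by (simp add: sum_distrib_left sum_distrib_right mult_ac)
  qed
  also have "\<dots> = (\<Sum>i<n. \<Sum>l\<in>multi_indices n (Suc k). mcoef n c k l * real (l i) * F l)"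
    by (rule sum.swap)
  also have "\<dots> = (\<Sum>i<n. c i * (\<Sum>l\<in>multi_indices n k. mcoef n c k l * F (l(i := Suc (l i)))))"
  proof (rule sum.cong[OF refl])
    fix i assume "i \<in> {..<n}"
    then have i: "i < n" by simp
    let ?g = "\<lambda>l. l(i := Suc (l i))"
    have inj: "inj_on ?g (multi_indices n k)"
    proof (rule inj_onI)
      fix l l' assume e: "l(i := Suc (l i)) = l'(i := Suc (l' i))"
      show "l = l'"
      proof
        fix j show "l j = l' j" using fun_cong[OF e, of j] by (cases "j = i") auto
      qed
    qed
    have s1: "(\<Sum>j<n. (?g l) j) = Suc (\<Sum>j<n. l j)" for l :: "nat \<Rightarrow> nat"
    proof -
      have "(\<Sum>j<n. (?g l) j) = Suc (l i) + (\<Sum>j\<in>{..<n} - {i}. l j)"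
        using i by (subst sum.remove[of _ i]) (auto intro!: sum.cong)
      also have "\<dots> = Suc (\<Sum>j<n. l j)" using i by (subst (2) sum.remove[of _ i]) auto
      finally show ?thesis .
    qed
    have img: "?g ` multi_indices n k = {l \<in> multi_indices n (Suc k). l i \<noteq> 0}"
    proof (intro equalityI subsetI)
      fix l assume "l \<in> ?g ` multi_indices n k"
      then obtain l' where l': "l' \<in> multi_indices n k" "l = ?g l'" by blast
      then have "(\<Sum>j<n. l j) = Suc k" using s1[of l'] by (simp add: multi_indices_def)
      then show "l \<in> {l \<in> multi_indices n (Suc k). l i \<noteq> 0}"
        using l' i by (auto simp: multi_indices_def PiE_iff extensional_def)
    next
      fix l assume l: "l \<in> {l \<in> multi_indices n (Suc k). l i \<noteq> 0}"
      let ?l = "l(i := l i - 1)"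
      have g: "?g ?l = l" using l by auto
      have "(\<Sum>j<n. ?l j) = k" using s1[of ?l] l unfolding g by (simp add: multi_indices_def)
      then have "?l \<in> multi_indices n k" using l i by (auto simp: multi_indices_def PiE_iff extensional_def)
      then have "?g ?l \<in> ?g ` multi_indices n k" by (rule imageI)
      then show "l \<in> ?g ` multi_indices n k" unfolding g .
    qed
    have "(\<Sum>l\<in>multi_indices n (Suc k). mcoef n c k l * real (l i) * F l)
        = (\<Sum>l\<in>{l \<in> multi_indices n (Suc k). l i \<noteq> 0}. mcoef n c k l * real (l i) * F l)"
      by (rule sum.mono_neutral_right) (auto simp: finite_multi_indices)
    also have "\<dots> = (\<Sum>l\<in>multi_indices n k. mcoef n c k (?g l) * real (Suc (l i)) * F (?g l))"
      unfolding img[symmetric] by (subst sum.reindex[OF inj]) simp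
    also have "\<dots> = (\<Sum>l\<in>multi_indices n k. c i * mcoef n c k l * F (?g l))"
      by (simp only: mcoef_shift[OF i])
    finally show "(\<Sum>l\<in>multi_indices n (Suc k). mcoef n c k l * real (l i) * F l)
      = c i * (\<Sum>l\<in>multi_indices n k. mcoef n c k l * F (?g l))"
      by (simp add: sum_distrib_left mult.assoc)
  qed
  finally show ?thesis .
qed

section \<open>Convergence and fractional integration of the Mittag-Leffler series\<close>

locale ml_exponents =
  fixes n :: nat and \<beta> :: "nat \<Rightarrow> real"
  assumes \<beta>_pos: "i < n \<Longrightarrow> \<beta> i > 0"
begin

definition expo :: "(nat \<Rightarrow> nat) \<Rightarrow> real" where
  "expo l = (\<Sum>i<n. \<beta> i * real (l i))"

definition layer :: "(nat \<Rightarrow> real) \<Rightarrow> real \<Rightarrow> nat \<Rightarrow> real \<Rightarrow> real" where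
  "layer c \<mu> k t = (\<Sum>l\<in>multi_indices n k. mcoef n c k l * omega (\<mu> + expo l) t)"

(* With the powers of t distributed over the fractional kernels omega, which convolution merely shifts,
  ml c \<mu> t is t powr (\<mu> - 1) times the Mittag-Leffler function with arguments c i * t powr \<beta> i. *)
definition ml :: "(nat \<Rightarrow> real) \<Rightarrow> real \<Rightarrow> real \<Rightarrow> real" where
  "ml c \<mu> t = (\<Sum>k. layer c \<mu> k t)"

lemma expo_nonneg: "expo l \<ge> 0"
  unfolding expo_def by (intro sum_nonneg mult_nonneg_nonneg) (auto simp: \<beta>_pos less_imp_le)

lemma expo_shift: "i < n \<Longrightarrow> expo (l(i := Suc (l i))) = expo l + \<beta> i"
  unfolding expo_def by (subst (1 2) sum.remove[of _ i]) (auto simp: algebra_simps intro!: sum.cong)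

lemma layer_0: "layer c \<mu> 0 t = omega \<mu> t"
proof -
  have "multi_indices n 0 = {\<lambda>i. if i < n then 0 else undefined}"
    by (auto simp: multi_indices_def PiE_iff extensional_def fun_eq_iff)
  then show ?thesis by (simp add: layer_def mcoef_def expo_def)
qed

text \<open>Pascal's rule; with it, induction on k and summation over k need no
  multi-indices.\<close>

lemma layer_Suc: "layer c \<mu> (Suc k) t = (\<Sum>i<n. c i * layer c (\<mu> + \<beta> i) k t)"
  unfolding layer_def multinomial_pascal[where F = "\<lambda>l. omega (\<mu> + expo l) t"]
  by (intro sum.cong refl arg_cong2[where f = "(*)"]) (auto simp: expo_shift add_ac)

lemma layer_measurable [measurable]: "layer c \<mu> k \<in> borel_measurable borel"
  unfolding layer_def by measurable

lemma layer_causal: "t \<le> 0 \<Longrightarrow> layer c \<mu> k t = 0"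
  by (simp add: layer_def omega_def)

lemma mcoef_abs: "\<bar>mcoef n c k l\<bar> = mcoef n (\<lambda>i. \<bar>c i\<bar>) k l"
  by (simp add: mcoef_def abs_mult abs_prod power_abs)

lemma layer_abs: "\<mu> > 0 \<Longrightarrow> \<bar>layer c \<mu> k t\<bar> \<le> layer (\<lambda>i. \<bar>c i\<bar>) \<mu> k t"
  unfolding layer_def
  by (rule order_trans[OF sum_abs])
    (auto simp: abs_mult mcoef_abs expo_nonneg add_pos_nonneg omega_nonneg intro!: sum_mono)

lemma layer_nonneg: "\<mu> > 0 \<Longrightarrow> (\<And>i. c i \<ge> 0) \<Longrightarrow> layer c \<mu> k t \<ge> 0"
  unfolding layer_def
  by (intro sum_nonneg mult_nonneg_nonneg)
    (auto simp: expo_nonneg add_pos_nonneg omega_nonneg intro: mcoef_nonneg)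

text \<open>All exponents are at least \<open>\<mu> - 1\<close>. After this possibly singular power
  is split off, the rest increases with time, so one good time u controls all earlier ones.\<close>

lemma layer_scaling:
  assumes "\<mu> > 0" "\<And>i. c i \<ge> 0" "0 < t" "t \<le> u"
  shows "layer c \<mu> k t \<le> (t / u) powr (\<mu> - 1) * layer c \<mu> k u"
  unfolding layer_def sum_distrib_left
proof (rule sum_mono)
  fix l
  have m: "mcoef n c k l \<ge> 0" using assms(2) by (rule mcoef_nonneg)
  have "t powr (\<mu> + expo l - 1) = t powr (\<mu> - 1) * t powr expo l" by (simp flip: powr_add add: algebra_simps)
  also have "\<dots> \<le> t powr (\<mu> - 1) * u powr expo l"
    using assms expo_nonneg by (intro mult_left_mono powr_mono2) auto
  also have "\<dots> = (t / u) powr (\<mu> - 1) * u powr (\<mu> + expo l - 1)"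
  proof -
    have "u powr (\<mu> + expo l - 1) = u powr (\<mu> - 1) * u powr expo l" by (simp flip: powr_add add: algebra_simps)
    then show ?thesis using assms by (simp add: powr_divide)
  qed
  finally have "omega (\<mu> + expo l) t \<le> (t / u) powr (\<mu> - 1) * omega (\<mu> + expo l) u"
    using assms Gamma_real_pos[of "\<mu> + expo l"] expo_nonneg[of l]
    by (simp add: omega_def divide_right_mono)
  from mult_left_mono[OF this m]
  show "mcoef n c k l * omega (\<mu> + expo l) t \<le> (t / u) powr (\<mu> - 1) * (mcoef n c k l * omega (\<mu> + expo l) u)"
    by (simp add: mult_ac)
qed

lemma nn_integral_layer_laplace:
  assumes "\<mu> > 0" and c: "\<And>i. c i \<ge> 0" and \<sigma>: "\<sigma> > 0"
  shows "(\<integral>\<^sup>+t. ennreal (exp (- \<sigma> * t) * layer c \<mu> k t) \<partial>lborel) = ennreal (\<sigma> powr (- \<mu>) * (\<Sum>i<n. c i * \<sigma> powr (- \<beta> i)) ^ k)"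
  using assms(1)
proof (induction k arbitrary: \<mu>)
  case 0
  then show ?case using nn_integral_omega_laplace[OF 0 \<sigma>] by (simp add: layer_0)
next
  case (Suc k)
  have p: "\<mu> + \<beta> i > 0" if "i < n" for i using Suc.prems \<beta>_pos[OF that] by simp
  let ?S = "\<Sum>i<n. c i * \<sigma> powr (- \<beta> i)"
  have S0: "?S \<ge> 0" by (intro sum_nonneg) (simp add: c)
  have "(\<integral>\<^sup>+t. ennreal (exp (- \<sigma> * t) * layer c \<mu> (Suc k) t) \<partial>lborel)
     = (\<integral>\<^sup>+t. (\<Sum>i<n. ennreal (c i) * ennreal (exp (- \<sigma> * t) * layer c (\<mu> + \<beta> i) k t)) \<partial>lborel)"
  proof (rule nn_integral_cong)
    fix t
    have "exp (- \<sigma> * t) * layer c \<mu> (Suc k) t = (\<Sum>i<n. c i * (exp (- \<sigma> * t) * layer c (\<mu> + \<beta> i) k t))"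
      by (simp add: layer_Suc sum_distrib_left mult_ac)
    also have "ennreal \<dots> = (\<Sum>i<n. ennreal (c i * (exp (- \<sigma> * t) * layer c (\<mu> + \<beta> i) k t)))"
      using p c by (subst sum_ennreal) (auto intro!: mult_nonneg_nonneg layer_nonneg)
    also have "\<dots> = (\<Sum>i<n. ennreal (c i) * ennreal (exp (- \<sigma> * t) * layer c (\<mu> + \<beta> i) k t))"
      using c by (simp add: ennreal_mult')
    finally show "ennreal (exp (- \<sigma> * t) * layer c \<mu> (Suc k) t) = (\<Sum>i<n. ennreal (c i) * ennreal (exp (- \<sigma> * t) * layer c (\<mu> + \<beta> i) k t))" .
  qed
  also have "\<dots> = (\<Sum>i<n. ennreal (c i) * ennreal (\<sigma> powr (- (\<mu> + \<beta> i)) * ?S ^ k))"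
  proof (subst nn_integral_sum, measurable, rule sum.cong[OF refl])
    fix i assume "i \<in> {..<n}"
    then have "\<mu> + \<beta> i > 0" using p by simp
    note IH = Suc.IH[OF this]
    have "(\<integral>\<^sup>+t. ennreal (c i) * ennreal (exp (- \<sigma> * t) * layer c (\<mu> + \<beta> i) k t) \<partial>lborel)
      = ennreal (c i) * (\<integral>\<^sup>+t. ennreal (exp (- \<sigma> * t) * layer c (\<mu> + \<beta> i) k t) \<partial>lborel)"
      by (rule nn_integral_cmult) measurable
    then show "(\<integral>\<^sup>+t. ennreal (c i) * ennreal (exp (- \<sigma> * t) * layer c (\<mu> + \<beta> i) k t) \<partial>lborel)
      = ennreal (c i) * ennreal (\<sigma> powr (- (\<mu> + \<beta> i)) * ?S ^ k)"
      by (simp only: IH)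
  qed
  also have "\<dots> = (\<Sum>i<n. ennreal (c i * (\<sigma> powr (- (\<mu> + \<beta> i)) * ?S ^ k)))"
    using c by (simp add: ennreal_mult')
  also have "\<dots> = ennreal (\<Sum>i<n. c i * (\<sigma> powr (- (\<mu> + \<beta> i)) * ?S ^ k))"
    using c S0 by (intro sum_ennreal) auto
  also have "(\<Sum>i<n. c i * (\<sigma> powr (- (\<mu> + \<beta> i)) * ?S ^ k)) = \<sigma> powr (- \<mu>) * ?S ^ Suc k"
  proof -
    have "\<sigma> powr (- (\<mu> + \<beta> i)) = \<sigma> powr (- \<mu>) * \<sigma> powr (- \<beta> i)" for i by (simp flip: powr_add)
    then show ?thesis by (simp add: sum_distrib_left sum_distrib_right mult_ac)
  qed
  finally show ?case .
qed

text \<open>For large \<open>\<sigma>\<close> the ratio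
  \<open>\<Sum>i<n. c i * \<sigma> powr (- \<beta> i)\<close> is below 1, so the Laplace transforms
  of the layers form a convergent geometric series. No growth estimate of the Gamma function is
  needed.\<close>

lemma nn_integral_layers_finite:
  assumes \<mu>: "\<mu> > 0" and c: "\<And>i. c i \<ge> 0"
  shows "\<exists>\<sigma>>0. (\<integral>\<^sup>+t. (\<Sum>k. ennreal (exp (- \<sigma> * t) * layer c \<mu> k t)) \<partial>lborel) < \<infinity>"
proof -
  have "((\<lambda>\<sigma>. \<Sum>i<n. c i * \<sigma> powr (- \<beta> i)) \<longlongrightarrow> (\<Sum>i<n. c i * 0)) at_top"
    by (intro tendsto_sum tendsto_mult tendsto_const tendsto_neg_powr filterlim_ident) (auto simp: \<beta>_pos)
  then have "eventually (\<lambda>\<sigma>. (\<Sum>i<n. c i * \<sigma> powr (- \<beta> i)) < 1) at_top"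
    by (intro order_tendstoD(2)) auto
  from eventually_conj[OF this eventually_gt_at_top[of 0]]
  obtain \<sigma> where \<sigma>: "(\<Sum>i<n. c i * \<sigma> powr (- \<beta> i)) < 1" "\<sigma> > 0"
    using eventually_happens'[OF trivial_limit_at_top_linorder] by blast
  let ?S = "\<Sum>i<n. c i * \<sigma> powr (- \<beta> i)"
  have S0: "?S \<ge> 0" by (intro sum_nonneg) (simp add: c)
  have "(\<integral>\<^sup>+t. (\<Sum>k. ennreal (exp (- \<sigma> * t) * layer c \<mu> k t)) \<partial>lborel) = (\<Sum>k. ennreal (\<sigma> powr (- \<mu>) * ?S ^ k))"
    by (subst nn_integral_suminf) (auto simp: nn_integral_layer_laplace[OF \<mu> c \<sigma>(2), simplified])
  also have "\<dots> = ennreal (\<Sum>k. \<sigma> powr (- \<mu>) * ?S ^ k)"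
    using S0 \<sigma> by (intro suminf_ennreal2) (auto intro!: summable_mult summable_geometric)
  finally show ?thesis using \<sigma>(2) by (intro exI[of _ \<sigma>]) simp
qed

text \<open>The finite Laplace integral yields summability at almost every time only. There is such
  a time u above t, and \<open>layer_scaling\<close> brings it down to t.\<close>

lemma layers_summable_nonneg:
  assumes \<mu>: "\<mu> > 0" and c: "\<And>i. c i \<ge> 0"
  shows "summable (\<lambda>k. layer c \<mu> k t)"
proof (cases "t > 0")
  case False
  then show ?thesis by (simp add: layer_causal)
next
  case t: True
  obtain \<sigma> where \<sigma>: "\<sigma> > 0" and fin: "(\<integral>\<^sup>+t. (\<Sum>k. ennreal (exp (- \<sigma> * t) * layer c \<mu> k t)) \<partial>lborel) < \<infinity>"
    using nn_integral_layers_finite[of \<mu> c, OF \<mu> c] by blast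
  have ae: "AE t in lborel. (\<Sum>k. ennreal (exp (- \<sigma> * t) * layer c \<mu> k t)) \<noteq> \<infinity>"
    by (rule nn_integral_PInf_AE) (use fin in auto)
  have "\<exists>u. t < u \<and> (\<Sum>k. ennreal (exp (- \<sigma> * u) * layer c \<mu> k u)) \<noteq> \<infinity>"
  proof (rule ccontr)
    assume n: "\<not> ?thesis"
    have "AE u in lborel. u \<notin> {t<..<t + 1}" using ae by eventually_elim (use n in force)
    then have "{t<..<t + 1} \<in> null_sets lborel" by (subst (asm) AE_iff_null_sets[symmetric]) auto
    then show False by (simp add: null_sets_def)
  qed
  then obtain u where u: "t < u" "(\<Sum>k. ennreal (exp (- \<sigma> * u) * layer c \<mu> k u)) \<noteq> \<infinity>" by blast
  have "summable (\<lambda>k. exp (- \<sigma> * u) * layer c \<mu> k u)"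
    using u(2) by (intro summable_suminf_not_top) (auto intro!: mult_nonneg_nonneg layer_nonneg \<mu> c)
  then have "summable (\<lambda>k. exp (\<sigma> * u) * (exp (- \<sigma> * u) * layer c \<mu> k u))" by (rule summable_mult)
  then have "summable (\<lambda>k. layer c \<mu> k u)" by (simp add: mult.assoc[symmetric] exp_add[symmetric])
  then have "summable (\<lambda>k. (t / u) powr (\<mu> - 1) * layer c \<mu> k u)" by (rule summable_mult)
  then show ?thesis
    by (rule summable_comparison_test') (use layer_scaling[of \<mu> c, OF \<mu> c t] layer_nonneg[of \<mu> c, OF \<mu> c] u in auto)
qed

lemma layers_summable:
  assumes "\<mu> > 0"
  shows "summable (\<lambda>k. \<bar>layer c \<mu> k t\<bar>)" "summable (\<lambda>k. layer c \<mu> k t)"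
    "\<bar>ml c \<mu> t\<bar> \<le> ml (\<lambda>i. \<bar>c i\<bar>) \<mu> t"
proof -
  have s: "summable (\<lambda>k. layer (\<lambda>i. \<bar>c i\<bar>) \<mu> k t)" by (rule layers_summable_nonneg[OF assms]) simp
  show a: "summable (\<lambda>k. \<bar>layer c \<mu> k t\<bar>)"
    by (rule summable_comparison_test'[OF s]) (use layer_abs[OF assms] in auto)
  then show "summable (\<lambda>k. layer c \<mu> k t)" by (rule summable_rabs_cancel)
  have "\<bar>ml c \<mu> t\<bar> \<le> (\<Sum>k. \<bar>layer c \<mu> k t\<bar>)" unfolding ml_def by (rule summable_rabs[OF a])
  also have "\<dots> \<le> ml (\<lambda>i. \<bar>c i\<bar>) \<mu> t" unfolding ml_def
    by (rule suminf_le) (use layer_abs[OF assms] a s in auto)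
  finally show "\<bar>ml c \<mu> t\<bar> \<le> ml (\<lambda>i. \<bar>c i\<bar>) \<mu> t" .
qed

lemma ml_measurable [measurable]: "ml c \<mu> \<in> borel_measurable borel"
  unfolding ml_def by measurable

lemma ml_causal: "causal (ml c \<mu>)"
  by (auto simp: causal_def) (simp add: ml_def layer_causal)

lemma ml_nonneg: "\<mu> > 0 \<Longrightarrow> (\<And>i. c i \<ge> 0) \<Longrightarrow> ml c \<mu> t \<ge> 0"
  unfolding ml_def by (intro suminf_nonneg layers_summable_nonneg layer_nonneg)

text \<open>Split off layer 0 and apply Pascal's rule. At parameter 1 this is the first-kind
  equation of the kernels in disguise.\<close>

lemma ml_recurrence:
  assumes "\<mu> > 0"
  shows "ml c \<mu> t = omega \<mu> t + (\<Sum>i<n. c i * ml c (\<mu> + \<beta> i) t)"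
proof -
  have p: "\<mu> + \<beta> i > 0" if "i < n" for i using assms \<beta>_pos[OF that] by simp
  have "ml c \<mu> t = layer c \<mu> 0 t + (\<Sum>k. layer c \<mu> (Suc k) t)"
    unfolding ml_def by (subst suminf_split_head[OF layers_summable(2)[OF assms]]) simp
  also have "(\<Sum>k. layer c \<mu> (Suc k) t) = (\<Sum>i<n. (\<Sum>k. c i * layer c (\<mu> + \<beta> i) k t))"
    unfolding layer_Suc by (rule suminf_sum) (auto intro!: summable_mult layers_summable p)
  also have "\<dots> = (\<Sum>i<n. c i * ml c (\<mu> + \<beta> i) t)"
    unfolding ml_def by (intro sum.cong refl suminf_mult layers_summable p) auto
  finally show ?thesis by (simp add: layer_0)
qed

text \<open>Before T the factor \<open>exp (\<sigma> * (T - t))\<close> is at least 1, so the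
  weighted Laplace integral of the majorant series dominates.\<close>

lemma ml_cut_integrable:
  assumes \<mu>: "\<mu> > 0"
  shows "integrable lborel (cut T (ml c \<mu>))"
proof -
  let ?c = "\<lambda>i. \<bar>c i\<bar>"
  obtain \<sigma> where \<sigma>: "\<sigma> > 0" and fin: "(\<integral>\<^sup>+t. (\<Sum>k. ennreal (exp (- \<sigma> * t) * layer ?c \<mu> k t)) \<partial>lborel) < \<infinity>"
    using nn_integral_layers_finite[of \<mu> ?c, OF \<mu>] by auto
  show ?thesis
  proof (rule integrableI_bounded)
    show m: "cut T (ml c \<mu>) \<in> borel_measurable lborel"
      using cut_causal[OF ml_measurable] by (simp add: causal_def)
    have "ennreal (norm (cut T (ml c \<mu>) t)) \<le> ennreal (exp (\<sigma> * T)) * (\<Sum>k. ennreal (exp (- \<sigma> * t) * layer ?c \<mu> k t))" for t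
    proof (cases "0 < t \<and> t < T")
      case True
      have s: "summable (\<lambda>k. layer ?c \<mu> k t)" by (rule layers_summable_nonneg[OF \<mu>]) simp
      have nn: "layer ?c \<mu> k t \<ge> 0" for k by (rule layer_nonneg[OF \<mu>]) simp
      have "(\<Sum>k. ennreal (exp (- \<sigma> * t) * layer ?c \<mu> k t)) = ennreal (\<Sum>k. exp (- \<sigma> * t) * layer ?c \<mu> k t)"
        by (rule suminf_ennreal2) (auto intro!: mult_nonneg_nonneg nn summable_mult s)
      also have "\<dots> = ennreal (exp (- \<sigma> * t) * ml ?c \<mu> t)"
        unfolding ml_def using s by (subst suminf_mult) auto
      finally have e: "ennreal (exp (\<sigma> * T)) * (\<Sum>k. ennreal (exp (- \<sigma> * t) * layer ?c \<mu> k t))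
         = ennreal (exp (\<sigma> * (T - t)) * ml ?c \<mu> t)"
        using ml_nonneg[of \<mu> ?c t, OF \<mu>]
        by (simp add: ennreal_mult[symmetric] mult.assoc[symmetric] exp_add[symmetric] algebra_simps)
      have "\<bar>ml c \<mu> t\<bar> \<le> 1 * ml ?c \<mu> t" using layers_summable(3)[OF \<mu>] by simp
      also have "\<dots> \<le> exp (\<sigma> * (T - t)) * ml ?c \<mu> t"
        using True \<sigma> ml_nonneg[of \<mu> ?c t, OF \<mu>] by (intro mult_right_mono) auto
      finally show ?thesis unfolding e using True by (simp add: cut_def ennreal_leI)
    qed (auto simp: cut_def)
    then have "(\<integral>\<^sup>+t. ennreal (norm (cut T (ml c \<mu>) t)) \<partial>lborel)
      \<le> (\<integral>\<^sup>+t. ennreal (exp (\<sigma> * T)) * (\<Sum>k. ennreal (exp (- \<sigma> * t) * layer ?c \<mu> k t)) \<partial>lborel)"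
      by (intro nn_integral_mono)
    also have "\<dots> = ennreal (exp (\<sigma> * T)) * (\<integral>\<^sup>+t. (\<Sum>k. ennreal (exp (- \<sigma> * t) * layer ?c \<mu> k t)) \<partial>lborel)"
      by (rule nn_integral_cmult) measurable
    also have "\<dots> < \<infinity>" using fin by (simp add: ennreal_mult_less_top)
    finally show "(\<integral>\<^sup>+t. ennreal (norm (cut T (ml c \<mu>) t)) \<partial>lborel) < \<infinity>" .
  qed
qed

text \<open>For nonnegative coefficients; it supplies the majorant that justifies integrating signed
  layers term by term.\<close>

lemma nn_integral_layer_convol:
  assumes \<gamma>: "\<gamma> > 0" and "\<mu> > 0" and c: "\<And>i. c i \<ge> 0"
  shows "(\<integral>\<^sup>+s. ennreal (omega \<gamma> (t - s) * layer c \<mu> k s) \<partial>lborel) = ennreal (layer c (\<gamma> + \<mu>) k t)"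
proof -
  have m0: "mcoef n c k l \<ge> 0" for l using c by (rule mcoef_nonneg)
  have p: "\<mu> + expo l > 0" for l using assms expo_nonneg[of l] by linarith
  have "(\<integral>\<^sup>+s. ennreal (omega \<gamma> (t - s) * layer c \<mu> k s) \<partial>lborel)
     = (\<integral>\<^sup>+s. (\<Sum>l\<in>multi_indices n k. ennreal (mcoef n c k l) * ennreal (omega \<gamma> (t - s) * omega (\<mu> + expo l) s)) \<partial>lborel)"
  proof (rule nn_integral_cong)
    fix s
    have "omega \<gamma> (t - s) * layer c \<mu> k s = (\<Sum>l\<in>multi_indices n k. mcoef n c k l * (omega \<gamma> (t - s) * omega (\<mu> + expo l) s))"
      by (simp add: layer_def sum_distrib_left mult_ac)
    also have "ennreal \<dots> = (\<Sum>l\<in>multi_indices n k. ennreal (mcoef n c k l * (omega \<gamma> (t - s) * omega (\<mu> + expo l) s)))"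
      by (rule sum_ennreal[symmetric]) (auto intro!: mult_nonneg_nonneg m0 omega_nonneg \<gamma> p)
    finally show "ennreal (omega \<gamma> (t - s) * layer c \<mu> k s) = (\<Sum>l\<in>multi_indices n k. ennreal (mcoef n c k l) * ennreal (omega \<gamma> (t - s) * omega (\<mu> + expo l) s))"
      using m0 by (simp add: ennreal_mult')
  qed
  also have "\<dots> = (\<Sum>l\<in>multi_indices n k. ennreal (mcoef n c k l) * ennreal (omega (\<gamma> + (\<mu> + expo l)) t))"
    by (subst nn_integral_sum) (auto simp: nn_integral_cmult nn_integral_omega_convol[OF \<gamma> p])
  also have "\<dots> = (\<Sum>l\<in>multi_indices n k. ennreal (mcoef n c k l * omega (\<gamma> + \<mu> + expo l) t))"
    using m0 by (simp add: ennreal_mult' add.assoc)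
  also have "\<dots> = ennreal (layer c (\<gamma> + \<mu>) k t)"
    unfolding layer_def using p \<gamma> by (intro sum_ennreal mult_nonneg_nonneg m0 omega_nonneg) (simp add: add_pos_pos add.assoc)
  finally show ?thesis .
qed

lemma layer_convol:
  assumes \<gamma>: "\<gamma> > 0" and \<mu>: "\<mu> > 0"
  shows "integrable lborel (\<lambda>s. omega \<gamma> (t - s) * layer c \<mu> k s)"
    "(LINT s|lborel. omega \<gamma> (t - s) * layer c \<mu> k s) = layer c (\<gamma> + \<mu>) k t"
    "(LINT s|lborel. \<bar>omega \<gamma> (t - s) * layer c \<mu> k s\<bar>) \<le> layer (\<lambda>i. \<bar>c i\<bar>) (\<gamma> + \<mu>) k t"
proof -
  have p: "\<mu> + expo l > 0" for l using assms expo_nonneg[of l] by linarith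
  have i: "integrable lborel (\<lambda>s. omega \<gamma> (t - s) * omega q s)"
    "(LINT s|lborel. omega \<gamma> (t - s) * omega q s) = omega (\<gamma> + q) t" if q: "q > 0" for q
  proof -
    have nn: "AE s in lborel. 0 \<le> omega \<gamma> (t - s) * omega q s" using \<gamma> q by (simp add: omega_nonneg)
    show "integrable lborel (\<lambda>s. omega \<gamma> (t - s) * omega q s)"
      by (rule integrableI_nonneg[OF _ nn]) (auto simp: nn_integral_omega_convol[OF \<gamma> q])
    show "(LINT s|lborel. omega \<gamma> (t - s) * omega q s) = omega (\<gamma> + q) t"
      using \<gamma> q by (subst integral_eq_nn_integral[OF _ nn]) (auto simp: nn_integral_omega_convol omega_nonneg)
  qed
  have e: "omega \<gamma> (t - s) * layer c \<mu> k s = (\<Sum>l\<in>multi_indices n k. mcoef n c k l * (omega \<gamma> (t - s) * omega (\<mu> + expo l) s))" for s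
    by (simp add: layer_def sum_distrib_left mult_ac)
  show int: "integrable lborel (\<lambda>s. omega \<gamma> (t - s) * layer c \<mu> k s)"
    unfolding e by (intro Bochner_Integration.integrable_sum integrable_mult_right i p)
  show "(LINT s|lborel. omega \<gamma> (t - s) * layer c \<mu> k s) = layer c (\<gamma> + \<mu>) k t"
    unfolding e by (subst Bochner_Integration.integral_sum) (auto simp: i p layer_def add.assoc intro!: integrable_mult_right)
  have "ennreal (LINT s|lborel. \<bar>omega \<gamma> (t - s) * layer c \<mu> k s\<bar>) = (\<integral>\<^sup>+s. ennreal \<bar>omega \<gamma> (t - s) * layer c \<mu> k s\<bar> \<partial>lborel)"
    by (rule nn_integral_eq_integral[symmetric]) (use int in auto)
  also have "\<dots> \<le> (\<integral>\<^sup>+s. ennreal (omega \<gamma> (t - s) * layer (\<lambda>i. \<bar>c i\<bar>) \<mu> k s) \<partial>lborel)"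
    using layer_abs[OF \<mu>] omega_nonneg[OF \<gamma>]
    by (intro nn_integral_mono ennreal_leI) (auto simp: abs_mult intro!: mult_left_mono)
  also have "\<dots> = ennreal (layer (\<lambda>i. \<bar>c i\<bar>) (\<gamma> + \<mu>) k t)"
    by (rule nn_integral_layer_convol[OF \<gamma> \<mu>]) simp
  finally show "(LINT s|lborel. \<bar>omega \<gamma> (t - s) * layer c \<mu> k s\<bar>) \<le> layer (\<lambda>i. \<bar>c i\<bar>) (\<gamma> + \<mu>) k t"
    using layer_nonneg[of "\<gamma> + \<mu>" "\<lambda>i. \<bar>c i\<bar>" k t] assms by (subst (asm) ennreal_le_iff) auto
qed

text \<open>The semigroup law in each layer, summed. Absolute convergence of the series with
  coefficients \<open>\<bar>c i\<bar>\<close> justifies this at every t, not only almost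
  everywhere.\<close>

lemma omega_convol_ml:
  assumes \<gamma>: "\<gamma> > 0" and \<mu>: "\<mu> > 0"
  shows "integrable lborel (\<lambda>s. omega \<gamma> (t - s) * ml c \<mu> s)" "convol (omega \<gamma>) (ml c \<mu>) t = ml c (\<gamma> + \<mu>) t"
proof -
  have gm: "\<gamma> + \<mu> > 0" using assms by simp
  have e: "omega \<gamma> (t - s) * ml c \<mu> s = (\<Sum>k. omega \<gamma> (t - s) * layer c \<mu> k s)" for s
    unfolding ml_def by (rule suminf_mult[symmetric, OF layers_summable(2)[OF \<mu>]])
  have S: "summable (\<lambda>k. LINT s|lborel. norm (omega \<gamma> (t - s) * layer c \<mu> k s))"
    by (rule summable_comparison_test'[OF layers_summable_nonneg[of "\<gamma> + \<mu>" "\<lambda>i. \<bar>c i\<bar>" t, OF gm]])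
      (use layer_convol(3)[OF \<gamma> \<mu>] in auto)
  have A: "AE s in lborel. summable (\<lambda>k. norm (omega \<gamma> (t - s) * layer c \<mu> k s))"
    using summable_mult[OF layers_summable(1)[OF \<mu>]] by (simp add: abs_mult)
  note sm = integrable_suminf[OF layer_convol(1)[OF \<gamma> \<mu>] A S] integral_suminf[OF layer_convol(1)[OF \<gamma> \<mu>] A S]
  show "integrable lborel (\<lambda>s. omega \<gamma> (t - s) * ml c \<mu> s)" unfolding e by (rule sm(1))
  show "convol (omega \<gamma>) (ml c \<mu>) t = ml c (\<gamma> + \<mu>) t"
    unfolding convol_def e sm(2) by (simp add: layer_convol(2)[OF \<gamma> \<mu>] ml_def)
qed

section \<open>Local regularity of the series and its sign near zero\<close>

text \<open>Differentiating a power brings down its exponent, which is unbounded over the layers. As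
  1 + p is at most \<open>exp p\<close>, this factor is absorbed by evaluating the majorant series
  at \<open>exp 1 * b\<close> instead of b.\<close>

lemma ml_lipschitz:
  assumes \<mu>: "\<mu> > 0" and a: "0 < a"
  shows "\<exists>L\<ge>0. \<forall>s\<in>{a..b}. \<forall>t\<in>{a..b}. \<bar>ml c \<mu> t - ml c \<mu> s\<bar> \<le> L * \<bar>t - s\<bar>"
proof -
  let ?c = "\<lambda>i. \<bar>c i\<bar>"
  \<comment> \<open>The first factor times \<open>exp p\<close> bounds the exponent, the maximum
    bounds the power \<open>\<mu> - 1\<close> at the intermediate point, 1 / a its reciprocal, and
    the last factor offsets the power \<open>\<mu> - 1\<close> in \<open>omega\<close> at
    \<open>exp 1 * b\<close>.\<close>
  define K where "K = (1 + \<bar>\<mu> - 1\<bar>) * max (a powr (\<mu> - 1)) (b powr (\<mu> - 1)) / a * (exp 1 * b) powr (1 - \<mu>)"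
  have om: "\<bar>omega (\<mu> + p) t - omega (\<mu> + p) s\<bar> \<le> K * omega (\<mu> + p) (exp 1 * b) * \<bar>t - s\<bar>"
    if p: "p \<ge> 0" and st: "a \<le> s" "s < t" "t \<le> b" for p s t
  proof -
    let ?q = "\<mu> + p - 1"
    have bpos: "b > 0" using st a by linarith
    have "\<exists>z. z > s \<and> z < t \<and> t powr ?q - s powr ?q = (t - s) * (?q * z powr (?q - 1))"
      by (rule MVT2[OF st(2)]) (rule has_real_derivative_powr, use st a in linarith)
    then obtain z where z: "s < z" "z < t" "t powr ?q - s powr ?q = (t - s) * (?q * z powr (?q - 1))" by auto
    have zp: "z > 0" "a \<le> z" "z \<le> b" using z st a by auto
    have mx: "z powr (\<mu> - 1) \<le> max (a powr (\<mu> - 1)) (b powr (\<mu> - 1))"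
    proof (cases "\<mu> \<ge> 1")
      case True
      then have "z powr (\<mu> - 1) \<le> b powr (\<mu> - 1)" using zp by (intro powr_mono2) auto
      then show ?thesis by simp
    next
      case False
      then have "z powr (\<mu> - 1) \<le> a powr (\<mu> - 1)" using zp a by (intro powr_mono2') auto
      then show ?thesis by simp
    qed
    have e1: "1 + p \<le> exp p" by (rule exp_ge_add_one_self)
    have "\<bar>\<mu> - 1\<bar> * 1 \<le> \<bar>\<mu> - 1\<bar> * exp p" using p by (intro mult_left_mono) auto
    then have "\<bar>\<mu> - 1\<bar> * 1 + exp p \<le> \<bar>\<mu> - 1\<bar> * exp p + exp p" by (rule add_right_mono)
    moreover have "\<bar>?q\<bar> \<le> \<bar>\<mu> - 1\<bar> * 1 + exp p"
    proof -
      have "\<bar>?q\<bar> = \<bar>(\<mu> - 1) + p\<bar>" by (simp add: algebra_simps)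
      also have "\<dots> \<le> \<bar>\<mu> - 1\<bar> + \<bar>p\<bar>" by (rule abs_triangle_ineq)
      finally show ?thesis using order_trans[OF _ e1, of p] p by simp
    qed
    ultimately have qb: "\<bar>?q\<bar> \<le> (1 + \<bar>\<mu> - 1\<bar>) * exp p"
      unfolding distrib_right by (simp only: mult_1_left add.commute[of "exp p"] order_trans)
    have "z powr (?q - 1) = z powr (\<mu> - 1) * z powr p / z"
      using zp by (simp add: powr_diff powr_add power2_eq_square)
    also have "\<dots> \<le> max (a powr (\<mu> - 1)) (b powr (\<mu> - 1)) * b powr p / a"
      using zp a p by (intro frac_le mult_mono mx powr_mono2 mult_nonneg_nonneg) (auto simp: le_max_iff_disj)
    finally have zb: "z powr (?q - 1) \<le> max (a powr (\<mu> - 1)) (b powr (\<mu> - 1)) * b powr p / a" .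
    have "\<bar>?q\<bar> * z powr (?q - 1) \<le> ((1 + \<bar>\<mu> - 1\<bar>) * exp p) * (max (a powr (\<mu> - 1)) (b powr (\<mu> - 1)) * b powr p / a)"
      using qb zb by (intro mult_mono) auto
    also have "\<dots> = K * (exp 1 * b) powr ?q"
    proof -
      have "(exp 1 * b) powr ?q = (exp 1 * b) powr (\<mu> - 1) * (exp p * b powr p)"
      proof -
        have "(exp 1 * b) powr ?q = (exp 1 * b) powr (\<mu> - 1) * (exp 1 * b) powr p"
          by (simp flip: powr_add add: algebra_simps)
        moreover have "(exp 1 * b) powr p = exp p * b powr p"
          using bpos by (simp add: powr_mult exp_powr_real)
        ultimately show ?thesis by simp
      qed
      moreover have "(exp 1 * b) powr (1 - \<mu>) * (exp 1 * b) powr (\<mu> - 1) = 1"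
        using bpos by (simp flip: powr_add)
      ultimately show ?thesis unfolding K_def by (simp add: mult_ac)
    qed
    finally have main: "\<bar>?q\<bar> * z powr (?q - 1) \<le> K * (exp 1 * b) powr ?q" .
    have G: "Gamma (\<mu> + p) > 0" using \<mu> p by (intro Gamma_real_pos) simp
    have "omega (\<mu> + p) t - omega (\<mu> + p) s = (t powr ?q - s powr ?q) / Gamma (\<mu> + p)"
      using st a by (simp add: omega_def diff_divide_distrib)
    also have "\<bar>\<dots>\<bar> = \<bar>t - s\<bar> * (\<bar>?q\<bar> * z powr (?q - 1)) / Gamma (\<mu> + p)"
      unfolding z(3) using G by (simp add: abs_mult)
    also have "\<dots> \<le> \<bar>t - s\<bar> * (K * (exp 1 * b) powr ?q) / Gamma (\<mu> + p)"
      using main G by (intro divide_right_mono mult_left_mono) auto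
    also have "\<dots> = K * omega (\<mu> + p) (exp 1 * b) * \<bar>t - s\<bar>"
      using bpos by (simp add: omega_def)
    finally show ?thesis .
  qed
  have lay: "\<bar>layer c \<mu> k t - layer c \<mu> k s\<bar> \<le> K * layer ?c \<mu> k (exp 1 * b) * \<bar>t - s\<bar>"
    if st: "a \<le> s" "s < t" "t \<le> b" for s t k
  proof -
    have "\<bar>layer c \<mu> k t - layer c \<mu> k s\<bar> = \<bar>\<Sum>l\<in>multi_indices n k. mcoef n c k l * (omega (\<mu> + expo l) t - omega (\<mu> + expo l) s)\<bar>"
      by (simp add: layer_def sum_subtractf right_diff_distrib)
    also have "\<dots> \<le> (\<Sum>l\<in>multi_indices n k. mcoef n ?c k l * (K * omega (\<mu> + expo l) (exp 1 * b) * \<bar>t - s\<bar>))"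
      by (rule order_trans[OF sum_abs])
        (auto simp: abs_mult mcoef_abs simp flip: mcoef_abs intro!: sum_mono mult_left_mono om[OF expo_nonneg st])
    finally show ?thesis by (simp add: layer_def sum_distrib_left sum_distrib_right mult_ac)
  qed
  define L where "L = \<bar>K\<bar> * ml ?c \<mu> (exp 1 * b)"
  have L: "\<bar>ml c \<mu> t - ml c \<mu> s\<bar> \<le> L * \<bar>t - s\<bar>" if st: "a \<le> s" "s < t" "t \<le> b" for s t
  proof -
    have sm: "summable (\<lambda>k. layer ?c \<mu> k (exp 1 * b))" by (rule layers_summable_nonneg[OF \<mu>]) simp
    have bd: "\<bar>layer c \<mu> k t - layer c \<mu> k s\<bar> \<le> \<bar>K\<bar> * \<bar>t - s\<bar> * layer ?c \<mu> k (exp 1 * b)" for k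
    proof -
      have "K * layer ?c \<mu> k (exp 1 * b) * \<bar>t - s\<bar> \<le> \<bar>K\<bar> * layer ?c \<mu> k (exp 1 * b) * \<bar>t - s\<bar>"
        by (intro mult_right_mono) (auto intro!: layer_nonneg \<mu>)
      then show ?thesis using lay[OF st, of k] by (simp add: mult_ac)
    qed
    have S: "summable (\<lambda>k. \<bar>K\<bar> * \<bar>t - s\<bar> * layer ?c \<mu> k (exp 1 * b))" by (rule summable_mult[OF sm])
    have A: "summable (\<lambda>k. \<bar>layer c \<mu> k t - layer c \<mu> k s\<bar>)"
      by (rule summable_comparison_test'[OF S]) (use bd in auto)
    have "ml c \<mu> t - ml c \<mu> s = (\<Sum>k. layer c \<mu> k t - layer c \<mu> k s)"
      unfolding ml_def by (rule suminf_diff) (auto intro: layers_summable \<mu>)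
    also have "\<bar>\<dots>\<bar> \<le> (\<Sum>k. \<bar>layer c \<mu> k t - layer c \<mu> k s\<bar>)" by (rule summable_rabs[OF A])
    also have "\<dots> \<le> (\<Sum>k. \<bar>K\<bar> * \<bar>t - s\<bar> * layer ?c \<mu> k (exp 1 * b))"
      by (rule suminf_le[OF bd A S])
    also have "\<dots> = L * \<bar>t - s\<bar>" unfolding L_def ml_def using sm by (subst suminf_mult) auto
    finally show ?thesis .
  qed
  have L0: "L \<ge> 0" unfolding L_def by (intro mult_nonneg_nonneg ml_nonneg \<mu>) auto
  have "\<bar>ml c \<mu> t - ml c \<mu> s\<bar> \<le> L * \<bar>t - s\<bar>" if "s \<in> {a..b}" "t \<in> {a..b}" for s t
    using L[of s t] L[of t s] that by (cases s t rule: linorder_cases) (auto simp: abs_minus_commute)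
  then show ?thesis using L0 by blast
qed

text \<open>By the recurrence \<open>ml\<close> is \<open>omega \<mu>\<close> plus terms that are
  smaller by factors \<open>t powr \<beta> i\<close>; near zero the positive leading term
  wins.\<close>

lemma ml_positive_near_zero:
  assumes \<mu>: "\<mu> > 0"
  shows "\<exists>\<delta>>0. \<forall>t. 0 < t \<and> t < \<delta> \<longrightarrow> ml c \<mu> t > 0"
proof -
  let ?B = "\<lambda>i. \<bar>c i\<bar> * ml (\<lambda>i. \<bar>c i\<bar>) (\<mu> + \<beta> i) 1"
  have p: "\<mu> + \<beta> i > 0" if "i < n" for i using \<mu> \<beta>_pos[OF that] by simp
  have bd: "\<bar>ml c (\<mu> + \<beta> i) t\<bar> \<le> t powr (\<mu> + \<beta> i - 1) * ml (\<lambda>i. \<bar>c i\<bar>) (\<mu> + \<beta> i) 1"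
    if t: "0 < t" "t \<le> 1" and i: "i < n" for t i
  proof -
    have s: "summable (\<lambda>k. layer (\<lambda>i. \<bar>c i\<bar>) (\<mu> + \<beta> i) k u)" for u
      by (rule layers_summable_nonneg[OF p[OF i]]) simp
    have "\<bar>ml c (\<mu> + \<beta> i) t\<bar> \<le> ml (\<lambda>i. \<bar>c i\<bar>) (\<mu> + \<beta> i) t" by (rule layers_summable(3)[OF p[OF i]])
    also have "\<dots> \<le> (\<Sum>k. t powr (\<mu> + \<beta> i - 1) * layer (\<lambda>i. \<bar>c i\<bar>) (\<mu> + \<beta> i) k 1)"
      unfolding ml_def
      using layer_scaling[of "\<mu> + \<beta> i" "\<lambda>i. \<bar>c i\<bar>" t 1] p[OF i] t
      by (intro suminf_le s summable_mult) auto
    also have "\<dots> = t powr (\<mu> + \<beta> i - 1) * ml (\<lambda>i. \<bar>c i\<bar>) (\<mu> + \<beta> i) 1"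
      unfolding ml_def by (rule suminf_mult[OF s])
    finally show ?thesis .
  qed
  have "((\<lambda>t. \<Sum>i<n. ?B i * t powr \<beta> i) \<longlongrightarrow> (\<Sum>i<n. ?B i * 0)) (at_right 0)"
    by (intro tendsto_sum tendsto_mult tendsto_const tendsto_zero_powrI[OF tendsto_ident_at tendsto_const])
      (auto simp: \<beta>_pos eventually_at_right_field intro!: exI[of _ 1])
  then have "eventually (\<lambda>t. (\<Sum>i<n. ?B i * t powr \<beta> i) < 1 / Gamma \<mu>) (at_right 0)"
    using Gamma_real_pos[OF \<mu>] by (intro order_tendstoD(2)) auto
  then obtain \<delta> where \<delta>: "\<delta> > 0" "\<And>t. 0 < t \<Longrightarrow> t < \<delta> \<Longrightarrow> (\<Sum>i<n. ?B i * t powr \<beta> i) < 1 / Gamma \<mu>"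
    unfolding eventually_at_right_field by auto
  have "ml c \<mu> t > 0" if t: "0 < t" "t < min \<delta> 1" for t
  proof -
    have "\<bar>\<Sum>i<n. c i * ml c (\<mu> + \<beta> i) t\<bar> \<le> (\<Sum>i<n. t powr (\<mu> - 1) * (?B i * t powr \<beta> i))"
    proof (rule order_trans[OF sum_abs], rule sum_mono)
      fix i assume "i \<in> {..<n}"
      then have i: "i < n" by simp
      have "\<bar>c i * ml c (\<mu> + \<beta> i) t\<bar> \<le> \<bar>c i\<bar> * (t powr (\<mu> + \<beta> i - 1) * ml (\<lambda>i. \<bar>c i\<bar>) (\<mu> + \<beta> i) 1)"
        using bd[OF t(1) _ i] t by (simp add: abs_mult mult_left_mono)
      also have "t powr (\<mu> + \<beta> i - 1) = t powr (\<mu> - 1) * t powr \<beta> i" by (simp flip: powr_add add: algebra_simps)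
      finally show "\<bar>c i * ml c (\<mu> + \<beta> i) t\<bar> \<le> t powr (\<mu> - 1) * (?B i * t powr \<beta> i)" by (simp add: mult_ac)
    qed
    also have "\<dots> = t powr (\<mu> - 1) * (\<Sum>i<n. ?B i * t powr \<beta> i)" by (simp add: sum_distrib_left)
    also have "\<dots> < t powr (\<mu> - 1) * (1 / Gamma \<mu>)"
      using \<delta>(2)[of t] t by (intro mult_strict_left_mono) auto
    also have "\<dots> = omega \<mu> t" using t by (simp add: omega_def)
    finally show ?thesis unfolding ml_recurrence[OF \<mu>, of c t] by linarith
  qed
  then show ?thesis using \<delta>(1) by (intro exI[of _ "min \<delta> 1"]) auto
qed

end

section \<open>Positive solutions of Volterra equations of the first kind\<close>

lemma integral_right_limit_zero:
  assumes G: "integrable lborel (\<lambda>s. indicator {0<..1} s * G s :: real)"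
  shows "((\<lambda>h. LINT s|lborel. indicator {0<..h} s * G s) \<longlongrightarrow> 0) (at_right (0::real))"
proof (rule tendsto_at_right_sequentially[where b = 1])
  fix h :: "nat \<Rightarrow> real" assume h: "\<And>n. 0 < h n" "\<And>n. h n < 1" and lim: "h \<longlonglongrightarrow> 0"
  have "(\<lambda>n. LINT s|lborel. indicator {0<..h n} s * (indicator {0<..1} s * G s)) \<longlonglongrightarrow> (LINT s::real|lborel. 0)"
  proof (rule integral_dominated_convergence[where w = "\<lambda>s. \<bar>indicator {0<..1} s * G s\<bar>"])
    show "AE s in lborel. (\<lambda>n. indicator {0<..h n} s * (indicator {0<..1} s * G s)) \<longlonglongrightarrow> 0"
    proof (rule AE_I2)
      fix s :: real
      have "eventually (\<lambda>n. indicator {0<..h n} s * (indicator {0<..1} s * G s) = 0) sequentially"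
      proof (cases "s > 0")
        case True
        from order_tendstoD(2)[OF lim this] show ?thesis by eventually_elim (auto simp: indicator_def)
      qed (auto simp: indicator_def)
      then show "(\<lambda>n. indicator {0<..h n} s * (indicator {0<..1} s * G s)) \<longlonglongrightarrow> 0" by (rule tendsto_eventually)
    qed
    show "integrable lborel (\<lambda>s. \<bar>indicator {0<..1} s * G s\<bar>)" using G by simp
    have m: "(\<lambda>s. indicator {0<..1} s * G s) \<in> borel_measurable lborel" using G by simp
    show "(\<lambda>s. indicator {0<..h n} s * (indicator {0<..1} s * G s)) \<in> borel_measurable lborel" for n
      by (intro borel_measurable_times m) simp
    show "AE s in lborel. norm (indicator {0<..h n} s * (indicator {0<..1} s * G s)) \<le> \<bar>indicator {0<..1} s * G s\<bar>" for n
      by (auto simp: indicator_def)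
  qed simp
  moreover have "indicator {0<..h n} s * (indicator {0<..1} s * G s) = indicator {0<..h n} s * G s" for n s
    using h(2)[of n] by (auto simp: indicator_def)
  ultimately show "(\<lambda>n. LINT s|lborel. indicator {0<..h n} s * G s) \<longlonglongrightarrow> 0" by simp
qed simp

(* At the first zero t0 of k the value of G * k would strictly drop to first order in h, because G
  decreases, while the mass of k in [t0, t0 + h] only contributes o(h). *)
lemma first_kind_solution_positive:
  fixes G k :: "real \<Rightarrow> real"
  assumes G: "causal G" "\<And>t. G t \<ge> 0" "\<And>s t. 0 < s \<Longrightarrow> s \<le> t \<Longrightarrow> G t \<le> G s"
    and Gdec: "\<And>a b. 0 < a \<Longrightarrow> \<exists>c>0. \<forall>s h. a \<le> s \<longrightarrow> s \<le> b \<longrightarrow> 0 < h \<longrightarrow> h \<le> 1 \<longrightarrow> G (s + h) \<le> G s - c * h"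
    and Gint: "integrable lborel (\<lambda>s. indicator {0<..1} s * G s)"
    and k: "causal k" "\<And>T. integrable lborel (cut T k)"
    and klip: "\<And>a b. 0 < a \<Longrightarrow> \<exists>L\<ge>0. \<forall>s\<in>{a..b}. \<forall>t\<in>{a..b}. \<bar>k t - k s\<bar> \<le> L * \<bar>t - s\<bar>"
    and knear: "\<exists>\<delta>>0. \<forall>t. 0 < t \<and> t < \<delta> \<longrightarrow> k t > 0"
    and Gk: "\<And>t. t > 0 \<Longrightarrow> integrable lborel (\<lambda>s. G (t - s) * k s)" "\<And>t. t > 0 \<Longrightarrow> convol G k t = 1"
    and t: "t > 0"
  shows "k t > 0"
proof (rule ccontr)
  assume "\<not> k t > 0"
  define Z where "Z = {u. 0 < u \<and> k u \<le> 0}"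
  have tZ: "t \<in> Z" using t \<open>\<not> k t > 0\<close> by (simp add: Z_def)
  obtain \<delta> where \<delta>: "\<delta> > 0" "\<And>t. 0 < t \<Longrightarrow> t < \<delta> \<Longrightarrow> k t > 0" using knear by blast
  define t0 where "t0 = Inf Z"
  have bdd: "bdd_below Z" by (rule bdd_belowI[of _ 0]) (auto simp: Z_def)
  have "\<delta> \<le> t0" unfolding t0_def
  proof (rule cInf_greatest)
    show "Z \<noteq> {}" using tZ by blast
    fix u assume "u \<in> Z"
    then show "\<delta> \<le> u" using \<delta>(2)[of u] by (auto simp: Z_def not_less[symmetric])
  qed
  then have t0: "t0 > 0" using \<delta>(1) by linarith
  have kpos: "k u > 0" if "0 < u" "u < t0" for u
  proof (rule ccontr)
    assume "\<not> k u > 0"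
    then have "u \<in> Z" using that by (simp add: Z_def)
    then show False using cInf_lower[OF _ bdd] that by (fastforce simp: t0_def)
  qed
  obtain L where L: "L \<ge> 0" "\<And>s t. s \<in> {t0 / 2..t0 + 1} \<Longrightarrow> t \<in> {t0 / 2..t0 + 1} \<Longrightarrow> \<bar>k t - k s\<bar> \<le> L * \<bar>t - s\<bar>"
    using klip[of "t0 / 2" "t0 + 1"] t0 by auto
  have k0: "k t0 \<le> 0"
  proof (rule ccontr)
    assume n: "\<not> k t0 \<le> 0"
    \<comment> \<open>Within distance e the Lipschitz bound keeps k above 0, so no point of Z could
      lie in [t0, t0 + e) and t0 would not be the infimum of Z.\<close>
    define e where "e = min 1 (k t0 / (2 * (L + 1)))"
    have e: "e > 0" "e \<le> 1" "L * e < k t0"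
    proof -
      show "e > 0" "e \<le> 1" using n L(1) by (auto simp: e_def)
      have "L * e \<le> L * (k t0 / (2 * (L + 1)))" using L(1) by (intro mult_left_mono) (auto simp: e_def)
      also have "\<dots> < k t0"
      proof -
        have "L / (2 * (L + 1)) < 1" using L(1) by simp
        from mult_strict_right_mono[OF this, of "k t0"] show ?thesis using n by simp
      qed
      finally show "L * e < k t0" .
    qed
    have "\<exists>u\<in>Z. u < t0 + e" using tZ e(1) cInf_lessD[of Z "t0 + e"] by (auto simp: t0_def)
    then obtain u where u: "u \<in> Z" "u < t0 + e" by blast
    then have "t0 \<le> u" using cInf_lower[OF u(1) bdd] by (simp add: t0_def)
    then have "\<bar>k u - k t0\<bar> \<le> L * \<bar>u - t0\<bar>" using u e t0 by (intro L(2)) auto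
    also have "\<dots> \<le> L * e" using L(1) u \<open>t0 \<le> u\<close> by (intro mult_left_mono) auto
    finally show False using e(3) u(1) by (auto simp: Z_def)
  qed
  \<comment> \<open>In the middle third both s and t0 - s stay away from 0: k is positive there, and
    G decreases at t0 - s with a uniform rate c.\<close>
  let ?J = "{t0 / 3..2 * t0 / 3}"
  obtain c where c: "c > 0" "\<And>s h. t0 / 3 \<le> s \<Longrightarrow> s \<le> 2 * t0 / 3 \<Longrightarrow> 0 < h \<Longrightarrow> h \<le> 1 \<Longrightarrow> G (s + h) \<le> G s - c * h"
    using Gdec[of "t0 / 3" "2 * t0 / 3"] t0 by auto
  have km [measurable]: "k \<in> borel_measurable borel" and Gm [measurable]: "G \<in> borel_measurable borel"
    using k(1) G(1) by (auto simp: causal_def)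
  have kJ: "integrable lborel (\<lambda>s. indicator ?J s * k s)"
  proof (rule Bochner_Integration.integrable_bound[OF k(2)[of t0]])
    show "AE s in lborel. norm (indicator ?J s * k s) \<le> norm (cut t0 k s)"
      using t0 by (auto simp: indicator_def cut_def)
  qed measurable
  define I where "I = (LINT s|lborel. indicator ?J s * k s)"
  have nonneg: "indicator ?J s * k s \<ge> 0" for s
    using kpos[of s] t0 by (auto simp: indicator_def less_imp_le)
  have "I \<noteq> 0"
  proof
    assume "I = 0"
    then have "AE s in lborel. indicator ?J s * k s = 0"
      unfolding I_def using nonneg by (subst (asm) integral_nonneg_eq_0_iff_AE[OF kJ]) auto
    then have "AE s in lborel. s \<notin> ?J"
    proof eventually_elim
      case (elim s)
      then show ?case using kpos[of s] t0 by (auto simp: indicator_def)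
    qed
    then have "?J \<in> null_sets lborel" by (subst (asm) AE_iff_null_sets[symmetric]) auto
    then show False using t0 by (simp add: null_sets_def)
  qed
  then have I: "I > 0" unfolding I_def using integral_nonneg_AE[OF AE_I2[OF nonneg]] by (simp add: less_le)
  \<comment> \<open>\<open>convol G k\<close> equals 1 at both t0 + h and t0. The integrated
    difference loses at least \<open>c * h * I\<close> on \<open>?J\<close>, gains nothing on the
    rest of (0,t0), and gains at most \<open>L * h\<close> times an integral of G beyond t0, where
    \<open>k s \<le> L * h\<close>. Divide by h.\<close>
  have main: "c * I \<le> L * (LINT s|lborel. indicator {0<..h} s * G s)" if h: "0 < h" "h \<le> 1" for h
  proof -
    let ?g = "\<lambda>s. indicator {t0..<t0 + h} s * G (t0 + h - s)"
    have gi: "integrable lborel (\<lambda>s. indicator {0<..h} s * G s)"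
    proof (rule Bochner_Integration.integrable_bound[OF Gint])
      show "AE s in lborel. norm (indicator {0<..h} s * G s) \<le> norm (indicator {0<..1} s * G s)"
        using h by (auto simp: indicator_def)
    qed measurable
    have ge: "?g s = indicator {0<..h} (t0 + h + (-1) * s) * G (t0 + h + (-1) * s)" for s
      by (auto simp: indicator_def)
    have g1: "integrable lborel ?g"
      unfolding ge using gi by (subst lborel_integrable_real_affine_iff) auto
    have g2: "(LINT s|lborel. ?g s) = (LINT s|lborel. indicator {0<..h} s * G s)"
      unfolding ge by (subst (2) lborel_integral_real_affine[of "-1" _ "t0 + h"]) auto
    have th: "t0 + h > 0" using t0 h by simp
    have "(LINT s|lborel. G (t0 + h - s) * k s - G (t0 - s) * k s)
        \<le> (LINT s|lborel. L * h * ?g s - c * h * (indicator ?J s * k s))"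
    proof (rule integral_mono)
      show "integrable lborel (\<lambda>s. G (t0 + h - s) * k s - G (t0 - s) * k s)"
        using Gk(1)[OF th] Gk(1)[OF t0] by simp
      show "integrable lborel (\<lambda>s. L * h * ?g s - c * h * (indicator ?J s * k s))"
        using g1 kJ by simp
      fix s
      show "G (t0 + h - s) * k s - G (t0 - s) * k s \<le> L * h * ?g s - c * h * (indicator ?J s * k s)"
      proof -
        consider "s \<le> 0" | "s \<in> ?J" | "0 < s" "s < t0" "s \<notin> ?J" | "t0 \<le> s" "s < t0 + h" | "s \<ge> t0 + h" using t0 by force
        then show ?thesis
        proof cases
          case 1
          then show ?thesis using causal_zero[OF k(1) 1] t0 by (simp add: indicator_def)
        next
          case 2
          have sJ: "0 < s" "s < t0" "t0 / 3 \<le> t0 - s" "t0 - s \<le> 2 * t0 / 3" using 2 t0 by auto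
          have e: "t0 - s + h = t0 + h - s" by simp
          have "G (t0 + h - s) \<le> G (t0 - s) - c * h" using c(2)[OF sJ(3,4) h] unfolding e .
          from mult_right_mono[OF this less_imp_le[OF kpos[OF sJ(1,2)]]]
          show ?thesis using 2 sJ by (simp add: indicator_def algebra_simps)
        next
          case 3
          have "G (t0 + h - s) \<le> G (t0 - s)" using 3 h by (intro G(3)) auto
          from mult_right_mono[OF this less_imp_le[OF kpos[OF 3(1,2)]]]
          show ?thesis using 3 by (auto simp: indicator_def)
        next
          case 4
          have Gz: "G (t0 - s) = 0" using 4 by (intro causal_zero[OF G(1)]) simp
          have "\<bar>k s - k t0\<bar> \<le> L * \<bar>s - t0\<bar>" using 4 t0 h by (intro L(2)) auto
          also have "\<dots> \<le> L * h" using L(1) 4 by (intro mult_left_mono) auto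
          finally have "k s \<le> L * h" using k0 by linarith
          from mult_left_mono[OF this G(2)[of "t0 + h - s"]]
          show ?thesis using 4 t0 Gz by (simp add: indicator_def mult_ac)
        next
          case 5
          have "G (t0 - s) = 0" "G (t0 + h - s) = 0" using 5 h by (auto intro!: causal_zero[OF G(1)])
          then show ?thesis using 5 t0 h by (auto simp: indicator_def)
        qed
      qed
    qed
    moreover have "(LINT s|lborel. G (t0 + h - s) * k s - G (t0 - s) * k s) = 0"
      using Gk(1)[OF th] Gk(1)[OF t0] Gk(2)[OF th] Gk(2)[OF t0] by (simp add: convol_def)
    moreover have "(LINT s|lborel. L * h * ?g s - c * h * (indicator ?J s * k s))
        = L * h * (LINT s|lborel. indicator {0<..h} s * G s) - c * h * I"
      using g1 kJ by (simp add: g2[symmetric] I_def)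
    ultimately have "h * (c * I) \<le> h * (L * (LINT s|lborel. indicator {0<..h} s * G s))"
      by (simp add: mult_ac)
    then show ?thesis using h by simp
  qed
  have "((\<lambda>h. L * (LINT s|lborel. indicator {0<..h} s * G s)) \<longlongrightarrow> L * 0) (at_right 0)"
    by (intro tendsto_mult tendsto_const integral_right_limit_zero Gint)
  moreover have "eventually (\<lambda>h. c * I \<le> L * (LINT s|lborel. indicator {0<..h} s * G s)) (at_right 0)"
    unfolding eventually_at_right_field using main by (intro exI[of _ 1]) auto
  ultimately have "c * I \<le> L * 0" by (rule tendsto_lowerbound) simp
  then show False using c(1) I by (simp add: mult_le_0_iff)
qed

section \<open>The solution kernels\<close>

lemma convol_sum:
  assumes f: "integrable lborel f" and g: "\<And>i. i \<in> A \<Longrightarrow> integrable lborel (g i)" and A: "finite A"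
  shows "AE t in lborel. convol f (\<lambda>s. \<Sum>i\<in>A. b i * g i s) t = (\<Sum>i\<in>A. b i * convol f (g i) t)"
proof -
  have "AE t in lborel. \<forall>i\<in>A. integrable lborel (\<lambda>s. f (t - s) * g i s)"
    by (subst AE_finite_all[OF A]) (intro ballI convol_AE_integrable f g)
  then show ?thesis
  proof eventually_elim
    case (elim t)
    have "convol f (\<lambda>s. \<Sum>i\<in>A. b i * g i s) t = (LINT s|lborel. (\<Sum>i\<in>A. b i * (f (t - s) * g i s)))"
      by (simp add: convol_def sum_distrib_left mult_ac)
    also have "\<dots> = (\<Sum>i\<in>A. (LINT s|lborel. b i * (f (t - s) * g i s)))"
      by (rule Bochner_Integration.integral_sum) (use elim in auto)
    finally show ?case by (simp add: convol_def)
  qed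
qed

lemma convol_cut:
  assumes "causal f" "causal g" "t \<le> T"
  shows "convol (cut T f) (cut T g) t = convol f g t"
  unfolding convol_def
proof (rule Bochner_Integration.integral_cong[OF refl])
  fix s
  show "cut T f (t - s) * cut T g s = f (t - s) * g s"
    using causal_zero[OF assms(1), of "t - s"] causal_zero[OF assms(2), of s] assms(3)
    by (cases "0 < s \<and> s < t") (auto simp: cut_def not_less)
qed

lemma omega_cut_integrable: "p > 0 \<Longrightarrow> integrable lborel (cut T (omega p))"
proof -
  assume p: "p > 0"
  \<comment> \<open>Without arguments only layer 0 survives, so \<open>ml\<close> is
    \<open>omega\<close> itself.\<close>
  interpret e: ml_exponents 0 "\<lambda>_. 1" by unfold_locales simp
  have "e.ml undefined p = omega p" by (rule ext) (simp add: e.ml_recurrence[OF p])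
  then show ?thesis using e.ml_cut_integrable[OF p, of T undefined] by simp
qed

lemma one_cut_integrable: "integrable lborel (cut T (\<lambda>_. 1))"
  using omega_cut_integrable[of 1 T] by (simp add: cut_def[abs_def] omega_one cong: if_cong)

lemma cut_omega_one: "cut T (omega 1) = cut T (\<lambda>_. 1)"
  by (auto simp: cut_def omega_one fun_eq_iff)

section \<open>The kernels of the multi-term equation\<close>

locale multiterm =
  fixes \<alpha> :: real and m :: nat and a b :: "nat \<Rightarrow> real"
  assumes \<alpha>: "0 < \<alpha>" "\<alpha> < 1"
    and a: "\<And>i. i \<in> {1..m} \<Longrightarrow> 0 < a i" "\<And>i. i \<in> {1..m} \<Longrightarrow> a i < \<alpha>"
    and b: "\<And>i. i \<in> {1..m} \<Longrightarrow> 0 < b i"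
begin

sublocale ml_exponents "Suc m" "\<lambda>i. if i = 0 then \<alpha> else \<alpha> - a i"
  using \<alpha> a by unfold_locales auto

definition cc :: "real \<Rightarrow> nat \<Rightarrow> real" where
  "cc l i = (if i = 0 then - l else - b i)"

definition kern :: "real \<Rightarrow> real \<Rightarrow> real" where
  "kern l = ml (cc l) \<alpha>"

text \<open>Convolution with it applies all the fractional integrals of the time-integrated equation
  at once, including \<open>l\<close> times the primitive.\<close>

definition symb :: "real \<Rightarrow> real \<Rightarrow> real" where
  "symb l t = omega (1 - \<alpha>) t + (\<Sum>i=1..m. b i * omega (1 - a i) t) + l * omega 1 t"

lemma sum_shift: "(\<Sum>i<Suc m. h i) = h 0 + (\<Sum>i=1..m. h i)" for h :: "nat \<Rightarrow> real"
  by (simp add: sum.lessThan_Suc_shift sum.atLeast1_atMost_eq del: sum.lessThan_Suc)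

text \<open>Each summand of \<open>symb\<close> merely raises the parameter of \<open>ml\<close>;
  the resulting combination is \<open>ml_recurrence\<close> at parameter 1, which leaves
  \<open>omega 1\<close>.\<close>

lemma symb_convol_kern:
  assumes t: "t > 0"
  shows "integrable lborel (\<lambda>s. symb l (t - s) * kern l s)" "convol (symb l) (kern l) t = 1"
proof -
  have p: "1 - \<alpha> > 0" "\<And>i. i \<in> {1..m} \<Longrightarrow> 1 - a i > 0" using \<alpha> a(2) by force+
  have e: "symb l (t - s) * kern l s = omega (1 - \<alpha>) (t - s) * kern l s
     + (\<Sum>i=1..m. b i * (omega (1 - a i) (t - s) * kern l s)) + l * (omega 1 (t - s) * kern l s)" for s
    by (simp add: symb_def distrib_right sum_distrib_right mult.assoc)
  note i1 = omega_convol_ml(1)[OF p(1) \<alpha>(1), of t "cc l", folded kern_def]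
  note i2 = omega_convol_ml(1)[OF p(2) \<alpha>(1), of _ t "cc l", folded kern_def]
  note i3 = omega_convol_ml(1)[OF zero_less_one \<alpha>(1), of t "cc l", folded kern_def]
  show "integrable lborel (\<lambda>s. symb l (t - s) * kern l s)"
    unfolding e
    by (intro Bochner_Integration.integrable_add Bochner_Integration.integrable_sum integrable_mult_right i1 i2 i3)
  have "convol (symb l) (kern l) t = convol (omega (1 - \<alpha>)) (kern l) t
     + (\<Sum>i=1..m. b i * convol (omega (1 - a i)) (kern l) t) + l * convol (omega 1) (kern l) t"
  proof -
    have "(LINT s|lborel. (\<Sum>i=1..m. b i * (omega (1 - a i) (t - s) * kern l s)))
        = (\<Sum>i=1..m. (LINT s|lborel. b i * (omega (1 - a i) (t - s) * kern l s)))"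
      by (intro Bochner_Integration.integral_sum integrable_mult_right i2)
    moreover have "integrable lborel (\<lambda>s. \<Sum>i=1..m. b i * (omega (1 - a i) (t - s) * kern l s))"
      by (intro Bochner_Integration.integrable_sum integrable_mult_right i2)
    ultimately show ?thesis unfolding convol_def e using i1 i3 by simp
  qed
  also have "\<dots> = ml (cc l) 1 t + (\<Sum>i=1..m. b i * ml (cc l) (1 + (\<alpha> - a i)) t) + l * ml (cc l) (1 + \<alpha>) t"
  proof -
    have "convol (omega (1 - a i)) (kern l) t = ml (cc l) (1 + (\<alpha> - a i)) t" if "i \<in> {1..m}" for i
      using omega_convol_ml(2)[OF p(2)[OF that] \<alpha>(1), of "cc l" t] by (simp add: kern_def algebra_simps)
    then show ?thesis
      using omega_convol_ml(2)[OF p(1) \<alpha>(1), of "cc l" t] omega_convol_ml(2)[OF zero_less_one \<alpha>(1), of "cc l" t]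
      by (simp add: kern_def)
  qed
  also have "\<dots> = omega 1 t"
    using ml_recurrence[of 1 "cc l" t] unfolding sum_shift by (simp add: cc_def sum_negf)
  finally show "convol (symb l) (kern l) t = 1" using t by (simp add: omega_one)
qed

lemma kern_causal: "causal (kern l)"
  unfolding kern_def by (rule ml_causal)

lemma kern_cut_integrable: "integrable lborel (cut T (kern l))"
  unfolding kern_def by (rule ml_cut_integrable[OF \<alpha>(1)])

text \<open>The prefactor and the powers of t in the arguments combine to
  \<open>t powr (\<alpha> + expo x - 1)\<close>, the power inside \<open>omega\<close>.\<close>

lemma E_bar_coeff_eq:
  assumes t: "t > 0"
  shows "E_bar_coeff \<alpha> m a b l t = kern l t"
proof -
  let ?\<beta> = "\<lambda>i. if i = 0 then \<alpha> else \<alpha> - a i"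
  let ?z = "\<lambda>i. if i = 0 then - l * t powr \<alpha> else - b i * t powr (\<alpha> - a i)"
  define tm where "tm k = (\<Sum>x\<in>multi_indices (Suc m) k. fact k / (\<Prod>i<Suc m. fact (x i)) *
        ((\<Prod>i<Suc m. ?z i ^ x i) / Gamma (\<alpha> + (\<Sum>i<Suc m. ?\<beta> i * real (x i)))))" for k
  have e: "layer (cc l) \<alpha> k t = t powr (\<alpha> - 1) * tm k" for k
    unfolding layer_def tm_def sum_distrib_left
  proof (rule sum.cong[OF refl])
    fix x
    have z: "?z i = cc l i * t powr ?\<beta> i" for i by (simp add: cc_def)
    have "(\<Prod>i<Suc m. ?z i ^ x i) = (\<Prod>i<Suc m. cc l i ^ x i) * (\<Prod>i<Suc m. t powr (?\<beta> i * real (x i)))"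
      unfolding prod.distrib[symmetric]
    proof (rule prod.cong[OF refl])
      fix i
      have "(t powr ?\<beta> i) ^ x i = t powr (?\<beta> i * real (x i))"
        using t by (simp add: powr_realpow[symmetric] powr_powr)
      then show "?z i ^ x i = cc l i ^ x i * t powr (?\<beta> i * real (x i))"
        unfolding z by (simp only: power_mult_distrib)
    qed
    also have "(\<Prod>i<Suc m. t powr (?\<beta> i * real (x i))) = t powr expo x"
      using t unfolding expo_def by (intro powr_sum[symmetric]) auto
    finally have zz: "(\<Prod>i<Suc m. ?z i ^ x i) = (\<Prod>i<Suc m. cc l i ^ x i) * t powr expo x" .
    have "t powr (\<alpha> + expo x - 1) = t powr (\<alpha> - 1) * t powr expo x" by (simp flip: powr_add add: algebra_simps)
    then have "omega (\<alpha> + expo x) t = t powr (\<alpha> - 1) * (t powr expo x / Gamma (\<alpha> + expo x))"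
      using t by (simp add: omega_def)
    then show "mcoef (Suc m) (cc l) k x * omega (\<alpha> + expo x) t = t powr (\<alpha> - 1) * (fact k / (\<Prod>i<Suc m. fact (x i)) *
        ((\<Prod>i<Suc m. ?z i ^ x i) / Gamma (\<alpha> + (\<Sum>i<Suc m. ?\<beta> i * real (x i)))))"
      unfolding zz mcoef_def expo_def[symmetric] by simp
  qed
  have s: "summable tm"
  proof -
    have "summable (\<lambda>k. t powr (1 - \<alpha>) * layer (cc l) \<alpha> k t)"
      by (intro summable_mult layers_summable(2) \<alpha>)
    moreover have "t powr (1 - \<alpha>) * layer (cc l) \<alpha> k t = tm k" for k
      unfolding e mult.assoc[symmetric] using t by (simp flip: powr_add)
    ultimately show ?thesis by simp
  qed
  have "kern l t = t powr (\<alpha> - 1) * suminf tm"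
    unfolding kern_def ml_def e by (rule suminf_mult[OF s])
  then show ?thesis
    by (simp only: E_bar_coeff_def multinomial_ML_def tm_def[abs_def] multi_indices_def)
qed

lemma symb_causal: "causal (symb l)"
  by (auto simp: causal_def symb_def[abs_def]) (simp add: omega_def)

lemma symb_ge_omega: "symb l t \<ge> l * omega 1 t"
proof -
  have "b i * omega (1 - a i) t \<ge> 0" if "i \<in> {1..m}" for i
    using b[OF that] a(2)[OF that] \<alpha> by (intro mult_nonneg_nonneg omega_nonneg) auto
  then have "(\<Sum>i=1..m. b i * omega (1 - a i) t) \<ge> 0" by (rule sum_nonneg)
  moreover have "omega (1 - \<alpha>) t \<ge> 0" using \<alpha> by (intro omega_nonneg) simp
  ultimately show ?thesis by (simp add: symb_def)
qed

lemma omega_antimono: "0 < p \<Longrightarrow> p \<le> 1 \<Longrightarrow> 0 < s \<Longrightarrow> s \<le> t \<Longrightarrow> omega p t \<le> omega p s"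
  using Gamma_real_pos[of p] by (auto simp: omega_def intro!: divide_right_mono powr_mono2')

text \<open>Every summand of \<open>symb\<close> is nonincreasing for positive times; the definite
  rate of decrease required by the first-zero argument comes from
  \<open>omega (1 - \<alpha>)\<close>.\<close>

lemma kern_pos:
  assumes l: "l \<ge> 0" and t: "t > 0"
  shows "kern l t > 0"
proof -
  have p: "1 - \<alpha> > 0" "\<And>i. i \<in> {1..m} \<Longrightarrow> 1 - a i > 0" using \<alpha> a(2) by force+
  have b0: "b i \<ge> 0" if "i \<in> {1..m}" for i using b[OF that] by simp
  have mono: "symb l t - omega (1 - \<alpha>) t \<le> symb l s - omega (1 - \<alpha>) s" if "0 < s" "s \<le> t" for s t
  proof -
    have "(\<Sum>i=1..m. b i * omega (1 - a i) t) \<le> (\<Sum>i=1..m. b i * omega (1 - a i) s)"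
      using that p a(1) by (intro sum_mono mult_left_mono omega_antimono b0) (auto simp: less_imp_le)
    moreover have "l * omega 1 t \<le> l * omega 1 s" using that by (simp add: omega_one)
    ultimately show ?thesis by (simp add: symb_def)
  qed
  show ?thesis
  proof (rule first_kind_solution_positive[OF symb_causal _ _ _ _ kern_causal kern_cut_integrable _ _ _ _ t])
    show "symb l t \<ge> 0" for t
      using symb_ge_omega[of l t] mult_nonneg_nonneg[OF l omega_nonneg[of 1 t]] by linarith
    show "symb l t \<le> symb l s" if "0 < s" "s \<le> t" for s t
      using mono[OF that] omega_antimono[OF p(1) _ that] \<alpha> by simp
    show "\<exists>c>0. \<forall>s h. u \<le> s \<longrightarrow> s \<le> v \<longrightarrow> 0 < h \<longrightarrow> h \<le> 1 \<longrightarrow> symb l (s + h) \<le> symb l s - c * h" if u: "0 < u" for u v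
    proof (cases "u \<le> v")
      case False
      then show ?thesis by (intro exI[of _ 1]) auto
    next
      case uv: True
      \<comment> \<open>The smallest slope of \<open>omega (1 - \<alpha>)\<close> in absolute value
        on [u, v + 1]; the extra 1 accommodates h \<le> 1.\<close>
      let ?c = "\<alpha> * (v + 1) powr (- \<alpha> - 1) / Gamma (1 - \<alpha>)"
      show ?thesis
      proof (intro exI[of _ ?c] conjI allI impI)
        show "?c > 0" using \<alpha> u uv Gamma_real_pos[OF p(1)] by simp
        fix s h assume s: "u \<le> s" "s \<le> v" and h: "0 < h" "h \<le> (1::real)"
        have sp: "s > 0" using u s by linarith
        have "\<exists>z. z > s \<and> z < s + h \<and> (s + h) powr (- \<alpha>) - s powr (- \<alpha>) = (s + h - s) * (- \<alpha> * z powr (- \<alpha> - 1))"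
          by (rule MVT2) (use h in simp, rule has_real_derivative_powr, use sp in linarith)
        then obtain z where z: "s < z" "z < s + h" "(s + h) powr (- \<alpha>) - s powr (- \<alpha>) = h * (- \<alpha> * z powr (- \<alpha> - 1))" by auto
        have "(v + 1) powr (- \<alpha> - 1) \<le> z powr (- \<alpha> - 1)"
          using z s h sp \<alpha> by (intro powr_mono2') auto
        then have "h * (\<alpha> * (v + 1) powr (- \<alpha> - 1)) \<le> h * (\<alpha> * z powr (- \<alpha> - 1))"
          using h \<alpha> by (intro mult_left_mono) auto
        then have "(s + h) powr (- \<alpha>) \<le> s powr (- \<alpha>) - h * (\<alpha> * (v + 1) powr (- \<alpha> - 1))"
          using z(3) by simp
        from divide_right_mono[OF this less_imp_le[OF Gamma_real_pos[OF p(1)]]]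
        have "omega (1 - \<alpha>) (s + h) \<le> omega (1 - \<alpha>) s - ?c * h"
          using sp h by (simp add: omega_def diff_divide_distrib mult_ac)
        then show "symb l (s + h) \<le> symb l s - ?c * h" using mono[OF sp, of "s + h"] h by simp
      qed
    qed
    show "integrable lborel (\<lambda>s. indicator {0<..1} s * symb l s)"
    proof -
      have i: "integrable lborel (\<lambda>s. indicator {0<..1} s * omega q s)" if q: "q > 0" for q
      proof (rule Bochner_Integration.integrable_bound[OF omega_cut_integrable[OF q, of 2]])
        show "AE s in lborel. norm (indicator {0<..1} s * omega q s) \<le> norm (cut 2 (omega q) s)"
          by (auto simp: indicator_def cut_def)
      qed measurable
      have e: "indicator {0<..1} s * symb l s = indicator {0<..1} s * omega (1 - \<alpha>) s
        + (\<Sum>i=1..m. b i * (indicator {0<..1} s * omega (1 - a i) s)) + l * (indicator {0<..1} s * omega 1 s)" for s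
        by (simp add: symb_def distrib_left sum_distrib_left mult_ac)
      show ?thesis unfolding e using p
        by (intro Bochner_Integration.integrable_add Bochner_Integration.integrable_sum integrable_mult_right i) auto
    qed
    show "\<exists>L\<ge>0. \<forall>s\<in>{u..v}. \<forall>t\<in>{u..v}. \<bar>kern l t - kern l s\<bar> \<le> L * \<bar>t - s\<bar>" if "0 < u" for u v
      unfolding kern_def by (rule ml_lipschitz[OF \<alpha>(1) that])
    show "\<exists>\<delta>>0. \<forall>t. 0 < t \<and> t < \<delta> \<longrightarrow> kern l t > 0"
      unfolding kern_def by (rule ml_positive_near_zero[OF \<alpha>(1)])
  qed (use symb_convol_kern in auto)
qed

lemma kern_nonneg: "l \<ge> 0 \<Longrightarrow> kern l t \<ge> 0"
  using kern_pos[of l t] causal_zero[OF kern_causal, of t l] by (cases "t > 0") auto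

lemma kern_integral_le:
  assumes l: "l \<ge> 0" and T: "T > 0"
  shows "l * (LINT t|lborel. cut T (kern l) t) \<le> 1"
proof -
  have "l * (LINT s|lborel. cut T (kern l) s) = (LINT s|lborel. l * cut T (kern l) s)" by simp
  also have "\<dots> \<le> (LINT s|lborel. symb l (T - s) * kern l s)"
  proof (rule integral_mono)
    show "integrable lborel (\<lambda>s. l * cut T (kern l) s)" using kern_cut_integrable by simp
    show "integrable lborel (\<lambda>s. symb l (T - s) * kern l s)" by (rule symb_convol_kern(1)[OF T])
    fix s
    have "l * omega 1 (T - s) * kern l s \<le> symb l (T - s) * kern l s"
      by (intro mult_right_mono symb_ge_omega kern_nonneg l)
    moreover have "l * cut T (kern l) s \<le> l * omega 1 (T - s) * kern l s"
      using kern_nonneg[OF l, of s] l by (auto simp: cut_def omega_one)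
    ultimately show "l * cut T (kern l) s \<le> symb l (T - s) * kern l s" by linarith
  qed
  also have "\<dots> = 1" using symb_convol_kern(2)[OF T] by (simp add: convol_def)
  finally show ?thesis .
qed


lemma symb_cut_integrable: "integrable lborel (cut T (symb l))"
proof -
  have p: "1 - \<alpha> > 0" "\<And>i. i \<in> {1..m} \<Longrightarrow> 1 - a i > 0" using \<alpha> a(2) by force+
  have e: "cut T (symb l) = (\<lambda>s. cut T (omega (1 - \<alpha>)) s
        + (\<Sum>i=1..m. b i * cut T (omega (1 - a i)) s) + l * cut T (omega 1) s)"
    by (auto simp: cut_def symb_def fun_eq_iff)
  show ?thesis unfolding e using p
    by (intro Bochner_Integration.integrable_add Bochner_Integration.integrable_sum integrable_mult_right omega_cut_integrable) auto
qed

lemma cut_one_causal: "causal (cut T (\<lambda>_. 1))"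
  by (rule cut_causal) simp

text \<open>Evaluate the triple convolution of \<open>k0\<close>, g and k in two ways, using that g
  with \<open>k0\<close> gives \<open>one\<close> and that g with k gives \<open>one\<close> minus l
  times \<open>one\<close> with k. The difference x of both sides then has vanishing
  primitive.\<close>

lemma resolvent_identity:
  "AE t in lborel. t < T \<longrightarrow> cut T (kern l) t + l * convol (cut T (kern 0)) (cut T (kern l)) t = cut T (kern 0) t"
proof -
  define g where "g = cut T (symb 0)"
  define k0 where "k0 = cut T (kern 0)"
  define k where "k = cut T (kern l)"
  define one where "one = cut T (\<lambda>_::real. 1::real)"
  have int: "integrable lborel g" "integrable lborel k0" "integrable lborel k" "integrable lborel one"
    unfolding g_def k0_def k_def one_def by (intro symb_cut_integrable kern_cut_integrable one_cut_integrable)+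
  have ca: "causal g" "causal k0" "causal k" "causal one"
    unfolding g_def k0_def k_def one_def using symb_causal kern_causal by (auto intro!: cut_causal)
  note [measurable] = ca[THEN causal_measurable]
  have gk0: "convol g k0 t = one t" if "t < T" for t
  proof (cases "t > 0")
    case True
    have "convol g k0 t = convol (symb 0) (kern 0) t"
      unfolding g_def k0_def by (rule convol_cut[OF symb_causal kern_causal]) (use that in simp)
    then show ?thesis using symb_convol_kern(2)[OF True] True that by (simp add: one_def cut_def)
  next
    case False
    then show ?thesis using causal_zero[OF causal_convol[OF ca(1,2)], of t] by (simp add: one_def cut_def)
  qed
  have gk: "convol g k t = one t - l * convol one k t" if "t < T" for t
  proof (cases "t > 0")
    case True
    have s1: "symb l = (\<lambda>s. symb 0 s + l * omega 1 s)" by (auto simp: symb_def)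
    have i: "integrable lborel (\<lambda>s. omega 1 (t - s) * kern l s)"
      unfolding kern_def by (rule omega_convol_ml(1)[OF zero_less_one \<alpha>(1)])
    have i0: "integrable lborel (\<lambda>s. symb 0 (t - s) * kern l s)"
    proof -
      have "integrable lborel (\<lambda>s. symb l (t - s) * kern l s - l * (omega 1 (t - s) * kern l s))"
        by (intro Bochner_Integration.integrable_diff integrable_mult_right i symb_convol_kern(1)[OF True])
      then show ?thesis unfolding s1 by (simp add: algebra_simps)
    qed
    have "1 = (LINT s|lborel. symb 0 (t - s) * kern l s + l * (omega 1 (t - s) * kern l s))"
      using symb_convol_kern(2)[OF True, of l] unfolding convol_def s1 by (simp add: algebra_simps)
    also have "\<dots> = convol (symb 0) (kern l) t + l * convol (omega 1) (kern l) t"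
      using i i0 by (simp add: convol_def)
    also have "convol (symb 0) (kern l) t = convol g k t"
      unfolding g_def k_def by (rule convol_cut[OF symb_causal kern_causal, symmetric]) (use that in simp)
    also have "convol (omega 1) (kern l) t = convol one k t"
      unfolding one_def k_def cut_omega_one[symmetric]
      by (rule convol_cut[OF omega_causal kern_causal, symmetric]) (use that in simp)
    finally show ?thesis using True that by (simp add: one_def cut_def)
  next
    case False
    then show ?thesis using causal_zero[OF causal_convol[OF ca(1,3)], of t] causal_zero[OF causal_convol[OF ca(4,3)], of t]
      by (simp add: one_def cut_def)
  qed
  \<comment> \<open>The explicit coefficients 1 and -1 give x the shape of a linear combination of
    two integrable functions, twice nested.\<close>
  define x where "x t = 1 * (1 * k t + l * convol k0 k t) + (-1) * k0 t" for t
  have ik: "integrable lborel (convol k0 k)" by (intro convol_integrable int)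
  have xi: "integrable lborel x" "causal x"
    using int ik causal_convol[OF ca(2,3)] ca by (auto simp: x_def[abs_def] causal_def)
  have "AE t in lborel. t < T \<longrightarrow> convol one x t = 0"
    using convol_assoc[OF int(2,1,3)] convol_assoc[OF int(4,2,3)] convol_assoc[OF int(2,4,3)]
      convol_lincomb[OF int(4) Bochner_Integration.integrable_add[OF integrable_mult_right[OF int(3)] integrable_mult_right[OF ik]] int(2), of 1 1 l "-1"]
      convol_lincomb[OF int(4,3) ik, of 1 l]
      convol_lincomb[OF int(2,4) convol_integrable[OF int(4,3)], of 1 "- l"]
  proof eventually_elim
    case (elim t)
    show ?case
    proof
      assume t: "t < T"
      have "convol k0 (convol g k) t = convol k0 (\<lambda>s. 1 * one s + - l * convol one k s) t"
        by (rule convol_cong_right[OF ca(2), where T = T]) (use gk t in auto)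
      moreover have "convol (convol k0 g) k t = convol one k t"
        by (rule convol_cong_left[OF ca(3), where T = T]) (use gk0 t in \<open>auto simp: convol_commute[of k0 g]\<close>)
      moreover have "convol k0 one = convol one k0" by (rule convol_commute)
      ultimately show "convol one x t = 0" using elim by (simp add: x_def[abs_def])
    qed
  qed
  then have "AE t in lborel. t < T \<longrightarrow> x t = 0"
    unfolding one_def by (rule convol_one_zero[OF xi])
  then show ?thesis by eventually_elim (auto simp: x_def k_def k0_def)
qed

text \<open>The resolvent identity gives the inequality only almost everywhere. A violation at t
  would, by the Lipschitz bounds, persist on an interval of length e. The inequality is wanted at
  every t because it serves as a pointwise majorant.\<close>

lemma kern_le_kern_0:
  assumes l: "l \<ge> 0"
  shows "kern l t \<le> kern 0 t"
proof (rule ccontr)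
  assume n: "\<not> kern l t \<le> kern 0 t"
  then have t: "t > 0" using causal_zero[OF kern_causal, of t] by force
  have lip: "\<exists>L\<ge>0. \<forall>s\<in>{t / 2..t + 1}. \<forall>u\<in>{t / 2..t + 1}. \<bar>kern l' u - kern l' s\<bar> \<le> L * \<bar>u - s\<bar>" for l'
    unfolding kern_def by (rule ml_lipschitz[OF \<alpha>(1)]) (use t in simp)
  obtain L0 where L0: "L0 \<ge> 0" "\<And>s u. s \<in> {t / 2..t + 1} \<Longrightarrow> u \<in> {t / 2..t + 1} \<Longrightarrow> \<bar>kern 0 u - kern 0 s\<bar> \<le> L0 * \<bar>u - s\<bar>"
    using lip[of 0] by blast
  obtain L where L: "L \<ge> 0" "\<And>s u. s \<in> {t / 2..t + 1} \<Longrightarrow> u \<in> {t / 2..t + 1} \<Longrightarrow> \<bar>kern l u - kern l s\<bar> \<le> L * \<bar>u - s\<bar>"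
    using lip[of l] by blast
  define d where "d = kern l t - kern 0 t"
  have d: "d > 0" using n by (simp add: d_def)
  define e where "e = min 1 (d / (2 * (L + L0 + 1)))"
  have e: "e > 0" "e \<le> 1" "(L + L0) * e < d"
  proof -
    show "e > 0" "e \<le> 1" using d L(1) L0(1) by (auto simp: e_def)
    have "(L + L0) * e \<le> (L + L0) * (d / (2 * (L + L0 + 1)))"
      using L(1) L0(1) by (intro mult_left_mono) (auto simp: e_def)
    also have "\<dots> < d"
    proof -
      have "(L + L0) / (2 * (L + L0 + 1)) < 1" using L(1) L0(1) by simp
      from mult_strict_right_mono[OF this d] show ?thesis by simp
    qed
    finally show "(L + L0) * e < d" .
  qed
  have gt: "kern l u > kern 0 u" if u: "t < u" "u < t + e" for u
  proof -
    have m: "t \<in> {t / 2..t + 1}" "u \<in> {t / 2..t + 1}" using u e t by auto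
    have "L * \<bar>u - t\<bar> \<le> L * e" "L0 * \<bar>u - t\<bar> \<le> L0 * e" using L(1) L0(1) u by (auto intro!: mult_left_mono)
    then have "\<bar>kern l u - kern l t\<bar> + \<bar>kern 0 u - kern 0 t\<bar> < d"
      using L(2)[OF m] L0(2)[OF m] e(3) by (simp add: distrib_right)
    then show ?thesis by (simp add: d_def)
  qed
  have "AE u in lborel. u \<notin> {t<..<t + e}"
    using resolvent_identity[of "t + 2" l]
  proof eventually_elim
    case (elim u)
    show ?case
    proof
      assume u: "u \<in> {t<..<t + e}"
      have "convol (cut (t + 2) (kern 0)) (cut (t + 2) (kern l)) u \<ge> 0"
        unfolding convol_def using kern_nonneg[OF l] kern_nonneg[of 0] by (intro integral_nonneg_AE) (auto simp: cut_def)
      then have "l * convol (cut (t + 2) (kern 0)) (cut (t + 2) (kern l)) u \<ge> 0" using l by simp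
      moreover have "kern l u + l * convol (cut (t + 2) (kern 0)) (cut (t + 2) (kern l)) u = kern 0 u"
        using elim u e t by (simp add: cut_def)
      ultimately show False using gt[of u] u by simp
    qed
  qed
  then have "{t<..<t + e} \<in> null_sets lborel" by (subst (asm) AE_iff_null_sets[symmetric]) auto
  then show False using e(1) by (simp add: null_sets_def)
qed

end

section \<open>One mode: Young's inequality and fractional derivatives of the solution\<close>

context multiterm
begin

text \<open>The kernel times l has mass at most 1. By causality f may be restricted to times before
  t, which makes the estimate local in t.\<close>

lemma kern_young:
  assumes l: "l \<ge> 0" and f: "causal f" and t: "0 < t" "t \<le> T"
  shows "(\<integral>\<^sup>+s. ennreal ((l * convol (cut T (kern l)) f s)\<^sup>2) * indicator {..<t} s \<partial>lborel)
    \<le> (\<integral>\<^sup>+s. ennreal ((f s)\<^sup>2) * indicator {..<t} s \<partial>lborel)"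
proof -
  let ?k = "cut T (kern l)"
  let ?f = "\<lambda>s. indicator {..<t} s * f s"
  have [measurable]: "f \<in> borel_measurable borel" using f by (simp add: causal_def)
  have k: "causal ?k" using kern_causal by (auto intro: cut_causal)
  have [measurable]: "?k \<in> borel_measurable borel" using k by (simp add: causal_def)
  have lk: "(\<integral>\<^sup>+s. ennreal \<bar>l * ?k s\<bar> \<partial>lborel) \<le> 1"
  proof -
    have nn: "l * ?k s \<ge> 0" for s using l kern_nonneg[OF l, of s] by (simp add: cut_def)
    have "(\<integral>\<^sup>+s. ennreal \<bar>l * ?k s\<bar> \<partial>lborel) = ennreal (LINT s|lborel. l * ?k s)"
      using nn kern_cut_integrable by (subst nn_integral_eq_integral[symmetric]) (auto simp: abs_of_nonneg)
    also have "\<dots> \<le> ennreal 1" using kern_integral_le[OF l, of T] t by (intro ennreal_leI) simp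
    finally show ?thesis by simp
  qed
  have "(\<integral>\<^sup>+s. ennreal ((l * convol ?k f s)\<^sup>2) * indicator {..<t} s \<partial>lborel)
      \<le> (\<integral>\<^sup>+s. ennreal ((convol (\<lambda>s. l * ?k s) ?f s)\<^sup>2) \<partial>lborel)"
  proof (rule nn_integral_mono)
    fix s
    show "ennreal ((l * convol ?k f s)\<^sup>2) * indicator {..<t} s \<le> ennreal ((convol (\<lambda>s. l * ?k s) ?f s)\<^sup>2)"
    proof (cases "s < t")
      case True
      have "convol ?k f s = convol ?k ?f s"
        by (rule convol_cong_right[OF k, where T = t]) (use True in auto)
      moreover have "l * convol ?k ?f s = convol (\<lambda>s. l * ?k s) ?f s"
        by (simp add: convol_def mult.assoc)
      ultimately show ?thesis using True by simp
    qed simp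
  qed
  also have "\<dots> \<le> (\<integral>\<^sup>+s. ennreal \<bar>l * ?k s\<bar> \<partial>lborel)\<^sup>2 * (\<integral>\<^sup>+s. ennreal ((?f s)\<^sup>2) \<partial>lborel)"
    by (rule young_L2) measurable
  also have "\<dots> \<le> 1 * (\<integral>\<^sup>+s. ennreal ((?f s)\<^sup>2) \<partial>lborel)"
    using power_mono[OF lk, of 2] by (intro mult_right_mono) auto
  also have "\<dots> = (\<integral>\<^sup>+s. ennreal ((f s)\<^sup>2) * indicator {..<t} s \<partial>lborel)"
    by (auto simp: indicator_def intro!: nn_integral_cong)
  finally show ?thesis .
qed

context
  fixes T l :: real and f :: "real \<Rightarrow> real"
  assumes f: "integrable lborel f" "causal f"
begin

private abbreviation "k0 \<equiv> cut T (kern 0)"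
private abbreviation "k \<equiv> cut T (kern l)"
private abbreviation "one \<equiv> cut T (\<lambda>_::real. 1::real)"
private abbreviation "U \<equiv> convol k f"
text \<open>The residual f - l U, which will turn out to be the multi-term derivative of U.\<close>

private definition "F t = 1 * f t + (- l) * U t"

lemma solution_props: "integrable lborel U" "causal U" "integrable lborel F" "causal F"
  "integrable lborel k0" "causal k0" "integrable lborel k" "causal k"
proof -
  show k: "integrable lborel k" "integrable lborel k0" by (intro kern_cut_integrable)+
  show c: "causal k" "causal k0" using kern_causal by (auto intro: cut_causal)
  show U: "integrable lborel U" "causal U" using k c f by (auto intro: convol_integrable causal_convol)
  then show "integrable lborel F" "causal F" using f by (auto simp: F_def[abs_def] causal_def)
qed

text \<open>The resolvent identity convolved with f, rearranged by associativity.\<close>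

lemma solution_via_kern_0: "AE t in lborel. t < T \<longrightarrow> U t = convol k0 F t"
  using convol_lincomb[OF solution_props(5) f(1) solution_props(1), of 1 "- l"]
    convol_assoc[OF solution_props(5,7) f(1)]
    convol_lincomb[OF f(1) solution_props(7) convol_integrable[OF solution_props(5,7)], of 1 l]
proof eventually_elim
  case (elim t)
  show ?case
  proof
    assume t: "t < T"
    note [measurable] = solution_props(6,8)[THEN causal_measurable]
    have "convol k0 f t = convol (\<lambda>s. 1 * k s + l * convol k0 k s) f t"
      by (rule convol_cong_left[OF f(2), where T = T])
        (use resolvent_identity[of T l] t in \<open>auto elim!: eventually_mono\<close>)
    also have "\<dots> = convol k f t + l * convol (convol k0 k) f t"
      using elim(3) by (simp add: convol_commute[of _ f])
    finally show "U t = convol k0 F t"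
      using elim(1,2) by (simp add: F_def[abs_def])
  qed
qed

text \<open>Fractional integration of order 1 - \<open>\<gamma>\<close> turns \<open>kern 0\<close>
  into \<open>ml\<close> with parameter \<open>1 + (\<alpha> - \<gamma>)\<close>, which is the
  primitive of the one with parameter \<open>\<alpha> - \<gamma>\<close>. The latter is locally
  integrable precisely because \<open>\<gamma> < \<alpha>\<close>; convolving it with F exhibits the
  derivative.\<close>

private lemma fractional_kern_0:
  assumes \<gamma>: "0 < \<gamma>" "\<gamma> < \<alpha>"
  shows "AE t in lborel. t < T \<longrightarrow> convol (cut T (omega (1 - \<gamma>))) U t
    = convol one (convol (cut T (ml (cc 0) (\<alpha> - \<gamma>))) F) t"
proof -
  let ?w = "cut T (omega (1 - \<gamma>))" and ?h = "cut T (ml (cc 0) (\<alpha> - \<gamma>))"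
  have w: "integrable lborel ?w" "causal ?w" using \<gamma> \<alpha> by (auto intro: omega_cut_integrable cut_causal)
  have h: "integrable lborel ?h" "causal ?h" using \<gamma> by (auto intro: ml_cut_integrable cut_causal)
  note one = one_cut_integrable[of T] cut_one_causal[of T]
  note P = solution_props
  have wk: "convol ?w k0 t = convol one ?h t" if t: "t < T" for t
  proof -
    have "convol ?w k0 t = convol (omega (1 - \<gamma>)) (ml (cc 0) \<alpha>) t"
      unfolding kern_def by (rule convol_cut[OF omega_causal ml_causal]) (use t in simp)
    also have "\<dots> = ml (cc 0) (1 - \<gamma> + \<alpha>) t" by (rule omega_convol_ml) (use \<gamma> \<alpha> in auto)
    also have "\<dots> = convol (omega 1) (ml (cc 0) (\<alpha> - \<gamma>)) t"
      using omega_convol_ml(2)[of 1 "\<alpha> - \<gamma>" "cc 0" t] \<gamma> by (simp add: algebra_simps)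
    also have "\<dots> = convol one ?h t"
      unfolding cut_omega_one[symmetric] by (rule convol_cut[OF omega_causal ml_causal, symmetric]) (use t in simp)
    finally show ?thesis .
  qed
  note [measurable] = w(2)[THEN causal_measurable] h(2)[THEN causal_measurable] one(2)[THEN causal_measurable]
    P(2,4,6,8)[THEN causal_measurable]
  show ?thesis
    using convol_assoc[OF w(1) P(5,3)] convol_assoc[OF one(1) h(1) P(3)]
  proof eventually_elim
    case (elim t)
    show ?case
    proof
      assume t: "t < T"
      have "convol ?w U t = convol ?w (convol k0 F) t"
        by (rule convol_cong_right[OF w(2), where T = T]) (use solution_via_kern_0 t in auto)
      also have "\<dots> = convol (convol ?w k0) F t" by (rule elim(1))
      also have "\<dots> = convol (convol one ?h) F t"
        by (rule convol_cong_left[OF P(4), where T = T]) (use wk t in auto)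
      finally show "convol ?w U t = convol one (convol ?h F) t" using elim(2) by simp
    qed
  qed
qed

lemma fractional_derivative_lower:
  assumes "i \<in> {1..m}"
  shows "AE t in lborel. t < T \<longrightarrow> convol (cut T (omega (1 - a i))) (convol (cut T (kern l)) f) t
    = convol (cut T (\<lambda>_. 1)) (convol (cut T (ml (cc 0) (\<alpha> - a i))) (\<lambda>s. f s - l * convol (cut T (kern l)) f s)) t"
  using fractional_kern_0[OF a[OF assms]] by (simp add: F_def[abs_def])

text \<open>At order \<open>\<alpha>\<close> the parameter of the preceding argument would drop to
  0. Instead, convolving U with \<open>symb 0\<close> gives the primitive of F, since
  \<open>symb 0\<close> and \<open>kern 0\<close> convolve to 1; subtracting the lower-order
  primitives leaves the term of order \<open>\<alpha>\<close>.\<close>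

lemma fractional_derivative_leading:
  "AE t in lborel. t < T \<longrightarrow> convol (cut T (omega (1 - \<alpha>))) (convol (cut T (kern l)) f) t
    = convol (cut T (\<lambda>_. 1)) (\<lambda>s. f s - l * convol (cut T (kern l)) f s
       - (\<Sum>i=1..m. b i * convol (cut T (ml (cc 0) (\<alpha> - a i))) (\<lambda>s. f s - l * convol (cut T (kern l)) f s) s)) t"
proof -
  let ?w = "cut T (omega (1 - \<alpha>))" and ?v = "\<lambda>i. cut T (omega (1 - a i))"
  let ?h = "\<lambda>i. cut T (ml (cc 0) (\<alpha> - a i))"
  have w: "integrable lborel ?w" "causal ?w" using \<alpha> by (auto intro: omega_cut_integrable cut_causal)
  have v: "integrable lborel (?v i)" "causal (?v i)" if "i \<in> {1..m}" for i
    using \<alpha> a[OF that] by (auto intro: omega_cut_integrable cut_causal)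
  have h: "integrable lborel (?h i)" "causal (?h i)" if "i \<in> {1..m}" for i
    using a[OF that] by (auto intro: ml_cut_integrable cut_causal)
  note one = one_cut_integrable[of T] cut_one_causal[of T]
  note P = solution_props
  have g: "cut T (symb 0) = (\<lambda>s. ?w s + (\<Sum>i=1..m. b i * ?v i s))"
    by (auto simp: cut_def symb_def fun_eq_iff)
  have vU: "AE t in lborel. \<forall>i\<in>{1..m}. t < T \<longrightarrow> convol (?v i) U t = convol one (convol (?h i) F) t"
  proof (subst AE_finite_all, simp, intro ballI)
    fix i assume "i \<in> {1..m}"
    from fractional_kern_0[OF a[OF this]]
    show "AE t in lborel. t < T \<longrightarrow> convol (?v i) U t = convol one (convol (?h i) F) t" .
  qed
  have gk0: "convol (cut T (symb 0)) k0 t = one t" if "t < T" for t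
  proof (cases "t > 0")
    case True
    have "convol (cut T (symb 0)) k0 t = convol (symb 0) (kern 0) t"
      by (rule convol_cut[OF symb_causal kern_causal]) (use that in simp)
    then show ?thesis using symb_convol_kern(2)[OF True] True that by (simp add: cut_def)
  next
    case False
    have "causal (cut T (symb 0))" using symb_causal by (auto intro: cut_causal)
    then show ?thesis using False causal_zero[OF causal_convol[OF _ P(6)], of _ t] by (simp add: cut_def)
  qed
  have sc: "integrable lborel (cut T (symb 0))" "causal (cut T (symb 0))"
    using symb_cut_integrable symb_causal by (auto intro: cut_causal)
  note [measurable] = w(2)[THEN causal_measurable] one(2)[THEN causal_measurable] sc(2)[THEN causal_measurable]
    P(2,4,6,8)[THEN causal_measurable]
  have hF: "integrable lborel (\<lambda>s. \<Sum>i=1..m. b i * convol (?h i) F s)"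
    by (intro Bochner_Integration.integrable_sum integrable_mult_right convol_integrable h P)
  have sumU: "integrable lborel (\<lambda>s. \<Sum>i=1..m. b i * ?v i s)"
    by (intro Bochner_Integration.integrable_sum integrable_mult_right v)
  have s1: "AE t in lborel. convol U (\<lambda>s. \<Sum>i=1..m. b i * ?v i s) t = (\<Sum>i=1..m. b i * convol U (?v i) t)"
    by (rule convol_sum[OF P(1) v(1)]) auto
  have s2: "AE t in lborel. convol one (\<lambda>s. \<Sum>i=1..m. b i * convol (?h i) F s) t
      = (\<Sum>i=1..m. b i * convol one (convol (?h i) F) t)"
    by (rule convol_sum[OF one(1) convol_integrable[OF h(1) P(3)]]) auto
  have "AE t in lborel. t < T \<longrightarrow> convol ?w U t = convol one (\<lambda>s. 1 * F s + (-1) * (\<Sum>i=1..m. b i * convol (?h i) F s)) t"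
    using vU convol_assoc[OF sc(1) P(5,3)] convol_lincomb[OF P(1) w(1) sumU, of 1 1]
      s1 convol_lincomb[OF one(1) P(3) hF, of 1 "-1"] s2
  proof eventually_elim
    case (elim t)
    show ?case
    proof
      assume t: "t < T"
      have "convol (cut T (symb 0)) U t = convol (cut T (symb 0)) (convol k0 F) t"
        by (rule convol_cong_right[OF sc(2), where T = T]) (use solution_via_kern_0 t in auto)
      also have "\<dots> = convol (convol (cut T (symb 0)) k0) F t" by (rule elim(2))
      also have "\<dots> = convol one F t"
        by (rule convol_cong_left[OF P(4), where T = T]) (use gk0 t in auto)
      finally have 1: "convol one F t = convol U ?w t + convol U (\<lambda>s. \<Sum>i=1..m. b i * ?v i s) t"
        using elim(3) unfolding g by (simp add: convol_commute[of _ U])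
      have 2: "convol U (\<lambda>s. \<Sum>i=1..m. b i * ?v i s) t = (\<Sum>i=1..m. b i * convol one (convol (?h i) F) t)"
        unfolding elim(4)
        by (rule sum.cong[OF refl]) (use elim(1) t in \<open>simp add: convol_commute[of U]\<close>)
      show "convol ?w U t = convol one (\<lambda>s. 1 * F s + (-1) * (\<Sum>i=1..m. b i * convol (?h i) F s)) t"
        using 1 2 elim(5,6) by (simp add: convol_commute[of U])
    qed
  qed
  then show ?thesis by (simp add: F_def[abs_def])
qed

end

end

section \<open>Weighted square integrals in time\<close>

lemma AE_time_measure_iff: "(AE s in time_measure t. P s) \<longleftrightarrow> (AE s in lborel. 0 < s \<and> s < t \<longrightarrow> P s)"
  by (subst AE_restrict_space_iff) (auto simp: AE_completion_iff)

lemma measurable_time_measure: "f \<in> borel_measurable borel \<Longrightarrow> f \<in> borel_measurable (time_measure t)"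
  by (intro measurable_restrict_space1 measurable_completion) simp

lemma nn_integral_time_measure:
  assumes "f \<in> borel_measurable borel"
  shows "(\<integral>\<^sup>+s. f s \<partial>time_measure t) = (\<integral>\<^sup>+s. f s * indicator {0<..<t} s \<partial>lborel)"
  using assms by (subst nn_integral_restrict_space) (auto simp: nn_integral_completion)

lemma integral_time_measure:
  fixes f :: "real \<Rightarrow> real"
  assumes "f \<in> borel_measurable borel" "\<And>s. s \<notin> {0<..<t} \<Longrightarrow> f s = 0"
  shows "(LINT s|time_measure t. f s) = (LINT s|lborel. f s)"
proof -
  have e: "indicator {0<..<t} s * f s = f s" for s using assms(2)[of s] by (cases "s \<in> {0<..<t}") auto
  show ?thesis using assms(1)
    by (subst integral_restrict_space) (auto simp: e integral_completion)
qed

text \<open>Functions of time are measurable for the completed measure, while the convolution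
  calculus works with Borel functions on the line; the version also vanishes outside (0,T).\<close>

lemma borel_version:
  fixes h :: "real \<Rightarrow> real"
  assumes "h \<in> borel_measurable (time_measure T)"
  obtains h' where "causal h'" "\<And>t. t \<ge> T \<Longrightarrow> h' t = 0" "AE t in time_measure T. h t = h' t"
proof -
  have "(\<lambda>t. indicator {0<..<T} t *\<^sub>R h t) \<in> borel_measurable lebesgue"
    using assms by (subst (asm) borel_measurable_restrict_space_iff) auto
  from completion_ex_borel_measurable_real[OF this]
  obtain g where g: "g \<in> borel_measurable lborel" "AE t in lborel. indicator {0<..<T} t *\<^sub>R h t = g t" by blast
  show ?thesis
  proof (rule that[of "cut T g"])
    show "causal (cut T g)" using g by (intro cut_causal) simp
    show "AE t in time_measure T. h t = cut T g t"
      unfolding AE_time_measure_iff using g(2) by eventually_elim (auto simp: cut_def)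
  qed (simp add: cut_def)
qed

section \<open>Energies of coefficient families\<close>

definition supported :: "real \<Rightarrow> (nat \<Rightarrow> real \<Rightarrow> real) \<Rightarrow> bool" where
  "supported T c \<longleftrightarrow> (\<forall>j. causal (c j) \<and> (\<forall>t\<ge>T. c j t = 0))"

lemma supportedD: "supported T c \<Longrightarrow> causal (c j)" "supported T c \<Longrightarrow> t \<ge> T \<Longrightarrow> c j t = 0"
  "supported T c \<Longrightarrow> c j \<in> borel_measurable borel" "supported T c \<Longrightarrow> cut T (c j) = c j"
  by (auto simp: supported_def causal_def cut_def fun_eq_iff not_less)

lemma supported_cut: "(\<And>j. c j \<in> borel_measurable borel) \<Longrightarrow> supported T (\<lambda>j. cut T (c j))"
  by (auto simp: supported_def intro: cut_causal) (simp add: cut_def)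

text \<open>The square of the norm in time and space, with values in \<open>ennreal\<close> so that
  it makes sense before any summability or integrability is known.\<close>

definition energy :: "(nat \<Rightarrow> real) \<Rightarrow> (nat \<Rightarrow> real \<Rightarrow> real) \<Rightarrow> real \<Rightarrow> ennreal" where
  "energy v c t = (\<integral>\<^sup>+s. (\<Sum>j. ennreal (v j * (c j s)\<^sup>2)) * indicator {..<t} s \<partial>lborel)"

lemma energy_eq:
  assumes v: "\<And>j. v j \<ge> 0" and c: "\<And>j. c j \<in> borel_measurable borel"
  shows "energy v c t = (\<Sum>j. ennreal (v j) * (\<integral>\<^sup>+s. ennreal ((c j s)\<^sup>2) * indicator {..<t} s \<partial>lborel))"
proof -
  note [measurable] = c
  have "energy v c t = (\<integral>\<^sup>+s. (\<Sum>j. ennreal (v j) * (ennreal ((c j s)\<^sup>2) * indicator {..<t} s)) \<partial>lborel)"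
    unfolding energy_def using v by (intro nn_integral_cong) (simp add: ennreal_mult mult.assoc[symmetric])
  also have "\<dots> = (\<Sum>j. \<integral>\<^sup>+s. ennreal (v j) * (ennreal ((c j s)\<^sup>2) * indicator {..<t} s) \<partial>lborel)"
    by (rule nn_integral_suminf) measurable
  also have "\<dots> = (\<Sum>j. ennreal (v j) * (\<integral>\<^sup>+s. ennreal ((c j s)\<^sup>2) * indicator {..<t} s \<partial>lborel))"
    by (intro suminf_cong nn_integral_cmult) measurable
  finally show ?thesis .
qed

text \<open>Sum and integral of nonnegative terms commute, so an estimate mode by mode suffices once
  its constant K does not depend on j.\<close>

lemma energy_mono:
  assumes v: "\<And>j. v j \<ge> 0" "\<And>j. v' j \<ge> 0" and K: "K \<ge> 0"
    and c: "\<And>j. c j \<in> borel_measurable borel" "\<And>j. d j \<in> borel_measurable borel"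
    and le: "\<And>j. (\<integral>\<^sup>+s. ennreal (v j * (d j s)\<^sup>2) * indicator {..<t} s \<partial>lborel)
       \<le> ennreal K * (\<integral>\<^sup>+s. ennreal (v' j * (c j s)\<^sup>2) * indicator {..<t} s \<partial>lborel)"
  shows "energy v d t \<le> ennreal K * energy v' c t"
proof -
  have e: "energy v c t = (\<Sum>j. (\<integral>\<^sup>+s. ennreal (v j * (c j s)\<^sup>2) * indicator {..<t} s \<partial>lborel))"
    if v: "\<And>j. v j \<ge> 0" and c [measurable]: "\<And>j. c j \<in> borel_measurable borel" for v c
  proof -
    have "(\<integral>\<^sup>+s. ennreal (v j * (c j s)\<^sup>2) * indicator {..<t} s \<partial>lborel)
       = ennreal (v j) * (\<integral>\<^sup>+s. ennreal ((c j s)\<^sup>2) * indicator {..<t} s \<partial>lborel)" for j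
      using v by (subst nn_integral_cmult[symmetric]) (auto simp: ennreal_mult mult.assoc)
    then show ?thesis by (simp add: energy_eq[OF that])
  qed
  show ?thesis
    unfolding e[OF v(1) c(2)] e[OF v(2) c(1)] ennreal_suminf_cmult[symmetric]
    by (intro suminf_le le) auto
qed

lemma energy_mono_time: "s \<le> t \<Longrightarrow> energy v c s \<le> energy v c t"
  unfolding energy_def by (intro nn_integral_mono mult_left_mono) (auto simp: indicator_def)

lemma energy_supported:
  assumes "supported T c" and "T \<le> t"
  shows "energy v c t = (\<integral>\<^sup>+s. (\<Sum>j. ennreal (v j * (c j s)\<^sup>2)) \<partial>lborel)"
  unfolding energy_def
proof (rule nn_integral_cong)
  fix s
  show "(\<Sum>j. ennreal (v j * (c j s)\<^sup>2)) * indicator {..<t} s = (\<Sum>j. ennreal (v j * (c j s)\<^sup>2))"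
    using supportedD(2)[OF assms(1), of s] assms(2) by (cases "s < t") auto
qed

lemma energy_finite_AE:
  assumes v: "\<And>j. v j \<ge> 0" and c: "supported T c" and fin: "energy v c T < \<infinity>"
  shows "AE t in lborel. wsummable v (\<lambda>j. c j t)"
proof -
  note [measurable] = supportedD(3)[OF c]
  have "AE t in lborel. (\<Sum>j. ennreal (v j * (c j t)\<^sup>2)) \<noteq> \<infinity>"
    by (rule nn_integral_PInf_AE) (use fin energy_supported[OF c order_refl] in auto)
  then show ?thesis
    by eventually_elim (auto simp: wsummable_def intro!: summable_suminf_not_top mult_nonneg_nonneg v)
qed

text \<open>On a bounded interval square integrability implies integrability, because a norm is at
  most 1 plus its square.\<close>

lemma wnorm_integrable:
  assumes v: "\<And>j. v j \<ge> 0" and c: "supported T c" and fin: "energy v c T < \<infinity>"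
  shows "integrable lborel (\<lambda>t. wnorm v (\<lambda>j. c j t))"
proof (rule integrableI_bounded)
  note [measurable] = supportedD(3)[OF c]
  show "(\<lambda>t. wnorm v (\<lambda>j. c j t)) \<in> borel_measurable lborel" unfolding wnorm_def by measurable
  have "(\<integral>\<^sup>+t. ennreal (norm (wnorm v (\<lambda>j. c j t))) \<partial>lborel)
     \<le> (\<integral>\<^sup>+t. indicator {0<..<T} t + (\<Sum>j. ennreal (v j * (c j t)\<^sup>2)) \<partial>lborel)"
  proof (rule nn_integral_mono_AE)
    show "AE t in lborel. ennreal (norm (wnorm v (\<lambda>j. c j t))) \<le> indicator {0<..<T} t + (\<Sum>j. ennreal (v j * (c j t)\<^sup>2))"
      using energy_finite_AE[OF assms]
    proof eventually_elim
      case (elim t)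
      show ?case
      proof (cases "t \<in> {0<..<T}")
        case True
        let ?n = "wnorm v (\<lambda>j. c j t)"
        have n0: "?n \<ge> 0" by (rule wnorm_nonneg[OF v elim])
        have "0 \<le> (\<Sum>j. v j * (c j t)\<^sup>2)" using elim v by (auto simp: wsummable_def intro!: suminf_nonneg)
        then have n2: "?n\<^sup>2 = (\<Sum>j. v j * (c j t)\<^sup>2)" by (simp add: wnorm_def)
        have "?n \<le> 1 + ?n\<^sup>2" using sum_squares_bound[of 1 ?n] n0 by (simp add: power2_eq_square)
        then have "ennreal ?n \<le> ennreal (1 + ?n\<^sup>2)" by (rule ennreal_leI)
        also have "\<dots> = 1 + ennreal (\<Sum>j. v j * (c j t)\<^sup>2)" by (simp add: n2[symmetric])
        also have "ennreal (\<Sum>j. v j * (c j t)\<^sup>2) = (\<Sum>j. ennreal (v j * (c j t)\<^sup>2))"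
          using elim v by (intro suminf_ennreal2[symmetric]) (auto simp: wsummable_def)
        finally show ?thesis using True n0 by simp
      next
        case False
        then have "c j t = 0" for j using supportedD(1,2)[OF c] by (auto simp: causal_def not_less)
        then show ?thesis by (simp add: wnorm_def)
      qed
    qed
  qed
  also have "\<dots> = (\<integral>\<^sup>+t. indicator {0<..<T} t \<partial>lborel) + energy v c T"
    by (subst nn_integral_add) (auto simp: energy_supported[OF c order_refl])
  also have "\<dots> < \<infinity>" using fin emeasure_bounded_finite[of "{0<..<T}"] by (simp add: less_top)
  finally show "(\<integral>\<^sup>+t. ennreal (norm (wnorm v (\<lambda>j. c j t))) \<partial>lborel) < \<infinity>" .
qed

lemma component_integrable:
  assumes v: "\<And>j. v j > 0" and c: "supported T c" and fin: "energy v c T < \<infinity>"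
  shows "integrable lborel (c j)"
proof (rule integrable_cong_AE_imp)
  note [measurable] = supportedD(3)[OF c]
  have v0: "v j \<ge> 0" for j using v[of j] by simp
  show "integrable lborel (\<lambda>t. c j t)"
  proof (rule Bochner_Integration.integrable_bound)
    show "integrable lborel (\<lambda>t. wnorm v (\<lambda>j. c j t) / sqrt (v j))"
      using wnorm_integrable[OF v0 c fin] by simp
    show "AE t in lborel. norm (c j t) \<le> norm (wnorm v (\<lambda>j. c j t) / sqrt (v j))"
      using energy_finite_AE[OF v0 c fin]
    proof eventually_elim
      case (elim t)
      have "\<bar>c j t\<bar> \<le> wnorm v (\<lambda>j. c j t) / sqrt (v j)" by (rule component_le_wnorm[OF v elim])
      then show ?case unfolding real_norm_def by (rule order_trans[OF _ abs_ge_self])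
    qed
  qed measurable
qed (use supportedD(3)[OF c] in auto)

lemma energy_add_finite:
  assumes v: "\<And>j. v j \<ge> 0" and c: "\<And>j. c j \<in> borel_measurable borel" "\<And>j. d j \<in> borel_measurable borel"
    and fin: "energy v c t < \<infinity>" "energy v d t < \<infinity>"
  shows "energy v (\<lambda>j s. c j s + d j s) t < \<infinity>"
proof -
  note [measurable] = c
  have "energy v (\<lambda>j s. c j s + d j s) t \<le> (\<integral>\<^sup>+s. (2 * ((\<Sum>j. ennreal (v j * (c j s)\<^sup>2)) * indicator {..<t} s)
      + 2 * ((\<Sum>j. ennreal (v j * (d j s)\<^sup>2)) * indicator {..<t} s)) \<partial>lborel)"
    unfolding energy_def
  proof (rule nn_integral_mono)
    fix s
    have le: "ennreal (v j * (c j s + d j s)\<^sup>2) \<le> 2 * ennreal (v j * (c j s)\<^sup>2) + 2 * ennreal (v j * (d j s)\<^sup>2)" for j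
    proof -
      have "(c j s + d j s)\<^sup>2 \<le> 2 * (c j s)\<^sup>2 + 2 * (d j s)\<^sup>2"
        using sum_squares_bound[of "c j s" "d j s"] by (simp add: power2_sum)
      from mult_left_mono[OF this v[of j]]
      have "ennreal (v j * (c j s + d j s)\<^sup>2) \<le> ennreal (2 * (v j * (c j s)\<^sup>2) + 2 * (v j * (d j s)\<^sup>2))"
        by (intro ennreal_leI) (simp add: algebra_simps)
      also have "\<dots> = 2 * ennreal (v j * (c j s)\<^sup>2) + 2 * ennreal (v j * (d j s)\<^sup>2)"
        using v by (simp add: ennreal_plus ennreal_mult' del: ennreal_plus[symmetric])
      finally show ?thesis .
    qed
    have "(\<Sum>j. ennreal (v j * (c j s + d j s)\<^sup>2)) \<le> (\<Sum>j. 2 * ennreal (v j * (c j s)\<^sup>2) + 2 * ennreal (v j * (d j s)\<^sup>2))"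
      by (intro suminf_le le) auto
    also have "\<dots> = 2 * (\<Sum>j. ennreal (v j * (c j s)\<^sup>2)) + 2 * (\<Sum>j. ennreal (v j * (d j s)\<^sup>2))"
      by (simp add: suminf_add[symmetric] ennreal_suminf_cmult)
    finally have "(\<Sum>j. ennreal (v j * (c j s + d j s)\<^sup>2)) * indicator {..<t} s
       \<le> (2 * (\<Sum>j. ennreal (v j * (c j s)\<^sup>2)) + 2 * (\<Sum>j. ennreal (v j * (d j s)\<^sup>2))) * indicator {..<t} s"
      by (rule mult_right_mono) simp
    then show "(\<Sum>j. ennreal (v j * (c j s + d j s)\<^sup>2)) * indicator {..<t} s
       \<le> 2 * ((\<Sum>j. ennreal (v j * (c j s)\<^sup>2)) * indicator {..<t} s)
      + 2 * ((\<Sum>j. ennreal (v j * (d j s)\<^sup>2)) * indicator {..<t} s)"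
      by (simp add: distrib_right mult.assoc)
  qed
  also have "\<dots> = 2 * energy v c t + 2 * energy v d t"
    unfolding energy_def by (simp add: nn_integral_add nn_integral_cmult)
  also have "\<dots> < \<infinity>" using fin by (simp add: ennreal_mult_less_top)
  finally show ?thesis .
qed

lemma energy_scale_finite:
  assumes v: "\<And>j. v j \<ge> 0" and c: "\<And>j. c j \<in> borel_measurable borel" and fin: "energy v c t < \<infinity>"
  shows "energy v (\<lambda>j s. r * c j s) t < \<infinity>"
proof -
  note [measurable] = c
  have "energy v (\<lambda>j s. r * c j s) t \<le> ennreal (r\<^sup>2) * energy v c t"
  proof (rule energy_mono[OF v v])
    fix j
    have "(\<integral>\<^sup>+s. ennreal (v j * (r * c j s)\<^sup>2) * indicator {..<t} s \<partial>lborel)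
      = (\<integral>\<^sup>+s. ennreal (r\<^sup>2) * (ennreal (v j * (c j s)\<^sup>2) * indicator {..<t} s) \<partial>lborel)"
    proof (rule nn_integral_cong)
      fix s
      have "v j * (r * c j s)\<^sup>2 = r\<^sup>2 * (v j * (c j s)\<^sup>2)" by (simp add: power_mult_distrib)
      then have "ennreal (v j * (r * c j s)\<^sup>2) = ennreal (r\<^sup>2) * ennreal (v j * (c j s)\<^sup>2)"
        by (simp only: ennreal_mult' zero_le_power2)
      then show "ennreal (v j * (r * c j s)\<^sup>2) * indicator {..<t} s = ennreal (r\<^sup>2) * (ennreal (v j * (c j s)\<^sup>2) * indicator {..<t} s)"
        by (simp only: mult.assoc)
    qed
    then show "(\<integral>\<^sup>+s. ennreal (v j * (r * c j s)\<^sup>2) * indicator {..<t} s \<partial>lborel)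
      \<le> ennreal (r\<^sup>2) * (\<integral>\<^sup>+s. ennreal (v j * (c j s)\<^sup>2) * indicator {..<t} s \<partial>lborel)"
      by (simp add: nn_integral_cmult)
  qed auto
  also have "\<dots> < \<infinity>" using fin by (simp add: ennreal_mult_less_top)
  finally show ?thesis .
qed

lemma energy_sum_finite:
  assumes v: "\<And>j. v j \<ge> 0" and A: "finite A"
    and c: "\<And>i j. i \<in> A \<Longrightarrow> c i j \<in> borel_measurable borel" and fin: "\<And>i. i \<in> A \<Longrightarrow> energy v (c i) t < \<infinity>"
  shows "energy v (\<lambda>j s. \<Sum>i\<in>A. r i * c i j s) t < \<infinity>"
  using A c fin
proof (induction A rule: finite_induct)
  case empty
  then show ?case by (simp add: energy_def)
next
  case (insert x A)
  have [measurable]: "\<And>i j. i \<in> A \<Longrightarrow> c i j \<in> borel_measurable borel" "\<And>j. c x j \<in> borel_measurable borel"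
    using insert.prems by auto
  have "energy v (\<lambda>j s. r x * c x j s + (\<Sum>i\<in>A. r i * c i j s)) t < \<infinity>"
  proof (rule energy_add_finite[OF v])
    show "(\<lambda>s. r x * c x j s) \<in> borel_measurable borel" for j by measurable
    show "(\<lambda>s. \<Sum>i\<in>A. r i * c i j s) \<in> borel_measurable borel" for j by measurable
    show "energy v (\<lambda>j s. r x * c x j s) t < \<infinity>" by (rule energy_scale_finite[OF v insert.prems]) auto
    show "energy v (\<lambda>j s. \<Sum>i\<in>A. r i * c i j s) t < \<infinity>" by (rule insert.IH[OF insert.prems]) auto
  qed
  moreover have "(\<lambda>j s. \<Sum>i\<in>insert x A. r i * c i j s) = (\<lambda>j s. r x * c x j s + (\<Sum>i\<in>A. r i * c i j s))"
    using insert.hyps by (intro ext) simp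
  ultimately show ?case by (simp only:)
qed

text \<open>Young's inequality in each mode; the common majorant \<open>k0\<close> makes the
  constant \<open>K\<^sup>2\<close> independent of the mode.\<close>

lemma energy_convol:
  assumes v: "\<And>j. v j \<ge> 0" and c: "supported T c" and k: "\<And>j. causal (k j)"
    and k0: "integrable lborel k0" "\<And>j t. \<bar>k j t\<bar> \<le> k0 t" and fin: "energy v c T < \<infinity>"
  shows "energy v (\<lambda>j. cut T (convol (k j) (c j))) T < \<infinity>"
proof -
  note [measurable] = supportedD(3)[OF c] k[THEN causal_measurable]
  define K where "K = (LINT t|lborel. k0 t)"
  have k00: "k0 t \<ge> 0" for t using k0(2)[of undefined t] by (meson abs_ge_zero order_trans)
  have K0: "K \<ge> 0" unfolding K_def by (intro integral_nonneg_AE) (simp add: k00)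
  have "energy v (\<lambda>j. cut T (convol (k j) (c j))) T \<le> ennreal (K\<^sup>2) * energy v c T"
  proof (rule energy_mono[OF v v])
    fix j
    show "cut T (convol (k j) (c j)) \<in> borel_measurable borel" "c j \<in> borel_measurable borel"
      using cut_causal[of "convol (k j) (c j)" T] by (auto simp: causal_def)
    have "(\<integral>\<^sup>+t. ennreal \<bar>k j t\<bar> \<partial>lborel) \<le> (\<integral>\<^sup>+t. ennreal (k0 t) \<partial>lborel)"
      by (intro nn_integral_mono ennreal_leI k0)
    also have "\<dots> = ennreal K" unfolding K_def by (rule nn_integral_eq_integral[OF k0(1)]) (simp add: k00)
    finally have kK: "(\<integral>\<^sup>+t. ennreal \<bar>k j t\<bar> \<partial>lborel)\<^sup>2 \<le> (ennreal K)\<^sup>2" by (rule power_mono) simp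
    have "(\<integral>\<^sup>+s. ennreal (v j * (cut T (convol (k j) (c j)) s)\<^sup>2) * indicator {..<T} s \<partial>lborel)
       \<le> (\<integral>\<^sup>+s. ennreal (v j) * ennreal ((convol (k j) (c j) s)\<^sup>2) \<partial>lborel)"
      using v by (intro nn_integral_mono) (auto simp: cut_def indicator_def ennreal_mult'[symmetric])
    also have "\<dots> = ennreal (v j) * (\<integral>\<^sup>+s. ennreal ((convol (k j) (c j) s)\<^sup>2) \<partial>lborel)"
      by (rule nn_integral_cmult) measurable
    also have "\<dots> \<le> ennreal (v j) * ((\<integral>\<^sup>+t. ennreal \<bar>k j t\<bar> \<partial>lborel)\<^sup>2 * (\<integral>\<^sup>+s. ennreal ((c j s)\<^sup>2) \<partial>lborel))"
      by (intro mult_left_mono young_L2) auto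
    also have "\<dots> \<le> ennreal (v j) * ((ennreal K)\<^sup>2 * (\<integral>\<^sup>+s. ennreal ((c j s)\<^sup>2) \<partial>lborel))"
      by (intro mult_left_mono mult_right_mono kK) auto
    also have "\<dots> = ennreal (K\<^sup>2) * (\<integral>\<^sup>+s. ennreal (v j) * ennreal ((c j s)\<^sup>2) \<partial>lborel)"
      using K0 by (subst nn_integral_cmult) (auto simp: ennreal_power mult_ac)
    also have "(\<integral>\<^sup>+s. ennreal (v j) * ennreal ((c j s)\<^sup>2) \<partial>lborel) = (\<integral>\<^sup>+s. ennreal (v j * (c j s)\<^sup>2) * indicator {..<T} s \<partial>lborel)"
    proof (rule nn_integral_cong)
      fix s
      show "ennreal (v j) * ennreal ((c j s)\<^sup>2) = ennreal (v j * (c j s)\<^sup>2) * indicator {..<T} s"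
        using supportedD(2)[OF c, of s j] v[of j] by (cases "s < T") (auto simp: ennreal_mult')
    qed
    finally show "(\<integral>\<^sup>+s. ennreal (v j * (cut T (convol (k j) (c j)) s)\<^sup>2) * indicator {..<T} s \<partial>lborel)
       \<le> ennreal (K\<^sup>2) * (\<integral>\<^sup>+s. ennreal (v j * (c j s)\<^sup>2) * indicator {..<T} s \<partial>lborel)" .
  qed simp
  also have "\<dots> < \<infinity>" using fin by (simp add: ennreal_mult_less_top)
  finally show ?thesis .
qed

section \<open>Integrals and norms of functionals in terms of coefficients\<close>

context dirichlet
begin

lemma powr_nonneg: "lam j powr s \<ge> 0"
  by simp

lemma wnorm_hw_le:
  assumes "s \<ge> -1"
  obtains K where "K \<ge> 0" "\<And>c. wsummable (\<lambda>j. lam j powr s) c \<Longrightarrow> wnorm hw c \<le> K * wnorm (\<lambda>j. lam j powr s) c"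
proof -
  obtain K where K: "K > 0" "\<And>j. hw j \<le> K * lam j powr s" using hw_le[OF assms] by blast
  show ?thesis
  proof (rule that[of "sqrt K"])
    fix c assume "wsummable (\<lambda>j. lam j powr s) c"
    from real_sqrt_le_mono[OF wsummable_weight(2)[OF hw_nonneg K(2) this]]
    show "wnorm hw c \<le> sqrt K * wnorm (\<lambda>j. lam j powr s) c" by (simp add: wnorm_def real_sqrt_mult)
  qed (use K(1) in simp)
qed

text \<open>The exceptional times are those at which the scalar convolution of \<open>k0\<close>
  with the norm of the coefficients fails to be integrable. The integrands of interest change with
  t, so the quantifier over g stands inside the almost-everywhere statement.\<close>

lemma has_Hm1_integral_convol:
  assumes s: "s \<ge> -1" and c: "supported T c" and fin: "energy (\<lambda>j. lam j powr s) c T < \<infinity>"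
    and k: "\<And>j. causal (k j)" and k0: "integrable lborel k0" "\<And>j t. \<bar>k j t\<bar> \<le> k0 t"
  shows "AE t in time_measure T. \<forall>g. (AE r in time_measure t. g r = S (\<lambda>j. k j (t - r) * c j r)) \<longrightarrow>
    has_Hm1_integral \<Omega> (time_measure t) g (S (\<lambda>j. convol (k j) (c j) t))"
proof -
  let ?v = "\<lambda>j. lam j powr s"
  let ?n = "\<lambda>r. wnorm ?v (\<lambda>j. c j r)"
  note [measurable] = supportedD(3)[OF c] k[THEN causal_measurable]
  have [measurable]: "k0 \<in> borel_measurable borel" using k0(1) by auto
  obtain K where K: "K \<ge> 0" "\<And>c. wsummable ?v c \<Longrightarrow> wnorm hw c \<le> K * wnorm ?v c"
    using wnorm_hw_le[OF s] by blast
  have sm: "AE r in lborel. wsummable ?v (\<lambda>j. c j r)" by (rule energy_finite_AE[OF powr_nonneg c fin])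
  have n: "integrable lborel ?n" by (rule wnorm_integrable[OF powr_nonneg c fin])
  have "AE t in lborel. integrable lborel (\<lambda>r. k0 (t - r) * ?n r)" by (rule convol_AE_integrable[OF k0(1) n])
  then show ?thesis unfolding AE_time_measure_iff[where t = T]
  proof eventually_elim
    case (elim t)
    show ?case
    proof (intro impI allI)
      fix g assume t: "0 < t \<and> t < T" and g: "AE r in time_measure t. g r = S (\<lambda>j. k j (t - r) * c j r)"
      have dom: "wsummable ?v (\<lambda>j. k j (t - r) * c j r)" "wnorm ?v (\<lambda>j. k j (t - r) * c j r) \<le> k0 (t - r) * ?n r"
        if "wsummable ?v (\<lambda>j. c j r)" for r
      proof -
        have k00: "0 \<le> k0 (t - r)" using k0(2)[of undefined "t - r"] by linarith
        have le: "\<bar>k j (t - r) * c j r\<bar> \<le> k0 (t - r) * \<bar>c j r\<bar>" for j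
          unfolding abs_mult by (rule mult_right_mono[OF k0(2)]) simp
        show "wsummable ?v (\<lambda>j. k j (t - r) * c j r)" "wnorm ?v (\<lambda>j. k j (t - r) * c j r) \<le> k0 (t - r) * ?n r"
          by (rule wsummable_dominated[OF powr_nonneg le k00 that])+
      qed
      have "has_Hm1_integral \<Omega> (time_measure t) g (S (\<lambda>j. LINT r|time_measure t. k j (t - r) * c j r))"
      proof (rule has_Hm1_integral_S(1)[OF time_measure_props _ _ g])
        show "(\<lambda>r. k j (t - r) * c j r) \<in> borel_measurable (time_measure t)" for j
          by (rule measurable_time_measure) measurable
        show "AE r in time_measure t. wsummable hw (\<lambda>j. k j (t - r) * c j r)"
          unfolding AE_time_measure_iff using sm by eventually_elim (blast intro: wsummable_hw[OF s] dom)
        have "(\<integral>\<^sup>+r. ennreal (wnorm hw (\<lambda>j. k j (t - r) * c j r)) \<partial>time_measure t)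
           = (\<integral>\<^sup>+r. ennreal (wnorm hw (\<lambda>j. k j (t - r) * c j r)) * indicator {0<..<t} r \<partial>lborel)"
          by (rule nn_integral_time_measure) (unfold wnorm_def, measurable)
        also have "\<dots> \<le> (\<integral>\<^sup>+r. ennreal (norm (K * (k0 (t - r) * ?n r))) \<partial>lborel)"
        proof (rule nn_integral_mono_AE)
          show "AE r in lborel. ennreal (wnorm hw (\<lambda>j. k j (t - r) * c j r)) * indicator {0<..<t} r
            \<le> ennreal (norm (K * (k0 (t - r) * ?n r)))"
            using sm
          proof eventually_elim
            case (elim r)
            have "wnorm hw (\<lambda>j. k j (t - r) * c j r) \<le> K * wnorm ?v (\<lambda>j. k j (t - r) * c j r)"
              by (rule K(2)[OF dom(1)[OF elim]])
            also have "\<dots> \<le> K * (k0 (t - r) * ?n r)" by (rule mult_left_mono[OF dom(2)[OF elim] K(1)])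
            also have "\<dots> \<le> norm (K * (k0 (t - r) * ?n r))" by simp
            finally show ?case by (auto simp: indicator_def intro: ennreal_leI)
          qed
        qed
        also have "\<dots> < \<infinity>" using integrable_mult_right[OF elim, of K] unfolding integrable_iff_bounded by blast
        finally show "(\<integral>\<^sup>+r. ennreal (wnorm hw (\<lambda>j. k j (t - r) * c j r)) \<partial>time_measure t) < \<infinity>" .
      qed
      moreover have "(LINT r|time_measure t. k j (t - r) * c j r) = convol (k j) (c j) t" for j
        unfolding convol_def
      proof (rule integral_time_measure)
        fix r assume "r \<notin> {0<..<t}"
        then show "k j (t - r) * c j r = 0"
          using causal_zero[OF k, of "t - r" j] causal_zero[OF supportedD(1)[OF c], of r j] by force
      qed measurable
      ultimately show "has_Hm1_integral \<Omega> (time_measure t) g (S (\<lambda>j. convol (k j) (c j) t))" by simp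
    qed
  qed
qed

lemma has_Hm1_integral_coeffs:
  assumes s: "s \<ge> -1" and c: "supported T c" and fin: "energy (\<lambda>j. lam j powr s) c T < \<infinity>"
    and g: "AE r in time_measure T. g r = S (\<lambda>j. c j r)" and t: "t \<le> T"
  shows "has_Hm1_integral \<Omega> (time_measure t) g (S (\<lambda>j. convol (cut T (\<lambda>_. 1)) (c j) t))"
proof -
  let ?v = "\<lambda>j. lam j powr s"
  let ?n = "\<lambda>r. wnorm ?v (\<lambda>j. c j r)"
  note [measurable] = supportedD(3)[OF c]
  obtain K where K: "K \<ge> 0" "\<And>c. wsummable ?v c \<Longrightarrow> wnorm hw c \<le> K * wnorm ?v c"
    using wnorm_hw_le[OF s] by blast
  have sm: "AE r in lborel. wsummable ?v (\<lambda>j. c j r)" by (rule energy_finite_AE[OF powr_nonneg c fin])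
  have n: "integrable lborel ?n" by (rule wnorm_integrable[OF powr_nonneg c fin])
  have "has_Hm1_integral \<Omega> (time_measure t) g (S (\<lambda>j. LINT r|time_measure t. c j r))"
  proof (rule has_Hm1_integral_S(1)[OF time_measure_props _ _ AE_time_measure_mono[OF g t]])
    show "(\<lambda>r. c j r) \<in> borel_measurable (time_measure t)" for j
      by (rule measurable_time_measure) measurable
    show "AE r in time_measure t. wsummable hw (\<lambda>j. c j r)"
      unfolding AE_time_measure_iff using sm by eventually_elim (blast intro: wsummable_hw[OF s])
    have "(\<integral>\<^sup>+r. ennreal (wnorm hw (\<lambda>j. c j r)) \<partial>time_measure t)
       = (\<integral>\<^sup>+r. ennreal (wnorm hw (\<lambda>j. c j r)) * indicator {0<..<t} r \<partial>lborel)"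
      by (rule nn_integral_time_measure) (unfold wnorm_def, measurable)
    also have "\<dots> \<le> (\<integral>\<^sup>+r. ennreal (norm (K * ?n r)) \<partial>lborel)"
    proof (rule nn_integral_mono_AE)
      show "AE r in lborel. ennreal (wnorm hw (\<lambda>j. c j r)) * indicator {0<..<t} r \<le> ennreal (norm (K * ?n r))"
        using sm
      proof eventually_elim
        case (elim r)
        have "wnorm hw (\<lambda>j. c j r) \<le> K * ?n r" by (rule K(2)[OF elim])
        also have "\<dots> \<le> norm (K * ?n r)" by simp
        finally show ?case by (auto simp: indicator_def intro: ennreal_leI)
      qed
    qed
    also have "\<dots> < \<infinity>" using integrable_mult_right[OF n, of K] unfolding integrable_iff_bounded by blast
    finally show "(\<integral>\<^sup>+r. ennreal (wnorm hw (\<lambda>j. c j r)) \<partial>time_measure t) < \<infinity>" .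
  qed
  moreover have "(LINT r|time_measure t. c j r) = convol (cut T (\<lambda>_. 1)) (c j) t" for j
  proof -
    have "(LINT r|time_measure t. c j r) = (LINT r|time_measure t. cut T (\<lambda>_. 1) (t - r) * c j r)"
      by (rule Bochner_Integration.integral_cong) (use t in \<open>auto simp: cut_def\<close>)
    also have "\<dots> = convol (cut T (\<lambda>_. 1)) (c j) t"
      unfolding convol_def
    proof (rule integral_time_measure)
      show "(\<lambda>r. cut T (\<lambda>_. 1) (t - r) * c j r) \<in> borel_measurable borel" unfolding cut_def by measurable
      fix r assume "r \<notin> {0<..<t}"
      then show "cut T (\<lambda>_. 1) (t - r) * c j r = 0"
        using causal_zero[OF supportedD(1)[OF c], of r j] by (auto simp: cut_def)
    qed
    finally show ?thesis .
  qed
  ultimately show ?thesis by simp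
qed

context
  fixes s T :: real and c :: "nat \<Rightarrow> real \<Rightarrow> real" and g :: "real \<Rightarrow> 'd functional"
  assumes s: "s \<ge> -1" and c: "supported T c" and fin: "energy (\<lambda>j. lam j powr s) c T < \<infinity>"
    and g: "AE r in time_measure T. \<forall>j. g r (\<phi> j) = c j r"
begin

text \<open>The squared norm of g agrees almost everywhere with the Borel function D, and
  completeness of the measure transfers measurability to it.\<close>

lemma Hdot_norm_square_integral:
  assumes t: "t \<le> T"
  shows "integrable (time_measure t) (\<lambda>r. (Hdot_norm lam \<phi> s (g r))\<^sup>2)"
    "L2_time_norm t (Hdot_norm lam \<phi> s) g = sqrt (enn2real (energy (\<lambda>j. lam j powr s) c t))"
proof -
  note [measurable] = supportedD(3)[OF c]
  define D where "D r = (\<Sum>j. lam j powr s * (c j r)\<^sup>2)" for r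
  have [measurable]: "D \<in> borel_measurable borel" unfolding D_def by measurable
  have sm: "AE r in lborel. wsummable (\<lambda>j. lam j powr s) (\<lambda>j. c j r)" by (rule energy_finite_AE[OF powr_nonneg c fin])
  have smt: "AE r in time_measure t. wsummable (\<lambda>j. lam j powr s) (\<lambda>j. c j r)"
    unfolding AE_time_measure_iff using sm by eventually_elim simp
  have Dn: "D r \<ge> 0" if "wsummable (\<lambda>j. lam j powr s) (\<lambda>j. c j r)" for r
    unfolding D_def using that by (intro suminf_nonneg) (auto simp: wsummable_def)
  have HD: "AE r in time_measure t. D r = (Hdot_norm lam \<phi> s (g r))\<^sup>2"
    using smt AE_time_measure_mono[OF g t]
  proof eventually_elim
    case (elim r)
    show ?case using Dn[OF elim(1)] elim(2) by (simp add: Hdot_norm_def D_def)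
  qed
  have DM: "D \<in> borel_measurable (time_measure t)" by (rule measurable_time_measure) measurable
  have HM: "(\<lambda>r. (Hdot_norm lam \<phi> s (g r))\<^sup>2) \<in> borel_measurable (time_measure t)"
    by (rule complete_measure.measurable_AE_cong[OF time_measure_props(1) DM HD])
  have DE: "(\<integral>\<^sup>+r. ennreal (D r) \<partial>time_measure t) = energy (\<lambda>j. lam j powr s) c t"
  proof -
    have "(\<integral>\<^sup>+r. ennreal (D r) \<partial>time_measure t) = (\<integral>\<^sup>+r. ennreal (D r) * indicator {0<..<t} r \<partial>lborel)"
      by (rule nn_integral_time_measure) measurable
    also have "\<dots> = energy (\<lambda>j. lam j powr s) c t" unfolding energy_def
    proof (rule nn_integral_cong_AE)
      show "AE r in lborel. ennreal (D r) * indicator {0<..<t} r = (\<Sum>j. ennreal (lam j powr s * (c j r)\<^sup>2)) * indicator {..<t} r"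
        using sm
      proof eventually_elim
        case (elim r)
        have e: "(\<Sum>j. ennreal (lam j powr s * (c j r)\<^sup>2)) = ennreal (D r)"
          unfolding D_def using elim by (intro suminf_ennreal2) (auto simp: wsummable_def)
        show ?case
        proof (cases "r > 0")
          case True
          then show ?thesis by (simp add: e indicator_def)
        next
          case False
          then have "D r = 0" using causal_zero[OF supportedD(1)[OF c], of r] by (simp add: D_def)
          then show ?thesis by (simp add: e)
        qed
      qed
    qed
    finally show ?thesis .
  qed
  have Dfin: "energy (\<lambda>j. lam j powr s) c t < \<infinity>" using energy_mono_time[OF t] fin by (rule order.strict_trans1)
  have D0: "AE r in time_measure t. 0 \<le> D r" using smt by eventually_elim (rule Dn)
  have "integrable (time_measure t) D"
    by (rule integrableI_nonneg[OF DM D0]) (use DE Dfin in simp)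
  then show "integrable (time_measure t) (\<lambda>r. (Hdot_norm lam \<phi> s (g r))\<^sup>2)"
    using integrable_cong_AE[OF DM HM HD] by simp
  have "(LINT r|time_measure t. (Hdot_norm lam \<phi> s (g r))\<^sup>2) = (LINT r|time_measure t. D r)"
    by (rule integral_cong_AE[OF HM DM]) (use HD in \<open>eventually_elim, simp\<close>)
  also have "\<dots> = enn2real (energy (\<lambda>j. lam j powr s) c t)"
    using DE by (simp add: integral_eq_nn_integral[OF DM D0])
  finally show "L2_time_norm t (Hdot_norm lam \<phi> s) g = sqrt (enn2real (energy (\<lambda>j. lam j powr s) c t))"
    by (simp add: L2_time_norm_def)
qed

lemma L2_time_spaceI:
  assumes "AE r in time_measure T. g r \<in> Hm1_space \<Omega>"
  shows "g \<in> L2_time_space T (Hdot_space \<Omega> lam \<phi> s) (Hdot_norm lam \<phi> s)"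
proof -
  have "strongly_measurable_on (time_measure T) (Hdot_space \<Omega> lam \<phi> s) (Hdot_norm lam \<phi> s) g"
  proof (rule Hdot_strongly_measurable[OF s _ assms g])
    show "(\<lambda>t. c j t) \<in> borel_measurable (time_measure T)" for j
      by (rule measurable_time_measure) (rule supportedD(3)[OF c])
    show "AE t in time_measure T. wsummable (\<lambda>j. lam j powr s) (\<lambda>j. c j t)"
      unfolding AE_time_measure_iff using energy_finite_AE[OF powr_nonneg c fin] by eventually_elim simp
  qed
  then show ?thesis using Hdot_norm_square_integral(1)[OF order_refl] by (simp add: L2_time_space_def)
qed

end

text \<open>The passage from functionals to Borel functions of time: as there are countably many
  modes, one null set serves all of them.\<close>

lemma L2_time_space_coeffs:
  assumes f: "f \<in> L2_time_space T (Hdot_space \<Omega> lam \<phi> s) (Hdot_norm lam \<phi> s)"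
  obtains c where "supported T c" "AE r in time_measure T. \<forall>j. f r (\<phi> j) = c j r" "energy (\<lambda>j. lam j powr s) c T < \<infinity>"
proof -
  have sm: "strongly_measurable_on (time_measure T) (Hdot_space \<Omega> lam \<phi> s) (Hdot_norm lam \<phi> s) f"
    and int: "integrable (time_measure T) (\<lambda>r. (Hdot_norm lam \<phi> s (f r))\<^sup>2)"
    using f by (auto simp: L2_time_space_def)
  have "\<exists>h. causal h \<and> (\<forall>t\<ge>T. h t = 0) \<and> (AE t in time_measure T. f t (\<phi> j) = h t)" for j
    using borel_version[OF Hdot_coeff_measurable[OF time_measure_props(1) sm, of j]] by metis
  then obtain c where c: "\<And>j. causal (c j)" "\<And>j t. t \<ge> T \<Longrightarrow> c j t = 0" "\<And>j. AE t in time_measure T. f t (\<phi> j) = c j t"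
    by metis
  have sc: "supported T c" using c by (simp add: supported_def)
  note [measurable] = supportedD(3)[OF sc]
  have eq: "AE r in time_measure T. \<forall>j. f r (\<phi> j) = c j r" using c(3) by (simp add: AE_all_countable)
  have fV: "AE r in time_measure T. f r \<in> Hdot_space \<Omega> lam \<phi> s" using sm by (simp add: strongly_measurable_on_def)
  have "energy (\<lambda>j. lam j powr s) c T = (\<integral>\<^sup>+r. (\<Sum>j. ennreal (lam j powr s * (c j r)\<^sup>2)) * indicator {0<..<T} r \<partial>lborel)"
    unfolding energy_def
  proof (rule nn_integral_cong)
    fix r
    show "(\<Sum>j. ennreal (lam j powr s * (c j r)\<^sup>2)) * indicator {..<T} r = (\<Sum>j. ennreal (lam j powr s * (c j r)\<^sup>2)) * indicator {0<..<T} r"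
    proof (cases "r > 0")
      case True
      then show ?thesis by (simp add: indicator_def)
    next
      case False
      then have "c j r = 0" for j by (intro causal_zero[OF c(1)]) simp
      then show ?thesis by simp
    qed
  qed
  also have "\<dots> = (\<integral>\<^sup>+r. (\<Sum>j. ennreal (lam j powr s * (c j r)\<^sup>2)) \<partial>time_measure T)"
    by (rule nn_integral_time_measure[symmetric]) measurable
  also have "\<dots> = (\<integral>\<^sup>+r. ennreal (norm ((Hdot_norm lam \<phi> s (f r))\<^sup>2)) \<partial>time_measure T)"
  proof (rule nn_integral_cong_AE)
    show "AE r in time_measure T. (\<Sum>j. ennreal (lam j powr s * (c j r)\<^sup>2)) = ennreal (norm ((Hdot_norm lam \<phi> s (f r))\<^sup>2))"
      using eq fV
    proof eventually_elim
      case (elim r)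
      then have w: "summable (\<lambda>j. lam j powr s * (c j r)\<^sup>2)" by (simp add: Hdot_space_def)
      have "(\<Sum>j. ennreal (lam j powr s * (c j r)\<^sup>2)) = ennreal (\<Sum>j. lam j powr s * (c j r)\<^sup>2)"
        by (rule suminf_ennreal2[OF _ w]) simp
      moreover have "0 \<le> (\<Sum>j. lam j powr s * (c j r)\<^sup>2)" by (rule suminf_nonneg[OF w]) simp
      ultimately show ?case using elim(1) by (simp add: Hdot_norm_def)
    qed
  qed
  also have "\<dots> < \<infinity>" using int by (simp add: integrable_iff_bounded)
  finally show ?thesis using that[OF sc eq] by blast
qed

end

section \<open>Regularity of the solution\<close>

context dirichlet
begin

context
  fixes s T \<beta> :: real and U G :: "nat \<Rightarrow> real \<Rightarrow> real" and u :: "real \<Rightarrow> 'd functional"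
  assumes s: "s \<ge> -1" and \<beta>: "0 < \<beta>" "\<beta> < 1" and T: "T > 0"
    and U: "supported T U" "energy (\<lambda>j. lam j powr s) U T < \<infinity>"
    and u: "AE t in time_measure T. u t = S (\<lambda>j. U j t)"
    and G: "supported T G" "energy (\<lambda>j. lam j powr s) G T < \<infinity>"
    and UG: "\<And>j. AE t in lborel. t < T \<longrightarrow>
      convol (cut T (omega (1 - \<beta>))) (U j) t = convol (cut T (\<lambda>_. 1)) (G j) t"
begin

lemma fractional_integral_coeffs:
  "AE t in time_measure T. fractional_integral \<Omega> (1 - \<beta>) (\<lambda>\<tau> w. u \<tau> w - (\<lambda>_. 0) w) t
    = S (\<lambda>j. convol (cut T (\<lambda>_. 1)) (G j) t)"
proof -
  let ?w = "cut T (omega (1 - \<beta>))"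
  have p: "1 - \<beta> > 0" using \<beta> by simp
  have w: "causal ?w" by (rule cut_causal) measurable
  have "\<bar>?w t\<bar> \<le> ?w t" for t using omega_nonneg[OF p, of t] by (simp add: cut_def)
  note conv = has_Hm1_integral_convol[OF s U w omega_cut_integrable[OF p] this]
  have id: "AE t in time_measure T. \<forall>j. convol ?w (U j) t = convol (cut T (\<lambda>_. 1)) (G j) t"
    unfolding AE_all_countable
  proof
    fix j show "AE t in time_measure T. convol ?w (U j) t = convol (cut T (\<lambda>_. 1)) (G j) t"
      unfolding AE_time_measure_iff using UG[of j] by eventually_elim simp
  qed
  show ?thesis using conv id AE_space
  proof eventually_elim
    case (elim t)
    have t: "0 < t" "t < T" using elim(3) by auto
    have ut: "AE \<tau> in time_measure t. u \<tau> = S (\<lambda>j. U j \<tau>)"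
      by (rule AE_time_measure_mono[OF u]) (use t in simp)
    have sm: "AE \<tau> in time_measure t. wsummable hw (\<lambda>j. U j \<tau>)"
      unfolding AE_time_measure_iff using energy_finite_AE[OF powr_nonneg U]
      by eventually_elim (blast intro: wsummable_hw[OF s])
    have "AE \<tau> in time_measure t. (\<lambda>w. (t - \<tau>) powr (1 - \<beta> - 1) / Gamma (1 - \<beta>) * (u \<tau> w - (\<lambda>_. 0) w))
        = S (\<lambda>j. ?w (t - \<tau>) * U j \<tau>)"
      using ut sm AE_space
    proof eventually_elim
      case (elim \<tau>)
      have "?w (t - \<tau>) = (t - \<tau>) powr (1 - \<beta> - 1) / Gamma (1 - \<beta>)"
        using elim(3) t by (simp add: cut_def omega_def)
      then show ?case using S_scale[OF elim(2), of "?w (t - \<tau>)"] elim(1) by (intro ext) simp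
    qed
    then have "has_Hm1_integral \<Omega> (time_measure t)
        (\<lambda>\<tau> w. (t - \<tau>) powr (1 - \<beta> - 1) / Gamma (1 - \<beta>) * (u \<tau> w - (\<lambda>_. 0) w)) (S (\<lambda>j. convol ?w (U j) t))"
      by (rule elim(1)[THEN spec, THEN mp])
    from Hm1_integral_eq[OF time_measure_props this]
    show ?case unfolding fractional_integral_def using elim(2) by simp
  qed
qed

lemma has_caputo_derivative_coeffs: "has_caputo_derivative \<Omega> T \<beta> (\<lambda>_. 0) u (\<lambda>t. S (\<lambda>j. G j t))"
  unfolding has_caputo_derivative_def
proof (intro conjI)
  show "Hm1_integrable \<Omega> (time_measure T) u"
    unfolding Hm1_integrable_def using has_Hm1_integral_coeffs[OF s U u order_refl] by blast
  have g: "AE t in time_measure T. S (\<lambda>j. G j t) = S (\<lambda>j. G j t)" by simp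
  note gi = has_Hm1_integral_coeffs[OF s G g]
  show "Hm1_integrable \<Omega> (time_measure T) (\<lambda>t. S (\<lambda>j. G j t))"
    unfolding Hm1_integrable_def using gi[OF order_refl] by blast
  show "AE t in time_measure T. fractional_integral \<Omega> (1 - \<beta>) (\<lambda>\<tau> w. u \<tau> w - (\<lambda>_. 0) w) t
      = Hm1_integral \<Omega> (time_measure t) (\<lambda>t. S (\<lambda>j. G j t))"
    using fractional_integral_coeffs AE_space
  proof eventually_elim
    case (elim t)
    then have "t \<le> T" by simp
    from Hm1_integral_eq[OF time_measure_props gi[OF this]] elim(1) show ?case by simp
  qed
qed

text \<open>\<open>caputo_derivative\<close> is an arbitrary choice, so its coefficients must be the
  same for every candidate. Testing the defining relation with \<open>\<phi> j\<close> shows that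
  the primitives of both coefficients agree, and \<open>convol_one_zero\<close> removes the
  primitive. Membership in \<open>Hm1_space\<close> and the coefficients are all that the Hdot norms
  see.\<close>

lemma caputo_derivative_coeffs_unique:
  assumes g: "has_caputo_derivative \<Omega> T \<beta> (\<lambda>_. 0) u g"
  shows "AE t in time_measure T. g t \<in> Hm1_space \<Omega>" "AE t in time_measure T. \<forall>j. g t (\<phi> j) = G j t"
proof -
  obtain I where I: "has_Hm1_integral \<Omega> (time_measure T) g I"
    using g by (auto simp: has_caputo_derivative_def Hm1_integrable_def)
  note D = has_Hm1_integralD[OF time_measure_props I]
  show "AE t in time_measure T. g t \<in> Hm1_space \<Omega>" using D(4) by (simp add: strongly_measurable_on_def)
  have "AE t in time_measure T. g t (\<phi> j) = G j t" for j
  proof -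
    have gi: "integrable (time_measure T) (\<lambda>t. g t (\<phi> j))" by (rule D(2)[OF eigenfunction])
    obtain y where y: "causal y" "\<And>t. t \<ge> T \<Longrightarrow> y t = 0" "AE t in time_measure T. g t (\<phi> j) = y t"
      using borel_version[OF borel_measurable_integrable[OF gi]] by blast
    note [measurable] = y(1)[THEN causal_measurable] supportedD(3)[OF G(1)]
    have ym: "y \<in> borel_measurable (time_measure t)" for t by (rule measurable_time_measure) measurable
    have yT: "integrable (time_measure T) y"
      using integrable_cong_AE[OF borel_measurable_integrable[OF gi] ym y(3)] gi by simp
    have yi: "integrable lborel y"
    proof -
      have "integrable lebesgue (\<lambda>t. indicator {0<..<T} t *\<^sub>R y t)"
        using yT by (subst (asm) integrable_restrict_space) auto
      moreover have "(\<lambda>t. indicator {0<..<T} t *\<^sub>R y t) = y"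
      proof
        fix t show "indicator {0<..<T} t *\<^sub>R y t = y t"
          using causal_zero[OF y(1), of t] y(2)[of t] by (cases "0 < t \<and> t < T") (auto simp: not_less)
      qed
      ultimately have "integrable lebesgue y" by simp
      then show ?thesis using integrable_completion[of y lborel] by simp
    qed
    have Gi: "integrable lborel (G j)" by (rule component_integrable[OF lam_powr_pos G])
    have "AE t in time_measure T. convol (cut T (\<lambda>_. 1)) (G j) t = convol (cut T (\<lambda>_. 1)) y t"
    proof -
      have "AE t in time_measure T. fractional_integral \<Omega> (1 - \<beta>) (\<lambda>\<tau> w. u \<tau> w - (\<lambda>_. 0) w) t = Hm1_integral \<Omega> (time_measure t) g"
        using g by (simp add: has_caputo_derivative_def)
      then show ?thesis using fractional_integral_coeffs AE_space
      proof eventually_elim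
        case (elim t)
        then have t: "0 < t" "t < T" "t \<le> T" by auto
        have "Hm1_integral \<Omega> (time_measure t) g = pairing (time_measure t) g"
          by (rule Hm1_integral_eq[OF time_measure_props has_Hm1_integral_restrict[OF I t(3)]])
        then have "S (\<lambda>j. convol (cut T (\<lambda>_. 1)) (G j) t) (\<phi> j) = pairing (time_measure t) g (\<phi> j)"
          using elim by simp
        then have "convol (cut T (\<lambda>_. 1)) (G j) t = (LINT r|time_measure t. g r (\<phi> j))"
          by (simp add: S_eigenfunction pairing_def eigenfunction)
        also have "\<dots> = (LINT r|time_measure t. y r)"
        proof (rule integral_cong_AE)
          have "integrable (time_measure t) (\<lambda>r. g r (\<phi> j))"
            by (rule has_Hm1_integralD(2)[OF time_measure_props has_Hm1_integral_restrict[OF I t(3)] eigenfunction])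
          then show "(\<lambda>r. g r (\<phi> j)) \<in> borel_measurable (time_measure t)" by (rule borel_measurable_integrable)
        qed (use ym AE_time_measure_mono[OF y(3) t(3)] in auto)
        also have "\<dots> = (LINT r|time_measure t. cut T (\<lambda>_. 1) (t - r) * y r)"
          by (rule Bochner_Integration.integral_cong) (use t in \<open>auto simp: cut_def\<close>)
        also have "\<dots> = convol (cut T (\<lambda>_. 1)) y t"
          unfolding convol_def
        proof (rule integral_time_measure)
          show "(\<lambda>r. cut T (\<lambda>_. 1) (t - r) * y r) \<in> borel_measurable borel" unfolding cut_def by measurable
          fix r assume "r \<notin> {0<..<t}"
          then show "cut T (\<lambda>_. 1) (t - r) * y r = 0"
            using causal_zero[OF y(1), of r] by (auto simp: cut_def)
        qed
        finally show ?case .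
      qed
    qed
    then have eq: "AE t in lborel. 0 < t \<and> t < T \<longrightarrow> convol (cut T (\<lambda>_. 1)) (G j) t = convol (cut T (\<lambda>_. 1)) y t"
      unfolding AE_time_measure_iff .
    define x where "x t = 1 * G j t + (-1) * y t" for t
    have xi: "integrable lborel x" "causal x"
      using Gi yi supportedD(1)[OF G(1), of j] y(1) by (auto simp: x_def[abs_def] causal_def)
    have "AE t in lborel. t < T \<longrightarrow> convol (cut T (\<lambda>_. 1)) x t = 0"
      using eq convol_lincomb[OF one_cut_integrable[of T] Gi yi, of 1 "-1"]
    proof eventually_elim
      case (elim t)
      show ?case
      proof
        assume "t < T"
        then show "convol (cut T (\<lambda>_. 1)) x t = 0"
          using elim causal_zero[OF causal_convol[OF cut_causal[of "\<lambda>_. 1" T] xi(2)], of t]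
          by (cases "t > 0") (auto simp: x_def[abs_def])
      qed
    qed
    from convol_one_zero[OF xi this]
    have "AE t in time_measure T. y t = G j t"
      unfolding AE_time_measure_iff by eventually_elim (auto simp: x_def)
    then show ?thesis using y(3) by eventually_elim simp
  qed
  then show "AE t in time_measure T. \<forall>j. g t (\<phi> j) = G j t" by (simp add: AE_all_countable)
qed

end

end

section \<open>Coefficients of the solution and the energy estimates\<close>

locale parabolic_data = dirichlet \<Omega> lam \<phi> + multiterm \<alpha> m a b
  for \<Omega> :: "(real^'d) set" and lam \<phi> \<alpha> m a b +
  fixes T q :: real and f :: "real \<Rightarrow> 'd functional" and c :: "nat \<Rightarrow> real \<Rightarrow> real"
  assumes T: "T > 0" and q: "q \<ge> -1"
    and c: "supported T c" "energy (\<lambda>j. lam j powr q) c T < \<infinity>"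
    and fc: "AE r in time_measure T. \<forall>j. f r (\<phi> j) = c j r"
begin

abbreviation "v \<equiv> \<lambda>j. lam j powr q"

definition sol :: "nat \<Rightarrow> real \<Rightarrow> real" where
  "sol j = cut T (convol (cut T (kern (lam j))) (c j))"

text \<open>Coefficients of f + \<Delta>u, hence of the multi-term derivative of u.\<close>

definition res :: "nat \<Rightarrow> real \<Rightarrow> real" where
  "res j t = c j t - lam j * sol j t"

text \<open>Coefficients of the Caputo derivative of order \<open>a i\<close>: the convolved kernel
  is the derivative of the fractional integral of order \<open>1 - a i\<close> of
  \<open>kern 0\<close>.\<close>

definition G :: "nat \<Rightarrow> nat \<Rightarrow> real \<Rightarrow> real" where
  "G i j = cut T (convol (cut T (ml (cc 0) (\<alpha> - a i))) (res j))"

text \<open>Coefficients of the leading Caputo derivative, arranged so that the multi-term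
  combination collapses to \<open>res\<close>.\<close>

definition G\<^sub>\<alpha> :: "nat \<Rightarrow> real \<Rightarrow> real" where
  "G\<^sub>\<alpha> j t = res j t - (\<Sum>i=1..m. b i * G i j t)"

lemma lam_nonneg: "lam j \<ge> 0"
  using lam_pos[of j] by simp

lemma kern_cut_causal: "causal (cut T (kern l))"
  by (rule cut_causal) (rule causal_measurable[OF kern_causal])

lemma cmeas: "c j \<in> borel_measurable borel"
  by (rule supportedD(3)[OF c(1)])

lemma c_integrable: "integrable lborel (c j)"
  by (rule component_integrable[OF lam_powr_pos c])

lemma sol_supported: "supported T sol"
  unfolding sol_def
  by (rule supported_cut) (intro convol_measurable causal_measurable kern_cut_causal cmeas)

lemma res_supported: "supported T res"
proof -
  have "causal (res j)" for j
    using supportedD(1)[OF c(1), of j] supportedD(1)[OF sol_supported, of j] by (auto simp: res_def[abs_def] causal_def)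
  then show ?thesis
    using supportedD(2)[OF c(1)] supportedD(2)[OF sol_supported] by (simp add: supported_def res_def)
qed

lemma G_supported: "supported T (G i)"
  unfolding G_def
  by (rule supported_cut)
    (intro convol_measurable causal_measurable[OF cut_causal] ml_measurable supportedD(3)[OF res_supported])

lemma G\<^sub>\<alpha>_supported: "supported T G\<^sub>\<alpha>"
proof -
  note [measurable] = supportedD(3)[OF res_supported] supportedD(3)[OF G_supported]
  have "G\<^sub>\<alpha> j \<in> borel_measurable borel" for j unfolding G\<^sub>\<alpha>_def[abs_def] by measurable
  then show ?thesis
    using supportedD(2)[OF res_supported] supportedD(2)[OF G_supported]
      causal_zero[OF supportedD(1)[OF res_supported]] causal_zero[OF supportedD(1)[OF G_supported]]
    by (simp add: supported_def causal_def G\<^sub>\<alpha>_def)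
qed

lemma sol_eq: "t < T \<Longrightarrow> sol j t = convol (cut T (kern (lam j))) (c j) t"
  using causal_zero[OF causal_convol[OF kern_cut_causal supportedD(1)[OF c(1)]], of t]
  by (auto simp: sol_def cut_def not_less)

lemma G_eq: "t < T \<Longrightarrow> G i j t = convol (cut T (ml (cc 0) (\<alpha> - a i))) (res j) t"
  using causal_zero[OF causal_convol[OF cut_causal[OF ml_measurable] supportedD(1)[OF res_supported]], of t]
  by (auto simp: G_def cut_def not_less)

lemma lam_sol_le:
  assumes t: "0 < t" "t \<le> T"
  shows "(\<integral>\<^sup>+s. ennreal ((lam j * sol j s)\<^sup>2) * indicator {..<t} s \<partial>lborel)
    \<le> (\<integral>\<^sup>+s. ennreal ((c j s)\<^sup>2) * indicator {..<t} s \<partial>lborel)"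
proof -
  have "(\<integral>\<^sup>+s. ennreal ((lam j * sol j s)\<^sup>2) * indicator {..<t} s \<partial>lborel)
     = (\<integral>\<^sup>+s. ennreal ((lam j * convol (cut T (kern (lam j))) (c j) s)\<^sup>2) * indicator {..<t} s \<partial>lborel)"
    using t by (intro nn_integral_cong) (auto simp: indicator_def sol_eq)
  also have "\<dots> \<le> (\<integral>\<^sup>+s. ennreal ((c j s)\<^sup>2) * indicator {..<t} s \<partial>lborel)"
    by (rule kern_young[OF lam_nonneg supportedD(1)[OF c(1)] t])
  finally show ?thesis .
qed

text \<open>The two additional powers of \<open>lam j\<close> in the weight are exactly the square
  of the factor controlled by \<open>lam_sol_le\<close>.\<close>

lemma sol_energy_smooth:
  assumes t: "0 < t" "t \<le> T"
  shows "energy (\<lambda>j. lam j powr (q + 2)) sol t \<le> energy v c t"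
proof -
  note [measurable] = cmeas supportedD(3)[OF sol_supported]
  have "energy (\<lambda>j. lam j powr (q + 2)) sol t \<le> ennreal 1 * energy v c t"
  proof (rule energy_mono)
    fix j
    have "(\<integral>\<^sup>+s. ennreal (lam j powr (q + 2) * (sol j s)\<^sup>2) * indicator {..<t} s \<partial>lborel)
      = (\<integral>\<^sup>+s. ennreal (v j) * (ennreal ((lam j * sol j s)\<^sup>2) * indicator {..<t} s) \<partial>lborel)"
    proof (rule nn_integral_cong)
      fix s
      have "lam j powr (q + 2) * (sol j s)\<^sup>2 = v j * (lam j * sol j s)\<^sup>2"
        using lam_pos[of j] by (simp add: powr_add power_mult_distrib)
      then have "ennreal (lam j powr (q + 2) * (sol j s)\<^sup>2) = ennreal (v j) * ennreal ((lam j * sol j s)\<^sup>2)"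
        by (simp only: ennreal_mult' powr_nonneg)
      then show "ennreal (lam j powr (q + 2) * (sol j s)\<^sup>2) * indicator {..<t} s = ennreal (v j) * (ennreal ((lam j * sol j s)\<^sup>2) * indicator {..<t} s)"
        by (simp only: mult.assoc)
    qed
    also have "\<dots> = ennreal (v j) * (\<integral>\<^sup>+s. ennreal ((lam j * sol j s)\<^sup>2) * indicator {..<t} s \<partial>lborel)"
      by (rule nn_integral_cmult) measurable
    also have "\<dots> \<le> ennreal (v j) * (\<integral>\<^sup>+s. ennreal ((c j s)\<^sup>2) * indicator {..<t} s \<partial>lborel)"
      by (intro mult_left_mono lam_sol_le t) simp
    also have "\<dots> = (\<integral>\<^sup>+s. ennreal (v j) * (ennreal ((c j s)\<^sup>2) * indicator {..<t} s) \<partial>lborel)"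
      by (rule nn_integral_cmult[symmetric]) measurable
    also have "\<dots> = (\<integral>\<^sup>+s. ennreal (v j * (c j s)\<^sup>2) * indicator {..<t} s \<partial>lborel)"
      by (simp only: ennreal_mult' powr_nonneg mult.assoc)
    finally show "(\<integral>\<^sup>+s. ennreal (lam j powr (q + 2) * (sol j s)\<^sup>2) * indicator {..<t} s \<partial>lborel)
      \<le> ennreal 1 * (\<integral>\<^sup>+s. ennreal (v j * (c j s)\<^sup>2) * indicator {..<t} s \<partial>lborel)" by simp
  qed (auto simp: cmeas supportedD(3)[OF sol_supported])
  then show ?thesis by simp
qed

text \<open>The energy at level q, at which u and its Caputo derivatives are integrated as
  functionals; the majorant is the kernel for eigenvalue 0.\<close>

lemma sol_energy: "energy v sol T < \<infinity>"
  unfolding sol_def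
proof (rule energy_convol[OF powr_nonneg c(1) kern_cut_causal kern_cut_integrable _ c(2)])
  show "\<bar>cut T (kern (lam j)) t\<bar> \<le> cut T (kern 0) t" for j t
    using kern_le_kern_0[OF lam_nonneg, of j t] kern_nonneg[OF lam_nonneg, of j t] by (simp add: cut_def)
qed

text \<open>The square of a difference is at most twice the sum of the squares, and both parts are
  bounded by the energy of c: the 4 is 2 times 2 and becomes the factor 2 for norms.\<close>

lemma res_energy:
  assumes t: "0 < t" "t \<le> T"
  shows "energy v res t \<le> 4 * energy v c t"
proof -
  note [measurable] = cmeas supportedD(3)[OF sol_supported] supportedD(3)[OF res_supported]
  have "energy v res t \<le> ennreal 4 * energy v c t"
  proof (rule energy_mono)
    fix j
    let ?C = "\<integral>\<^sup>+s. ennreal ((c j s)\<^sup>2) * indicator {..<t} s \<partial>lborel"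
    have "(\<integral>\<^sup>+s. ennreal (v j * (res j s)\<^sup>2) * indicator {..<t} s \<partial>lborel)
      \<le> (\<integral>\<^sup>+s. ennreal (2 * v j) * (ennreal ((c j s)\<^sup>2) * indicator {..<t} s + ennreal ((lam j * sol j s)\<^sup>2) * indicator {..<t} s) \<partial>lborel)"
    proof (rule nn_integral_mono)
      fix s
      have "(res j s)\<^sup>2 \<le> 2 * ((c j s)\<^sup>2 + (lam j * sol j s)\<^sup>2)"
        using sum_squares_bound[of "c j s" "- (lam j * sol j s)"] by (simp add: res_def power2_diff)
      from mult_left_mono[OF this powr_nonneg[of j q]]
      have "ennreal (v j * (res j s)\<^sup>2) \<le> ennreal ((2 * v j) * ((c j s)\<^sup>2 + (lam j * sol j s)\<^sup>2))"
        by (intro ennreal_leI) (simp add: algebra_simps)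
      also have "\<dots> = ennreal (2 * v j) * (ennreal ((c j s)\<^sup>2) + ennreal ((lam j * sol j s)\<^sup>2))"
        by (subst ennreal_mult') auto
      finally show "ennreal (v j * (res j s)\<^sup>2) * indicator {..<t} s
        \<le> ennreal (2 * v j) * (ennreal ((c j s)\<^sup>2) * indicator {..<t} s + ennreal ((lam j * sol j s)\<^sup>2) * indicator {..<t} s)"
        by (cases "s < t") auto
    qed
    also have "\<dots> = ennreal (2 * v j) * (?C + (\<integral>\<^sup>+s. ennreal ((lam j * sol j s)\<^sup>2) * indicator {..<t} s \<partial>lborel))"
      by (subst nn_integral_cmult) (auto simp: nn_integral_add)
    also have "\<dots> \<le> ennreal (2 * v j) * (?C + ?C)"
      by (intro mult_left_mono add_left_mono lam_sol_le t) simp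
    also have "\<dots> = ennreal (2 * v j) * (2 * ?C)" by (simp only: mult_2)
    also have "\<dots> = ennreal 4 * (ennreal (v j) * ?C)"
    proof -
      have "ennreal (2 * v j) = 2 * ennreal (v j)" using ennreal_mult'[of 2 "v j"] by simp
      moreover have "ennreal 4 = 2 * 2" by simp
      ultimately show ?thesis by (simp only: mult_ac)
    qed
    also have "ennreal (v j) * ?C = (\<integral>\<^sup>+s. ennreal (v j) * (ennreal ((c j s)\<^sup>2) * indicator {..<t} s) \<partial>lborel)"
      by (rule nn_integral_cmult[symmetric]) measurable
    also have "\<dots> = (\<integral>\<^sup>+s. ennreal (v j * (c j s)\<^sup>2) * indicator {..<t} s \<partial>lborel)"
      by (simp only: ennreal_mult' powr_nonneg mult.assoc)
    finally show "(\<integral>\<^sup>+s. ennreal (v j * (res j s)\<^sup>2) * indicator {..<t} s \<partial>lborel)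
      \<le> ennreal 4 * (\<integral>\<^sup>+s. ennreal (v j * (c j s)\<^sup>2) * indicator {..<t} s \<partial>lborel)" .
  qed (auto simp: cmeas supportedD(3)[OF res_supported])
  then show ?thesis by simp
qed

lemma res_energy_finite: "energy v res T < \<infinity>"
  using res_energy[OF T order_refl] c(2) by (auto simp: ennreal_mult_less_top elim: order.strict_trans1)

lemma G_energy:
  assumes i: "i \<in> {1..m}"
  shows "energy v (G i) T < \<infinity>"
  unfolding G_def
proof (rule energy_convol[OF powr_nonneg res_supported _ _ _ res_energy_finite])
  show "causal (cut T (ml (cc 0) (\<alpha> - a i)))" by (rule cut_causal[OF ml_measurable])
  show "integrable lborel (\<lambda>t. \<bar>cut T (ml (cc 0) (\<alpha> - a i)) t\<bar>)"
    using a(2)[OF i] by (intro integrable_abs ml_cut_integrable) simp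
qed simp

lemma G\<^sub>\<alpha>_energy: "energy v G\<^sub>\<alpha> T < \<infinity>"
proof -
  have s: "energy v (\<lambda>j t. \<Sum>i\<in>{1..m}. (- b i) * G i j t) T < \<infinity>"
    by (rule energy_sum_finite[OF powr_nonneg _ supportedD(3)[OF G_supported] G_energy]) auto
  note [measurable] = supportedD(3)[OF G_supported]
  have "energy v (\<lambda>j t. res j t + (\<Sum>i\<in>{1..m}. (- b i) * G i j t)) T < \<infinity>"
    by (rule energy_add_finite[OF powr_nonneg supportedD(3)[OF res_supported] _ res_energy_finite s]) measurable
  moreover have "G\<^sub>\<alpha> = (\<lambda>j t. res j t + (\<Sum>i\<in>{1..m}. (- b i) * G i j t))"
    by (intro ext) (simp add: G\<^sub>\<alpha>_def sum_negf)
  ultimately show ?thesis by (simp only:)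
qed

text \<open>Inside the integral t - r lies in (0,T), so the Mittag-Leffler coefficient is the
  cut-off kernel, and the comparison with eigenvalue 0 gives the summability that identifies the
  series with \<open>S\<close>. The convolution lemma then integrates it.\<close>

lemma duhamel_coeffs: "AE t in time_measure T. duhamel \<Omega> lam \<phi> \<alpha> m a b f t = S (\<lambda>j. sol j t)"
proof -
  have le: "\<bar>cut T (kern (lam j)) t\<bar> \<le> cut T (kern 0) t" for j t
    using kern_le_kern_0[OF lam_nonneg, of j t] kern_nonneg[OF lam_nonneg, of j t] by (simp add: cut_def)
  note conv = has_Hm1_integral_convol[where k = "\<lambda>j. cut T (kern (lam j))", OF q c kern_cut_causal kern_cut_integrable le]
  have sm: "AE r in lborel. wsummable v (\<lambda>j. c j r)" by (rule energy_finite_AE[OF powr_nonneg c])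
  show ?thesis using conv AE_space
  proof eventually_elim
    case (elim t)
    have t: "0 < t" "t < T" using elim(2) by auto
    have smt: "AE r in time_measure t. wsummable v (\<lambda>j. c j r)"
      unfolding AE_time_measure_iff using sm by eventually_elim simp
    have "AE r in time_measure t. E_bar \<Omega> lam \<phi> \<alpha> m a b (t - r) (f r) = S (\<lambda>j. cut T (kern (lam j)) (t - r) * c j r)"
      using AE_time_measure_mono[OF fc less_imp_le[OF t(2)]] smt AE_space
    proof eventually_elim
      case (elim r)
      then have r: "0 < r" "r < t" by auto
      have e: "E_bar_coeff \<alpha> m a b (lam j) (t - r) * f r (\<phi> j) = cut T (kern (lam j)) (t - r) * c j r" for j
        using r t elim(1) E_bar_coeff_eq[of "t - r" "lam j"] by (simp add: cut_def)
      have "wsummable v (\<lambda>j. cut T (kern (lam j)) (t - r) * c j r)"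
      proof (rule wsummable_dominated[OF powr_nonneg _ _ elim(2)])
        show "\<bar>cut T (kern (lam j)) (t - r) * c j r\<bar> \<le> cut T (kern 0) (t - r) * \<bar>c j r\<bar>" for j
          unfolding abs_mult using kern_le_kern_0[OF lam_nonneg, of j "t - r"] kern_nonneg[OF lam_nonneg, of j "t - r"]
          by (intro mult_right_mono) (auto simp: cut_def)
        show "0 \<le> cut T (kern 0) (t - r)" using kern_nonneg[of 0 "t - r"] by (simp add: cut_def)
      qed
      from Hm1_suminf_eq[OF wsummable_hw[OF q this]] show ?case unfolding E_bar_def e .
    qed
    then have "has_Hm1_integral \<Omega> (time_measure t) (\<lambda>r. E_bar \<Omega> lam \<phi> \<alpha> m a b (t - r) (f r))
        (S (\<lambda>j. convol (cut T (kern (lam j))) (c j) t))"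
      by (rule elim(1)[THEN spec, THEN mp])
    from Hm1_integral_eq[OF time_measure_props this]
    show ?case unfolding duhamel_def using sol_eq[OF t(2)] by simp
  qed
qed

text \<open>Before T the cut-off functions \<open>sol\<close> and \<open>G\<close> coincide with the
  convolutions of the scalar theory, and causality lets the substitution pass through the outer
  convolutions.\<close>

lemma derivative_identity_lower:
  assumes i: "i \<in> {1..m}"
  shows "AE t in lborel. t < T \<longrightarrow> convol (cut T (omega (1 - a i))) (sol j) t = convol (cut T (\<lambda>_. 1)) (G i j) t"
  using fractional_derivative_lower[OF c_integrable supportedD(1)[OF c(1)] i, of T "lam j" j]
proof eventually_elim
  case (elim t)
  show ?case
  proof
    assume t: "t < T"
    note [measurable] = cmeas causal_measurable[OF kern_cut_causal] supportedD(3)[OF sol_supported]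
      supportedD(3)[OF res_supported] supportedD(3)[OF G_supported]
    have h: "causal (cut T (ml (cc 0) (\<alpha> - a i)))" by (rule cut_causal[OF ml_measurable])
    note [measurable] = causal_measurable[OF h]
    have 1: "convol (cut T (omega (1 - a i))) (sol j) t = convol (cut T (omega (1 - a i))) (convol (cut T (kern (lam j))) (c j)) t"
      by (rule convol_cong_right[OF cut_causal, where T = T]) (use t sol_eq in auto)
    have 2: "convol (cut T (\<lambda>_. 1)) (G i j) t
        = convol (cut T (\<lambda>_. 1)) (convol (cut T (ml (cc 0) (\<alpha> - a i))) (\<lambda>s. c j s - lam j * convol (cut T (kern (lam j))) (c j) s)) t"
    proof (rule convol_cong_right[OF cut_one_causal, where T = T])
      have "G i j s = convol (cut T (ml (cc 0) (\<alpha> - a i))) (\<lambda>s. c j s - lam j * convol (cut T (kern (lam j))) (c j) s) s" if "s < T" for s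
        unfolding G_eq[OF that]
        by (rule convol_cong_right[OF h, where T = T]) (use that sol_eq in \<open>auto simp: res_def\<close>)
      then show "AE s in lborel. s < T \<longrightarrow> G i j s = convol (cut T (ml (cc 0) (\<alpha> - a i))) (\<lambda>s. c j s - lam j * convol (cut T (kern (lam j))) (c j) s) s"
        by simp
    qed (use t in auto)
    show "convol (cut T (omega (1 - a i))) (sol j) t = convol (cut T (\<lambda>_. 1)) (G i j) t"
      unfolding 1 2 using elim t by blast
  qed
qed

lemma derivative_identity_leading:
  "AE t in lborel. t < T \<longrightarrow> convol (cut T (omega (1 - \<alpha>))) (sol j) t = convol (cut T (\<lambda>_. 1)) (G\<^sub>\<alpha> j) t"
  using fractional_derivative_leading[OF c_integrable supportedD(1)[OF c(1)], of T "lam j" j]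
proof eventually_elim
  case (elim t)
  show ?case
  proof
    assume t: "t < T"
    let ?h = "\<lambda>i. cut T (ml (cc 0) (\<alpha> - a i))"
    let ?F = "\<lambda>s. c j s - lam j * convol (cut T (kern (lam j))) (c j) s"
    note [measurable] = cmeas causal_measurable[OF kern_cut_causal] supportedD(3)[OF sol_supported]
      supportedD(3)[OF res_supported] supportedD(3)[OF G_supported] supportedD(3)[OF G\<^sub>\<alpha>_supported]
    have h: "causal (?h i)" for i by (rule cut_causal[OF ml_measurable])
    note [measurable] = causal_measurable[OF h]
    have 1: "convol (cut T (omega (1 - \<alpha>))) (sol j) t = convol (cut T (omega (1 - \<alpha>))) (convol (cut T (kern (lam j))) (c j)) t"
      by (rule convol_cong_right[OF cut_causal, where T = T]) (use t sol_eq in auto)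
    have 2: "convol (cut T (\<lambda>_. 1)) (G\<^sub>\<alpha> j) t
        = convol (cut T (\<lambda>_. 1)) (\<lambda>s. ?F s - (\<Sum>i=1..m. b i * convol (?h i) ?F s)) t"
    proof (rule convol_cong_right[OF cut_one_causal, where T = T])
      have "G i j s = convol (?h i) ?F s" if "s < T" for s i
        unfolding G_eq[OF that]
        by (rule convol_cong_right[OF h, where T = T]) (use that sol_eq in \<open>auto simp: res_def\<close>)
      then show "AE s in lborel. s < T \<longrightarrow> G\<^sub>\<alpha> j s = ?F s - (\<Sum>i=1..m. b i * convol (?h i) ?F s)"
        by (simp add: G\<^sub>\<alpha>_def res_def sol_eq)
    qed (use t in auto)
    show "convol (cut T (omega (1 - \<alpha>))) (sol j) t = convol (cut T (\<lambda>_. 1)) (G\<^sub>\<alpha> j) t"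
      unfolding 1 2 using elim t by blast
  qed
qed

lemma regularity:
  defines "u \<equiv> duhamel \<Omega> lam \<phi> \<alpha> m a b f"
  defines "Pu \<equiv> multiterm_derivative \<Omega> T \<alpha> m a b (\<lambda>_. 0) u"
  shows "u \<in> L2_time_space T (Hdot_space \<Omega> lam \<phi> (q + 2)) (Hdot_norm lam \<phi> (q + 2))"
    "caputo_differentiable \<Omega> T \<alpha> (\<lambda>_. 0) u"
    "i \<in> {1..m} \<Longrightarrow> caputo_differentiable \<Omega> T (a i) (\<lambda>_. 0) u"
    "Pu \<in> L2_time_space T (Hdot_space \<Omega> lam \<phi> q) (Hdot_norm lam \<phi> q)"
    "0 < t \<Longrightarrow> t \<le> T \<Longrightarrow> L2_time_norm t (Hdot_norm lam \<phi> (q + 2)) u + L2_time_norm t (Hdot_norm lam \<phi> q) Pu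
      \<le> 3 * L2_time_norm t (Hdot_norm lam \<phi> q) f"
proof -
  have q2: "q + 2 \<ge> -1" using q by simp
  have uS: "AE t in time_measure T. u t = S (\<lambda>j. sol j t)" unfolding u_def by (rule duhamel_coeffs)
  have uc: "AE t in time_measure T. \<forall>j. u t (\<phi> j) = sol j t"
    using uS by eventually_elim (simp add: S_eigenfunction)
  have Ufin: "energy (\<lambda>j. lam j powr (q + 2)) sol T < \<infinity>"
    using sol_energy_smooth[OF T order_refl] c(2) by (rule order.strict_trans1)
  have uH: "AE t in time_measure T. u t \<in> Hm1_space \<Omega>"
  proof -
    have "AE t in time_measure T. wsummable v (\<lambda>j. sol j t)"
      unfolding AE_time_measure_iff using energy_finite_AE[OF powr_nonneg sol_supported sol_energy] by eventually_elim simp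
    then show ?thesis using uS by eventually_elim (simp add: S_in_Hm1 wsummable_hw[OF q])
  qed
  show "u \<in> L2_time_space T (Hdot_space \<Omega> lam \<phi> (q + 2)) (Hdot_norm lam \<phi> (q + 2))"
    by (rule L2_time_spaceI[OF q2 sol_supported Ufin uc uH])
  have ai: "0 < a i" "a i < 1" if "i \<in> {1..m}" for i using a[OF that] \<alpha> by auto
  note D\<alpha> = q \<alpha> T sol_supported sol_energy uS G\<^sub>\<alpha>_supported G\<^sub>\<alpha>_energy derivative_identity_leading
  have c\<alpha>: "has_caputo_derivative \<Omega> T \<alpha> (\<lambda>_. 0) u (\<lambda>t. S (\<lambda>j. G\<^sub>\<alpha> j t))"
    by (rule has_caputo_derivative_coeffs[OF D\<alpha>])
  have ci: "has_caputo_derivative \<Omega> T (a i) (\<lambda>_. 0) u (\<lambda>t. S (\<lambda>j. G i j t))" if i: "i \<in> {1..m}" for i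
    by (rule has_caputo_derivative_coeffs[OF q ai[OF i] T sol_supported sol_energy uS G_supported G_energy[OF i]
      derivative_identity_lower[OF i]])
  show "caputo_differentiable \<Omega> T \<alpha> (\<lambda>_. 0) u"
    unfolding caputo_differentiable_def using c\<alpha> by blast
  show "caputo_differentiable \<Omega> T (a i) (\<lambda>_. 0) u" if "i \<in> {1..m}"
    unfolding caputo_differentiable_def using ci[OF that] by blast
  \<comment> \<open>The explicit derivative shows that the choice is not vacuous, so the chosen
    function satisfies the defining relation and uniqueness applies to it.\<close>
  have d\<alpha>: "has_caputo_derivative \<Omega> T \<alpha> (\<lambda>_. 0) u (caputo_derivative \<Omega> T \<alpha> (\<lambda>_. 0) u)"
    unfolding caputo_derivative_def by (rule someI[where P = "has_caputo_derivative \<Omega> T \<alpha> (\<lambda>_. 0) u", OF c\<alpha>])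
  have di: "has_caputo_derivative \<Omega> T (a i) (\<lambda>_. 0) u (caputo_derivative \<Omega> T (a i) (\<lambda>_. 0) u)" if "i \<in> {1..m}" for i
    unfolding caputo_derivative_def by (rule someI[where P = "has_caputo_derivative \<Omega> T (a i) (\<lambda>_. 0) u", OF ci[OF that]])
  note k\<alpha> = caputo_derivative_coeffs_unique[OF D\<alpha> d\<alpha>]
  note ki = caputo_derivative_coeffs_unique[OF q ai T sol_supported sol_energy uS G_supported G_energy derivative_identity_lower di]
  have kiH: "AE t in time_measure T. \<forall>i\<in>{1..m}. caputo_derivative \<Omega> T (a i) (\<lambda>_. 0) u t \<in> Hm1_space \<Omega>"
    by (subst AE_finite_all) (auto intro: ki(1))
  have kiG: "AE t in time_measure T. \<forall>i\<in>{1..m}. \<forall>j. caputo_derivative \<Omega> T (a i) (\<lambda>_. 0) u t (\<phi> j) = G i j t"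
    by (subst AE_finite_all) (auto intro: ki(2))
  have PuH: "AE t in time_measure T. Pu t \<in> Hm1_space \<Omega>"
    using k\<alpha>(1) kiH unfolding Pu_def multiterm_derivative_def
    by eventually_elim (intro Hm1_add Hm1_sum Hm1_scale, auto)
  have Puc: "AE t in time_measure T. \<forall>j. Pu t (\<phi> j) = res j t"
    using k\<alpha>(2) kiG unfolding Pu_def multiterm_derivative_def
    by eventually_elim (auto simp: G\<^sub>\<alpha>_def)
  show "Pu \<in> L2_time_space T (Hdot_space \<Omega> lam \<phi> q) (Hdot_norm lam \<phi> q)"
    by (rule L2_time_spaceI[OF q res_supported res_energy_finite Puc PuH])
  show "L2_time_norm t (Hdot_norm lam \<phi> (q + 2)) u + L2_time_norm t (Hdot_norm lam \<phi> q) Pu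
      \<le> 3 * L2_time_norm t (Hdot_norm lam \<phi> q) f" if t: "0 < t" "t \<le> T"
  proof -
    have cfin: "energy v c t < \<infinity>" using energy_mono_time[OF t(2)] c(2) by (rule order.strict_trans1)
    have 1: "L2_time_norm t (Hdot_norm lam \<phi> (q + 2)) u = sqrt (enn2real (energy (\<lambda>j. lam j powr (q + 2)) sol t))"
      by (rule Hdot_norm_square_integral(2)[OF q2 sol_supported Ufin uc t(2)])
    have 2: "L2_time_norm t (Hdot_norm lam \<phi> q) Pu = sqrt (enn2real (energy v res t))"
      by (rule Hdot_norm_square_integral(2)[OF q res_supported res_energy_finite Puc t(2)])
    have 3: "L2_time_norm t (Hdot_norm lam \<phi> q) f = sqrt (enn2real (energy v c t))"
      by (rule Hdot_norm_square_integral(2)[OF q c fc t(2)])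
    have "sqrt (enn2real (energy (\<lambda>j. lam j powr (q + 2)) sol t)) \<le> sqrt (enn2real (energy v c t))"
      using sol_energy_smooth[OF t] cfin by (intro real_sqrt_le_mono enn2real_mono) auto
    moreover have "enn2real (energy v res t) \<le> 4 * enn2real (energy v c t)"
      using enn2real_mono[OF res_energy[OF t]] cfin by (simp add: enn2real_mult ennreal_mult_less_top)
    then have "sqrt (enn2real (energy v res t)) \<le> 2 * sqrt (enn2real (energy v c t))"
      using real_sqrt_le_mono by (fastforce simp: real_sqrt_mult)
    ultimately show ?thesis unfolding 1 2 3 by linarith
  qed
qed

end

theorem theorem2p3:
  fixes \<Omega> :: "(real^'d) set"
    and lam :: "nat \<Rightarrow> real" and \<phi> :: "nat \<Rightarrow> real^'d \<Rightarrow> real"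
    and T \<alpha> q :: real and m :: nat and a b :: "nat \<Rightarrow> real"
  assumes "CARD('d) \<in> {1, 2, 3}"
    and "convex_polyhedral_domain \<Omega>"
    and "dirichlet_eigensystem \<Omega> lam \<phi>"
    and "T > 0"
    and "0 < \<alpha>" and "\<alpha> < 1"
    and "\<forall>i\<in>{1..m}. 0 < a i \<and> a i < \<alpha>"
    and "\<forall>i\<in>{1..m}. \<forall>j\<in>{1..m}. i \<le> j \<longrightarrow> a j \<le> a i"
    and "\<forall>i\<in>{1..m}. b i > 0"
    and "-1 < q" and "q \<le> 1"
  shows "\<exists>C>0. \<forall>f \<in> L2_time_space T (Hdot_space \<Omega> lam \<phi> q) (Hdot_norm lam \<phi> q).
           (let u = duhamel \<Omega> lam \<phi> \<alpha> m a b f;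
                Pu = multiterm_derivative \<Omega> T \<alpha> m a b (\<lambda>_. 0) u
            in u \<in> L2_time_space T (Hdot_space \<Omega> lam \<phi> (q + 2)) (Hdot_norm lam \<phi> (q + 2)) \<and>
               caputo_differentiable \<Omega> T \<alpha> (\<lambda>_. 0) u \<and>
               (\<forall>i\<in>{1..m}. caputo_differentiable \<Omega> T (a i) (\<lambda>_. 0) u) \<and>
               Pu \<in> L2_time_space T (Hdot_space \<Omega> lam \<phi> q) (Hdot_norm lam \<phi> q) \<and>
               (\<forall>t. 0 < t \<and> t \<le> T \<longrightarrow>
                  L2_time_norm t (Hdot_norm lam \<phi> (q + 2)) u + L2_time_norm t (Hdot_norm lam \<phi> q) Pu
                  \<le> C * L2_time_norm t (Hdot_norm lam \<phi> q) f))"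
proof (intro exI[of _ 3] conjI ballI)
  fix f assume f: "f \<in> L2_time_space T (Hdot_space \<Omega> lam \<phi> q) (Hdot_norm lam \<phi> q)"
  interpret dirichlet \<Omega> lam \<phi>
    using assms(2,3) by unfold_locales (auto simp: convex_polyhedral_domain_def)
  obtain c where c: "supported T c" "AE r in time_measure T. \<forall>j. f r (\<phi> j) = c j r"
    "energy (\<lambda>j. lam j powr q) c T < \<infinity>"
    using L2_time_space_coeffs[OF f] by blast
  \<comment> \<open>The coefficients c depend on f, so the setting is entered only after f is fixed;
    the constant was chosen before.\<close>
  interpret parabolic_data \<Omega> lam \<phi> \<alpha> m a b T q f c
    using assms c by unfold_locales auto
  show "let u = duhamel \<Omega> lam \<phi> \<alpha> m a b f;
            Pu = multiterm_derivative \<Omega> T \<alpha> m a b (\<lambda>_. 0) u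
        in u \<in> L2_time_space T (Hdot_space \<Omega> lam \<phi> (q + 2)) (Hdot_norm lam \<phi> (q + 2)) \<and>
           caputo_differentiable \<Omega> T \<alpha> (\<lambda>_. 0) u \<and>
           (\<forall>i\<in>{1..m}. caputo_differentiable \<Omega> T (a i) (\<lambda>_. 0) u) \<and>
           Pu \<in> L2_time_space T (Hdot_space \<Omega> lam \<phi> q) (Hdot_norm lam \<phi> q) \<and>
           (\<forall>t. 0 < t \<and> t \<le> T \<longrightarrow>
              L2_time_norm t (Hdot_norm lam \<phi> (q + 2)) u + L2_time_norm t (Hdot_norm lam \<phi> q) Pu
              \<le> 3 * L2_time_norm t (Hdot_norm lam \<phi> q) f)"
    unfolding Let_def using regularity by blast
qed simp

end
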